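(* Let $\theta$ satisfy the initial condition, i.e. $\theta\in\overline L^2_{\mathcal F}(t_0-l,t_0)$ with $\theta_{t_0}\in L^2(\mathcal F_{t_0})$. Let $$b:\Omega\times[0,T]\times\overline L^2_{\mathcal F}(t_0-l,T+u)\to\mathbf R,\qquad \sigma:\Omega\times[0,T]\times\overline L^2_{\mathcal F}(t_0-l,T+u)\to\mathbf R^d$$ be such that for each $\mathbf x\in\overline L^2_{\mathcal F}(t_0-l,T+u)$ the processes $(b(t,\mathbf x))_{t\in[0,T]}$ and $(\sigma(t,\mathbf x))_{t\in[0,T]}$ are progressively measurable, with $b(\cdot,\mathbf x)\in L^2_{\mathcal F}(0,T)$ and $\sigma(\cdot,\mathbf x)\in L^2_{\mathcal F}(0,T;\mathbf R^d)$. Consider the SDE $$X_t=X_{t_0}+\int_{t_0}^tb(s,\mathbf X)\,ds+\int_{t_0}^t\sigma(s,\mathbf X)\,dB_s,\quad t\in(t_0,T];\qquad X_t=\theta_t,\ t\in[t_0-l,t_0];\qquad X_t=X_T,\ t\in(T,T+u].\quad( ** )$$ (i) Suppose there exist a constant $K_2>0$ and a probability measure $\lambda_1$ on $[-l,u]$ such that for each $t\in[t_0,T]$ and all $\mathbf x,\tilde{\mathbf x}\in\overline L^2_{\mathcal F}(t_0-l,T+u)$, $$|b(t,\mathbf x)-b(t,\tilde{\mathbf x})|+|\sigma(t,\mathbf x)-\sigma(t,\tilde{\mathbf x})|\le K_2E\Big[\int_{-l}^u|x_{t+r}-\tilde x_{t+r}|\lambda_1(dr)\,\Big|\,\mathcal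 F_t\Big].$$ If there exists a constant $\beta>0$ such that $\frac{4K_2^2e^{\beta u}}{\beta}\big(1+\frac2\beta\big)<1$, then SDE $( ** )$ has a unique solution. (ii) Suppose there exists a constant $K_3>0$ such that for all $\mathbf x,\tilde{\mathbf x}\in\overline L^2_{\mathcal F}(t_0-l,T+u)$, $$E\Big[\int_{t_0}^{T}\big(|b(t,\mathbf x)-b(t,\tilde{\mathbf x})|^2+|\sigma(t,\mathbf x)-\sigma(t,\tilde{\mathbf x})|^2\big)dt\Big]\le K_3E\Big[\int_{t_0-l}^{T+u}|x_t-\tilde x_t|^2dt\Big].$$ If there exists a constant $\beta>0$ such that $\frac{2K_3e^{\beta(T+u-t_0)}}{\beta}\big(1+\frac2\beta\big)<1$, then SDE $( ** )$ has a unique solution.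
   Context: $(\Omega,\mathcal F,P)$ is a complete probability space with a $d$-dimensional standard Brownian motion $(B_t)_{t\ge0}$; $(\mathcal F_t)_{t\ge0}$ is its natural filtration augmented by the $P$-null sets. $T>0$, $l\ge0$, $u\ge0$ and $t_0\in[0,T]$ are given constants. $|\cdot|$ is the Euclidean norm. Spaces (when $d=1$, the target $\mathbf R^d$ is omitted from the notation): - $L^2(\mathcal F_t;\mathbf R^d)$: $\mathcal F_t$-measurable $\mathbf R^d$-valued random variables $\xi$ with $E|\xi|^2<\infty$. - $L^2_{\mathcal F}(a,b;\mathbf R^d)$ ($0\le a\le b$): $\mathbf R^d$-valued progressively measurable processes $\psi$ on $[a,b]$ with $E\int_a^b|\psi_r|^2dr<\infty$. - $\mathcal S^2_{\mathcal F}(a,b;\mathbf R^d)$: continuous processes in $L^2_{\mathcal F}(a,b;\mathbf R^d)$ with $E[\sup_{r\in[a,b]}|\psi_r|^2]<\infty$. - $\overline L^2_{\mathcal F}(a,b;\mathbf R^d)$ ($a\le b$, $b\ge0$, $a$ possibly negative): processes $\psi$ on $[a,b]$ whose restriction to $[a,b]\cap[0,\infty)$ is progressively measurable and square integrable with respect to $dP\times dr$, and whose restriction to $[a,b]\cap(-\infty,0]$ (if $a<0$) is a deterministic Lebesgue square integrable function. Boldface $\mathbf X$ denotes the whole process $\{X_t\}_{t_0-l\le t\le T+u}$. A solution of the SDE is a process $\mathbf X$ satisfying the SDE with $(X_t)_{t\in[t_0,T]}\in\mathcal S^2_{\mathcal F}(t_0,T)$. *)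

theory Defs
  imports "HOL-Probability.Probability"
begin

text \<open>
  A process on an index set \<open>I\<close> over a measure space \<open>M\<close> is a total function
  \<open>real \<Rightarrow> 'a \<Rightarrow> 'b\<close> (time first), of which only the values at times in \<open>I\<close> and points of
  \<open>space M\<close> matter. Expectations and time integrals of nonnegative quantities are taken in
  \<open>[0,\<infinity>]\<close> by means of \<open>nn_integral\<close>, so that a finite value is a genuine integrability
  statement.
\<close>

definition std_brownian_motion :: "'a measure \<Rightarrow> (real \<Rightarrow> 'a \<Rightarrow> real ^ 'd::finite) \<Rightarrow> bool" where
  "std_brownian_motion M B \<longleftrightarrow>
     (\<forall>t\<ge>0. B t \<in> borel_measurable M) \<and>
     (AE \<omega> in M. B 0 \<omega> = 0) \<and>
     (AE \<omega> in M. continuous_on {0..} (\<lambda>t. B t \<omega>)) \<and>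
     (\<forall>\<tau>::nat \<Rightarrow> real. 0 \<le> \<tau> 0 \<and> incseq \<tau> \<longrightarrow>
        prob_space.indep_vars M (\<lambda>_. borel) (\<lambda>k \<omega>. B (\<tau> (Suc k)) \<omega> - B (\<tau> k) \<omega>) UNIV) \<and>
     (\<forall>s t. 0 \<le> s \<and> s < t \<longrightarrow>
        prob_space.indep_vars M (\<lambda>_. borel) (\<lambda>i \<omega>. (B t \<omega> - B s \<omega>) $ i) UNIV \<and>
        (\<forall>i. distributed M lborel (\<lambda>\<omega>. (B t \<omega> - B s \<omega>) $ i) (normal_density 0 (sqrt (t - s)))))"

text \<open>
  Only the \<open>\<sigma>\<close>-algebra of the following measure matters (the measure that \<open>sigma\<close> attaches to it
  is the zero measure; the probabilities are always those of \<open>M\<close>).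
\<close>

definition brownian_filtration ::
    "'a measure \<Rightarrow> (real \<Rightarrow> 'a \<Rightarrow> real ^ 'd::finite) \<Rightarrow> real \<Rightarrow> 'a measure" where
  "brownian_filtration M B t =
     sigma (space M) ({B s -` A \<inter> space M | s A. 0 \<le> s \<and> s \<le> t \<and> A \<in> sets borel} \<union> null_sets M)"

definition prog_measurable ::
    "(real \<Rightarrow> 'a measure) \<Rightarrow> real \<Rightarrow> real \<Rightarrow> (real \<Rightarrow> 'a \<Rightarrow> 'b::topological_space) \<Rightarrow> bool" where
  "prog_measurable F a b \<psi> \<longleftrightarrow>
     (\<forall>s\<in>{a..b}. (\<lambda>(r, \<omega>). \<psi> r \<omega>) \<in> borel_measurable (restrict_space borel {a..s} \<Otimes>\<^sub>M F s))"

definition L2_rv :: "'a measure \<Rightarrow> 'a measure \<Rightarrow> ('a \<Rightarrow> 'b::euclidean_space) set" where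
  "L2_rv M G = {\<xi>. \<xi> \<in> borel_measurable G \<and> (\<integral>\<^sup>+\<omega>. ennreal ((norm (\<xi> \<omega>))\<^sup>2) \<partial>M) < \<infinity>}"

definition L2_F :: "'a measure \<Rightarrow> (real \<Rightarrow> 'a measure) \<Rightarrow> real \<Rightarrow> real \<Rightarrow>
    (real \<Rightarrow> 'a \<Rightarrow> 'b::euclidean_space) set" where
  "L2_F M F a b = {\<psi>. prog_measurable F a b \<psi> \<and>
     (\<integral>\<^sup>+\<omega>. (\<integral>\<^sup>+r\<in>{a..b}. ennreal ((norm (\<psi> r \<omega>))\<^sup>2) \<partial>lborel) \<partial>M) < \<infinity>}"

definition S2_F :: "'a measure \<Rightarrow> (real \<Rightarrow> 'a measure) \<Rightarrow> real \<Rightarrow> real \<Rightarrow>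
    (real \<Rightarrow> 'a \<Rightarrow> 'b::euclidean_space) set" where
  "S2_F M F a b = {\<psi> \<in> L2_F M F a b.
     (\<forall>\<omega>\<in>space M. continuous_on {a..b} (\<lambda>r. \<psi> r \<omega>)) \<and>
     (\<integral>\<^sup>+\<omega>. (SUP r\<in>{a..b}. ennreal ((norm (\<psi> r \<omega>))\<^sup>2)) \<partial>M) < \<infinity>}"

text \<open>
  The space of extended processes on \<open>{a..b}\<close>, for \<open>a \<le> b\<close> and \<open>b \<ge> 0\<close>, where \<open>a\<close> may be negative.
\<close>

definition L2bar_F :: "'a measure \<Rightarrow> (real \<Rightarrow> 'a measure) \<Rightarrow> real \<Rightarrow> real \<Rightarrow>
    (real \<Rightarrow> 'a \<Rightarrow> 'b::euclidean_space) set" where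
  "L2bar_F M F a b = {\<psi>. \<psi> \<in> L2_F M F (max a 0) b \<and>
     (a < 0 \<longrightarrow> (\<exists>f. f \<in> borel_measurable (lebesgue_on {a..0}) \<and>
                    (\<integral>\<^sup>+r\<in>{a..0}. ennreal ((norm (f r))\<^sup>2) \<partial>lebesgue) < \<infinity> \<and>
                    (\<forall>r\<in>{a..0}. \<forall>\<omega>\<in>space M. \<psi> r \<omega> = f r)))}"

text \<open>
  The Ito integral, by the usual construction: explicit on simple integrands
  \<open>\<Sum>k<n. 1\<^bsub>(\<tau> k, \<tau> (k+1)]\<^esub> \<xi> k\<close>, and extended by \<open>L\<^sup>2\<close>-limits.
\<close>

definition simple_integrand :: "'a measure \<Rightarrow> (real \<Rightarrow> 'a measure) \<Rightarrow> real \<Rightarrow> real \<Rightarrow>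
    nat \<Rightarrow> (nat \<Rightarrow> real) \<Rightarrow> (nat \<Rightarrow> 'a \<Rightarrow> 'b::euclidean_space) \<Rightarrow> bool" where
  "simple_integrand M F a b n \<tau> \<xi> \<longleftrightarrow>
     (\<forall>k\<le>n. \<tau> k \<in> {a..b}) \<and> (\<forall>k<n. \<tau> k \<le> \<tau> (Suc k)) \<and>
     (\<forall>k<n. \<xi> k \<in> borel_measurable (F (\<tau> k)) \<and> (\<exists>C. \<forall>\<omega>\<in>space M. norm (\<xi> k \<omega>) \<le> C))"

definition simple_process ::
    "nat \<Rightarrow> (nat \<Rightarrow> real) \<Rightarrow> (nat \<Rightarrow> 'a \<Rightarrow> 'b::euclidean_space) \<Rightarrow> real \<Rightarrow> 'a \<Rightarrow> 'b" where
  "simple_process n \<tau> \<xi> r \<omega> = (\<Sum>k<n. indicator {\<tau> k<..\<tau> (Suc k)} r *\<^sub>R \<xi> k \<omega>)"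

definition simple_ito_integral :: "(real \<Rightarrow> 'a \<Rightarrow> 'b) \<Rightarrow>
    nat \<Rightarrow> (nat \<Rightarrow> real) \<Rightarrow> (nat \<Rightarrow> 'a \<Rightarrow> 'b::euclidean_space) \<Rightarrow> real \<Rightarrow> 'a \<Rightarrow> real" where
  "simple_ito_integral B n \<tau> \<xi> t \<omega> =
     (\<Sum>k<n. \<xi> k \<omega> \<bullet> (B (min t (\<tau> (Suc k))) \<omega> - B (min t (\<tau> k)) \<omega>))"

text \<open>
  \<open>has_ito_integral M B a b \<phi> J\<close>: the process \<open>(J t)\<close> for \<open>t \<in> {a..b}\<close> is a continuous adapted
  version of the integral process \<open>\<integral>\<^sub>a\<^sup>t \<phi>\<^sub>s dB\<^sub>s\<close>; it is determined by \<open>\<phi>\<close> up to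
  indistinguishability.
\<close>

definition has_ito_integral :: "'a measure \<Rightarrow> (real \<Rightarrow> 'a \<Rightarrow> real ^ 'd::finite) \<Rightarrow>
    real \<Rightarrow> real \<Rightarrow> (real \<Rightarrow> 'a \<Rightarrow> real ^ 'd) \<Rightarrow> (real \<Rightarrow> 'a \<Rightarrow> real) \<Rightarrow> bool" where
  "has_ito_integral M B a b \<phi> J \<longleftrightarrow>
     \<phi> \<in> L2_F M (brownian_filtration M B) a b \<and>
     (\<forall>t\<in>{a..b}. J t \<in> borel_measurable (brownian_filtration M B t)) \<and>
     (\<forall>\<omega>\<in>space M. continuous_on {a..b} (\<lambda>t. J t \<omega>)) \<and>
     (\<exists>n \<tau> \<xi>.
        (\<forall>m::nat. simple_integrand M (brownian_filtration M B) a b (n m) (\<tau> m) (\<xi> m)) \<and>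
        (\<lambda>m. \<integral>\<^sup>+\<omega>. (\<integral>\<^sup>+r\<in>{a..b}.
            ennreal ((norm (simple_process (n m) (\<tau> m) (\<xi> m) r \<omega> - \<phi> r \<omega>))\<^sup>2) \<partial>lborel) \<partial>M)
          \<longlonglongrightarrow> 0 \<and>
        (\<forall>t\<in>{a..b}. (\<lambda>m. \<integral>\<^sup>+\<omega>.
            ennreal ((simple_ito_integral B (n m) (\<tau> m) (\<xi> m) t \<omega> - J t \<omega>)\<^sup>2) \<partial>M)
          \<longlonglongrightarrow> 0))"

text \<open>
  Coefficients take the whole process as last argument, \<open>b \<omega> t \<^bold>x\<close>. The requirement that
  \<open>X\<close> lies in the extended space is what makes \<open>b \<omega> s X\<close> and \<open>\<sigma> \<omega> s X\<close> meaningful.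
\<close>

definition sde_solution :: "'a measure \<Rightarrow> (real \<Rightarrow> 'a \<Rightarrow> real ^ 'd::finite) \<Rightarrow>
    real \<Rightarrow> real \<Rightarrow> real \<Rightarrow> real \<Rightarrow>
    ('a \<Rightarrow> real \<Rightarrow> (real \<Rightarrow> 'a \<Rightarrow> real) \<Rightarrow> real) \<Rightarrow>
    ('a \<Rightarrow> real \<Rightarrow> (real \<Rightarrow> 'a \<Rightarrow> real) \<Rightarrow> real ^ 'd) \<Rightarrow>
    (real \<Rightarrow> 'a \<Rightarrow> real) \<Rightarrow> (real \<Rightarrow> 'a \<Rightarrow> real) \<Rightarrow> bool" where
  "sde_solution M B T l u t0 b \<sigma> \<theta> X \<longleftrightarrow>
     X \<in> L2bar_F M (brownian_filtration M B) (t0 - l) (T + u) \<and>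
     X \<in> S2_F M (brownian_filtration M B) t0 T \<and>
     (\<exists>J. has_ito_integral M B t0 T (\<lambda>s \<omega>. \<sigma> \<omega> s X) J \<and>
          (AE \<omega> in M. \<forall>t\<in>{t0<..T}.
             X t \<omega> = X t0 \<omega> + (LINT s:{t0..t}|lborel. b \<omega> s X) + J t \<omega>)) \<and>
     (AE \<omega> in M. \<forall>t\<in>{t0 - l..t0}. X t \<omega> = \<theta> t \<omega>) \<and>
     (AE \<omega> in M. \<forall>t\<in>{T<..T + u}. X t \<omega> = X T \<omega>)"

text \<open>Uniqueness is up to indistinguishability on the whole time interval.\<close>

definition sde_unique_solution :: "'a measure \<Rightarrow> (real \<Rightarrow> 'a \<Rightarrow> real ^ 'd::finite) \<Rightarrow>
    real \<Rightarrow> real \<Rightarrow> real \<Rightarrow> real \<Rightarrow>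
    ('a \<Rightarrow> real \<Rightarrow> (real \<Rightarrow> 'a \<Rightarrow> real) \<Rightarrow> real) \<Rightarrow>
    ('a \<Rightarrow> real \<Rightarrow> (real \<Rightarrow> 'a \<Rightarrow> real) \<Rightarrow> real ^ 'd) \<Rightarrow>
    (real \<Rightarrow> 'a \<Rightarrow> real) \<Rightarrow> bool" where
  "sde_unique_solution M B T l u t0 b \<sigma> \<theta> \<longleftrightarrow>
     (\<exists>X. sde_solution M B T l u t0 b \<sigma> \<theta> X) \<and>
     (\<forall>X Y. sde_solution M B T l u t0 b \<sigma> \<theta> X \<and> sde_solution M B T l u t0 b \<sigma> \<theta> Y \<longrightarrow>
        (AE \<omega> in M. \<forall>t\<in>{t0 - l..T + u}. X t \<omega> = Y t \<omega>))"

text \<open>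
  The conditional expectation of the nonnegative variable below is taken in \<open>[0,\<infinity>]\<close>
  (\<open>nn_cond_exp\<close>), since at an individual time it need not be integrable. The deterministic part of
  a process is only Lebesgue measurable, so the integral against the possibly singular \<open>\<mu>\<close> need
  not exist; the bound is demanded only where the integrand is measurable. When \<open>t + r \<ge> 0\<close>
  for all \<open>r\<close> this is automatic.
\<close>

definition lipschitz_cond_exp :: "'a measure \<Rightarrow> (real \<Rightarrow> 'a \<Rightarrow> real ^ 'd::finite) \<Rightarrow>
    real \<Rightarrow> real \<Rightarrow> real \<Rightarrow> real \<Rightarrow>
    ('a \<Rightarrow> real \<Rightarrow> (real \<Rightarrow> 'a \<Rightarrow> real) \<Rightarrow> real) \<Rightarrow>
    ('a \<Rightarrow> real \<Rightarrow> (real \<Rightarrow> 'a \<Rightarrow> real) \<Rightarrow> real ^ 'd) \<Rightarrow>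
    real \<Rightarrow> real measure \<Rightarrow> bool" where
  "lipschitz_cond_exp M B T l u t0 b \<sigma> K \<mu> \<longleftrightarrow>
     (\<forall>t\<in>{t0..T}.
       \<forall>x\<in>L2bar_F M (brownian_filtration M B) (t0 - l) (T + u).
       \<forall>y\<in>L2bar_F M (brownian_filtration M B) (t0 - l) (T + u).
         (\<forall>\<omega>\<in>space M. (\<lambda>r. x (t + r) \<omega> - y (t + r) \<omega>) \<in> borel_measurable \<mu>) \<longrightarrow>
         (AE \<omega> in M.
            ennreal (\<bar>b \<omega> t x - b \<omega> t y\<bar> + norm (\<sigma> \<omega> t x - \<sigma> \<omega> t y)) \<le>
            ennreal K * nn_cond_exp M (brownian_filtration M B t)
              (\<lambda>\<omega>. \<integral>\<^sup>+r. ennreal \<bar>x (t + r) \<omega> - y (t + r) \<omega>\<bar> \<partial>\<mu>) \<omega>))"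

definition lipschitz_integrated :: "'a measure \<Rightarrow> (real \<Rightarrow> 'a \<Rightarrow> real ^ 'd::finite) \<Rightarrow>
    real \<Rightarrow> real \<Rightarrow> real \<Rightarrow> real \<Rightarrow>
    ('a \<Rightarrow> real \<Rightarrow> (real \<Rightarrow> 'a \<Rightarrow> real) \<Rightarrow> real) \<Rightarrow>
    ('a \<Rightarrow> real \<Rightarrow> (real \<Rightarrow> 'a \<Rightarrow> real) \<Rightarrow> real ^ 'd) \<Rightarrow>
    real \<Rightarrow> bool" where
  "lipschitz_integrated M B T l u t0 b \<sigma> K \<longleftrightarrow>
     (\<forall>x\<in>L2bar_F M (brownian_filtration M B) (t0 - l) (T + u).
      \<forall>y\<in>L2bar_F M (brownian_filtration M B) (t0 - l) (T + u).
        (\<integral>\<^sup>+\<omega>. (\<integral>\<^sup>+t\<in>{t0..T}.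
            ennreal (\<bar>b \<omega> t x - b \<omega> t y\<bar>\<^sup>2 + (norm (\<sigma> \<omega> t x - \<sigma> \<omega> t y))\<^sup>2) \<partial>lborel) \<partial>M)
        \<le> ennreal K * (\<integral>\<^sup>+\<omega>. (\<integral>\<^sup>+t\<in>{t0 - l..T + u}.
            ennreal (\<bar>x t \<omega> - y t \<omega>\<bar>\<^sup>2) \<partial>lebesgue) \<partial>M))"

end

theory Submission
  imports Defs
begin

text \<open>
  A solution is a fixed point of the Picard map, which sends an extended process \<open>x\<close> to the process
  \<open>Y\<close> that equals \<open>\<theta>\<close> up to \<open>t0\<close>, has drift \<open>b(s, x)\<close> and diffusion \<open>\<sigma>(s, x)\<close> on \<open>[t0, T]\<close>, and
  is constant after \<open>T\<close>. Its contraction is measured by the weighted square norm \<open>W\<close>,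
  \<open>W(x) = E \<integral> exp (- \<beta> s) |x\<^sub>s|\<^sup>2 ds\<close> over \<open>[t0, T + u]\<close>.

  Let \<open>x\<close> and \<open>x'\<close> have the same past and let \<open>\<delta>b\<close> and \<open>\<delta>\<sigma>\<close> be the differences of the coefficients
  along them. The Picard images differ by the sum of \<open>\<integral> \<delta>b ds\<close> and \<open>\<integral> \<delta>\<sigma> dB\<close>. A Hardy inequality
  with exponential weight bounds the first term by \<open>4 / \<beta>\<^sup>2\<close> times \<open>W(\<delta>b)\<close> (\<open>Hardy_exp_weight\<close>); the
  Ito isometry and Fubini bound the second by \<open>1 / \<beta>\<close> times \<open>W(\<delta>\<sigma>)\<close> (\<open>ito_diff_bound\<close>,
  \<open>nn_integral_exp_weight\<close>). Young's inequality with parameter \<open>\<beta> / 4\<close> for the square of the sum makes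
  the two constants equal to \<open>4 / \<beta>\<^sup>2 + 1 / \<beta>\<close> (\<open>picard_difference\<close>). If the coefficients satisfy
  \<open>W(\<delta>b) + W(\<delta>\<sigma>) \<le> L W(x - x')\<close>, the Picard map therefore contracts \<open>W\<close> by the factor
  \<open>(4 / \<beta>\<^sup>2 + 1 / \<beta>) L\<close>.

  Both Lipschitz conditions have this form. From the conditional one, Jensen's inequality for the
  conditional expectation, Cauchy-Schwarz for \<open>\<mu>\<close> and the substitution \<open>s = t + r\<close> with \<open>r \<le> u\<close> give
  \<open>L = K2\<^sup>2 exp (\<beta> u)\<close> (\<open>lipschitz_cond_exp_imp_weighted\<close>). For the integrated one, comparing the
  weight with its extreme values on \<open>[t0, T + u]\<close> gives \<open>L = K3 exp (\<beta> (T + u - t0))\<close>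
  (\<open>lipschitz_integrated_imp_weighted\<close>). As \<open>4 / \<beta>\<^sup>2 + 1 / \<beta> \<le> (2 / \<beta>) (1 + 2 / \<beta>)\<close>, the conditions on
  \<open>\<beta>\<close> make the factor smaller than 1. Two solutions are then at distance 0, hence
  indistinguishable by continuity (\<open>sde_uniqueness\<close>); the Picard iterates converge almost everywhere,
  and the Picard image of their limit is a solution (\<open>sde_existence\<close>).

  The Ito integral itself is constructed along the way. Increments of \<open>B\<close> are independent of the
  augmented filtration (\<open>F_increment_indep\<close>), whence the isometry and the martingale property for
  simple integrands. Averaging an integrand over the preceding cell of a fine grid produces simple
  integrands that converge to it (\<open>grid_average_L2_tendsto\<close>, \<open>simple_integrands_dense\<close>). Doob's
  maximal inequality, derived from the pathwise bound \<open>running_max_squared_le\<close>, makes the simple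
  integrals converge uniformly in time, so that the limit is continuous (\<open>ito_exists\<close>).
\<close>

section \<open>Quadratic estimates\<close>

text \<open>
  Squares of norms are taken in \<open>[0,\<infinity>]\<close>, so that estimates between their integrals carry no
  integrability side conditions.
\<close>

abbreviation nsq :: "'b::real_normed_vector \<Rightarrow> ennreal" where
  "nsq x \<equiv> ennreal ((norm x)\<^sup>2)"

text \<open>
  Young's inequality for the cross term. The free parameter later balances the constants of two
  error terms.
\<close>

lemma norm_add_squared_le:
  fixes x y :: "'b::real_normed_vector"
  assumes "\<epsilon> > 0"
  shows "(norm (x + y))\<^sup>2 \<le> (1 + \<epsilon>) * (norm x)\<^sup>2 + (1 + 1 / \<epsilon>) * (norm y)\<^sup>2"
proof -
  have "0 \<le> (\<epsilon> * norm x - norm y)\<^sup>2 / \<epsilon>"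
    using assms by simp
  also have "\<dots> = \<epsilon> * (norm x)\<^sup>2 + (norm y)\<^sup>2 / \<epsilon> - 2 * norm x * norm y"
    using assms by (simp add: power2_eq_square field_simps)
  finally have "2 * norm x * norm y \<le> \<epsilon> * (norm x)\<^sup>2 + (norm y)\<^sup>2 / \<epsilon>" by simp
  moreover have "(norm (x + y))\<^sup>2 \<le> (norm x + norm y)\<^sup>2"
    by (intro power_mono norm_triangle_ineq) auto
  moreover have "(norm x + norm y)\<^sup>2 = (norm x)\<^sup>2 + (norm y)\<^sup>2 + 2 * norm x * norm y"
    by (simp add: power2_sum)
  ultimately show ?thesis by (simp add: algebra_simps)
qed

lemma nsq_add_le:
  fixes x y :: "'b::real_normed_vector"
  assumes "\<epsilon> > 0"
  shows "nsq (x + y) \<le> ennreal (1 + \<epsilon>) * nsq x + ennreal (1 + 1 / \<epsilon>) * nsq y"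
proof -
  have "nsq (x + y) \<le> ennreal ((1 + \<epsilon>) * (norm x)\<^sup>2 + (1 + 1 / \<epsilon>) * (norm y)\<^sup>2)"
    using norm_add_squared_le[OF assms] by (rule ennreal_leI)
  also have "\<dots> = ennreal (1 + \<epsilon>) * nsq x + ennreal (1 + 1 / \<epsilon>) * nsq y"
    using assms by (subst ennreal_plus) (auto simp: ennreal_mult intro!: mult_nonneg_nonneg add_nonneg_nonneg)
  finally show ?thesis .
qed

lemma nsq_add_le2:
  fixes x y :: "'b::real_normed_vector"
  shows "nsq (x + y) \<le> 2 * nsq x + 2 * nsq y"
  using nsq_add_le[of 1 x y] by simp

lemma nsq_diff_le2:
  fixes x y :: "'b::real_normed_vector"
  shows "nsq (x - y) \<le> 2 * nsq x + 2 * nsq y"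
  using nsq_add_le2[of x "-y"] by simp

lemma nn_integral_nsq_le:
  fixes f g :: "'a \<Rightarrow> 'b::{real_normed_vector, second_countable_topology}"
  assumes [measurable]: "f \<in> borel_measurable N" "g \<in> borel_measurable N" and "\<epsilon> > 0"
  shows "(\<integral>\<^sup>+x. nsq (f x) \<partial>N) \<le>
    ennreal (1 + \<epsilon>) * (\<integral>\<^sup>+x. nsq (g x) \<partial>N) + ennreal (1 + 1 / \<epsilon>) * (\<integral>\<^sup>+x. nsq (f x - g x) \<partial>N)"
proof -
  have "(\<integral>\<^sup>+x. nsq (f x) \<partial>N) \<le>
     (\<integral>\<^sup>+x. ennreal (1 + \<epsilon>) * nsq (g x) + ennreal (1 + 1 / \<epsilon>) * nsq (f x - g x) \<partial>N)"
  proof (rule nn_integral_mono)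
    fix x show "nsq (f x) \<le> ennreal (1 + \<epsilon>) * nsq (g x) + ennreal (1 + 1 / \<epsilon>) * nsq (f x - g x)"
      using nsq_add_le[OF \<open>\<epsilon> > 0\<close>, of "g x" "f x - g x"] by simp
  qed
  also have "\<dots> = ennreal (1 + \<epsilon>) * (\<integral>\<^sup>+x. nsq (g x) \<partial>N) + ennreal (1 + 1 / \<epsilon>) * (\<integral>\<^sup>+x. nsq (f x - g x) \<partial>N)"
    by (simp add: nn_integral_add nn_integral_cmult)
  finally show ?thesis .
qed

text \<open>
  The passage to the limit behind the isometries: the constant stays 1 because \<open>\<epsilon>\<close> is sent to 0
  only after the errors \<open>d\<close> and \<open>d'\<close> have vanished.
\<close>

lemma le_of_L2_approximation:
  fixes A B :: ennreal and D :: "nat \<Rightarrow> ennreal"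
  assumes "d \<longlonglongrightarrow> 0" "d' \<longlonglongrightarrow> 0"
    and 1: "\<And>m \<epsilon>. \<epsilon> > 0 \<Longrightarrow> A \<le> ennreal (1 + \<epsilon>) * D m + ennreal (1 + 1 / \<epsilon>) * d m"
    and 2: "\<And>m \<epsilon>. \<epsilon> > 0 \<Longrightarrow> D m \<le> ennreal (1 + \<epsilon>) * B + ennreal (1 + 1 / \<epsilon>) * d' m"
  shows "A \<le> B"
proof (cases "B = top")
  case False
  have *: "A \<le> ennreal (1 + \<epsilon>) * (ennreal (1 + \<epsilon>) * B)" if "\<epsilon> > 0" for \<epsilon>
  proof -
    have "(\<lambda>m. ennreal (1 + \<epsilon>) * (ennreal (1 + \<epsilon>) * B + ennreal (1 + 1 / \<epsilon>) * d' m) + ennreal (1 + 1 / \<epsilon>) * d m)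
        \<longlonglongrightarrow> ennreal (1 + \<epsilon>) * (ennreal (1 + \<epsilon>) * B + ennreal (1 + 1 / \<epsilon>) * 0) + ennreal (1 + 1 / \<epsilon>) * 0"
      by (intro tendsto_add ennreal_tendsto_cmult tendsto_const assms) auto
    then have "A \<le> ennreal (1 + \<epsilon>) * (ennreal (1 + \<epsilon>) * B + ennreal (1 + 1 / \<epsilon>) * 0) + ennreal (1 + 1 / \<epsilon>) * 0"
      by (rule LIMSEQ_le_const)
         (use order.trans[OF 1[OF that] add_right_mono[OF mult_left_mono[OF 2[OF that] zero_le]]] in blast)
    then show ?thesis by simp
  qed
  have "(\<lambda>n. ennreal ((1 + 1 / Suc n) * (1 + 1 / Suc n)) * B) \<longlonglongrightarrow> ennreal ((1 + 0) * (1 + 0)) * B"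
    by (intro tendsto_mult_ennreal tendsto_const tendsto_ennrealI tendsto_mult tendsto_add LIMSEQ_Suc[OF lim_1_over_n])
       (use False in auto)
  then have "A \<le> ennreal ((1 + 0) * (1 + 0)) * B"
    by (rule LIMSEQ_le_const)
       (use * in \<open>auto simp: ennreal_mult mult.assoc[symmetric] intro!: exI[of _ 0]\<close>)
  then show ?thesis by simp
qed simp

lemma ennreal_weighted_AM_GM:
  fixes a b :: ennreal
  assumes "c > 0"
  shows "2 * (a * b) \<le> ennreal c * a\<^sup>2 + ennreal (1 / c) * b\<^sup>2"
proof (cases a; cases b)
  fix x y :: real assume xy: "0 \<le> x" "0 \<le> y" "a = ennreal x" "b = ennreal y"
  have "0 \<le> (c * x - y)\<^sup>2 / c" using assms by simp
  also have "\<dots> = c * x\<^sup>2 + 1 / c * y\<^sup>2 - 2 * (x * y)"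
    using assms by (simp add: power2_eq_square field_simps)
  finally have "ennreal (2 * (x * y)) \<le> ennreal (c * x\<^sup>2 + 1 / c * y\<^sup>2)" by (intro ennreal_leI) simp
  also have "\<dots> = ennreal c * ennreal (x\<^sup>2) + ennreal (1 / c) * ennreal (y\<^sup>2)"
    using assms by (subst ennreal_plus) (auto simp del: times_divide_eq_left simp: ennreal_mult)
  finally show ?thesis using xy assms
    by (simp add: ennreal_mult ennreal_power)
qed (use assms in \<open>auto simp: ennreal_mult_top ennreal_top_mult\<close>)

lemma Cauchy_Schwarz_nn_integral:
  assumes [measurable]: "f \<in> borel_measurable N" "g \<in> borel_measurable N"
  shows "(\<integral>\<^sup>+x. f x * g x \<partial>N)\<^sup>2 \<le> (\<integral>\<^sup>+x. (f x)\<^sup>2 \<partial>N) * (\<integral>\<^sup>+x. (g x)\<^sup>2 \<partial>N)"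
proof -
  let ?F = "\<integral>\<^sup>+x. (f x)\<^sup>2 \<partial>N" and ?G = "\<integral>\<^sup>+x. (g x)\<^sup>2 \<partial>N"
  consider "?F = 0" | "?G = 0" | "?F \<noteq> 0" "?G \<noteq> 0" "?F = top \<or> ?G = top"
    | "?F \<noteq> 0" "?G \<noteq> 0" "?F \<noteq> top" "?G \<noteq> top" by blast
  then show ?thesis
  proof cases
    case 1
    then have "AE x in N. f x = 0" by (subst (asm) nn_integral_0_iff_AE) auto
    then have "(\<integral>\<^sup>+x. f x * g x \<partial>N) = 0" by (subst nn_integral_0_iff_AE) auto
    then show ?thesis by simp
  next
    case 2
    then have "AE x in N. g x = 0" by (subst (asm) nn_integral_0_iff_AE) auto
    then have "(\<integral>\<^sup>+x. f x * g x \<partial>N) = 0" by (subst nn_integral_0_iff_AE) auto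
    then show ?thesis by simp
  next
    case 3
    then show ?thesis by (auto simp: ennreal_mult_top ennreal_top_mult)
  next
    case 4
    obtain p where p: "?F = ennreal p" "p \<ge> 0" using 4(3) by (cases ?F) auto
    obtain q where q: "?G = ennreal q" "q \<ge> 0" using 4(4) by (cases ?G) auto
    have pq: "p > 0" "q > 0" using 4 p q by (auto simp: less_le)
    \<comment> \<open>This weight balances the two terms of the weighted AM-GM inequality.\<close>
    define c where "c = sqrt (q / p)"
    have c: "c > 0" using pq by (simp add: c_def)
    have "2 * (\<integral>\<^sup>+x. f x * g x \<partial>N) = (\<integral>\<^sup>+x. 2 * (f x * g x) \<partial>N)"
      by (simp add: nn_integral_cmult)
    also have "\<dots> \<le> (\<integral>\<^sup>+x. ennreal c * (f x)\<^sup>2 + ennreal (1 / c) * (g x)\<^sup>2 \<partial>N)"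
      by (intro nn_integral_mono ennreal_weighted_AM_GM c)
    also have "\<dots> = ennreal c * ?F + ennreal (1 / c) * ?G"
      by (simp add: nn_integral_add nn_integral_cmult)
    also have "\<dots> = ennreal (c * p + 1 / c * q)"
      using c p q by (subst ennreal_plus) (auto simp del: times_divide_eq_left simp: ennreal_mult)
    also have "c * p + 1 / c * q = 2 * sqrt (p * q)"
      using pq by (simp add: c_def real_sqrt_divide real_sqrt_mult field_simps)
    finally have *: "2 * (\<integral>\<^sup>+x. f x * g x \<partial>N) \<le> 2 * ennreal (sqrt (p * q))"
      using pq by (simp add: ennreal_mult)
    have "(\<integral>\<^sup>+x. f x * g x \<partial>N) \<le> ennreal (sqrt (p * q))"
    proof (cases "\<integral>\<^sup>+x. f x * g x \<partial>N")
      case (real r)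
      then show ?thesis using * pq
        by (auto simp: ennreal_mult[symmetric] ennreal_numeral[symmetric] simp del: ennreal_numeral)
    next
      case top
      then show ?thesis using * by (simp add: ennreal_mult_top top_unique ennreal_mult_eq_top_iff)
    qed
    then have "(\<integral>\<^sup>+x. f x * g x \<partial>N)\<^sup>2 \<le> (ennreal (sqrt (p * q)))\<^sup>2" by (rule power_mono) simp
    also have "\<dots> = ?F * ?G" using pq p q by (simp add: ennreal_power ennreal_mult)
    finally show ?thesis .
  qed
qed

section \<open>A pathwise maximal inequality\<close>

text \<open>
  The pathwise form of Doob's inequality. For a martingale \<open>s\<close> the sum has expectation 0, since
  its coefficients \<open>m i * sgn (s i)\<close> are known at step \<open>i\<close>. The running maximum grows only at
  steps where \<open>\<bar>s\<bar>\<close> attains it, which bounds the sum by \<open>m n * \<bar>s n\<bar> - (m n)\<^sup>2 / 2\<close>; it remains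
  to use \<open>4 * m n * \<bar>s n\<bar> \<le> (m n)\<^sup>2 + 4 * (s n)\<^sup>2\<close>.
\<close>

lemma running_max_squared_le:
  fixes s :: "nat \<Rightarrow> real"
  defines "m \<equiv> \<lambda>n. Max ((\<lambda>i. \<bar>s i\<bar>) ` {..n})"
  shows "(m n)\<^sup>2 \<le> 4 * (s n)\<^sup>2 - 4 * (\<Sum>i<n. m i * sgn (s i) * (s (Suc i) - s i))"
proof -
  have mS: "m (Suc k) = max \<bar>s (Suc k)\<bar> (m k)" for k
    unfolding m_def by (simp add: atMost_Suc)
  have m0: "m 0 = \<bar>s 0\<bar>" unfolding m_def by simp
  have m_nonneg: "0 \<le> m k" for k by (induction k) (auto simp: m0 mS)
  have step: "m k * sgn (s k) * (s (Suc k) - s k) \<le> m k * (\<bar>s (Suc k)\<bar> - \<bar>s k\<bar>)" for k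
  proof -
    have "sgn (s k) * (s (Suc k) - s k) \<le> \<bar>s (Suc k)\<bar> - \<bar>s k\<bar>"
      by (auto simp: sgn_if abs_if)
    from mult_left_mono[OF this m_nonneg[of k]] show ?thesis by (simp add: mult.assoc)
  qed
  have "(\<Sum>i<n. m i * (\<bar>s (Suc i)\<bar> - \<bar>s i\<bar>)) \<le> m n * \<bar>s n\<bar> - (m n)\<^sup>2 / 2"
  proof (induction n)
    case 0
    show ?case by (simp add: m0 power2_eq_square)
  next
    case (Suc n)
    have "m n * \<bar>s (Suc n)\<bar> - (m n)\<^sup>2 / 2 \<le> m (Suc n) * \<bar>s (Suc n)\<bar> - (m (Suc n))\<^sup>2 / 2"
    proof (cases "\<bar>s (Suc n)\<bar> \<le> m n")
      case False
      then have e: "m (Suc n) = \<bar>s (Suc n)\<bar>" by (simp add: mS)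
      show ?thesis unfolding e
        using zero_le_power2[of "\<bar>s (Suc n)\<bar> - m n"]
        by (simp add: power2_eq_square algebra_simps)
    qed (simp add: mS)
    with Suc.IH show ?case by (simp add: algebra_simps)
  qed
  with sum_mono[of "{..<n}", OF step] have
    "(\<Sum>i<n. m i * sgn (s i) * (s (Suc i) - s i)) \<le> m n * \<bar>s n\<bar> - (m n)\<^sup>2 / 2"
    by (meson order_trans)
  moreover have "4 * (m n * \<bar>s n\<bar>) \<le> (m n)\<^sup>2 + 4 * (s n)\<^sup>2"
    using zero_le_power2[of "m n - 2 * \<bar>s n\<bar>"]
    by (simp add: power2_eq_square algebra_simps)
  ultimately show ?thesis by linarith
qed

section \<open>Delayed averages over a grid\<close>

lemma sum_indicator_intervals:
  fixes p :: "nat \<Rightarrow> real"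
  assumes "\<And>k. p k \<le> p (Suc k)"
  shows "(\<Sum>k<n. indicator {p k<..p (Suc k)} r) = (indicator {p 0<..p n} r :: 'c::semiring_1)"
proof (induction n)
  case (Suc n)
  have "p 0 \<le> p n" using assms by (rule lift_Suc_mono_le) simp
  moreover have "p n \<le> p (Suc n)" by (rule assms)
  ultimately show ?case using Suc.IH by (auto split: split_indicator simp: not_le not_less)
qed simp

text \<open>
  On each cell of the grid, the mean of \<open>f\<close> over the preceding cell. The delay makes the value
  on a cell depend on the past of that cell only, so that averaging an adapted integrand
  produces a simple integrand.
\<close>

definition delayed_average ::
    "real \<Rightarrow> real \<Rightarrow> nat \<Rightarrow> (real \<Rightarrow> 'b::{banach, second_countable_topology}) \<Rightarrow> real \<Rightarrow> 'b" where
  "delayed_average a \<delta> n f r = (\<Sum>k<n. indicator {a + real k * \<delta><..a + real (Suc k) * \<delta>} r *\<^sub>R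
     ((1 / \<delta>) *\<^sub>R (LINT s:{a + (real k - 1) * \<delta><..a + real k * \<delta>}|lborel. f s)))"

lemma delayed_average_measurable [measurable]:
  "delayed_average a \<delta> n f \<in> borel_measurable borel"
  unfolding delayed_average_def[abs_def] by measurable

lemma delayed_average_outside:
  assumes "\<delta> \<ge> 0" "r \<notin> {a<..a + real n * \<delta>}"
  shows "delayed_average a \<delta> n f r = 0"
proof -
  have "r \<notin> {a + real k * \<delta><..a + real (Suc k) * \<delta>}" if "k < n" for k
  proof -
    have "real (Suc k) * \<delta> \<le> real n * \<delta>" "0 \<le> real k * \<delta>"
      using that assms(1) by (auto intro!: mult_right_mono)
    then show ?thesis using assms(2) by (auto simp del: of_nat_Suc)
  qed
  then show ?thesis unfolding delayed_average_def by (intro sum.neutral) (auto simp del: of_nat_Suc)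
qed

lemma delayed_average_inside:
  assumes "\<delta> > 0" "k < n" "r \<in> {a + real k * \<delta><..a + real (Suc k) * \<delta>}"
  shows "delayed_average a \<delta> n f r =
    (1 / \<delta>) *\<^sub>R (LINT s:{a + (real k - 1) * \<delta><..a + real k * \<delta>}|lborel. f s)"
proof -
  have "r \<notin> {a + real j * \<delta><..a + real (Suc j) * \<delta>}" if "j \<noteq> k" for j
  proof (cases "j < k")
    case True
    then have "real (Suc j) * \<delta> \<le> real k * \<delta>" using assms(1) by (intro mult_right_mono) auto
    then show ?thesis using assms(3) by (auto simp del: of_nat_Suc)
  next
    case False
    then have "real (Suc k) * \<delta> \<le> real j * \<delta>" using assms(1) that by (intro mult_right_mono) auto
    then show ?thesis using assms(3) by (auto simp del: of_nat_Suc)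
  qed
  then have "delayed_average a \<delta> n f r = (\<Sum>j<n. if j = k then
      (1 / \<delta>) *\<^sub>R (LINT s:{a + (real k - 1) * \<delta><..a + real k * \<delta>}|lborel. f s) else 0)"
    unfolding delayed_average_def
    by (intro sum.cong) (use assms(3) in \<open>auto simp del: of_nat_Suc\<close>)
  then show ?thesis using assms(2) by simp
qed

lemma delayed_average_cell:
  fixes a \<delta> r :: real
  assumes "\<delta> > 0" "r \<in> {a<..a + real n * \<delta>}"
  obtains k where "k < n" "r \<in> {a + real k * \<delta><..a + real (Suc k) * \<delta>}"
proof -
  have "(\<Sum>k<n. indicator {a + real k * \<delta><..a + real (Suc k) * \<delta>} r) = (indicator {a + real 0 * \<delta><..a + real n * \<delta>} r :: real)"
    by (rule sum_indicator_intervals) (use assms in \<open>auto simp: field_simps\<close>)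
  also have "\<dots> = 1" using assms by simp
  finally have "\<exists>k<n. indicator {a + real k * \<delta><..a + real (Suc k) * \<delta>} r \<noteq> (0::real)"
    by (metis (no_types, lifting) lessThan_iff sum.neutral zero_neq_one)
  then show ?thesis using that by (auto simp: indicator_def split: if_splits)
qed

text \<open>
  If \<open>f\<close> is not integrable on the interval, the Bochner integral is 0 and the bound is trivial.
\<close>

lemma norm_average_le:
  fixes f :: "real \<Rightarrow> 'b::{banach, second_countable_topology}"
  assumes "\<And>s. norm (f s) \<le> C" "C \<ge> 0" "\<delta> > 0"
  shows "norm ((1 / \<delta>) *\<^sub>R (LINT s:{x<..x + \<delta>}|lborel. f s)) \<le> C"
proof -
  have "norm (LINT s:{x<..x + \<delta>}|lborel. f s) \<le> C * \<delta>"
  proof (cases "set_integrable lborel {x<..x + \<delta>} f")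
    case True
    have "norm (LINT s:{x<..x + \<delta>}|lborel. f s) \<le> (LINT s:{x<..x + \<delta>}|lborel. norm (f s))"
      by (rule set_integral_norm_bound[OF True])
    also have "\<dots> \<le> (LINT s:{x<..x + \<delta>}|lborel. C)"
      by (rule set_integral_mono) (use True assms set_integrable_norm[OF True] in \<open>auto simp: set_integrable_def\<close>)
    also have "\<dots> = C * \<delta>" using assms by (simp add: set_lebesgue_integral_def)
    finally show ?thesis .
  qed (use assms in \<open>simp add: set_lebesgue_integral_def set_integrable_def not_integrable_integral_eq\<close>)
  then show ?thesis using assms by (simp add: field_simps)
qed

lemma delayed_average_bounded:
  assumes "\<And>s. norm (f s) \<le> C" "\<delta> > 0"
  shows "norm (delayed_average a \<delta> n f r) \<le> C"
proof (cases "r \<in> {a<..a + real n * \<delta>}")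
  case True
  have C: "C \<ge> 0" using assms(1)[of 0] norm_ge_zero order_trans by blast
  obtain k where k: "k < n" "r \<in> {a + real k * \<delta><..a + real (Suc k) * \<delta>}"
    using delayed_average_cell[OF assms(2) True] .
  have e: "a + real k * \<delta> = a + (real k - 1) * \<delta> + \<delta>" by (simp add: field_simps)
  show ?thesis
    unfolding delayed_average_inside[OF assms(2) k] unfolding e by (rule norm_average_le) (use assms C in auto)
next
  case False
  have "C \<ge> 0" using assms(1)[of 0] norm_ge_zero order_trans by blast
  with False assms show ?thesis by (simp add: delayed_average_outside)
qed

text \<open>
  The mass of \<open>f\<close> on a cell reappears, up to cancellation, on the next cell.
\<close>

lemma delayed_average_contraction:
  fixes f :: "real \<Rightarrow> 'b::{banach, second_countable_topology}"
  assumes f: "integrable lborel f" and "\<delta> > 0"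
  shows "(\<integral>\<^sup>+r. norm (delayed_average a \<delta> n f r) \<partial>lborel) \<le> (\<integral>\<^sup>+r. norm (f r) \<partial>lborel)"
proof -
  have [measurable]: "f \<in> borel_measurable borel" using borel_measurable_integrable[OF f] by simp
  define I where "I k = (LINT s:{a + (real k - 1) * \<delta><..a + real k * \<delta>}|lborel. f s)" for k :: nat
  have I: "ennreal (norm (I k)) \<le> (\<integral>\<^sup>+s. indicator {a + (real k - 1) * \<delta><..a + real k * \<delta>} s * ennreal (norm (f s)) \<partial>lborel)" for k
  proof -
    have "ennreal (norm (I k)) \<le> (\<integral>\<^sup>+s. norm (indicator {a + (real k - 1) * \<delta><..a + real k * \<delta>} s *\<^sub>R f s) \<partial>lborel)"
      unfolding I_def set_lebesgue_integral_def
      by (rule integral_norm_bound_ennreal) (intro integrable_mult_indicator f, simp)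
    also have "\<dots> = (\<integral>\<^sup>+s. indicator {a + (real k - 1) * \<delta><..a + real k * \<delta>} s * ennreal (norm (f s)) \<partial>lborel)"
      by (intro nn_integral_cong) (auto split: split_indicator)
    finally show ?thesis .
  qed
  have "(\<integral>\<^sup>+r. norm (delayed_average a \<delta> n f r) \<partial>lborel) \<le>
      (\<integral>\<^sup>+r. (\<Sum>k<n. ennreal (1 / \<delta> * norm (I k)) * indicator {a + real k * \<delta><..a + real (Suc k) * \<delta>} r) \<partial>lborel)"
  proof (rule nn_integral_mono)
    fix r
    have "norm (delayed_average a \<delta> n f r) \<le> (\<Sum>k<n. 1 / \<delta> * norm (I k) * indicator {a + real k * \<delta><..a + real (Suc k) * \<delta>} r)"
      unfolding delayed_average_def I_def[symmetric]
      by (rule order.trans[OF norm_sum]) (use assms(2) in \<open>auto intro!: sum_mono split: split_indicator\<close>)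
    then have "ennreal (norm (delayed_average a \<delta> n f r)) \<le> ennreal (\<Sum>k<n. 1 / \<delta> * norm (I k) * indicator {a + real k * \<delta><..a + real (Suc k) * \<delta>} r)"
      by (rule ennreal_leI)
    also have "\<dots> = (\<Sum>k<n. ennreal (1 / \<delta> * norm (I k)) * indicator {a + real k * \<delta><..a + real (Suc k) * \<delta>} r)"
    proof -
      have "ennreal (1 / \<delta> * norm (I k)) * indicator {a + real k * \<delta><..a + real (Suc k) * \<delta>} r =
          ennreal (1 / \<delta> * norm (I k) * indicator {a + real k * \<delta><..a + real (Suc k) * \<delta>} r)" for k
        by (simp del: of_nat_Suc split: split_indicator)
      then show ?thesis
        using assms(2) by (subst sum_ennreal[symmetric]) (auto simp del: of_nat_Suc)
    qed
    finally show "ennreal (norm (delayed_average a \<delta> n f r)) \<le> (\<Sum>k<n. ennreal (1 / \<delta> * norm (I k)) * indicator {a + real k * \<delta><..a + real (Suc k) * \<delta>} r)" .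
  qed
  also have "\<dots> = (\<Sum>k<n. ennreal (1 / \<delta> * norm (I k)) * ennreal \<delta>)"
    using assms(2) by (subst nn_integral_sum) (auto simp: nn_integral_cmult field_simps intro!: sum.cong)
  also have "\<dots> = (\<Sum>k<n. ennreal (norm (I k)))"
    using assms(2) by (intro sum.cong) (auto simp: ennreal_mult[symmetric])
  also have "\<dots> \<le> (\<Sum>k<n. \<integral>\<^sup>+s. indicator {a + (real k - 1) * \<delta><..a + real k * \<delta>} s * ennreal (norm (f s)) \<partial>lborel)"
    by (intro sum_mono I)
  also have "\<dots> = (\<integral>\<^sup>+s. (\<Sum>k<n. indicator {a + (real k - 1) * \<delta><..a + real k * \<delta>} s * ennreal (norm (f s))) \<partial>lborel)"
    by (subst nn_integral_sum) auto
  also have "\<dots> \<le> (\<integral>\<^sup>+s. norm (f s) \<partial>lborel)"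
  proof (rule nn_integral_mono)
    fix s
    have "(\<Sum>k<n. indicator {a + (real k - 1) * \<delta><..a + (real (Suc k) - 1) * \<delta>} s) = (indicator {a + (real 0 - 1) * \<delta><..a + (real n - 1) * \<delta>} s :: ennreal)"
      by (rule sum_indicator_intervals) (use assms in \<open>auto simp: field_simps\<close>)
    then have "(\<Sum>k<n. indicator {a + (real k - 1) * \<delta><..a + real k * \<delta>} s) \<le> (1 :: ennreal)"
      by (simp add: indicator_def)
    then have "(\<Sum>k<n. indicator {a + (real k - 1) * \<delta><..a + real k * \<delta>} s) * ennreal (norm (f s)) \<le> 1 * ennreal (norm (f s))"
      by (rule mult_right_mono) simp
    then show "(\<Sum>k<n. indicator {a + (real k - 1) * \<delta><..a + real k * \<delta>} s * ennreal (norm (f s))) \<le> ennreal (norm (f s))"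
      by (simp add: sum_distrib_right)
  qed
  finally show ?thesis .
qed

lemma delayed_average_diff:
  assumes "integrable lborel f" "integrable lborel g"
  shows "delayed_average a \<delta> n (\<lambda>r. f r - g r) r = delayed_average a \<delta> n f r - delayed_average a \<delta> n g r"
proof -
  have *: "(LINT s:A|lborel. f s - g s) = (LINT s:A|lborel. f s) - (LINT s:A|lborel. g s)" if "A \<in> sets borel" for A
    by (rule set_integral_diff) (use assms that in \<open>auto simp: set_integrable_def intro!: integrable_mult_indicator\<close>)
  show ?thesis
    unfolding delayed_average_def by (simp add: * scaleR_diff_right sum_subtractf del: of_nat_Suc)
qed

definition grid_average :: "real \<Rightarrow> real \<Rightarrow> nat \<Rightarrow> (real \<Rightarrow> 'b::{banach, second_countable_topology}) \<Rightarrow> real \<Rightarrow> 'b" where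
  "grid_average a b n f = delayed_average a ((b - a) / Suc n) (Suc n) f"

text \<open>
  Convergence is first proved in \<open>L\<^sup>1\<close>, where it passes from indicators to all integrable
  functions by linearity and contraction.
\<close>

definition grid_error :: "real \<Rightarrow> real \<Rightarrow> nat \<Rightarrow> (real \<Rightarrow> 'b::{banach, second_countable_topology}) \<Rightarrow> ennreal" where
  "grid_error a b n f = (\<integral>\<^sup>+r. norm (grid_average a b n (\<lambda>r. indicator {a<..b} r *\<^sub>R f r) r - indicator {a<..b} r *\<^sub>R f r) \<partial>lborel)"

text \<open>
  Averaging is a contraction, so that replacing \<open>f\<close> by \<open>g\<close> costs their distance twice: once
  under the average and once for the function itself.
\<close>

lemma grid_error_approx:
  assumes "a < b"
    and f: "integrable lborel (\<lambda>r. indicator {a<..b} r *\<^sub>R f r)"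
    and g: "integrable lborel (\<lambda>r. indicator {a<..b} r *\<^sub>R g r)"
  shows "grid_error a b n f \<le> grid_error a b n g + 2 * (\<integral>\<^sup>+r. norm (indicator {a<..b} r *\<^sub>R f r - indicator {a<..b} r *\<^sub>R g r) \<partial>lborel)"
proof -
  let ?f = "\<lambda>r. indicator {a<..b} r *\<^sub>R f r" and ?g = "\<lambda>r. indicator {a<..b} r *\<^sub>R g r"
  have [measurable]: "?f \<in> borel_measurable borel" "?g \<in> borel_measurable borel"
    using f g by (auto dest: borel_measurable_integrable)
  have d: "(b - a) / Suc n > 0" using assms(1) by simp
  have "grid_error a b n f \<le> (\<integral>\<^sup>+r. norm (grid_average a b n ?g r - ?g r) +
     (norm (grid_average a b n (\<lambda>r. ?f r - ?g r) r) + norm (?f r - ?g r)) \<partial>lborel)"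
    unfolding grid_error_def
  proof (rule nn_integral_mono)
    fix r
    have "grid_average a b n ?f r - ?f r = (grid_average a b n ?g r - ?g r) + (grid_average a b n (\<lambda>r. ?f r - ?g r) r - (?f r - ?g r))"
      unfolding grid_average_def by (simp add: delayed_average_diff[OF f g])
    then have "norm (grid_average a b n ?f r - ?f r) \<le> norm (grid_average a b n ?g r - ?g r) + (norm (grid_average a b n (\<lambda>r. ?f r - ?g r) r) + norm (?f r - ?g r))"
      by (simp only: order.trans[OF norm_triangle_ineq add_left_mono[OF norm_triangle_ineq4]])
    then show "ennreal (norm (grid_average a b n ?f r - ?f r)) \<le> ennreal (norm (grid_average a b n ?g r - ?g r) + (norm (grid_average a b n (\<lambda>r. ?f r - ?g r) r) + norm (?f r - ?g r)))"
      by (rule ennreal_leI)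
  qed
  also have "\<dots> = (\<integral>\<^sup>+r. ennreal (norm (grid_average a b n ?g r - ?g r)) +
     (ennreal (norm (grid_average a b n (\<lambda>r. ?f r - ?g r) r)) + ennreal (norm (?f r - ?g r))) \<partial>lborel)"
    by (intro nn_integral_cong) (simp only: ennreal_plus norm_ge_zero add_nonneg_nonneg)
  also have "\<dots> = grid_error a b n g + ((\<integral>\<^sup>+r. norm (grid_average a b n (\<lambda>r. ?f r - ?g r) r) \<partial>lborel) + (\<integral>\<^sup>+r. norm (?f r - ?g r) \<partial>lborel))"
    unfolding grid_error_def grid_average_def
    by (subst nn_integral_add, measurable, subst nn_integral_add, measurable)
  also have "\<dots> \<le> grid_error a b n g + ((\<integral>\<^sup>+r. norm (?f r - ?g r) \<partial>lborel) + (\<integral>\<^sup>+r. norm (?f r - ?g r) \<partial>lborel))"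
    unfolding grid_average_def
    by (intro add_mono order.refl delayed_average_contraction d Bochner_Integration.integrable_diff f g)
  finally show ?thesis by (simp add: mult_2[symmetric])
qed

lemma grid_error_limit:
  assumes "a < b"
    and f: "integrable lborel (\<lambda>r. indicator {a<..b} r *\<^sub>R f r)"
    and g: "\<And>i. integrable lborel (\<lambda>r. indicator {a<..b} r *\<^sub>R g i r)"
    and g0: "\<And>i. (\<lambda>n. grid_error a b n (g i)) \<longlonglongrightarrow> 0"
    and lim: "(\<lambda>i. \<integral>\<^sup>+r. norm (indicator {a<..b} r *\<^sub>R f r - indicator {a<..b} r *\<^sub>R g i r) \<partial>lborel) \<longlonglongrightarrow> 0"
  shows "(\<lambda>n. grid_error a b n f) \<longlonglongrightarrow> 0"
proof -
  let ?d = "\<lambda>i. \<integral>\<^sup>+r. norm (indicator {a<..b} r *\<^sub>R f r - indicator {a<..b} r *\<^sub>R g i r) \<partial>lborel"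
  have "limsup (\<lambda>n. grid_error a b n f) \<le> 2 * ?d i" for i
  proof -
    have "limsup (\<lambda>n. grid_error a b n f) \<le> limsup (\<lambda>n. grid_error a b n (g i) + 2 * ?d i)"
      by (intro Limsup_mono always_eventually allI grid_error_approx assms)
    also have "(\<lambda>n. grid_error a b n (g i) + 2 * ?d i) \<longlonglongrightarrow> 0 + 2 * ?d i"
      by (intro tendsto_add g0 tendsto_const)
    then have "limsup (\<lambda>n. grid_error a b n (g i) + 2 * ?d i) = 0 + 2 * ?d i"
      by (rule lim_imp_Limsup[rotated]) simp
    finally show ?thesis by simp
  qed
  moreover have "(\<lambda>i. 2 * ?d i) \<longlonglongrightarrow> 2 * 0"
    by (intro ennreal_tendsto_cmult lim) simp
  ultimately have "limsup (\<lambda>n. grid_error a b n f) \<le> 2 * 0"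
    by (intro LIMSEQ_le_const[where X="\<lambda>i. 2 * ?d i"]) auto
  then show ?thesis by (intro tendsto_0_if_Limsup_eq_0_ennreal) simp
qed

lemma grid_error_diff:
  assumes "a < b"
    and f: "integrable lborel (\<lambda>r. indicator {a<..b} r *\<^sub>R f r)"
    and g: "integrable lborel (\<lambda>r. indicator {a<..b} r *\<^sub>R g r)"
    and f0: "(\<lambda>n. grid_error a b n f) \<longlonglongrightarrow> 0"
    and g0: "(\<lambda>n. grid_error a b n g) \<longlonglongrightarrow> 0"
  shows "(\<lambda>n. grid_error a b n (\<lambda>r. f r - g r)) \<longlonglongrightarrow> 0"
proof (rule tendsto_sandwich[OF _ _ tendsto_const])
  let ?f = "\<lambda>r. indicator {a<..b} r *\<^sub>R f r" and ?g = "\<lambda>r. indicator {a<..b} r *\<^sub>R g r"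
  have [measurable]: "?f \<in> borel_measurable borel" "?g \<in> borel_measurable borel"
    using f g by (auto dest: borel_measurable_integrable)
  have *: "grid_error a b n (\<lambda>r. f r - g r) \<le> grid_error a b n f + grid_error a b n g" for n
  proof -
    have "grid_error a b n (\<lambda>r. f r - g r) \<le> (\<integral>\<^sup>+r. norm (grid_average a b n ?f r - ?f r) + norm (grid_average a b n ?g r - ?g r) \<partial>lborel)"
      unfolding grid_error_def
    proof (rule nn_integral_mono)
      fix r
      have "grid_average a b n (\<lambda>r. indicator {a<..b} r *\<^sub>R (f r - g r)) r - indicator {a<..b} r *\<^sub>R (f r - g r)
        = (grid_average a b n ?f r - ?f r) - (grid_average a b n ?g r - ?g r)"
        unfolding grid_average_def by (simp add: delayed_average_diff[OF f g] scaleR_diff_right)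
      then show "ennreal (norm (grid_average a b n (\<lambda>r. indicator {a<..b} r *\<^sub>R (f r - g r)) r - indicator {a<..b} r *\<^sub>R (f r - g r)))
         \<le> ennreal (norm (grid_average a b n ?f r - ?f r) + norm (grid_average a b n ?g r - ?g r))"
        by (intro ennreal_leI) (simp add: norm_triangle_ineq4)
    qed
    also have "\<dots> = (\<integral>\<^sup>+r. ennreal (norm (grid_average a b n ?f r - ?f r)) + ennreal (norm (grid_average a b n ?g r - ?g r)) \<partial>lborel)"
      by (intro nn_integral_cong) simp
    also have "\<dots> = grid_error a b n f + grid_error a b n g"
      unfolding grid_error_def grid_average_def by (subst nn_integral_add) auto
    finally show ?thesis .
  qed
  then show "\<forall>\<^sub>F n in sequentially. grid_error a b n (\<lambda>r. f r - g r) \<le> grid_error a b n f + grid_error a b n g"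
    by simp
  show "(\<lambda>n. grid_error a b n f + grid_error a b n g) \<longlonglongrightarrow> 0"
    using tendsto_add[OF f0 g0] by simp
qed simp

text \<open>
  For a half line the average is exact on every cell except the first one and those whose own or
  preceding cell meets the jump. With mesh \<open>\<delta>\<close>, the error is carried by an interval of length
  \<open>\<delta>\<close> after \<open>a\<close> and one of length \<open>2 * \<delta>\<close> after \<open>x\<close>.
\<close>

lemma grid_error_atMost:
  fixes c :: "'b::{banach, second_countable_topology}"
  assumes "a < b"
  shows "(\<lambda>n. grid_error a b n (\<lambda>r. indicator {..x} r *\<^sub>R c)) \<longlonglongrightarrow> 0"
proof (rule tendsto_sandwich[OF _ _ tendsto_const])
  let ?f = "\<lambda>r. indicator {a<..b} r *\<^sub>R indicator {..x} r *\<^sub>R c"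
  have *: "grid_error a b n (\<lambda>r. indicator {..x} r *\<^sub>R c) \<le> ennreal (norm c * (3 * ((b - a) / Suc n)))" for n
  proof -
    define \<delta> where "\<delta> = (b - a) / Suc n"
    have d: "\<delta> > 0" using assms by (simp add: \<delta>_def)
    have b: "b = a + real (Suc n) * \<delta>" by (simp add: \<delta>_def del: of_nat_Suc)
    have f: "norm (?f r) \<le> norm c" for r by (simp split: split_indicator)
    have bound: "norm (delayed_average a \<delta> (Suc n) ?f r - ?f r) \<le> norm c * (indicator {a<..a + \<delta>} r + indicator {x<..x + 2 * \<delta>} r)" for r
    proof (cases "r \<in> {a<..b}")
      case False
      then show ?thesis using d b by (subst delayed_average_outside) (auto simp del: of_nat_Suc)
    next
      case True
      then obtain k where k: "k < Suc n" "r \<in> {a + real k * \<delta><..a + real (Suc k) * \<delta>}"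
        using delayed_average_cell[OF d, of r a "Suc n"] b by metis
      have avg: "delayed_average a \<delta> (Suc n) ?f r = (1 / \<delta>) *\<^sub>R (LINT s:{a + (real k - 1) * \<delta><..a + real k * \<delta>}|lborel. ?f s)"
        by (rule delayed_average_inside[OF d k])
      consider "k = 0" | "k > 0" "r \<le> x" | "k > 0" "r > x" "a + (real k - 1) * \<delta> \<ge> x" | "k > 0" "r > x" "a + (real k - 1) * \<delta> < x"
        by linarith
      then show ?thesis
      proof cases
        case 1
        have z: "(\<lambda>s. indicator {a - \<delta><..a} s *\<^sub>R ?f s) = (\<lambda>s. 0)"
          by (auto split: split_indicator)
        have "delayed_average a \<delta> (Suc n) ?f r = 0"
          unfolding avg using 1 z by (simp add: set_lebesgue_integral_def)
        moreover have "r \<in> {a<..a + \<delta>}" using 1 k by simp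
        ultimately show ?thesis using f[of r] by (simp add: add_increasing2 mult_le_cancel_left1 split: split_indicator)
      next
        case 2
        have k1: "0 \<le> (real k - 1) * \<delta>" using 2 d by simp
        have "(LINT s:{a + (real k - 1) * \<delta><..a + real k * \<delta>}|lborel. ?f s) = (LINT s:{a + (real k - 1) * \<delta><..a + real k * \<delta>}|lborel. c)"
          by (rule set_lebesgue_integral_cong) (use 2 k k1 True in \<open>auto split: split_indicator\<close>)
        also have "\<dots> = \<delta> *\<^sub>R c"
          using d by (simp add: set_lebesgue_integral_def algebra_simps)
        finally have "delayed_average a \<delta> (Suc n) ?f r = c" unfolding avg using d by simp
        then show ?thesis using 2 True by simp
      next
        case 3
        have z: "(\<lambda>s. indicator {a + (real k - 1) * \<delta><..a + real k * \<delta>} s *\<^sub>R ?f s) = (\<lambda>s. 0)"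
          using 3 by (auto split: split_indicator)
        have "delayed_average a \<delta> (Suc n) ?f r = 0"
          unfolding avg set_lebesgue_integral_def z by simp
        then show ?thesis using 3 by simp
      next
        case 4
        have "r \<le> a + (real k - 1) * \<delta> + 2 * \<delta>" using k by (simp add: algebra_simps)
        with 4 have "r \<in> {x<..x + 2 * \<delta>}" by simp
        moreover have le: "norm (delayed_average a \<delta> (Suc n) ?f r) \<le> norm c"
          by (rule delayed_average_bounded[OF f d])
        moreover have "norm (delayed_average a \<delta> (Suc n) ?f r) \<le> norm c * 2"
          using le norm_ge_zero[of c] by linarith
        ultimately show ?thesis using 4 by (simp split: split_indicator)
      qed
    qed
    have "grid_error a b n (\<lambda>r. indicator {..x} r *\<^sub>R c) \<le> (\<integral>\<^sup>+r. ennreal (norm c) * (indicator {a<..a + \<delta>} r + indicator {x<..x + 2 * \<delta>} r) \<partial>lborel)"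
      unfolding grid_error_def grid_average_def \<delta>_def[symmetric]
    proof (rule nn_integral_mono)
      fix r
      have "ennreal (norm (delayed_average a \<delta> (Suc n) ?f r - ?f r)) \<le> ennreal (norm c * (indicator {a<..a + \<delta>} r + indicator {x<..x + 2 * \<delta>} r))"
        using bound by (rule ennreal_leI)
      also have "\<dots> = ennreal (norm c) * (indicator {a<..a + \<delta>} r + indicator {x<..x + 2 * \<delta>} r)"
        by (simp add: ennreal_mult ennreal_indicator[symmetric] ennreal_plus del: ennreal_indicator)
      finally show "ennreal (norm (delayed_average a \<delta> (Suc n) ?f r - ?f r)) \<le> ennreal (norm c) * (indicator {a<..a + \<delta>} r + indicator {x<..x + 2 * \<delta>} r)" .
    qed
    also have "\<dots> = ennreal (norm c) * (ennreal \<delta> + ennreal (2 * \<delta>))"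
      using d by (simp add: nn_integral_cmult nn_integral_add)
    also have "\<dots> = ennreal (norm c * (3 * \<delta>))"
      using d by (simp add: ennreal_mult[symmetric] ennreal_plus[symmetric] del: ennreal_plus)
    finally show ?thesis unfolding \<delta>_def .
  qed
  then show "\<forall>\<^sub>F n in sequentially. grid_error a b n (\<lambda>r. indicator {..x} r *\<^sub>R c) \<le> ennreal (norm c * (3 * ((b - a) / Suc n)))"
    by simp
  have "(\<lambda>n. norm c * (3 * ((b - a) * (1 / Suc n)))) \<longlonglongrightarrow> norm c * (3 * ((b - a) * 0))"
    by (intro tendsto_intros LIMSEQ_Suc[OF lim_1_over_n])
  from tendsto_ennrealI[OF this] show "(\<lambda>n. ennreal (norm c * (3 * ((b - a) / Suc n)))) \<longlonglongrightarrow> 0"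
    by simp
qed simp

text \<open>
  Dynkin's argument: half lines form a generator stable under intersection, and vanishing of the
  error is inherited by complements and disjoint unions.
\<close>

lemma grid_error_indicator:
  fixes c :: "'b::{banach, second_countable_topology}"
  assumes "a < b" "A \<in> sets borel"
  shows "(\<lambda>n. grid_error a b n (\<lambda>r. indicator A r *\<^sub>R c)) \<longlonglongrightarrow> 0"
proof -
  have int: "integrable lborel (\<lambda>r. indicator {a<..b} r *\<^sub>R indicator A r *\<^sub>R c)" if "A \<in> sets borel" for A
  proof -
    have "emeasure lborel ({a<..b} \<inter> A) \<le> emeasure lborel {a<..b}" by (intro emeasure_mono) auto
    also have "\<dots> < \<infinity>" using assms(1) by simp
    finally have "integrable lborel (\<lambda>r. indicator ({a<..b} \<inter> A) r *\<^sub>R c)"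
      using that by (intro integrable_scaleR_left integrable_real_indicator) auto
    then show ?thesis by (simp add: indicator_inter_arith)
  qed
  have full: "(\<lambda>n. grid_error a b n (\<lambda>r. indicator UNIV r *\<^sub>R c)) \<longlonglongrightarrow> 0"
  proof -
    have "grid_error a b n (\<lambda>r. indicator UNIV r *\<^sub>R c) = grid_error a b n (\<lambda>r. indicator {..b} r *\<^sub>R c)" for n
    proof -
      have "(\<lambda>r. indicator {a<..b} r *\<^sub>R indicator UNIV r *\<^sub>R c) = (\<lambda>r. indicator {a<..b} r *\<^sub>R indicator {..b} r *\<^sub>R c)"
        by (auto split: split_indicator)
      then show ?thesis unfolding grid_error_def by (simp only: fun_eq_iff)
    qed
    then show ?thesis using grid_error_atMost[OF assms(1)] by simp
  qed
  have "Int_stable (range (\<lambda>x::real. {..x}))" by (auto simp: Int_stable_def)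
  moreover have "range (\<lambda>x::real. {..x}) \<subseteq> Pow UNIV" by simp
  moreover have "A \<in> sigma_sets UNIV (range (\<lambda>x::real. {..x}))"
    using assms(2) unfolding borel_eq_atMost by simp
  ultimately show ?thesis
  proof (induct rule: sigma_sets_induct_disjoint)
    show "(\<lambda>n. grid_error a b n (\<lambda>r. indicator A r *\<^sub>R c)) \<longlonglongrightarrow> 0" if "A \<in> range (\<lambda>x::real. {..x})" for A
      using that grid_error_atMost[OF assms(1)] by auto
    show "(\<lambda>n. grid_error a b n (\<lambda>r. indicator {} r *\<^sub>R c)) \<longlonglongrightarrow> 0"
      by (simp add: grid_error_def grid_average_def delayed_average_def)
    show "(\<lambda>n. grid_error a b n (\<lambda>r. indicator (UNIV - A) r *\<^sub>R c)) \<longlonglongrightarrow> 0"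
      if "A \<in> sigma_sets UNIV (range (\<lambda>x::real. {..x}))" "(\<lambda>n. grid_error a b n (\<lambda>r. indicator A r *\<^sub>R c)) \<longlonglongrightarrow> 0" for A
    proof -
      have [measurable]: "A \<in> sets borel" using that(1) unfolding borel_eq_atMost by simp
      have "(\<lambda>r. indicator (UNIV - A) r *\<^sub>R c) = (\<lambda>r. indicator UNIV r *\<^sub>R c - indicator A r *\<^sub>R c)"
        by (auto split: split_indicator)
      then show ?thesis using grid_error_diff[OF assms(1) int int full that(2)] by simp
    qed
    show "(\<lambda>n. grid_error a b n (\<lambda>r. indicator (\<Union>(range X)) r *\<^sub>R c)) \<longlonglongrightarrow> 0"
      if X: "disjoint_family X" "range X \<subseteq> sigma_sets UNIV (range (\<lambda>x::real. {..x}))"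
        "\<And>i. (\<lambda>n. grid_error a b n (\<lambda>r. indicator (X i) r *\<^sub>R c)) \<longlonglongrightarrow> 0" for X :: "nat \<Rightarrow> real set"
    proof -
      have [measurable]: "X i \<in> sets borel" for i using X(2) unfolding borel_eq_atMost by auto
      have fin: "(\<lambda>n. grid_error a b n (\<lambda>r. indicator (\<Union>i<m. X i) r *\<^sub>R c)) \<longlonglongrightarrow> 0" for m :: nat
      proof (induction m)
        case 0
        then show ?case by (simp add: grid_error_def grid_average_def delayed_average_def)
      next
        case (Suc m)
        have neg: "(\<lambda>n. grid_error a b n (\<lambda>r. indicator {} r *\<^sub>R c - indicator (X m) r *\<^sub>R c)) \<longlonglongrightarrow> 0"
          by (rule grid_error_diff[OF assms(1) int int _ X(3)])
             (auto simp: grid_error_def grid_average_def delayed_average_def)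
        have "(\<lambda>n. grid_error a b n (\<lambda>r. indicator (\<Union>i<m. X i) r *\<^sub>R c - (indicator {} r *\<^sub>R c - indicator (X m) r *\<^sub>R c))) \<longlonglongrightarrow> 0"
          by (rule grid_error_diff[OF assms(1) int _ Suc.IH neg])
             (use int[of "X m"] in \<open>auto simp: scaleR_diff_right\<close>)
        moreover have "indicator (\<Union>i<m. X i) r *\<^sub>R c - (indicator {} r *\<^sub>R c - indicator (X m) r *\<^sub>R c) = indicator (\<Union>i<Suc m. X i) r *\<^sub>R c" for r
        proof -
          have "indicator (\<Union>i<Suc m. X i) r = (indicator (\<Union>i<m. X i) r + indicator (X m) r :: real)"
          proof -
            have "r \<notin> X m" if "r \<in> X i" "i < m" for i
              using disjoint_family_onD[OF X(1), of i m] that by auto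
            then show ?thesis unfolding lessThan_Suc by (auto simp: indicator_def)
          qed
          then show ?thesis by (simp add: scaleR_add_left)
        qed
        ultimately show ?case by simp
      qed
      show ?thesis
      proof (rule grid_error_limit[OF assms(1) int int fin])
        let ?h = "\<lambda>m r. ennreal (norm (indicator {a<..b} r *\<^sub>R indicator (\<Union>(range X)) r *\<^sub>R c - indicator {a<..b} r *\<^sub>R indicator (\<Union>i<m. X i) r *\<^sub>R c))"
        have "(\<lambda>m. \<integral>\<^sup>+r. ?h m r \<partial>lborel) \<longlonglongrightarrow> (\<integral>\<^sup>+(r::real). 0 \<partial>lborel)"
        proof (rule nn_integral_dominated_convergence[where w="\<lambda>r. ennreal (norm c) * indicator {a<..b} r"])
          show "(\<integral>\<^sup>+r. ennreal (norm c) * indicator {a<..b} r \<partial>lborel) < \<infinity>"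
            using assms(1) by (simp add: nn_integral_cmult ennreal_mult_less_top)
          show "AE r in lborel. (\<lambda>m. ?h m r) \<longlonglongrightarrow> 0"
          proof (rule AE_I2)
            fix r :: real
            have "eventually (\<lambda>m. ?h m r = 0) sequentially"
            proof (cases "r \<in> \<Union>(range X)")
              case True
              then obtain i where "r \<in> X i" by auto
              then have "?h m r = 0" if "m > i" for m using that True by (auto simp: indicator_def)
              then show ?thesis by (auto intro: eventually_at_top_dense[THEN iffD2])
            next
              case False
              then have "?h m r = 0" for m by (auto simp: indicator_def)
              then show ?thesis by simp
            qed
            then show "(\<lambda>m. ?h m r) \<longlonglongrightarrow> 0" by (rule tendsto_eventually)
          qed
        qed (auto intro!: AE_I2 split: split_indicator)
        then show "(\<lambda>m. \<integral>\<^sup>+r. ?h m r \<partial>lborel) \<longlonglongrightarrow> 0" by simp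
      qed auto
    qed
  qed
qed

lemma grid_error_tendsto_0:
  fixes f :: "real \<Rightarrow> 'b::{banach, second_countable_topology}"
  assumes "a < b" and f: "integrable lborel f"
  shows "(\<lambda>n. grid_error a b n f) \<longlonglongrightarrow> 0"
  using f
proof (induction rule: integrable_induct)
  case (base A c)
  then show ?case by (intro grid_error_indicator assms) auto
next
  case (add f g)
  have int: "integrable lborel (\<lambda>r. indicator {a<..b} r *\<^sub>R h r)" if "integrable lborel h" for h :: "real \<Rightarrow> 'b"
    using that by (intro integrable_mult_indicator) auto
  have neg: "(\<lambda>n. grid_error a b n (\<lambda>r. indicator {} r *\<^sub>R 0 - g r)) \<longlonglongrightarrow> 0"
    by (rule grid_error_diff[OF assms(1) _ int grid_error_indicator[OF assms(1)] add.IH(2)]) (use add in auto)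
  have "(\<lambda>n. grid_error a b n (\<lambda>r. f r - (indicator {} r *\<^sub>R 0 - g r))) \<longlonglongrightarrow> 0"
    by (rule grid_error_diff[OF assms(1) int int add.IH(1) neg]) (use add in auto)
  then show ?case by simp
next
  case (lim f s)
  have int: "integrable lborel (\<lambda>r. indicator {a<..b} r *\<^sub>R h r)" if "integrable lborel h" for h :: "real \<Rightarrow> 'b"
    using that by (intro integrable_mult_indicator) auto
  have [measurable]: "f \<in> borel_measurable borel" "s i \<in> borel_measurable borel" for i
    using lim by (auto dest: borel_measurable_integrable)
  show ?case
  proof (rule grid_error_limit[OF assms(1) int int lim.IH])
    let ?h = "\<lambda>i r. ennreal (norm (indicator {a<..b} r *\<^sub>R f r - indicator {a<..b} r *\<^sub>R s i r))"
    have "(\<lambda>i. \<integral>\<^sup>+r. ?h i r \<partial>lborel) \<longlonglongrightarrow> (\<integral>\<^sup>+(r::real). 0 \<partial>lborel)"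
    proof (rule nn_integral_dominated_convergence[where w="\<lambda>r. ennreal (3 * norm (f r))"])
      show "(\<integral>\<^sup>+r. ennreal (3 * norm (f r)) \<partial>lborel) < \<infinity>"
        using lim.hyps(4) by (simp add: integrable_iff_bounded ennreal_mult nn_integral_cmult ennreal_mult_less_top)
      show "AE r in lborel. (\<lambda>i. ?h i r) \<longlonglongrightarrow> 0"
      proof (rule AE_I2)
        fix r :: real
        have "(\<lambda>i. norm (indicator {a<..b} r *\<^sub>R f r - indicator {a<..b} r *\<^sub>R s i r)) \<longlonglongrightarrow> norm (indicator {a<..b} r *\<^sub>R f r - indicator {a<..b} r *\<^sub>R f r)"
          by (intro tendsto_intros lim.hyps(2)) simp
        from tendsto_ennrealI[OF this] show "(\<lambda>i. ?h i r) \<longlonglongrightarrow> 0" by simp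
      qed
      show "AE r in lborel. ?h i r \<le> ennreal (3 * norm (f r))" for i
      proof (rule AE_I2)
        fix r
        have "norm (f r - s i r) \<le> norm (f r) + norm (s i r)" by (rule norm_triangle_ineq4)
        then have "norm (f r - s i r) \<le> 3 * norm (f r)" using lim.hyps(3)[of r i] by simp
        then show "?h i r \<le> ennreal (3 * norm (f r))" by (intro ennreal_leI) (auto split: split_indicator)
      qed
    qed auto
    then show "(\<lambda>i. \<integral>\<^sup>+r. ?h i r \<partial>lborel) \<longlonglongrightarrow> 0" by simp
  qed (use lim in auto)
qed

text \<open>
  For a function bounded by \<open>C\<close> the squared error is at most \<open>2 * C\<close> times the error, so that
  convergence in \<open>L\<^sup>1\<close> suffices.
\<close>

lemma grid_average_L2_tendsto:
  fixes f :: "real \<Rightarrow> 'b::{banach, second_countable_topology}"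
  assumes "a < b" and [measurable]: "f \<in> borel_measurable borel"
    and bound: "\<And>r. norm (f r) \<le> C" and zero: "\<And>r. r \<notin> {a<..b} \<Longrightarrow> f r = 0"
  shows "(\<lambda>n. \<integral>\<^sup>+r. nsq (grid_average a b n f r - f r) \<partial>lborel) \<longlonglongrightarrow> 0"
proof (rule tendsto_sandwich[OF _ _ tendsto_const])
  have C: "C \<ge> 0" using bound[of 0] norm_ge_zero order_trans by blast
  have f: "indicator {a<..b} r *\<^sub>R f r = f r" for r using zero[of r] by (auto simp: indicator_def)
  have "(\<integral>\<^sup>+r. norm (f r) \<partial>lborel) \<le> (\<integral>\<^sup>+r. ennreal C * indicator {a<..b} r \<partial>lborel)"
    by (intro nn_integral_mono) (use bound zero in \<open>auto split: split_indicator intro: ennreal_leI\<close>)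
  also have "\<dots> < \<infinity>" using assms(1) by (simp add: nn_integral_cmult ennreal_mult_less_top)
  finally have int: "integrable lborel f" by (simp add: integrable_iff_bounded)
  have d: "(b - a) / Suc n > 0" for n using assms(1) by simp
  have "(\<integral>\<^sup>+r. nsq (grid_average a b n f r - f r) \<partial>lborel) \<le> ennreal (2 * C) * grid_error a b n f" for n
  proof -
    have "(\<integral>\<^sup>+r. nsq (grid_average a b n f r - f r) \<partial>lborel) \<le> (\<integral>\<^sup>+r. ennreal (2 * C) * ennreal (norm (grid_average a b n f r - f r)) \<partial>lborel)"
    proof (rule nn_integral_mono)
      fix r
      have "norm (grid_average a b n f r - f r) \<le> norm (grid_average a b n f r) + norm (f r)"
        by (rule norm_triangle_ineq4)
      also have "\<dots> \<le> C + C"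
        unfolding grid_average_def by (intro add_mono bound delayed_average_bounded d)
      finally have "(norm (grid_average a b n f r - f r))\<^sup>2 \<le> 2 * C * norm (grid_average a b n f r - f r)"
        by (simp add: power2_eq_square mult_right_mono)
      then have "nsq (grid_average a b n f r - f r) \<le> ennreal (2 * C * norm (grid_average a b n f r - f r))"
        by (rule ennreal_leI)
      then show "nsq (grid_average a b n f r - f r) \<le> ennreal (2 * C) * ennreal (norm (grid_average a b n f r - f r))"
        using C by (simp add: ennreal_mult)
    qed
    also have "\<dots> = ennreal (2 * C) * grid_error a b n f"
      unfolding grid_error_def f grid_average_def by (rule nn_integral_cmult) measurable
    finally show ?thesis .
  qed
  then show "\<forall>\<^sub>F n in sequentially. (\<integral>\<^sup>+r. nsq (grid_average a b n f r - f r) \<partial>lborel) \<le> ennreal (2 * C) * grid_error a b n f"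
    by simp
  have "(\<lambda>n. ennreal (2 * C) * grid_error a b n f) \<longlonglongrightarrow> ennreal (2 * C) * 0"
    by (intro ennreal_tendsto_cmult grid_error_tendsto_0 assms(1) int) simp
  then show "(\<lambda>n. ennreal (2 * C) * grid_error a b n f) \<longlonglongrightarrow> 0" by simp
qed simp

section \<open>Exponentially weighted time integrals\<close>

lemma nn_integral_exp_tail:
  assumes "\<gamma> > 0"
  shows "(\<integral>\<^sup>+t. ennreal (exp (- \<gamma> * t)) * indicator {s..} t \<partial>lborel) = ennreal (exp (- \<gamma> * s) / \<gamma>)"
proof -
  have "((\<lambda>t. - exp (- \<gamma> * t) / \<gamma>) \<longlongrightarrow> - 0 / \<gamma>) at_top"
  proof (intro tendsto_intros)
    have "filterlim (\<lambda>t. - \<gamma> * t) at_bot at_top"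
      using assms by (intro filterlim_tendsto_neg_mult_at_bot[OF tendsto_const] filterlim_ident) auto
    then show "((\<lambda>t. exp (- \<gamma> * t)) \<longlongrightarrow> 0) at_top"
      by (rule filterlim_compose[OF exp_at_bot])
  qed (use assms in auto)
  then have "((\<lambda>t. - exp (- \<gamma> * t) / \<gamma>) \<longlongrightarrow> 0) at_top" by simp
  then have "(\<integral>\<^sup>+t. ennreal (exp (- \<gamma> * t)) * indicator {s..} t \<partial>lborel) = ennreal (0 - (- exp (- \<gamma> * s) / \<gamma>))"
    by (intro nn_integral_FTC_atLeast) (use assms in \<open>auto intro!: derivative_eq_intros\<close>)
  then show ?thesis by simp
qed

text \<open>
  Fubini: the value at time \<open>s\<close> is counted with the total weight of the times after \<open>s\<close>.
\<close>

lemma nn_integral_exp_weight: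
  fixes h :: "real \<Rightarrow> ennreal"
  assumes "\<gamma> > 0" and [measurable]: "h \<in> borel_measurable borel"
  shows "(\<integral>\<^sup>+t. ennreal (exp (- \<gamma> * t)) * (\<integral>\<^sup>+s\<in>{a..t}. h s \<partial>lborel) \<partial>lborel) =
    ennreal (1 / \<gamma>) * (\<integral>\<^sup>+s\<in>{a..}. ennreal (exp (- \<gamma> * s)) * h s \<partial>lborel)"
proof -
  have "(\<integral>\<^sup>+t. ennreal (exp (- \<gamma> * t)) * (\<integral>\<^sup>+s\<in>{a..t}. h s \<partial>lborel) \<partial>lborel) =
    (\<integral>\<^sup>+t. (\<integral>\<^sup>+s. ennreal (exp (- \<gamma> * t)) * (h s * indicator {a..} s * (if s \<le> t then 1 else 0)) \<partial>lborel) \<partial>lborel)"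
    by (subst nn_integral_cmult[symmetric]) (auto intro!: nn_integral_cong split: split_indicator)
  also have "\<dots> = (\<integral>\<^sup>+s. (\<integral>\<^sup>+t. ennreal (exp (- \<gamma> * t)) * (h s * indicator {a..} s * (if s \<le> t then 1 else 0)) \<partial>lborel) \<partial>lborel)"
    by (rule lborel_pair.Fubini') measurable
  also have "\<dots> = (\<integral>\<^sup>+s. h s * indicator {a..} s * (\<integral>\<^sup>+t. ennreal (exp (- \<gamma> * t)) * indicator {s..} t \<partial>lborel) \<partial>lborel)"
    by (subst nn_integral_cmult[symmetric]) (auto intro!: nn_integral_cong simp: ac_simps split: split_indicator)
  also have "\<dots> = (\<integral>\<^sup>+s. ennreal (1 / \<gamma>) * (ennreal (exp (- \<gamma> * s)) * h s * indicator {a..} s) \<partial>lborel)"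
  proof (rule nn_integral_cong)
    fix s
    have "ennreal (exp (- \<gamma> * s) / \<gamma>) = ennreal (1 / \<gamma>) * ennreal (exp (- \<gamma> * s))"
      using assms(1) by (simp add: ennreal_mult[symmetric])
    then show "h s * indicator {a..} s * (\<integral>\<^sup>+t. ennreal (exp (- \<gamma> * t)) * indicator {s..} t \<partial>lborel) =
        ennreal (1 / \<gamma>) * (ennreal (exp (- \<gamma> * s)) * h s * indicator {a..} s)"
      unfolding nn_integral_exp_tail[OF assms(1)] by (simp only: ac_simps)
  qed
  also have "\<dots> = ennreal (1 / \<gamma>) * (\<integral>\<^sup>+s\<in>{a..}. ennreal (exp (- \<gamma> * s)) * h s \<partial>lborel)"
    by (rule nn_integral_cmult) measurable
  finally show ?thesis .
qed

text \<open>
  Cauchy-Schwarz with the weight \<open>exp (\<gamma> * s)\<close> bounds the square of the inner integral by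
  \<open>exp (\<gamma> * t) / \<gamma>\<close> times the integral of \<open>exp (- \<gamma> * s) * (g s)\<^sup>2\<close>; what is left has the form
  treated by \<open>nn_integral_exp_weight\<close>, with rate \<open>\<beta> - \<gamma>\<close>. The choice \<open>\<gamma> = \<beta> / 2\<close> minimises the
  resulting constant \<open>1 / (\<gamma> * (\<beta> - \<gamma>))\<close>.
\<close>

lemma Hardy_exp_weight:
  fixes g :: "real \<Rightarrow> ennreal"
  assumes "\<beta> > 0" and [measurable]: "g \<in> borel_measurable borel"
  shows "(\<integral>\<^sup>+t. ennreal (exp (- \<beta> * t)) * (\<integral>\<^sup>+s\<in>{a..t}. g s \<partial>lborel)\<^sup>2 \<partial>lborel) \<le>
    ennreal (4 / \<beta>\<^sup>2) * (\<integral>\<^sup>+s\<in>{a..}. ennreal (exp (- \<beta> * s)) * (g s)\<^sup>2 \<partial>lborel)"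
proof -
  define \<gamma> where "\<gamma> = \<beta> / 2"
  have \<gamma>: "\<gamma> > 0" "\<beta> = \<gamma> + \<gamma>" using assms by (auto simp: \<gamma>_def)
  let ?h = "\<lambda>s. ennreal (exp (- \<gamma> * s)) * (g s)\<^sup>2"
  have CS: "(\<integral>\<^sup>+s\<in>{a..t}. g s \<partial>lborel)\<^sup>2 \<le> ennreal (exp (\<gamma> * t) / \<gamma>) * (\<integral>\<^sup>+s\<in>{a..t}. ?h s \<partial>lborel)" for t
  proof -
    define p q where "p s = ennreal (exp (\<gamma> * s / 2))" and "q s = ennreal (exp (- (\<gamma> * s / 2)))" for s
    have [measurable]: "p \<in> borel_measurable borel" "q \<in> borel_measurable borel"
      unfolding p_def q_def by measurable
    have pq: "p s * q s = 1" "(p s)\<^sup>2 = ennreal (exp (\<gamma> * s))" "(q s)\<^sup>2 = ennreal (exp (- \<gamma> * s))" for s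
      by (simp_all add: p_def q_def power2_eq_square ennreal_mult[symmetric] exp_add[symmetric])
    have "(\<integral>\<^sup>+s\<in>{a..t}. g s \<partial>lborel) = (\<integral>\<^sup>+s. (p s * indicator {a..t} s) * (q s * g s * indicator {a..t} s) \<partial>lborel)"
      by (intro nn_integral_cong) (simp add: mult.assoc[symmetric] pq(1) split: split_indicator)
    also have "\<dots>\<^sup>2 \<le> (\<integral>\<^sup>+s. (p s * indicator {a..t} s)\<^sup>2 \<partial>lborel) * (\<integral>\<^sup>+s. (q s * g s * indicator {a..t} s)\<^sup>2 \<partial>lborel)"
      by (rule Cauchy_Schwarz_nn_integral) auto
    also have "(\<integral>\<^sup>+s. (q s * g s * indicator {a..t} s)\<^sup>2 \<partial>lborel) = (\<integral>\<^sup>+s\<in>{a..t}. ?h s \<partial>lborel)"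
      by (intro nn_integral_cong) (simp add: power_mult_distrib pq split: split_indicator)
    also have "(\<integral>\<^sup>+s. (p s * indicator {a..t} s)\<^sup>2 \<partial>lborel) = (\<integral>\<^sup>+s. ennreal (exp (\<gamma> * s)) * indicator {a..t} s \<partial>lborel)"
      by (intro nn_integral_cong) (simp add: pq split: split_indicator)
    also have "\<dots> \<le> ennreal (exp (\<gamma> * t) / \<gamma>)"
    proof (cases "a \<le> t")
      case True
      have "(\<integral>\<^sup>+s. ennreal (exp (\<gamma> * s)) * indicator {a..t} s \<partial>lborel) = ennreal (exp (\<gamma> * t) / \<gamma> - exp (\<gamma> * a) / \<gamma>)"
        by (rule nn_integral_FTC_Icc) (use \<gamma>(1) True in \<open>auto intro!: derivative_eq_intros simp: has_real_derivative_iff_has_vector_derivative[symmetric]\<close>)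
      also have "\<dots> \<le> ennreal (exp (\<gamma> * t) / \<gamma>)" using \<gamma>(1) by (intro ennreal_leI) simp
      finally show ?thesis .
    qed simp
    finally show ?thesis by (simp add: mult_right_mono)
  qed
  have "(\<integral>\<^sup>+t. ennreal (exp (- \<beta> * t)) * (\<integral>\<^sup>+s\<in>{a..t}. g s \<partial>lborel)\<^sup>2 \<partial>lborel) \<le>
      (\<integral>\<^sup>+t. ennreal (exp (- \<beta> * t)) * (ennreal (exp (\<gamma> * t) / \<gamma>) * (\<integral>\<^sup>+s\<in>{a..t}. ?h s \<partial>lborel)) \<partial>lborel)"
    by (intro nn_integral_mono mult_left_mono CS zero_le)
  also have "\<dots> = (\<integral>\<^sup>+t. ennreal (1 / \<gamma>) * (ennreal (exp (- \<gamma> * t)) * (\<integral>\<^sup>+s\<in>{a..t}. ?h s \<partial>lborel)) \<partial>lborel)"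
  proof (rule nn_integral_cong)
    fix t
    have "exp (- \<beta> * t) * (exp (\<gamma> * t) / \<gamma>) = 1 / \<gamma> * exp (- \<gamma> * t)"
      by (simp add: \<gamma>(2) exp_add[symmetric] algebra_simps)
    then have "ennreal (exp (- \<beta> * t)) * ennreal (exp (\<gamma> * t) / \<gamma>) = ennreal (1 / \<gamma>) * ennreal (exp (- \<gamma> * t))"
      using \<gamma>(1) by (subst (1 2) ennreal_mult[symmetric]) auto
    then show "ennreal (exp (- \<beta> * t)) * (ennreal (exp (\<gamma> * t) / \<gamma>) * (\<integral>\<^sup>+s\<in>{a..t}. ?h s \<partial>lborel)) =
        ennreal (1 / \<gamma>) * (ennreal (exp (- \<gamma> * t)) * (\<integral>\<^sup>+s\<in>{a..t}. ?h s \<partial>lborel))"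
      by (simp only: mult.assoc[symmetric])
  qed
  also have "\<dots> = ennreal (1 / \<gamma>) * (\<integral>\<^sup>+t. ennreal (exp (- \<gamma> * t)) * (\<integral>\<^sup>+s\<in>{a..t}. ?h s \<partial>lborel) \<partial>lborel)"
  proof (rule nn_integral_cmult)
    have "(\<lambda>t. \<integral>\<^sup>+s. ?h s * (if a \<le> s \<and> s \<le> t then 1 else 0) \<partial>lborel) \<in> borel_measurable lborel"
      by measurable
    also have "(\<lambda>t. \<integral>\<^sup>+s. ?h s * (if a \<le> s \<and> s \<le> t then 1 else 0) \<partial>lborel) = (\<lambda>t. \<integral>\<^sup>+s\<in>{a..t}. ?h s \<partial>lborel)"
      by (intro ext nn_integral_cong) (simp add: indicator_def)
    finally show "(\<lambda>t. ennreal (exp (- \<gamma> * t)) * (\<integral>\<^sup>+s\<in>{a..t}. ?h s \<partial>lborel)) \<in> borel_measurable lborel"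
      by measurable
  qed
  also have "\<dots> = ennreal (1 / \<gamma>) * (ennreal (1 / \<gamma>) * (\<integral>\<^sup>+s\<in>{a..}. ennreal (exp (- \<gamma> * s)) * ?h s \<partial>lborel))"
    by (subst nn_integral_exp_weight[OF \<gamma>(1)]) auto
  also have "\<dots> = ennreal (4 / \<beta>\<^sup>2) * (\<integral>\<^sup>+s\<in>{a..}. ennreal (exp (- \<beta> * s)) * (g s)\<^sup>2 \<partial>lborel)"
  proof -
    have "ennreal (1 / \<gamma>) * ennreal (1 / \<gamma>) = ennreal (4 / \<beta>\<^sup>2)"
      using \<gamma>(1) by (simp add: ennreal_mult[symmetric] \<gamma>_def power2_eq_square)
    moreover have "ennreal (exp (- \<gamma> * s)) * ?h s = ennreal (exp (- \<beta> * s)) * (g s)\<^sup>2" for s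
      by (simp add: mult.assoc[symmetric] ennreal_mult[symmetric] exp_add[symmetric] \<gamma>_def)
    ultimately show ?thesis by (simp only: mult.assoc[symmetric])
  qed
  finally show ?thesis .
qed

section \<open>From integral estimates to pointwise statements\<close>

text \<open>
  Weighting the \<open>n\<close>-th squared increment by \<open>(1 / q) ^ n\<close>, with \<open>q = sqrt \<rho>\<close> strictly between
  \<open>\<rho>\<close> and 1, leaves a series with finite integral. Almost everywhere the increments are thus
  dominated by a geometric sequence.
\<close>

lemma L2_geometric_AE_convergent:
  fixes f :: "nat \<Rightarrow> 'z \<Rightarrow> real"
  assumes [measurable]: "\<And>n. f n \<in> borel_measurable N" and \<rho>: "0 < \<rho>" "\<rho> < 1" and d: "d \<ge> 0"
    and bound: "\<And>n. (\<integral>\<^sup>+z. nsq (f n z - f (Suc n) z) \<partial>N) \<le> ennreal (d * \<rho> ^ n)"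
  shows "AE z in N. convergent (\<lambda>n. f n z)"
proof -
  define q where "q = sqrt \<rho>"
  have q: "0 < q" "q < 1" "\<rho> = q * q" using \<rho> by (auto simp: q_def)
  have "(\<integral>\<^sup>+z. (\<Sum>n. ennreal ((1 / q) ^ n) * nsq (f n z - f (Suc n) z)) \<partial>N) = (\<Sum>n. ennreal ((1 / q) ^ n) * (\<integral>\<^sup>+z. nsq (f n z - f (Suc n) z) \<partial>N))"
    by (subst nn_integral_suminf) (auto simp: nn_integral_cmult)
  also have "\<dots> \<le> (\<Sum>n. ennreal (d * q ^ n))"
  proof (intro suminf_le summableI)
    fix n
    have "ennreal ((1 / q) ^ n) * (\<integral>\<^sup>+z. nsq (f n z - f (Suc n) z) \<partial>N) \<le> ennreal ((1 / q) ^ n) * ennreal (d * \<rho> ^ n)"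
      by (intro mult_left_mono bound) simp
    also have "\<dots> = ennreal (d * q ^ n)"
    proof -
      have "(1 / q) ^ n * (d * \<rho> ^ n) = d * q ^ n"
        using q by (simp add: power_mult_distrib power_divide)
      then show ?thesis using d q by (subst ennreal_mult[symmetric]) simp_all
    qed
    finally show "ennreal ((1 / q) ^ n) * (\<integral>\<^sup>+z. nsq (f n z - f (Suc n) z) \<partial>N) \<le> ennreal (d * q ^ n)" .
  qed
  also have "\<dots> < top"
    by (subst less_top[symmetric], rule ennreal_suminf_neq_top) (use d q in \<open>auto intro: summable_mult summable_geometric\<close>)
  finally have "AE z in N. (\<Sum>n. ennreal ((1 / q) ^ n) * nsq (f n z - f (Suc n) z)) \<noteq> \<infinity>"
    by (intro nn_integral_PInf_AE) auto
  then show ?thesis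
  proof eventually_elim
    case (elim z)
    obtain k where k: "(\<Sum>n. ennreal ((1 / q) ^ n) * nsq (f n z - f (Suc n) z)) = ennreal k" "k \<ge> 0"
      using elim by (cases "\<Sum>n. ennreal ((1 / q) ^ n) * nsq (f n z - f (Suc n) z)") auto
    have "norm (f (Suc n) z - f n z) \<le> sqrt k * (sqrt q) ^ n" for n
    proof -
      have "ennreal ((1 / q) ^ n * (f n z - f (Suc n) z)\<^sup>2) = ennreal ((1 / q) ^ n) * nsq (f n z - f (Suc n) z)"
        using q by (subst ennreal_mult) auto
      also have "\<dots> \<le> (\<Sum>n. ennreal ((1 / q) ^ n) * nsq (f n z - f (Suc n) z))"
        using sum_le_suminf[OF summableI, of "{n}" "\<lambda>n. ennreal ((1 / q) ^ n) * nsq (f n z - f (Suc n) z)"] by simp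
      finally have "(1 / q) ^ n * (f n z - f (Suc n) z)\<^sup>2 \<le> k" using k by simp
      then have "(f (Suc n) z - f n z)\<^sup>2 \<le> k * q ^ n"
        using q by (simp add: power_divide field_simps power2_commute)
      then have "\<bar>f (Suc n) z - f n z\<bar> \<le> sqrt (k * q ^ n)"
        by (metis real_sqrt_abs real_sqrt_le_iff)
      then show ?thesis by (simp add: real_sqrt_mult real_sqrt_power)
    qed
    moreover have "summable (\<lambda>n. sqrt k * (sqrt q) ^ n)"
      using q by (intro summable_mult summable_geometric) auto
    ultimately have "summable (\<lambda>n. f (Suc n) z - f n z)" by (rule summable_comparison_test'[rotated])
    then have "(\<lambda>n. \<Sum>i<n. f (Suc i) z - f i z) \<longlonglongrightarrow> (\<Sum>n. f (Suc n) z - f n z)"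
      by (rule summable_LIMSEQ)
    moreover have "(\<Sum>i<n. f (Suc i) z - f i z) = f n z - f 0 z" for n by (rule sum_lessThan_telescope)
    ultimately have "(\<lambda>n. f n z - f 0 z) \<longlonglongrightarrow> (\<Sum>n. f (Suc n) z - f n z)" by simp
    from tendsto_add[OF this tendsto_const[of "f 0 z"]] show ?case by (auto simp: convergent_def)
  qed
qed

lemma continuous_AE_zero:
  fixes f :: "real \<Rightarrow> real"
  assumes ab: "a < b" and c: "continuous_on {a..b} f" and z: "AE s in lborel. s \<in> {a..b} \<longrightarrow> f s = 0" and s: "s \<in> {a..b}"
  shows "f s = 0"
proof -
  have c2: "continuous_on {a..b} (\<lambda>s. (f s)\<^sup>2)" by (intro continuous_intros c)
  have "set_integrable lborel {a..b} (\<lambda>s. (f s)\<^sup>2)" by (rule borel_integrable_atLeastAtMost'[OF c2])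
  from set_borel_integral_eq_integral(2)[OF this]
  have "integral {a..b} (\<lambda>s. (f s)\<^sup>2) = (LINT s:{a..b}|lborel. (f s)\<^sup>2)" by simp
  also have "\<dots> = 0"
    unfolding set_lebesgue_integral_def
    by (rule integral_eq_zero_AE) (use z in \<open>eventually_elim, auto split: split_indicator\<close>)
  finally have "\<forall>s\<in>{a..b}. (f s)\<^sup>2 = 0" using integral_eq_0_iff[OF c2 ab] by simp
  with s show ?thesis by simp
qed

section \<open>The augmented Brownian filtration\<close>

locale brownian_space = prob_space M + complete_measure M
  for M :: "'a measure" +
  fixes B :: "real \<Rightarrow> 'a \<Rightarrow> real ^ 'd::finite"
  assumes bm: "std_brownian_motion M B"
begin

abbreviation F :: "real \<Rightarrow> 'a measure" where "F \<equiv> brownian_filtration M B"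

lemma B_measurable: "0 \<le> t \<Longrightarrow> B t \<in> borel_measurable M"
  using bm by (simp add: std_brownian_motion_def)

lemma B_0: "AE \<omega> in M. B 0 \<omega> = 0"
  using bm by (simp add: std_brownian_motion_def)

lemma B_continuous: "AE \<omega> in M. continuous_on {0..} (\<lambda>t. B t \<omega>)"
  using bm by (simp add: std_brownian_motion_def)

lemma space_F [simp]: "space (F t) = space M"
  unfolding brownian_filtration_def by (rule space_measure_of) (use sets.sets_into_space in auto)

lemma sets_F: "sets (F t) = sigma_sets (space M)
    ({B s -` A \<inter> space M | s A. 0 \<le> s \<and> s \<le> t \<and> A \<in> sets borel} \<union> null_sets M)"
  unfolding brownian_filtration_def by (rule sets_measure_of) (use sets.sets_into_space in auto)

lemma sets_F_subset: "sets (F t) \<subseteq> sets M"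
  unfolding sets_F by (rule sets.sigma_sets_subset) (auto intro!: measurable_sets[OF B_measurable])

lemma subalgebra_F: "subalgebra M (F t)"
  using sets_F_subset by (simp add: subalgebra_def)

lemma sets_F_mono: "s \<le> t \<Longrightarrow> sets (F s) \<subseteq> sets (F t)"
proof -
  assume "s \<le> t"
  then have "{B r -` A \<inter> space M | r A. 0 \<le> r \<and> r \<le> s \<and> A \<in> sets borel} \<subseteq> {B r -` A \<inter> space M | r A. 0 \<le> r \<and> r \<le> t \<and> A \<in> sets borel}"
    by fastforce
  then show ?thesis unfolding sets_F by (intro sigma_sets_mono') blast
qed

lemma null_sets_in_F: "N \<in> null_sets M \<Longrightarrow> N \<in> sets (F t)"
  unfolding sets_F by (auto intro!: sigma_sets.Basic)

lemma F_measurable_mono: "f \<in> measurable (F s) N \<Longrightarrow> s \<le> t \<Longrightarrow> f \<in> measurable (F t) N"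
  using sets_F_mono[of s t] by (auto simp: measurable_def)

lemma F_measurable_M: "f \<in> measurable (F s) N \<Longrightarrow> f \<in> measurable M N"
  using sets_F_subset[of s] by (auto simp: measurable_def)

lemma B_F_measurable: "0 \<le> s \<Longrightarrow> s \<le> t \<Longrightarrow> B s \<in> borel_measurable (F t)"
  by (rule measurableI) (auto simp: sets_F intro!: sigma_sets.Basic exI)

text \<open>
  As \<open>M\<close> is complete and the filtration contains its null sets, a variable may be changed on a
  null set without losing adaptedness.
\<close>

lemma F_measurable_AE_eq:
  assumes f: "f \<in> measurable (F t) N" and eq: "AE \<omega> in M. f \<omega> = g \<omega>"
    and g: "\<And>\<omega>. \<omega> \<in> space M \<Longrightarrow> g \<omega> \<in> space N"
  shows "g \<in> measurable (F t) N"
proof (rule measurableI)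
  obtain Z where Z: "{\<omega> \<in> space M. f \<omega> \<noteq> g \<omega>} \<subseteq> Z" "emeasure M Z = 0" "Z \<in> sets M" using eq by (rule AE_E)
  fix A assume A: "A \<in> sets N"
  have "Z \<in> null_sets M" "g -` A \<inter> Z \<inter> space M \<in> null_sets M"
  proof -
    show *: "Z \<in> null_sets M" using Z by auto
    have "g -` A \<inter> Z \<inter> space M \<in> sets M" by (rule complete[OF _ *]) auto
    then show "g -` A \<inter> Z \<inter> space M \<in> null_sets M" by (rule null_sets_subset[OF *]) auto
  qed
  then have "(f -` A \<inter> space (F t) - Z) \<union> (g -` A \<inter> Z \<inter> space M) \<in> sets (F t)"
    by (intro sets.Un sets.Diff measurable_sets[OF f A] null_sets_in_F)
  also have "(f -` A \<inter> space (F t) - Z) \<union> (g -` A \<inter> Z \<inter> space M) = g -` A \<inter> space (F t)"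
    using Z(1) by auto
  finally show "g -` A \<inter> space (F t) \<in> sets (F t)" .
qed (use g in simp)

definition cylinder_events :: "real \<Rightarrow> 'a set set" where
  "cylinder_events s = {{\<omega> \<in> space M. \<forall>r\<in>R. B r \<omega> \<in> C r} | R C. finite R \<and> R \<subseteq> {0..s} \<and> (\<forall>r\<in>R. C r \<in> sets borel)}"

lemma cylinder_event_sets: "A \<in> cylinder_events s \<Longrightarrow> A \<in> sets M"
proof -
  assume "A \<in> cylinder_events s"
  then obtain R C where R: "finite R" "R \<subseteq> {0..s}" "\<And>r. r \<in> R \<Longrightarrow> C r \<in> sets borel"
    and A: "A = {\<omega> \<in> space M. \<forall>r\<in>R. B r \<omega> \<in> C r}"
    unfolding cylinder_events_def by auto
  have "{\<omega> \<in> space M. B r \<omega> \<in> C r} \<in> sets M" if "r \<in> R" for r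
    using measurable_sets[OF B_measurable R(3)[OF that], of r] R(2) that
    by (auto simp: vimage_def Int_def conj_commute)
  then show ?thesis unfolding A by (intro sets.sets_Collect_finite_All R(1))
qed

text \<open>
  The definition of Brownian motion speaks of consecutive increments. Adding \<open>0\<close> and \<open>s\<close> to the
  finitely many times of the event and continuing with \<open>t\<close>, the event depends on the increments
  before \<open>s\<close> alone (up to a null set, since \<open>B 0\<close> vanishes almost surely), and the increment
  from \<open>s\<close> to \<open>t\<close> is the next one.
\<close>

lemma cylinder_increment_indep:
  assumes s: "0 \<le> s" "s < t" and A: "A \<in> cylinder_events s" and C: "C \<in> sets borel"
  shows "prob (A \<inter> ((\<lambda>\<omega>. B t \<omega> - B s \<omega>) -` C \<inter> space M)) = prob A * prob ((\<lambda>\<omega>. B t \<omega> - B s \<omega>) -` C \<inter> space M)"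
proof -
  obtain R G where R: "finite R" "R \<subseteq> {0..s}" and G: "\<And>r. r \<in> R \<Longrightarrow> G r \<in> sets borel"
    and A_eq: "A = {\<omega> \<in> space M. \<forall>r\<in>R. B r \<omega> \<in> G r}"
    using A unfolding cylinder_events_def by auto
  define xs where "xs = sorted_list_of_set (R \<union> {0, s})"
  have xs: "set xs = R \<union> {0, s}" "sorted xs" "distinct xs"
    using R(1) unfolding xs_def
    by (simp_all only: set_sorted_list_of_set finite_Un finite.intros sorted_sorted_list_of_set distinct_sorted_list_of_set)
  define n where "n = length xs - 1"
  have ne: "xs \<noteq> []" using xs(1) by auto
  then have len: "length xs = Suc n" by (cases xs) (auto simp: n_def)
  \<comment> \<open>From index \<open>Suc n\<close> on the sequence rests at \<open>t\<close>, which keeps it increasing.\<close>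
  define \<tau> where "\<tau> k = (if k \<le> n then xs ! k else t)" for k
  have mono: "xs ! i \<le> xs ! j" if "i \<le> j" "j \<le> n" for i j using sorted_nth_mono[OF xs(2) that(1)] that(2) len by simp
  have bounds: "0 \<le> xs ! k" "xs ! k \<le> s" if "k \<le> n" for k
    using nth_mem[of k xs] that len xs(1) R(2) s by auto
  have idx: "\<exists>k\<le>n. xs ! k = r" if "r \<in> set xs" for r
    using that len by (auto simp: in_set_conv_nth less_Suc_eq_le)
  have \<tau>0: "\<tau> 0 = 0" using idx[of 0] mono[of 0] bounds[of 0] xs(1) by (force simp: \<tau>_def)
  have \<tau>n: "\<tau> n = s" using idx[of s] mono[of _ n] bounds[of n] xs(1) by (force simp: \<tau>_def)
  have \<tau>Sn: "\<tau> (Suc n) = t" by (simp add: \<tau>_def)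
  have "incseq \<tau>"
  proof (rule incseq_SucI)
    fix k
    consider "Suc k \<le> n" | "k = n" | "k > n" by linarith
    then show "\<tau> k \<le> \<tau> (Suc k)"
      by cases (use mono[of k "Suc k"] bounds[of n] s in \<open>auto simp: \<tau>_def\<close>)
  qed
  define D where "D k \<omega> = B (\<tau> (Suc k)) \<omega> - B (\<tau> k) \<omega>" for k \<omega>
  have ind: "indep_vars (\<lambda>_. borel) D UNIV"
    using bm \<open>incseq \<tau>\<close> \<tau>0 unfolding std_brownian_motion_def D_def[abs_def] by auto
  from indep_var_restrict[OF ind, of "{..<n}" "{n}"]
  have iv: "indep_var (Pi\<^sub>M {..<n} (\<lambda>_. borel)) (\<lambda>\<omega>. restrict (\<lambda>i. D i \<omega>) {..<n}) (Pi\<^sub>M {n} (\<lambda>_. borel)) (\<lambda>\<omega>. restrict (\<lambda>i. D i \<omega>) {n})"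
    by auto
  have "\<forall>r\<in>R. \<exists>k\<le>n. \<tau> k = r" using idx xs(1) by (auto simp: \<tau>_def)
  then obtain k where k: "\<And>r. r \<in> R \<Longrightarrow> k r \<le> n" "\<And>r. r \<in> R \<Longrightarrow> \<tau> (k r) = r" by metis
  define U where "U = {f \<in> space (Pi\<^sub>M {..<n} (\<lambda>_. borel)). \<forall>r\<in>R. (\<Sum>i<k r. f i) \<in> G r}"
  have "(\<lambda>f. \<Sum>i<k r. f i) \<in> Pi\<^sub>M {..<n} (\<lambda>_. borel) \<rightarrow>\<^sub>M (borel :: (real^'d) measure)" if "r \<in> R" for r
    by (intro borel_measurable_sum measurable_component_singleton) (use k(1)[OF that] in auto)
  then have U: "U \<in> sets (Pi\<^sub>M {..<n} (\<lambda>_. borel))"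
    unfolding U_def using R(1) G by (intro sets.sets_Collect_finite_All) (auto intro!: measurable_sets simp: vimage_def Int_def conj_commute)
  define V where "V = {f \<in> space (Pi\<^sub>M {n} (\<lambda>_. borel :: (real^'d) measure)). f n \<in> C}"
  have V: "V \<in> sets (Pi\<^sub>M {n} (\<lambda>_. borel))"
    unfolding V_def using C by measurable
  have tele: "AE \<omega> in M. \<forall>r\<in>R. B r \<omega> = (\<Sum>i<k r. D i \<omega>)"
    using B_0
  proof eventually_elim
    case (elim \<omega>)
    show ?case
    proof
      fix r assume "r \<in> R"
      have "(\<Sum>i<k r. D i \<omega>) = B (\<tau> (k r)) \<omega> - B (\<tau> 0) \<omega>"
        unfolding D_def by (rule sum_lessThan_telescope)
      then show "B r \<omega> = (\<Sum>i<k r. D i \<omega>)" using k(2)[OF \<open>r \<in> R\<close>] \<tau>0 elim by simp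
    qed
  qed
  have D_meas [measurable]: "D i \<in> borel_measurable M" for i
    using ind by (auto simp: indep_vars_def)
  have rest: "restrict (\<lambda>i. D i \<omega>) {..<n} \<in> space (Pi\<^sub>M {..<n} (\<lambda>_. borel))" "restrict (\<lambda>i. D i \<omega>) {n} \<in> space (Pi\<^sub>M {n} (\<lambda>_. borel))" for \<omega>
    by (auto simp: space_PiM)
  have sumr: "(\<Sum>i<k r. restrict (\<lambda>i. D i \<omega>) {..<n} i) = (\<Sum>i<k r. D i \<omega>)" if "r \<in> R" for r \<omega>
    using k(1)[OF that] by (intro sum.cong) auto
  have A': "(\<lambda>\<omega>. restrict (\<lambda>i. D i \<omega>) {..<n}) -` U \<inter> space M = {\<omega> \<in> space M. \<forall>r\<in>R. (\<Sum>i<k r. D i \<omega>) \<in> G r}"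
    unfolding U_def using rest sumr by auto
  have C': "(\<lambda>\<omega>. restrict (\<lambda>i. D i \<omega>) {n}) -` V \<inter> space M = (\<lambda>\<omega>. B t \<omega> - B s \<omega>) -` C \<inter> space M"
    unfolding V_def using rest by (auto simp: D_def \<tau>n \<tau>Sn)
  have eAC: "(\<lambda>\<omega>. (restrict (\<lambda>i. D i \<omega>) {..<n}, restrict (\<lambda>i. D i \<omega>) {n})) -` (U \<times> V) \<inter> space M =
     ((\<lambda>\<omega>. restrict (\<lambda>i. D i \<omega>) {..<n}) -` U \<inter> space M) \<inter> ((\<lambda>\<omega>. restrict (\<lambda>i. D i \<omega>) {n}) -` V \<inter> space M)"
    by auto
  have mA': "{\<omega> \<in> space M. \<forall>r\<in>R. (\<Sum>i<k r. D i \<omega>) \<in> G r} \<in> sets M"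
    unfolding A'[symmetric] by (rule measurable_sets[OF indep_var_rv1[OF iv] U])
  have mC: "(\<lambda>\<omega>. B t \<omega> - B s \<omega>) -` C \<inter> space M \<in> sets M"
    unfolding C'[symmetric] by (rule measurable_sets[OF indep_var_rv2[OF iv] V])
  have mA: "A \<in> sets M" using A by (rule cylinder_event_sets)
  have 1: "prob A = prob {\<omega> \<in> space M. \<forall>r\<in>R. (\<Sum>i<k r. D i \<omega>) \<in> G r}"
    by (rule measure_eq_AE[OF _ mA mA']) (use tele in \<open>eventually_elim, auto simp: A_eq\<close>)
  have 2: "prob (A \<inter> ((\<lambda>\<omega>. B t \<omega> - B s \<omega>) -` C \<inter> space M)) =
     prob ({\<omega> \<in> space M. \<forall>r\<in>R. (\<Sum>i<k r. D i \<omega>) \<in> G r} \<inter> ((\<lambda>\<omega>. B t \<omega> - B s \<omega>) -` C \<inter> space M))"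
    by (rule measure_eq_AE[OF _ sets.Int[OF mA mC] sets.Int[OF mA' mC]]) (use tele in \<open>eventually_elim, auto simp: A_eq\<close>)
  from indep_varD[OF iv U V] show ?thesis unfolding eAC A' C' 1 2 .
qed

text \<open>
  The cylinder events together with the null sets are stable under intersection and generate the
  augmented \<open>\<sigma>\<close>-algebra, so that independence extends from them.
\<close>

lemma F_increment_indep:
  assumes s: "0 \<le> s" "s < t"
  shows "indep_set (sets (F s)) (sigma_sets (space M) {(\<lambda>\<omega>. B t \<omega> - B s \<omega>) -` C \<inter> space M | C. C \<in> sets borel})"
proof -
  let ?P = "cylinder_events s \<union> null_sets M"
  let ?Q = "{(\<lambda>\<omega>. B t \<omega> - B s \<omega>) -` C \<inter> space M | C. C \<in> sets borel}"
  have D: "(\<lambda>\<omega>. B t \<omega> - B s \<omega>) \<in> borel_measurable M"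
    using s by (intro borel_measurable_diff B_measurable) auto
  have "indep_set ?P ?Q"
    unfolding indep_sets2_eq
  proof (intro conjI ballI)
    show "?P \<subseteq> events" using cylinder_event_sets by auto
    show "?Q \<subseteq> events" using measurable_sets[OF D] by auto
    fix a b assume a: "a \<in> ?P" and b: "b \<in> ?Q"
    show "prob (a \<inter> b) = prob a * prob b"
    proof (cases "a \<in> null_sets M")
      case True
      moreover have "b \<in> sets M" using b measurable_sets[OF D] by auto
      ultimately have "a \<inter> b \<in> null_sets M" by (rule null_set_Int2)
      with True show ?thesis by (simp add: measure_eq_0_null_sets)
    next
      case False
      then have "a \<in> cylinder_events s" using a by simp
      with b s show ?thesis by (auto intro!: cylinder_increment_indep)
    qed
  qed
  then have "indep_set (sigma_sets (space M) ?P) (sigma_sets (space M) ?Q)"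
  proof (rule indep_set_sigma_sets)
    show "Int_stable ?P"
    proof (rule Int_stableI)
      fix a b assume ab: "a \<in> ?P" "b \<in> ?P"
      show "a \<inter> b \<in> ?P"
      proof (cases "a \<in> null_sets M \<or> b \<in> null_sets M")
        case True
        then show ?thesis using ab cylinder_event_sets by (auto intro: null_set_Int1 null_set_Int2)
      next
        case False
        then obtain R C R' C' where 1: "finite R" "R \<subseteq> {0..s}" "\<forall>r\<in>R. C r \<in> sets borel" "a = {\<omega> \<in> space M. \<forall>r\<in>R. B r \<omega> \<in> C r}"
          "finite R'" "R' \<subseteq> {0..s}" "\<forall>r\<in>R'. C' r \<in> sets borel" "b = {\<omega> \<in> space M. \<forall>r\<in>R'. B r \<omega> \<in> C' r}"
          using ab unfolding cylinder_events_def by auto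
        have "a \<inter> b = {\<omega> \<in> space M. \<forall>r\<in>R \<union> R'. B r \<omega> \<in> (if r \<in> R then C r else UNIV) \<inter> (if r \<in> R' then C' r else UNIV)}"
          using 1 by auto
        moreover have "finite (R \<union> R')" "R \<union> R' \<subseteq> {0..s}" "\<forall>r\<in>R \<union> R'. (if r \<in> R then C r else UNIV) \<inter> (if r \<in> R' then C' r else UNIV) \<in> sets borel"
          using 1 by auto
        ultimately have "a \<inter> b \<in> cylinder_events s" unfolding cylinder_events_def
          by (intro CollectI exI[of _ "R \<union> R'"] exI[of _ "\<lambda>r. (if r \<in> R then C r else UNIV) \<inter> (if r \<in> R' then C' r else UNIV)"] conjI)
        then show ?thesis by simp
      qed
    qed
    show "Int_stable ?Q"
    proof (rule Int_stableI)
      fix a b assume "a \<in> ?Q" "b \<in> ?Q"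
      then obtain C C' where "C \<in> sets borel" "C' \<in> sets borel" "a = (\<lambda>\<omega>. B t \<omega> - B s \<omega>) -` C \<inter> space M" "b = (\<lambda>\<omega>. B t \<omega> - B s \<omega>) -` C' \<inter> space M"
        by auto
      then show "a \<inter> b \<in> ?Q" by (intro CollectI exI[of _ "C \<inter> C'"]) auto
    qed
  qed
  moreover have "sets (F s) \<subseteq> sigma_sets (space M) ?P"
    unfolding sets_F
  proof (rule sigma_sets_mono, rule subsetI)
    fix a assume "a \<in> {B r -` A \<inter> space M | r A. 0 \<le> r \<and> r \<le> s \<and> A \<in> sets borel} \<union> null_sets M"
    then consider r A where "0 \<le> r" "r \<le> s" "A \<in> sets borel" "a = B r -` A \<inter> space M" | "a \<in> null_sets M" by auto
    then have "a \<in> ?P"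
    proof cases
      case 1
      then have "a \<in> cylinder_events s"
        unfolding cylinder_events_def by (intro CollectI exI[of _ "{r}"] exI[of _ "\<lambda>_. A"]) auto
      then show ?thesis by simp
    qed simp
    then show "a \<in> sigma_sets (space M) ?P" by (rule sigma_sets.Basic)
  qed
  ultimately show ?thesis unfolding indep_sets2_eq by blast
qed

lemma indep_var_F_increment:
  assumes s: "0 \<le> s" "s < t" and Z: "Z \<in> borel_measurable (F s)"
    and g: "g \<in> borel_measurable borel"
  shows "indep_var borel Z borel (\<lambda>\<omega>. g (B t \<omega> - B s \<omega>))"
proof -
  have D: "(\<lambda>\<omega>. B t \<omega> - B s \<omega>) \<in> borel_measurable M"
    using s by (intro borel_measurable_diff B_measurable) auto
  show ?thesis
    unfolding indep_var_eq
  proof (intro conjI)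
    show "random_variable borel Z" by (rule F_measurable_M[OF Z])
    show "random_variable borel (\<lambda>\<omega>. g (B t \<omega> - B s \<omega>))" using D g by measurable
    have Zs: "sigma_sets (space M) {Z -` A \<inter> space M |A. A \<in> sets borel} \<subseteq> sets (F s)"
      using sets.sigma_sets_subset[of "{Z -` A \<inter> space M |A. A \<in> sets borel}" "F s"] measurable_sets[OF Z] by auto
    have gs: "sigma_sets (space M) {(\<lambda>\<omega>. g (B t \<omega> - B s \<omega>)) -` A \<inter> space M |A. A \<in> sets borel}
       \<subseteq> sigma_sets (space M) {(\<lambda>\<omega>. B t \<omega> - B s \<omega>) -` A \<inter> space M |A. A \<in> sets borel}"
    proof (rule sigma_sets_mono', rule subsetI)
      fix a assume "a \<in> {(\<lambda>\<omega>. g (B t \<omega> - B s \<omega>)) -` A \<inter> space M |A. A \<in> sets borel}"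
      then obtain A where A: "A \<in> sets borel" "a = (\<lambda>\<omega>. g (B t \<omega> - B s \<omega>)) -` A \<inter> space M" by auto
      have "g -` A \<in> sets borel" using measurable_sets[OF g A(1)] by simp
      with A(2) show "a \<in> {(\<lambda>\<omega>. B t \<omega> - B s \<omega>) -` A \<inter> space M |A. A \<in> sets borel}"
        by (intro CollectI exI[of _ "g -` A"]) auto
    qed
    show "indep_set (sigma_sets (space M) {Z -` A \<inter> space M |A. A \<in> sets borel})
      (sigma_sets (space M) {(\<lambda>\<omega>. g (B t \<omega> - B s \<omega>)) -` A \<inter> space M |A. A \<in> sets borel})"
      using F_increment_indep[OF s] Zs gs unfolding indep_sets2_eq by (meson subset_iff subset_trans)
  qed
qed

lemma increment_moments:
  fixes i j :: 'd
  assumes s: "0 \<le> s" "s \<le> t"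
  shows "integrable M (\<lambda>\<omega>. (B t \<omega> - B s \<omega>) $ i)" (is ?int)
    and "expectation (\<lambda>\<omega>. (B t \<omega> - B s \<omega>) $ i) = 0" (is ?mean)
    and "integrable M (\<lambda>\<omega>. (B t \<omega> - B s \<omega>) $ i * (B t \<omega> - B s \<omega>) $ j)" (is ?int2)
    and "expectation (\<lambda>\<omega>. (B t \<omega> - B s \<omega>) $ i * (B t \<omega> - B s \<omega>) $ j) = (if i = j then t - s else 0)" (is ?cov)
proof -
  have "?int \<and> ?mean \<and> ?int2 \<and> ?cov"
  proof (cases "s = t")
    case False
    with s have st: "s < t" "0 < sqrt (t - s)" by auto
    let ?D = "\<lambda>i \<omega>. (B t \<omega> - B s \<omega>) $ i"
    have dist: "distributed M lborel (?D i) (normal_density 0 (sqrt (t - s)))" for i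
      using bm st s unfolding std_brownian_motion_def by blast
    have ind: "indep_vars (\<lambda>_. borel) ?D UNIV"
      using bm st s unfolding std_brownian_motion_def by blast
    have int: "integrable M (?D i)" for i
      by (rule distributed_integrable_var[OF dist _ integrable_normal_moment_nz_1[OF st(2)]]) simp
    have mean: "expectation (?D i) = 0" for i
      by (rule normal_distributed_expectation[OF st(2) dist])
    have "integrable lborel (\<lambda>x. normal_density 0 (sqrt (t - s)) x * x\<^sup>2)"
      using integrable_normal_moment[OF st(2), of 0 2] by simp
    then have int_sq: "integrable M (\<lambda>\<omega>. (?D i \<omega>)\<^sup>2)" for i
      by (subst (asm) distributed_integrable[OF dist]) auto
    have var: "expectation (\<lambda>\<omega>. (?D i \<omega>)\<^sup>2) = t - s" for i
      using normal_distributed_variance[OF st(2) dist[of i]] st unfolding mean by simp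
    show ?thesis
    proof (cases "i = j")
      case True
      then show ?thesis using int mean int_sq var by (simp add: power2_eq_square)
    next
      case False
      have ind': "indep_vars (\<lambda>_. borel) ?D {i, j}" by (rule indep_vars_subset[OF ind]) simp
      have "expectation (\<lambda>\<omega>. \<Prod>k\<in>{i, j}. ?D k \<omega>) = (\<Prod>k\<in>{i, j}. expectation (?D k))"
        by (rule indep_vars_lebesgue_integral[OF _ ind' int]) simp
      moreover have "integrable M (\<lambda>\<omega>. \<Prod>k\<in>{i, j}. ?D k \<omega>)"
        by (rule indep_vars_integrable[OF _ ind' int]) simp
      ultimately show ?thesis using False int mean by simp
    qed
  qed simp
  then show ?int ?mean ?int2 ?cov by auto
qed

lemma F_times_increment:
  fixes i j :: 'd
  assumes s: "0 \<le> s" "s \<le> t" and Z: "Z \<in> borel_measurable (F s)" "integrable M Z"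
  shows "integrable M (\<lambda>\<omega>. Z \<omega> * (B t \<omega> - B s \<omega>) $ i)" (is ?int)
    and "expectation (\<lambda>\<omega>. Z \<omega> * (B t \<omega> - B s \<omega>) $ i) = 0" (is ?mean)
    and "integrable M (\<lambda>\<omega>. Z \<omega> * ((B t \<omega> - B s \<omega>) $ i * (B t \<omega> - B s \<omega>) $ j))" (is ?int2)
    and "expectation (\<lambda>\<omega>. Z \<omega> * ((B t \<omega> - B s \<omega>) $ i * (B t \<omega> - B s \<omega>) $ j)) = (if i = j then t - s else 0) * expectation Z" (is ?cov)
proof -
  have "?int \<and> ?mean \<and> ?int2 \<and> ?cov"
  proof (cases "s = t")
    case False
    with s have st: "s < t" by auto
    note m = increment_moments[OF s]
    have 1: "indep_var borel Z borel (\<lambda>\<omega>. (B t \<omega> - B s \<omega>) $ i)"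
      by (rule indep_var_F_increment[OF s(1) st Z(1), where g="\<lambda>x. x $ i"]) simp
    have 2: "indep_var borel Z borel (\<lambda>\<omega>. (B t \<omega> - B s \<omega>) $ i * (B t \<omega> - B s \<omega>) $ j)"
      by (rule indep_var_F_increment[OF s(1) st Z(1), where g="\<lambda>x. x $ i * x $ j"]) simp
    show ?thesis
      using indep_var_integrable[OF 1 Z(2) m(1)] indep_var_lebesgue_integral[OF 1 Z(2) m(1)]
        indep_var_integrable[OF 2 Z(2) m(3)] indep_var_lebesgue_integral[OF 2 Z(2) m(3)]
      unfolding m(2) m(4) by (simp add: mult.commute)
  qed simp
  then show ?int ?mean ?int2 ?cov by auto
qed

section \<open>Square integrable variables and integrals over one block\<close>

definition sq_integrable :: "('a \<Rightarrow> 'b::euclidean_space) \<Rightarrow> bool" where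
  "sq_integrable \<xi> \<longleftrightarrow> \<xi> \<in> borel_measurable M \<and> integrable M (\<lambda>\<omega>. (norm (\<xi> \<omega>))\<^sup>2)"

lemma sq_integrable_measurable: "sq_integrable \<xi> \<Longrightarrow> \<xi> \<in> borel_measurable M"
  by (simp add: sq_integrable_def)

lemma sq_integrable_iff:
  "sq_integrable \<xi> \<longleftrightarrow> \<xi> \<in> borel_measurable M \<and> (\<integral>\<^sup>+\<omega>. nsq (\<xi> \<omega>) \<partial>M) < \<infinity>"
  unfolding sq_integrable_def by (auto simp: integrable_iff_bounded)

lemma sq_integrable_add:
  assumes "sq_integrable \<xi>" "sq_integrable \<eta>"
  shows "sq_integrable (\<lambda>\<omega>. \<xi> \<omega> + \<eta> \<omega>)"
proof -
  have [measurable]: "\<xi> \<in> borel_measurable M" "\<eta> \<in> borel_measurable M"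
    using assms by (auto simp: sq_integrable_def)
  have "(\<integral>\<^sup>+\<omega>. nsq (\<xi> \<omega> + \<eta> \<omega>) \<partial>M) \<le> (\<integral>\<^sup>+\<omega>. 2 * nsq (\<xi> \<omega>) + 2 * nsq (\<eta> \<omega>) \<partial>M)"
    by (intro nn_integral_mono nsq_add_le2)
  also have "\<dots> < \<infinity>"
    using assms by (simp add: nn_integral_add nn_integral_cmult sq_integrable_iff ennreal_mult_less_top)
  finally show ?thesis by (simp add: sq_integrable_iff)
qed

lemma sq_integrable_uminus: "sq_integrable \<xi> \<Longrightarrow> sq_integrable (\<lambda>\<omega>. - \<xi> \<omega>)"
  by (auto simp: sq_integrable_def)

lemma sq_integrable_diff:
  "sq_integrable \<xi> \<Longrightarrow> sq_integrable \<eta> \<Longrightarrow> sq_integrable (\<lambda>\<omega>. \<xi> \<omega> - \<eta> \<omega>)"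
  using sq_integrable_add[OF _ sq_integrable_uminus, of \<xi> \<eta>] by simp

lemma sq_integrable_zero [simp]: "sq_integrable (\<lambda>_. 0)"
  by (simp add: sq_integrable_def)

lemma sq_integrable_sum:
  "(\<And>i. i \<in> I \<Longrightarrow> sq_integrable (\<xi> i)) \<Longrightarrow> sq_integrable (\<lambda>\<omega>. \<Sum>i\<in>I. \<xi> i \<omega>)"
  by (induction I rule: infinite_finite_induct) (auto intro!: sq_integrable_add)

lemma measurable_vec_component:
  fixes f :: "'c \<Rightarrow> real ^ 'n::finite"
  shows "f \<in> borel_measurable N \<Longrightarrow> (\<lambda>\<omega>. f \<omega> $ i) \<in> borel_measurable N"
  using measurable_compose[of f N borel "\<lambda>x. x $ i" borel] by simp

lemma sq_integrable_bounded:
  assumes [measurable]: "\<xi> \<in> borel_measurable M" and "\<And>\<omega>. \<omega> \<in> space M \<Longrightarrow> norm (\<xi> \<omega>) \<le> C"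
  shows "sq_integrable \<xi>"
proof -
  have "integrable M (\<lambda>\<omega>. (norm (\<xi> \<omega>))\<^sup>2)"
    by (rule integrable_const_bound[of _ "C\<^sup>2"]) (use assms(2) in \<open>auto intro!: power_mono\<close>)
  then show ?thesis by (simp add: sq_integrable_def)
qed

lemma sq_integrable_product:
  fixes f :: "'a \<Rightarrow> real"
  assumes "sq_integrable \<xi>" "sq_integrable \<eta>" and [measurable]: "f \<in> borel_measurable M"
    and le: "\<And>\<omega>. norm (f \<omega>) \<le> norm (\<xi> \<omega>) * norm (\<eta> \<omega>)"
  shows "integrable M f"
proof (rule Bochner_Integration.integrable_bound)
  show "integrable M (\<lambda>\<omega>. (norm (\<xi> \<omega>))\<^sup>2 + (norm (\<eta> \<omega>))\<^sup>2)"
    using assms by (auto simp: sq_integrable_def)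
  have "norm (f \<omega>) \<le> (norm (\<xi> \<omega>))\<^sup>2 + (norm (\<eta> \<omega>))\<^sup>2" for \<omega>
  proof -
    have "norm (\<xi> \<omega>) * norm (\<eta> \<omega>) \<le> (norm (\<xi> \<omega>))\<^sup>2 + (norm (\<eta> \<omega>))\<^sup>2"
      using sum_squares_bound[of "norm (\<xi> \<omega>)" "norm (\<eta> \<omega>)"] mult_nonneg_nonneg[OF norm_ge_zero norm_ge_zero, of "\<xi> \<omega>" "\<eta> \<omega>"]
      by linarith
    then show ?thesis using le[of \<omega>] by linarith
  qed
  then show "AE \<omega> in M. norm (f \<omega>) \<le> norm ((norm (\<xi> \<omega>))\<^sup>2 + (norm (\<eta> \<omega>))\<^sup>2)" by simp
qed simp

text \<open>
  The stochastic integral of the integrand that is \<open>\<xi>\<close> on the interval from \<open>s\<close> to \<open>t\<close> and 0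
  elsewhere.
\<close>

definition block_int :: "real \<Rightarrow> real \<Rightarrow> ('a \<Rightarrow> real ^ 'd) \<Rightarrow> 'a \<Rightarrow> real" where
  "block_int s t \<xi> \<omega> = \<xi> \<omega> \<bullet> (B t \<omega> - B s \<omega>)"

lemma block_int_self [simp]: "block_int s s \<xi> \<omega> = 0"
  by (simp add: block_int_def)

lemma block_int_split: "block_int r t \<xi> \<omega> = block_int r s \<xi> \<omega> + block_int s t \<xi> \<omega>"
  by (simp add: block_int_def inner_diff_right)

lemma block_int_F_measurable:
  assumes "0 \<le> s" "s \<le> t" "\<xi> \<in> borel_measurable (F s)" "t \<le> r"
  shows "block_int s t \<xi> \<in> borel_measurable (F r)"
  unfolding block_int_def[abs_def]
  using assms by (intro borel_measurable_inner borel_measurable_diff B_F_measurable) (auto intro: F_measurable_mono)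

lemma block_int_mean:
  assumes s: "0 \<le> s" "s \<le> t" and \<xi>: "\<xi> \<in> borel_measurable (F s)"
    and Z: "Z \<in> borel_measurable (F s)" and int: "\<And>i. integrable M (\<lambda>\<omega>. Z \<omega> * \<xi> \<omega> $ i)"
  shows "integrable M (\<lambda>\<omega>. Z \<omega> * block_int s t \<xi> \<omega>)" "expectation (\<lambda>\<omega>. Z \<omega> * block_int s t \<xi> \<omega>) = 0"
proof -
  have [measurable]: "Z \<in> borel_measurable (F s)" "\<xi> \<in> borel_measurable (F s)" by fact+
  have meas: "(\<lambda>\<omega>. Z \<omega> * \<xi> \<omega> $ i) \<in> borel_measurable (F s)" for i
    by (intro borel_measurable_times Z measurable_compose[OF \<xi>]) simp
  have eq: "Z \<omega> * block_int s t \<xi> \<omega> = (\<Sum>i\<in>UNIV. (Z \<omega> * \<xi> \<omega> $ i) * (B t \<omega> - B s \<omega>) $ i)" for \<omega>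
    by (simp add: block_int_def inner_vec_def sum_distrib_left mult.assoc)
  note f = F_times_increment[OF s meas int]
  show "integrable M (\<lambda>\<omega>. Z \<omega> * block_int s t \<xi> \<omega>)"
    unfolding eq by (intro Bochner_Integration.integrable_sum f)
  show "expectation (\<lambda>\<omega>. Z \<omega> * block_int s t \<xi> \<omega>) = 0"
    unfolding eq by (subst Bochner_Integration.integral_sum) (intro f(1), simp only: f(2), simp)
qed

lemma block_int_product:
  assumes s: "0 \<le> s" "s \<le> t" and \<xi>: "\<xi> \<in> borel_measurable (F s)" "\<eta> \<in> borel_measurable (F s)"
    and sq: "sq_integrable \<xi>" "sq_integrable \<eta>"
  shows "integrable M (\<lambda>\<omega>. block_int s t \<xi> \<omega> * block_int s t \<eta> \<omega>)"
    and "expectation (\<lambda>\<omega>. block_int s t \<xi> \<omega> * block_int s t \<eta> \<omega>) = (t - s) * expectation (\<lambda>\<omega>. \<xi> \<omega> \<bullet> \<eta> \<omega>)"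
proof -
  have [measurable]: "\<xi> \<in> borel_measurable M" "\<eta> \<in> borel_measurable M" using sq by (auto simp: sq_integrable_def)
  have meas: "(\<lambda>\<omega>. \<xi> \<omega> $ i * \<eta> \<omega> $ j) \<in> borel_measurable (F s)" for i j
    by (intro borel_measurable_times measurable_compose[OF \<xi>(1)] measurable_compose[OF \<xi>(2)]) simp_all
  have int: "integrable M (\<lambda>\<omega>. \<xi> \<omega> $ i * \<eta> \<omega> $ j)" for i j
    by (rule sq_integrable_product[OF sq])
       (use sq in \<open>auto intro!: borel_measurable_times measurable_vec_component simp: sq_integrable_def\<close>,
        auto simp: abs_mult intro!: mult_mono component_le_norm_cart)
  have eq: "block_int s t \<xi> \<omega> * block_int s t \<eta> \<omega> =
      (\<Sum>i\<in>UNIV. \<Sum>j\<in>UNIV. (\<xi> \<omega> $ i * \<eta> \<omega> $ j) * ((B t \<omega> - B s \<omega>) $ i * (B t \<omega> - B s \<omega>) $ j))" for \<omega>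
    unfolding block_int_def inner_vec_def sum_product by (intro sum.cong refl) (simp add: ac_simps)
  note f = F_times_increment(3,4)[OF s meas int]
  show "integrable M (\<lambda>\<omega>. block_int s t \<xi> \<omega> * block_int s t \<eta> \<omega>)"
    unfolding eq by (intro Bochner_Integration.integrable_sum f)
  have "expectation (\<lambda>\<omega>. block_int s t \<xi> \<omega> * block_int s t \<eta> \<omega>) =
      (\<Sum>i\<in>UNIV. \<Sum>j\<in>UNIV. (if i = j then t - s else 0) * expectation (\<lambda>\<omega>. \<xi> \<omega> $ i * \<eta> \<omega> $ j))"
    unfolding eq
    by (subst Bochner_Integration.integral_sum, intro Bochner_Integration.integrable_sum f(1),
        subst Bochner_Integration.integral_sum, intro f(1)) (simp only: f(2))
  also have "\<dots> = (\<Sum>i\<in>UNIV. (t - s) * expectation (\<lambda>\<omega>. \<xi> \<omega> $ i * \<eta> \<omega> $ i))"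
    by (simp add: if_distrib[of "\<lambda>x. x * _"] cong: if_cong)
  also have "\<dots> = (t - s) * expectation (\<lambda>\<omega>. \<xi> \<omega> \<bullet> \<eta> \<omega>)"
    unfolding inner_vec_def sum_distrib_left[symmetric]
    by (subst Bochner_Integration.integral_sum) (simp_all add: int)
  finally show "expectation (\<lambda>\<omega>. block_int s t \<xi> \<omega> * block_int s t \<eta> \<omega>) = (t - s) * expectation (\<lambda>\<omega>. \<xi> \<omega> \<bullet> \<eta> \<omega>)" .
qed

lemma sq_integrable_block_int:
  assumes "0 \<le> s" "s \<le> t" "\<xi> \<in> borel_measurable (F s)" "sq_integrable \<xi>"
  shows "sq_integrable (block_int s t \<xi>)"
proof -
  have "block_int s t \<xi> \<in> borel_measurable M"
    by (rule F_measurable_M[OF block_int_F_measurable[OF assms(1-3) order.refl]])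
  then show ?thesis
    using block_int_product(1)[OF assms(1,2,3,3,4,4)] by (simp add: sq_integrable_def power2_eq_square)
qed

text \<open>
  The increment after \<open>s\<close> has mean 0 and is independent of everything known at \<open>s\<close>.
\<close>

lemma block_int_martingale:
  assumes s: "0 \<le> s" "s \<le> t" and \<xi>: "\<xi> \<in> borel_measurable (F s)" "sq_integrable \<xi>"
    and Z: "Z \<in> borel_measurable (F s)" "sq_integrable Z"
  shows "integrable M (\<lambda>\<omega>. Z \<omega> * block_int s t \<xi> \<omega>)" "expectation (\<lambda>\<omega>. Z \<omega> * block_int s t \<xi> \<omega>) = 0"
proof -
  have [measurable]: "\<xi> \<in> borel_measurable M" "Z \<in> borel_measurable M" using Z \<xi> by (auto simp: sq_integrable_def)
  have "integrable M (\<lambda>\<omega>. Z \<omega> * \<xi> \<omega> $ i)" for i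
    by (rule sq_integrable_product[OF Z(2) \<xi>(2)])
       (use Z \<xi> in \<open>auto intro!: borel_measurable_times measurable_vec_component simp: sq_integrable_def\<close>,
        auto simp: abs_mult intro!: mult_left_mono component_le_norm_cart)
  from block_int_mean[OF s \<xi>(1) Z(1) this]
  show "integrable M (\<lambda>\<omega>. Z \<omega> * block_int s t \<xi> \<omega>)" "expectation (\<lambda>\<omega>. Z \<omega> * block_int s t \<xi> \<omega>) = 0" .
qed

text \<open>
  Cutting both blocks at \<open>s'\<close> and at the earlier of the two end points leaves one product over a
  common interval; every other product pairs a block with a factor known at its beginning, and
  has mean 0.
\<close>

lemma block_int_covariance_ordered:
  assumes s: "0 \<le> s" "s \<le> e" "s \<le> s'" "s' \<le> e'"
    and \<xi>: "\<xi> \<in> borel_measurable (F s)" "sq_integrable \<xi>"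
    and \<eta>: "\<eta> \<in> borel_measurable (F s')" "sq_integrable \<eta>"
  shows "expectation (\<lambda>\<omega>. block_int s e \<xi> \<omega> * block_int s' e' \<eta> \<omega>) =
    max 0 (min e e' - max s s') * expectation (\<lambda>\<omega>. \<xi> \<omega> \<bullet> \<eta> \<omega>)"
proof (cases "e \<le> s'")
  case True
  have "expectation (\<lambda>\<omega>. block_int s e \<xi> \<omega> * block_int s' e' \<eta> \<omega>) = 0"
    by (rule block_int_martingale(2)) (use s \<xi> \<eta> True in \<open>auto intro!: block_int_F_measurable sq_integrable_block_int\<close>)
  then show ?thesis using s True by simp
next
  case False
  define m where "m = min e e'"
  have m: "s' \<le> m" "m \<le> e" "m \<le> e'" "0 \<le> m" "0 \<le> s'" "s \<le> m" using False s by (auto simp: m_def)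
  have \<xi>': "\<xi> \<in> borel_measurable (F s')" "\<xi> \<in> borel_measurable (F m)" using \<xi>(1) s m by (auto intro: F_measurable_mono)
  have \<eta>': "\<eta> \<in> borel_measurable (F m)" using \<eta>(1) m by (auto intro: F_measurable_mono)
  let ?a = "block_int s s' \<xi>" and ?b = "block_int s' m \<xi>" and ?c = "block_int m e \<xi>"
  let ?x = "block_int s' m \<eta>" and ?y = "block_int m e' \<eta>"
  have sqi: "sq_integrable ?a" "sq_integrable ?b" "sq_integrable ?c" "sq_integrable ?x" "sq_integrable ?y" "sq_integrable (block_int s' e' \<eta>)"
    using s m \<xi> \<xi>' \<eta> \<eta>' by (auto intro!: sq_integrable_block_int)
  have a: "?a \<in> borel_measurable (F s')" using s \<xi> by (intro block_int_F_measurable) auto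
  have b: "?b \<in> borel_measurable (F m)" using m \<xi>' by (intro block_int_F_measurable) auto
  have x: "?x \<in> borel_measurable (F m)" using m \<eta> by (intro block_int_F_measurable) auto
  note A = block_int_martingale[OF m(5) s(4) \<eta> a sqi(1)]
  note BX = block_int_product[OF m(5,1) \<xi>'(1) \<eta>(1) \<xi>(2) \<eta>(2)]
  note BY = block_int_martingale[OF m(4,3) \<eta>' \<eta>(2) b sqi(2)]
  note XC = block_int_martingale[OF m(4,2) \<xi>'(2) \<xi>(2) x sqi(4)]
  have "block_int s e \<xi> \<omega> * block_int s' e' \<eta> \<omega> =
      ?a \<omega> * block_int s' e' \<eta> \<omega> + (?b \<omega> * ?x \<omega> + (?b \<omega> * ?y \<omega> + ?x \<omega> * ?c \<omega>))" for \<omega>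
  proof -
    have "?c \<omega> * ?y \<omega> = 0" by (cases "e \<le> e'") (simp_all add: m_def)
    moreover have "block_int s e \<xi> \<omega> = ?a \<omega> + (?b \<omega> + ?c \<omega>)"
      using block_int_split[of s e \<xi> \<omega> s'] block_int_split[of s' e \<xi> \<omega> m] by simp
    moreover have "block_int s' e' \<eta> \<omega> = ?x \<omega> + ?y \<omega>" by (rule block_int_split)
    ultimately show ?thesis by (simp add: algebra_simps)
  qed
  then have "expectation (\<lambda>\<omega>. block_int s e \<xi> \<omega> * block_int s' e' \<eta> \<omega>) = (m - s') * expectation (\<lambda>\<omega>. \<xi> \<omega> \<bullet> \<eta> \<omega>)"
    using A BX BY XC by simp
  then show ?thesis using s m by (simp add: m_def max_def)
qed

lemma block_int_covariance:
  assumes s: "0 \<le> s" "s \<le> e" "0 \<le> s'" "s' \<le> e'"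
    and \<xi>: "\<xi> \<in> borel_measurable (F s)" "sq_integrable \<xi>"
    and \<eta>: "\<eta> \<in> borel_measurable (F s')" "sq_integrable \<eta>"
  shows "expectation (\<lambda>\<omega>. block_int s e \<xi> \<omega> * block_int s' e' \<eta> \<omega>) =
    max 0 (min e e' - max s s') * expectation (\<lambda>\<omega>. \<xi> \<omega> \<bullet> \<eta> \<omega>)"
proof (cases "s \<le> s'")
  case True
  then show ?thesis using assms by (intro block_int_covariance_ordered) auto
next
  case False
  then have "expectation (\<lambda>\<omega>. block_int s' e' \<eta> \<omega> * block_int s e \<xi> \<omega>) =
    max 0 (min e' e - max s' s) * expectation (\<lambda>\<omega>. \<eta> \<omega> \<bullet> \<xi> \<omega>)"
    using assms by (intro block_int_covariance_ordered) auto
  then show ?thesis by (simp add: mult.commute inner_commute min.commute max.commute)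
qed

text \<open>
  The blocks may overlap. The isometry therefore applies to the difference of two simple
  integrals without a common refinement of their partitions.
\<close>

lemma ito_isometry_blocks:
  fixes \<xi> :: "'i \<Rightarrow> 'a \<Rightarrow> real ^ 'd"
  assumes "finite I" and blk: "\<And>i. i \<in> I \<Longrightarrow> 0 \<le> S i \<and> S i \<le> E i \<and> \<xi> i \<in> borel_measurable (F (S i)) \<and> sq_integrable (\<xi> i)"
  shows "(\<integral>\<^sup>+\<omega>. nsq (\<Sum>i\<in>I. block_int (S i) (E i) (\<xi> i) \<omega>) \<partial>M) =
    (\<integral>\<^sup>+\<omega>. \<integral>\<^sup>+r. nsq (\<Sum>i\<in>I. indicator {S i<..E i} r *\<^sub>R \<xi> i \<omega>) \<partial>lborel \<partial>M)"
proof -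
  let ?J = "\<lambda>i. block_int (S i) (E i) (\<xi> i)"
  let ?l = "\<lambda>i j. max 0 (min (E i) (E j) - max (S i) (S j))"
  have sqJ: "sq_integrable (?J i)" if "i \<in> I" for i using blk[OF that] by (intro sq_integrable_block_int) auto
  have intJ: "integrable M (\<lambda>\<omega>. ?J i \<omega> * ?J j \<omega>)" if "i \<in> I" "j \<in> I" for i j
    by (rule sq_integrable_product[OF sqJ[OF that(1)] sqJ[OF that(2)]])
       (use sqJ[OF that(1)] sqJ[OF that(2)] in \<open>auto simp: sq_integrable_def abs_mult\<close>)
  have int\<xi>: "integrable M (\<lambda>\<omega>. \<xi> i \<omega> \<bullet> \<xi> j \<omega>)" if "i \<in> I" "j \<in> I" for i j
    by (rule sq_integrable_product[of "\<xi> i" "\<xi> j"])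
       (use blk[OF that(1)] blk[OF that(2)] in \<open>auto simp: sq_integrable_def Cauchy_Schwarz_ineq2\<close>)
  have ex1: "(norm (\<Sum>i\<in>I. ?J i \<omega>))\<^sup>2 = (\<Sum>i\<in>I. \<Sum>j\<in>I. ?J i \<omega> * ?J j \<omega>)" for \<omega>
    by (simp add: power2_eq_square sum_product)
  have "(\<integral>\<^sup>+\<omega>. nsq (\<Sum>i\<in>I. ?J i \<omega>) \<partial>M) = ennreal (expectation (\<lambda>\<omega>. (norm (\<Sum>i\<in>I. ?J i \<omega>))\<^sup>2))"
  proof (rule nn_integral_eq_integral)
    show "integrable M (\<lambda>\<omega>. (norm (\<Sum>i\<in>I. ?J i \<omega>))\<^sup>2)"
      unfolding ex1 by (intro Bochner_Integration.integrable_sum intJ)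
  qed simp
  also have "expectation (\<lambda>\<omega>. (norm (\<Sum>i\<in>I. ?J i \<omega>))\<^sup>2) = (\<Sum>i\<in>I. \<Sum>j\<in>I. ?l i j * expectation (\<lambda>\<omega>. \<xi> i \<omega> \<bullet> \<xi> j \<omega>))"
    unfolding ex1
    by (subst Bochner_Integration.integral_sum, intro Bochner_Integration.integrable_sum intJ, assumption, assumption,
        intro sum.cong refl, subst Bochner_Integration.integral_sum, intro intJ, assumption, assumption,
        intro sum.cong refl block_int_covariance) (use blk in auto)
  finally have L: "(\<integral>\<^sup>+\<omega>. nsq (\<Sum>i\<in>I. ?J i \<omega>) \<partial>M) = ennreal (\<Sum>i\<in>I. \<Sum>j\<in>I. ?l i j * expectation (\<lambda>\<omega>. \<xi> i \<omega> \<bullet> \<xi> j \<omega>))" .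
  have ex2: "(norm (\<Sum>i\<in>I. indicator {S i<..E i} r *\<^sub>R \<xi> i \<omega>))\<^sup>2 =
      (\<Sum>i\<in>I. \<Sum>j\<in>I. indicator ({S i<..E i} \<inter> {S j<..E j}) r * (\<xi> i \<omega> \<bullet> \<xi> j \<omega>))" for r \<omega>
    unfolding power2_norm_eq_inner
    by (subst inner_sum_left, intro sum.cong refl, subst inner_sum_right, intro sum.cong refl)
       (auto split: split_indicator)
  have Ioc: "{S i<..E i} \<inter> {S j<..E j} = {max (S i) (S j)<..min (E i) (E j)}" for i j by auto
  have intI: "integrable lborel (\<lambda>r. indicator ({S i<..E i} \<inter> {S j<..E j}) r * (\<xi> i \<omega> \<bullet> \<xi> j \<omega>))" for i j \<omega>
    unfolding Ioc by (cases "max (S i) (S j) \<le> min (E i) (E j)") auto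
  have valI: "(\<integral>r. indicator ({S i<..E i} \<inter> {S j<..E j}) r * (\<xi> i \<omega> \<bullet> \<xi> j \<omega>) \<partial>lborel) = ?l i j * (\<xi> i \<omega> \<bullet> \<xi> j \<omega>)" for i j \<omega>
    unfolding Ioc by (cases "max (S i) (S j) \<le> min (E i) (E j)") auto
  have inner: "(\<integral>\<^sup>+r. nsq (\<Sum>i\<in>I. indicator {S i<..E i} r *\<^sub>R \<xi> i \<omega>) \<partial>lborel) =
      ennreal (\<Sum>i\<in>I. \<Sum>j\<in>I. ?l i j * (\<xi> i \<omega> \<bullet> \<xi> j \<omega>))" for \<omega>
  proof -
    have "(\<integral>\<^sup>+r. nsq (\<Sum>i\<in>I. indicator {S i<..E i} r *\<^sub>R \<xi> i \<omega>) \<partial>lborel) =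
        ennreal (\<integral>r. (norm (\<Sum>i\<in>I. indicator {S i<..E i} r *\<^sub>R \<xi> i \<omega>))\<^sup>2 \<partial>lborel)"
    proof (rule nn_integral_eq_integral)
      show "integrable lborel (\<lambda>r. (norm (\<Sum>i\<in>I. indicator {S i<..E i} r *\<^sub>R \<xi> i \<omega>))\<^sup>2)"
        unfolding ex2 by (intro Bochner_Integration.integrable_sum intI)
    qed simp
    also have "(\<integral>r. (norm (\<Sum>i\<in>I. indicator {S i<..E i} r *\<^sub>R \<xi> i \<omega>))\<^sup>2 \<partial>lborel) = (\<Sum>i\<in>I. \<Sum>j\<in>I. ?l i j * (\<xi> i \<omega> \<bullet> \<xi> j \<omega>))"
      unfolding ex2
      by (subst Bochner_Integration.integral_sum, intro Bochner_Integration.integrable_sum intI,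
          intro sum.cong refl, subst Bochner_Integration.integral_sum, intro intI,
          intro sum.cong refl valI)
    finally show ?thesis .
  qed
  have nonneg: "0 \<le> (\<Sum>i\<in>I. \<Sum>j\<in>I. ?l i j * (\<xi> i \<omega> \<bullet> \<xi> j \<omega>))" for \<omega>
  proof -
    have "0 \<le> (\<integral>r. (norm (\<Sum>i\<in>I. indicator {S i<..E i} r *\<^sub>R \<xi> i \<omega>))\<^sup>2 \<partial>lborel)" by simp
    also have "\<dots> = (\<Sum>i\<in>I. \<Sum>j\<in>I. ?l i j * (\<xi> i \<omega> \<bullet> \<xi> j \<omega>))"
      unfolding ex2
      by (subst Bochner_Integration.integral_sum, intro Bochner_Integration.integrable_sum intI,
          intro sum.cong refl, subst Bochner_Integration.integral_sum, intro intI,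
          intro sum.cong refl valI)
    finally show ?thesis .
  qed
  have "(\<integral>\<^sup>+\<omega>. \<integral>\<^sup>+r. nsq (\<Sum>i\<in>I. indicator {S i<..E i} r *\<^sub>R \<xi> i \<omega>) \<partial>lborel \<partial>M) =
      ennreal (expectation (\<lambda>\<omega>. \<Sum>i\<in>I. \<Sum>j\<in>I. ?l i j * (\<xi> i \<omega> \<bullet> \<xi> j \<omega>)))"
    unfolding inner
    by (intro nn_integral_eq_integral) (auto intro!: Bochner_Integration.integrable_sum int\<xi> nonneg)
  also have "expectation (\<lambda>\<omega>. \<Sum>i\<in>I. \<Sum>j\<in>I. ?l i j * (\<xi> i \<omega> \<bullet> \<xi> j \<omega>)) = (\<Sum>i\<in>I. \<Sum>j\<in>I. ?l i j * expectation (\<lambda>\<omega>. \<xi> i \<omega> \<bullet> \<xi> j \<omega>))"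
    by (subst Bochner_Integration.integral_sum, intro Bochner_Integration.integrable_sum integrable_mult_right int\<xi>, assumption, assumption,
        intro sum.cong refl, subst Bochner_Integration.integral_sum, intro integrable_mult_right int\<xi>, assumption, assumption)
       simp
  finally show ?thesis using L by simp
qed

section \<open>Stochastic integrals of simple integrands\<close>

sublocale LM: pair_sigma_finite lborel M ..

text \<open>
  The end point \<open>max (\<tau> k) (min t (\<tau> (Suc k)))\<close> makes the block start at \<open>\<tau> k\<close>, the time at
  which \<open>\<xi> k\<close> is known, for every \<open>t\<close>; it is empty as long as \<open>t\<close> has not reached \<open>\<tau> k\<close>.
\<close>

lemma simple_ito_blocks:
  assumes "\<And>k. k < n \<Longrightarrow> \<tau> k \<le> \<tau> (Suc k)"
  shows "simple_ito_integral B n \<tau> \<xi> t \<omega> =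
    (\<Sum>k<n. block_int (\<tau> k) (max (\<tau> k) (min t (\<tau> (Suc k)))) (\<xi> k) \<omega>)"
  unfolding simple_ito_integral_def block_int_def
proof (rule sum.cong[OF refl])
  fix k assume "k \<in> {..<n}"
  then have "\<tau> k \<le> \<tau> (Suc k)" using assms by simp
  then show "\<xi> k \<omega> \<bullet> (B (min t (\<tau> (Suc k))) \<omega> - B (min t (\<tau> k)) \<omega>) =
    \<xi> k \<omega> \<bullet> (B (max (\<tau> k) (min t (\<tau> (Suc k)))) \<omega> - B (\<tau> k) \<omega>)"
    by (cases "t \<le> \<tau> k") (auto simp: min_def max_def)
qed

lemma simple_integrandD:
  assumes "simple_integrand M F a b n \<tau> \<xi>" "k < n"
  shows "a \<le> \<tau> k" "\<tau> k \<le> \<tau> (Suc k)" "\<tau> (Suc k) \<le> b" "\<xi> k \<in> borel_measurable (F (\<tau> k))" "sq_integrable (\<xi> k)"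
proof -
  have 1: "\<xi> k \<in> borel_measurable (F (\<tau> k))" using assms by (simp add: simple_integrand_def)
  obtain C where "\<And>\<omega>. \<omega> \<in> space M \<Longrightarrow> norm (\<xi> k \<omega>) \<le> C" using assms unfolding simple_integrand_def by blast
  with F_measurable_M[OF 1] show "sq_integrable (\<xi> k)" by (rule sq_integrable_bounded)
  show "\<xi> k \<in> borel_measurable (F (\<tau> k))" by fact
  show "a \<le> \<tau> k" "\<tau> k \<le> \<tau> (Suc k)" "\<tau> (Suc k) \<le> b" using assms by (auto simp: simple_integrand_def Suc_le_eq)
qed

lemma simple_process_truncate:
  assumes "simple_integrand M F a b n \<tau> \<xi>"
  shows "indicator {a..t} r *\<^sub>R simple_process n \<tau> \<xi> r \<omega> =
    (\<Sum>k<n. indicator {\<tau> k<..max (\<tau> k) (min t (\<tau> (Suc k)))} r *\<^sub>R \<xi> k \<omega>)"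
  unfolding simple_process_def scaleR_sum_right
proof (rule sum.cong[OF refl])
  fix k assume "k \<in> {..<n}"
  then show "indicator {a..t} r *\<^sub>R indicator {\<tau> k<..\<tau> (Suc k)} r *\<^sub>R \<xi> k \<omega> =
      indicator {\<tau> k<..max (\<tau> k) (min t (\<tau> (Suc k)))} r *\<^sub>R \<xi> k \<omega>"
    using simple_integrandD(1-3)[OF assms, of k] by (auto split: split_indicator)
qed

lemma nsq_indicator: "nsq (indicator A r *\<^sub>R x) = nsq x * indicator A r"
  by (simp split: split_indicator)

text \<open>
  The blocks of both integrands, those of the second with the opposite sign, form one family
  indexed by a disjoint sum.
\<close>

lemma simple_ito_diff_isometry:
  assumes "0 \<le> a" and s: "simple_integrand M F a b n \<tau> \<xi>" and s': "simple_integrand M F a b n' \<tau>' \<xi>'"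
  shows "(\<integral>\<^sup>+\<omega>. nsq (simple_ito_integral B n \<tau> \<xi> t \<omega> - simple_ito_integral B n' \<tau>' \<xi>' t \<omega>) \<partial>M) =
    (\<integral>\<^sup>+\<omega>. (\<integral>\<^sup>+r\<in>{a..t}. nsq (simple_process n \<tau> \<xi> r \<omega> - simple_process n' \<tau>' \<xi>' r \<omega>) \<partial>lborel) \<partial>M)"
proof -
  define I where "I = {..<n} <+> {..<n'}"
  define S where "S = case_sum \<tau> \<tau>'"
  define E where "E = case_sum (\<lambda>k. max (\<tau> k) (min t (\<tau> (Suc k)))) (\<lambda>k. max (\<tau>' k) (min t (\<tau>' (Suc k))))"
  define X where "X = case_sum \<xi> (\<lambda>k \<omega>. - \<xi>' k \<omega>)"
  have "0 \<le> S i \<and> S i \<le> E i \<and> X i \<in> borel_measurable (F (S i)) \<and> sq_integrable (X i)" if "i \<in> I" for i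
    using that assms(1) simple_integrandD[OF s] simple_integrandD[OF s']
    unfolding I_def S_def E_def X_def
    by (auto simp: max.coboundedI1 intro!: sq_integrable_uminus intro: order.trans)
  note iso = ito_isometry_blocks[of I S E X, OF _ this]
  have sum1: "(\<Sum>i\<in>I. block_int (S i) (E i) (X i) \<omega>) = simple_ito_integral B n \<tau> \<xi> t \<omega> - simple_ito_integral B n' \<tau>' \<xi>' t \<omega>" for \<omega>
    using simple_integrandD(2)[OF s] simple_integrandD(2)[OF s']
    unfolding I_def S_def E_def X_def
    by (simp add: sum.Plus simple_ito_blocks block_int_def sum_negf)
  have sum2: "(\<Sum>i\<in>I. indicator {S i<..E i} r *\<^sub>R X i \<omega>) =
      indicator {a..t} r *\<^sub>R (simple_process n \<tau> \<xi> r \<omega> - simple_process n' \<tau>' \<xi>' r \<omega>)" for r \<omega>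
    unfolding scaleR_diff_right simple_process_truncate[OF s] simple_process_truncate[OF s'] I_def S_def E_def X_def
    by (subst sum.Plus) (simp_all only: finite_lessThan o_def sum.case scaleR_minus_right sum_negf diff_conv_add_uminus)
  show ?thesis using iso unfolding sum1 sum2 nsq_indicator by (simp add: I_def)
qed

lemma simple_ito_F_measurable:
  assumes "0 \<le> a" and s: "simple_integrand M F a b n \<tau> \<xi>"
  shows "simple_ito_integral B n \<tau> \<xi> t \<in> borel_measurable (F t)"
proof -
  have "(\<lambda>\<omega>. \<Sum>k<n. block_int (\<tau> k) (max (\<tau> k) (min t (\<tau> (Suc k)))) (\<xi> k) \<omega>) \<in> borel_measurable (F t)"
  proof (rule borel_measurable_sum)
    fix k assume "k \<in> {..<n}"
    then have k: "k < n" by simp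
    note D = simple_integrandD[OF s k]
    show "block_int (\<tau> k) (max (\<tau> k) (min t (\<tau> (Suc k)))) (\<xi> k) \<in> borel_measurable (F t)"
    proof (cases "\<tau> k \<le> t")
      case True
      then show ?thesis using D assms(1) by (intro block_int_F_measurable) auto
    next
      case False
      then have "max (\<tau> k) (min t (\<tau> (Suc k))) = \<tau> k" by simp
      then show ?thesis by (simp add: block_int_def[abs_def])
    qed
  qed
  moreover have "simple_ito_integral B n \<tau> \<xi> t = (\<lambda>\<omega>. \<Sum>k<n. block_int (\<tau> k) (max (\<tau> k) (min t (\<tau> (Suc k)))) (\<xi> k) \<omega>)"
    using simple_ito_blocks[of n \<tau> \<xi> t] simple_integrandD(2)[OF s] by auto
  ultimately show ?thesis by simp
qed

lemma simple_ito_sq_integrable: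
  assumes "0 \<le> a" and s: "simple_integrand M F a b n \<tau> \<xi>"
  shows "sq_integrable (simple_ito_integral B n \<tau> \<xi> t)"
proof -
  have "sq_integrable (\<lambda>\<omega>. \<Sum>k<n. block_int (\<tau> k) (max (\<tau> k) (min t (\<tau> (Suc k)))) (\<xi> k) \<omega>)"
    using simple_integrandD[OF s] assms(1) by (intro sq_integrable_sum sq_integrable_block_int) (auto intro: order.trans)
  moreover have "simple_ito_integral B n \<tau> \<xi> t = (\<lambda>\<omega>. \<Sum>k<n. block_int (\<tau> k) (max (\<tau> k) (min t (\<tau> (Suc k)))) (\<xi> k) \<omega>)"
    using simple_ito_blocks[of n \<tau> \<xi> t] simple_integrandD(2)[OF s] by auto
  ultimately show ?thesis by simp
qed

lemma simple_ito_start: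
  assumes s: "simple_integrand M F a b n \<tau> \<xi>"
  shows "simple_ito_integral B n \<tau> \<xi> a \<omega> = 0"
  using simple_integrandD(1,2)[OF s] by (subst simple_ito_blocks) (auto intro!: sum.neutral simp: max_absorb1 min.coboundedI1)

lemma simple_ito_continuous:
  assumes "0 \<le> a" and s: "simple_integrand M F a b n \<tau> \<xi>" and B: "continuous_on {0..} (\<lambda>t. B t \<omega>)"
  shows "continuous_on {a..b} (\<lambda>t. simple_ito_integral B n \<tau> \<xi> t \<omega>)"
  unfolding simple_ito_integral_def
proof (intro continuous_intros)
  fix k assume "k \<in> {..<n}"
  then have *: "0 \<le> \<tau> k" "0 \<le> \<tau> (Suc k)"
    using simple_integrandD[OF s, of k] assms(1) by auto
  show "continuous_on {a..b} (\<lambda>t. B (min t (\<tau> (Suc k))) \<omega>)"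
    by (rule continuous_on_compose2[OF B]) (use * assms(1) in \<open>auto intro!: continuous_intros\<close>)
  show "continuous_on {a..b} (\<lambda>t. B (min t (\<tau> k)) \<omega>)"
    by (rule continuous_on_compose2[OF B]) (use * assms(1) in \<open>auto intro!: continuous_intros\<close>)
qed

text \<open>
  What remains of each block after \<open>s\<close> is a block that begins when both \<open>Z\<close> and its integrand
  are known.
\<close>

lemma simple_ito_martingale:
  assumes "0 \<le> a" and s: "simple_integrand M F a b n \<tau> \<xi>" and st: "s \<le> t"
    and Z: "Z \<in> borel_measurable (F s)" "sq_integrable Z"
  shows "expectation (\<lambda>\<omega>. Z \<omega> * (simple_ito_integral B n \<tau> \<xi> t \<omega> - simple_ito_integral B n \<tau> \<xi> s \<omega>)) = 0"
proof -
  let ?p = "\<lambda>t k. max (\<tau> k) (min t (\<tau> (Suc k)))"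
  have *: "integrable M (\<lambda>\<omega>. Z \<omega> * block_int (?p s k) (?p t k) (\<xi> k) \<omega>) \<and>
      expectation (\<lambda>\<omega>. Z \<omega> * block_int (?p s k) (?p t k) (\<xi> k) \<omega>) = 0" if "k < n" for k
  proof (cases "\<tau> (Suc k) \<le> s")
    case True
    then have "?p s k = ?p t k" using st by simp
    then show ?thesis by simp
  next
    case False
    note D = simple_integrandD[OF \<open>simple_integrand M F a b n \<tau> \<xi>\<close> that]
    have p: "0 \<le> ?p s k" "?p s k \<le> ?p t k" "s \<le> ?p s k" "\<tau> k \<le> ?p s k" using False D assms(1) st by auto
    show ?thesis
      using block_int_martingale[OF p(1,2) F_measurable_mono[OF D(4) p(4)] D(5) F_measurable_mono[OF Z(1) p(3)] Z(2)]
      by simp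
  qed
  have "Z \<omega> * (simple_ito_integral B n \<tau> \<xi> t \<omega> - simple_ito_integral B n \<tau> \<xi> s \<omega>) =
     (\<Sum>k<n. Z \<omega> * block_int (?p s k) (?p t k) (\<xi> k) \<omega>)" for \<omega>
  proof -
    have b: "block_int (\<tau> k) (?p t k) (\<xi> k) \<omega> - block_int (\<tau> k) (?p s k) (\<xi> k) \<omega> = block_int (?p s k) (?p t k) (\<xi> k) \<omega>" for k
      using block_int_split[of "\<tau> k" "?p t k" "\<xi> k" \<omega> "?p s k"] by simp
    have "simple_ito_integral B n \<tau> \<xi> t \<omega> - simple_ito_integral B n \<tau> \<xi> s \<omega> = (\<Sum>k<n. block_int (?p s k) (?p t k) (\<xi> k) \<omega>)"
      using simple_integrandD(2)[OF \<open>simple_integrand M F a b n \<tau> \<xi>\<close>]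
      by (simp add: simple_ito_blocks sum_subtractf[symmetric] b)
    then show ?thesis by (simp add: sum_distrib_left)
  qed
  then show ?thesis using * by (simp add: Bochner_Integration.integral_sum)
qed

section \<open>Doob's maximal inequality\<close>

text \<open>
  The expectation of \<open>running_max_squared_le\<close>: each correction term is a martingale increment
  multiplied by a square integrable factor known beforehand. The function \<open>g\<close> gives the time of
  each step.
\<close>

lemma Doob_discrete:
  fixes S :: "nat \<Rightarrow> 'a \<Rightarrow> real" and g :: "nat \<Rightarrow> real"
  assumes adapted: "\<And>i. i \<le> n \<Longrightarrow> S i \<in> borel_measurable (F (g i))" and g: "mono g"
    and sq: "\<And>i. i \<le> n \<Longrightarrow> sq_integrable (S i)"
    and mart: "\<And>i Z. i < n \<Longrightarrow> Z \<in> borel_measurable (F (g i)) \<Longrightarrow> sq_integrable Z \<Longrightarrow>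
      expectation (\<lambda>\<omega>. Z \<omega> * (S (Suc i) \<omega> - S i \<omega>)) = 0"
  shows "(\<integral>\<^sup>+\<omega>. ennreal ((Max ((\<lambda>i. \<bar>S i \<omega>\<bar>) ` {..n}))\<^sup>2) \<partial>M) \<le> 4 * (\<integral>\<^sup>+\<omega>. nsq (S n \<omega>) \<partial>M)"
proof -
  define m where "m k \<omega> = Max ((\<lambda>i. \<bar>S i \<omega>\<bar>) ` {..k})" for k \<omega>
  have m_meas: "m k \<in> borel_measurable (F (g k))" if "k \<le> n" for k
    unfolding m_def[abs_def]
    by (intro borel_measurable_Max borel_measurable_abs F_measurable_mono[OF adapted monoD[OF g]]) (use that in auto)
  have m_nonneg: "0 \<le> m k \<omega>" for k \<omega>
    unfolding m_def by (rule order.trans[OF abs_ge_zero[of "S 0 \<omega>"]]) (auto intro!: Max_ge)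
  have m_le: "m k \<omega> \<le> (\<Sum>i\<le>k. \<bar>S i \<omega>\<bar>)" for k \<omega>
    unfolding m_def by (subst Max_le_iff) (auto intro!: member_le_sum)
  have m_sq: "sq_integrable (m k)" if "k \<le> n" for k
  proof -
    have "sq_integrable (\<lambda>\<omega>. \<Sum>i\<le>k. \<bar>S i \<omega>\<bar>)"
      using sq that by (intro sq_integrable_sum) (auto simp: sq_integrable_def intro!: borel_measurable_abs)
    then have int: "integrable M (\<lambda>\<omega>. (norm (\<Sum>i\<le>k. \<bar>S i \<omega>\<bar>))\<^sup>2)" by (simp add: sq_integrable_def)
    have [measurable]: "m k \<in> borel_measurable M" by (rule F_measurable_M[OF m_meas[OF that]])
    have "integrable M (\<lambda>\<omega>. (norm (m k \<omega>))\<^sup>2)"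
      by (rule Bochner_Integration.integrable_bound[OF int])
         (auto intro!: power_mono m_le simp: m_nonneg sum_nonneg)
    then show ?thesis by (simp add: sq_integrable_def)
  qed
  have sq_Z: "sq_integrable (\<lambda>\<omega>. m i \<omega> * sgn (S i \<omega>))" if "i < n" for i
  proof -
    have [measurable]: "m i \<in> borel_measurable M" "S i \<in> borel_measurable M"
      using m_sq[of i] sq[of i] that by (auto simp: sq_integrable_def)
    have "integrable M (\<lambda>\<omega>. (norm (m i \<omega>))\<^sup>2)" using m_sq[of i] that by (simp add: sq_integrable_def)
    then have "integrable M (\<lambda>\<omega>. (norm (m i \<omega> * sgn (S i \<omega>)))\<^sup>2)"
      by (rule Bochner_Integration.integrable_bound) (auto simp: abs_mult power_mult_distrib sgn_if)
    then show ?thesis by (simp add: sq_integrable_def)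
  qed
  have Z_meas: "(\<lambda>\<omega>. m i \<omega> * sgn (S i \<omega>)) \<in> borel_measurable (F (g i))" if "i < n" for i
  proof -
    have [measurable]: "m i \<in> borel_measurable (F (g i))" "S i \<in> borel_measurable (F (g i))"
      using m_meas[of i] adapted[of i] that by auto
    show ?thesis unfolding sgn_if by measurable
  qed
  have sq_D: "sq_integrable (\<lambda>\<omega>. S (Suc i) \<omega> - S i \<omega>)" if "i < n" for i
    using sq that by (intro sq_integrable_diff) auto
  have int: "integrable M (\<lambda>\<omega>. m i \<omega> * sgn (S i \<omega>) * (S (Suc i) \<omega> - S i \<omega>))" if "i < n" for i
    by (rule sq_integrable_product[OF sq_Z[OF that] sq_D[OF that]])
       (use sq_integrable_measurable[OF sq_Z[OF that]] sq_integrable_measurable[OF sq_D[OF that]] in \<open>auto simp: abs_mult\<close>)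
  have intS: "integrable M (\<lambda>\<omega>. (S n \<omega>)\<^sup>2)" using sq[of n] by (simp add: sq_integrable_def)
  have intm: "integrable M (\<lambda>\<omega>. (m n \<omega>)\<^sup>2)" using m_sq[of n] by (simp add: sq_integrable_def)
  have "expectation (\<lambda>\<omega>. (m n \<omega>)\<^sup>2) \<le> expectation (\<lambda>\<omega>. 4 * (S n \<omega>)\<^sup>2 - 4 * (\<Sum>i<n. m i \<omega> * sgn (S i \<omega>) * (S (Suc i) \<omega> - S i \<omega>)))"
    using running_max_squared_le[of "\<lambda>i. S i _" n]
    by (intro integral_mono intm Bochner_Integration.integrable_diff integrable_mult_right intS Bochner_Integration.integrable_sum int)
       (auto simp: m_def)
  also have "\<dots> = 4 * expectation (\<lambda>\<omega>. (S n \<omega>)\<^sup>2)"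
  proof -
    have 1: "integrable M (\<lambda>\<omega>. \<Sum>i<n. m i \<omega> * sgn (S i \<omega>) * (S (Suc i) \<omega> - S i \<omega>))"
      by (intro Bochner_Integration.integrable_sum int) simp
    have 2: "expectation (\<lambda>\<omega>. \<Sum>i<n. m i \<omega> * sgn (S i \<omega>) * (S (Suc i) \<omega> - S i \<omega>)) = 0"
      by (subst Bochner_Integration.integral_sum) (use int mart[OF _ Z_meas sq_Z] in auto)
    show ?thesis using intS 1 2 by simp
  qed
  finally have "ennreal (expectation (\<lambda>\<omega>. (m n \<omega>)\<^sup>2)) \<le> 4 * ennreal (expectation (\<lambda>\<omega>. (S n \<omega>)\<^sup>2))"
    by (metis ennreal_leI ennreal_mult' ennreal_numeral zero_le_numeral)
  then show ?thesis
    using intS intm by (simp add: nn_integral_eq_integral m_def)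
qed

text \<open>
  The discrete inequality is applied on uniform grids of growing fineness. The lower limit \<open>G\<close>
  of the discrete maxima obeys the same bound by Fatou's lemma, and by continuity it dominates
  the path at every time. Stating a measurable majorant avoids the measurability of the supremum
  over an uncountable set of times.
\<close>

lemma Doob_maximal:
  fixes N :: "real \<Rightarrow> 'a \<Rightarrow> real"
  assumes ab: "a \<le> b"
    and adapted: "\<And>t. t \<in> {a..b} \<Longrightarrow> N t \<in> borel_measurable (F t)"
    and sq: "\<And>t. t \<in> {a..b} \<Longrightarrow> sq_integrable (N t)"
    and mart: "\<And>s t Z. a \<le> s \<Longrightarrow> s \<le> t \<Longrightarrow> t \<le> b \<Longrightarrow> Z \<in> borel_measurable (F s) \<Longrightarrow> sq_integrable Z \<Longrightarrow>
      expectation (\<lambda>\<omega>. Z \<omega> * (N t \<omega> - N s \<omega>)) = 0"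
    and cont: "AE \<omega> in M. continuous_on {a..b} (\<lambda>t. N t \<omega>)"
  obtains G where "G \<in> borel_measurable M" "AE \<omega> in M. \<forall>r\<in>{a..b}. nsq (N r \<omega>) \<le> G \<omega>"
    "(\<integral>\<^sup>+\<omega>. G \<omega> \<partial>M) \<le> 4 * (\<integral>\<^sup>+\<omega>. nsq (N b \<omega>) \<partial>M)"
proof -
  define g where "g n i = a + (b - a) * (real (min i (Suc n)) / real (Suc n))" for n i :: nat
  have g_range: "g n i \<in> {a..b}" for n i
  proof -
    have "0 \<le> real (min i (Suc n)) / real (Suc n)" "real (min i (Suc n)) / real (Suc n) \<le> 1" by auto
    from mult_nonneg_nonneg[OF _ this(1), of "b - a"] mult_left_mono[OF this(2), of "b - a"] ab
    show ?thesis unfolding g_def by simp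
  qed
  have g_mono: "mono (g n)" for n
    unfolding g_def using ab by (intro monoI add_left_mono mult_left_mono divide_right_mono) auto
  have g_last: "g n (Suc n) = b" for n by (simp add: g_def)
  define H where "H n \<omega> = ennreal ((Max ((\<lambda>i. \<bar>N (g n i) \<omega>\<bar>) ` {..Suc n}))\<^sup>2)" for n \<omega>
  have N_meas: "N (g n i) \<in> borel_measurable M" for n i by (rule F_measurable_M[OF adapted[OF g_range]])
  have H_meas: "H n \<in> borel_measurable M" for n
    unfolding H_def[abs_def] using N_meas
    by (intro measurable_compose[OF _ measurable_ennreal] borel_measurable_power borel_measurable_Max borel_measurable_abs) auto
  have H_int: "(\<integral>\<^sup>+\<omega>. H n \<omega> \<partial>M) \<le> 4 * (\<integral>\<^sup>+\<omega>. nsq (N b \<omega>) \<partial>M)" for n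
  proof -
    have "(\<integral>\<^sup>+\<omega>. H n \<omega> \<partial>M) \<le> 4 * (\<integral>\<^sup>+\<omega>. nsq (N (g n (Suc n)) \<omega>) \<partial>M)"
      unfolding H_def
      by (rule Doob_discrete[OF adapted[OF g_range] g_mono sq[OF g_range] mart])
         (use g_range[of n] monoD[OF g_mono[of n]] in auto)
    then show ?thesis by (simp only: g_last)
  qed
  show ?thesis
  proof (rule that[of "\<lambda>\<omega>. liminf (\<lambda>n. H n \<omega>)"])
    show "(\<lambda>\<omega>. liminf (\<lambda>n. H n \<omega>)) \<in> borel_measurable M" using H_meas by measurable
    have "(\<integral>\<^sup>+\<omega>. liminf (\<lambda>n. H n \<omega>) \<partial>M) \<le> liminf (\<lambda>n. \<integral>\<^sup>+\<omega>. H n \<omega> \<partial>M)"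
      by (rule nn_integral_liminf[OF H_meas])
    also have "\<dots> \<le> 4 * (\<integral>\<^sup>+\<omega>. nsq (N b \<omega>) \<partial>M)"
    proof -
      have "liminf (\<lambda>n. \<integral>\<^sup>+\<omega>. H n \<omega> \<partial>M) \<le> liminf (\<lambda>n::nat. 4 * (\<integral>\<^sup>+\<omega>. nsq (N b \<omega>) \<partial>M))"
        by (intro Liminf_mono always_eventually allI H_int)
      then show ?thesis by (simp only: Liminf_const sequentially_bot not_False_eq_True)
    qed
    finally show "(\<integral>\<^sup>+\<omega>. liminf (\<lambda>n. H n \<omega>) \<partial>M) \<le> 4 * (\<integral>\<^sup>+\<omega>. nsq (N b \<omega>) \<partial>M)" .
    show "AE \<omega> in M. \<forall>r\<in>{a..b}. nsq (N r \<omega>) \<le> liminf (\<lambda>n. H n \<omega>)"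
      using cont
    proof eventually_elim
      case (elim \<omega>)
      show ?case
      proof
        fix r assume r: "r \<in> {a..b}"
        define q where "q = (if a < b then (r - a) / (b - a) else 0)"
        have q: "0 \<le> q" "q \<le> 1" "r = a + (b - a) * q" using r by (auto simp: q_def)
        \<comment> \<open>The index of the last grid point that does not exceed the time considered.\<close>
        define i where "i n = nat \<lfloor>q * real (Suc n)\<rfloor>" for n
        have i_le: "i n \<le> Suc n" for n
        proof -
          have "q * real (Suc n) \<le> real (Suc n)" using q by (simp add: mult_left_le_one_le)
          then have "\<lfloor>q * real (Suc n)\<rfloor> \<le> int (Suc n)" by linarith
          then show ?thesis by (simp add: i_def)
        qed
        have i_eq: "real (i n) = of_int \<lfloor>q * real (Suc n)\<rfloor>" for n
          using q by (simp add: i_def)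
        have "(\<lambda>n. real (i n) / real (Suc n)) \<longlonglongrightarrow> q"
        proof (rule tendsto_sandwich)
          show "\<forall>\<^sub>F n in sequentially. q - 1 / real (Suc n) \<le> real (i n) / real (Suc n)"
          proof (intro always_eventually allI)
            fix n
            have "q * real (Suc n) - 1 \<le> real (i n)" unfolding i_eq by linarith
            then have "(q * real (Suc n) - 1) / real (Suc n) \<le> real (i n) / real (Suc n)" by (rule divide_right_mono) simp
            then show "q - 1 / real (Suc n) \<le> real (i n) / real (Suc n)" by (simp add: diff_divide_distrib del: of_nat_Suc)
          qed
          show "\<forall>\<^sub>F n in sequentially. real (i n) / real (Suc n) \<le> q"
          proof (intro always_eventually allI)
            fix n
            have "real (i n) \<le> q * real (Suc n)" unfolding i_eq by linarith
            then show "real (i n) / real (Suc n) \<le> q" by (simp add: divide_le_eq del: of_nat_Suc)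
          qed
          have "(\<lambda>n. q - 1 / real (Suc n)) \<longlonglongrightarrow> q - 0" by (intro tendsto_intros LIMSEQ_Suc[OF lim_1_over_n])
          then show "(\<lambda>n. q - 1 / real (Suc n)) \<longlonglongrightarrow> q" by simp
        qed simp
        then have "(\<lambda>n. a + (b - a) * (real (i n) / real (Suc n))) \<longlonglongrightarrow> a + (b - a) * q" by (intro tendsto_intros)
        then have gr: "(\<lambda>n. g n (i n)) \<longlonglongrightarrow> r" unfolding g_def q(3) min_absorb1[OF i_le] .
        have "(\<lambda>n. N (g n (i n)) \<omega>) \<longlonglongrightarrow> N r \<omega>"
          by (rule continuous_on_tendsto_compose[OF elim gr r]) (use g_range in auto)
        then have "(\<lambda>n. nsq (N (g n (i n)) \<omega>)) \<longlonglongrightarrow> nsq (N r \<omega>)" by (intro tendsto_intros)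
        then have "nsq (N r \<omega>) = liminf (\<lambda>n. nsq (N (g n (i n)) \<omega>))"
          by (rule lim_imp_Liminf[OF sequentially_bot, symmetric])
        also have "\<dots> \<le> liminf (\<lambda>n. H n \<omega>)"
        proof (intro Liminf_mono always_eventually allI)
          fix n
          have "\<bar>N (g n (i n)) \<omega>\<bar> \<le> Max ((\<lambda>i. \<bar>N (g n i) \<omega>\<bar>) ` {..Suc n})"
            using i_le[of n] by (intro Max_ge) auto
          then show "nsq (N (g n (i n)) \<omega>) \<le> H n \<omega>"
            unfolding H_def by (intro ennreal_leI power_mono) auto
        qed
        finally show "nsq (N r \<omega>) \<le> liminf (\<lambda>n. H n \<omega>)" .
      qed
    qed
  qed
qed

section \<open>Measurability and square integrability of processes\<close>

text \<open>
  Multiplication by an indicator replaces the restricted product space by the full one, where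
  the usual closure rules for measurability apply.
\<close>

lemma prog_measurable_iff:
  fixes \<phi> :: "real \<Rightarrow> 'a \<Rightarrow> 'b::euclidean_space"
  shows "prog_measurable F a b \<phi> \<longleftrightarrow>
    (\<forall>s\<in>{a..b}. (\<lambda>z. indicator {a..s} (fst z) *\<^sub>R \<phi> (fst z) (snd z)) \<in> borel_measurable (borel \<Otimes>\<^sub>M F s))"
  unfolding prog_measurable_def
proof (intro ball_cong refl iffI)
  fix s assume s: "s \<in> {a..b}"
  {
    assume *: "(\<lambda>(r, \<omega>). \<phi> r \<omega>) \<in> borel_measurable (restrict_space borel {a..s} \<Otimes>\<^sub>M F s)"
    have "(\<lambda>z. (max a (min s (fst z)), snd z)) \<in> borel \<Otimes>\<^sub>M F s \<rightarrow>\<^sub>M restrict_space borel {a..s} \<Otimes>\<^sub>M F s"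
      using s by (intro measurable_Pair measurable_restrict_space2) auto
    from measurable_compose[OF this *]
    have "(\<lambda>z. \<phi> (max a (min s (fst z))) (snd z)) \<in> borel_measurable (borel \<Otimes>\<^sub>M F s)" by simp
    then have "(\<lambda>z. indicator {a..s} (fst z) *\<^sub>R \<phi> (max a (min s (fst z))) (snd z)) \<in> borel_measurable (borel \<Otimes>\<^sub>M F s)"
      by measurable
    also have "(\<lambda>z. indicator {a..s} (fst z) *\<^sub>R \<phi> (max a (min s (fst z))) (snd z)) = (\<lambda>z. indicator {a..s} (fst z) *\<^sub>R \<phi> (fst z) (snd z))"
      by (auto simp: fun_eq_iff indicator_def)
    finally show "(\<lambda>z. indicator {a..s} (fst z) *\<^sub>R \<phi> (fst z) (snd z)) \<in> borel_measurable (borel \<Otimes>\<^sub>M F s)" .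
  }
  {
    assume *: "(\<lambda>z. indicator {a..s} (fst z) *\<^sub>R \<phi> (fst z) (snd z)) \<in> borel_measurable (borel \<Otimes>\<^sub>M F s)"
    have "(\<lambda>z. (fst z, snd z)) \<in> restrict_space borel {a..s} \<Otimes>\<^sub>M F s \<rightarrow>\<^sub>M borel \<Otimes>\<^sub>M F s"
      by (intro measurable_Pair measurable_snd measurable_compose[OF measurable_fst measurable_restrict_space1]) simp
    from measurable_compose[OF this *]
    have "(\<lambda>z. indicator {a..s} (fst z) *\<^sub>R \<phi> (fst z) (snd z)) \<in> borel_measurable (restrict_space borel {a..s} \<Otimes>\<^sub>M F s)" by simp
    then show "(\<lambda>(r, \<omega>). \<phi> r \<omega>) \<in> borel_measurable (restrict_space borel {a..s} \<Otimes>\<^sub>M F s)"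
      by (rule measurable_cong[THEN iffD1, rotated]) (auto simp: space_pair_measure space_restrict_space)
  }
qed

text \<open>
  The part of progressive measurability that Fubini needs.
\<close>

definition joint_meas :: "real \<Rightarrow> real \<Rightarrow> (real \<Rightarrow> 'a \<Rightarrow> 'b::euclidean_space) \<Rightarrow> bool" where
  "joint_meas a b \<phi> \<longleftrightarrow> (\<lambda>z. indicator {a..b} (fst z) *\<^sub>R \<phi> (fst z) (snd z)) \<in> borel_measurable (borel \<Otimes>\<^sub>M M)"

lemma borel_F_measurable_M: "f \<in> measurable (borel \<Otimes>\<^sub>M F s) N \<Longrightarrow> f \<in> measurable (borel \<Otimes>\<^sub>M M) N"
proof -
  assume f: "f \<in> measurable (borel \<Otimes>\<^sub>M F s) N"
  have "(\<lambda>z. (fst z, snd z)) \<in> borel \<Otimes>\<^sub>M M \<rightarrow>\<^sub>M borel \<Otimes>\<^sub>M F s"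
    by (intro measurable_Pair measurable_fst measurable_compose[OF measurable_snd] measurable_from_subalg[OF subalgebra_F measurable_ident_sets]) simp_all
  from measurable_compose[OF this f] show ?thesis by simp
qed

lemma prog_measurable_joint_meas: "prog_measurable F a b \<phi> \<Longrightarrow> joint_meas a b \<phi>"
proof (cases "a \<le> b")
  case True
  moreover assume "prog_measurable F a b \<phi>"
  ultimately show ?thesis
    unfolding prog_measurable_iff joint_meas_def by (intro borel_F_measurable_M[of _ b]) simp
qed (simp add: joint_meas_def)

lemma joint_meas_mono: "joint_meas a b \<phi> \<Longrightarrow> a \<le> c \<Longrightarrow> d \<le> b \<Longrightarrow> joint_meas c d \<phi>"
proof -
  assume "joint_meas a b \<phi>" and *: "a \<le> c" "d \<le> b"
  then have "(\<lambda>z. indicator {c..d} (fst z) *\<^sub>R indicator {a..b} (fst z) *\<^sub>R \<phi> (fst z) (snd z)) \<in> borel_measurable (borel \<Otimes>\<^sub>M M)"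
    unfolding joint_meas_def by measurable
  also have "(\<lambda>z. indicator {c..d} (fst z) *\<^sub>R indicator {a..b} (fst z) *\<^sub>R \<phi> (fst z) (snd z)) = (\<lambda>z. indicator {c..d} (fst z) *\<^sub>R \<phi> (fst z) (snd z))"
    using * by (auto simp: fun_eq_iff indicator_def)
  finally show ?thesis unfolding joint_meas_def .
qed

lemma joint_meas_diff: "joint_meas a b \<phi> \<Longrightarrow> joint_meas a b \<psi> \<Longrightarrow> joint_meas a b (\<lambda>r \<omega>. \<phi> r \<omega> - \<psi> r \<omega>)"
  unfolding joint_meas_def scaleR_diff_right by (rule borel_measurable_diff)

lemma joint_meas_section: "joint_meas a b \<phi> \<Longrightarrow> \<omega> \<in> space M \<Longrightarrow> (\<lambda>r. indicator {a..b} r *\<^sub>R \<phi> r \<omega>) \<in> borel_measurable borel"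
proof -
  assume "joint_meas a b \<phi>" and \<omega>: "\<omega> \<in> space M"
  from measurable_compose[OF measurable_Pair2'[OF \<omega>] this(1)[unfolded joint_meas_def]] show ?thesis by simp
qed

lemma prog_measurable_mono:
  fixes \<phi> :: "real \<Rightarrow> 'a \<Rightarrow> 'b::euclidean_space"
  assumes "prog_measurable F a b \<phi>" "a \<le> a'" "b' \<le> b"
  shows "prog_measurable F a' b' \<phi>"
  unfolding prog_measurable_iff
proof
  fix s assume s: "s \<in> {a'..b'}"
  then have "(\<lambda>z. indicator {a..s} (fst z) *\<^sub>R \<phi> (fst z) (snd z)) \<in> borel_measurable (borel \<Otimes>\<^sub>M F s)"
    using assms by (auto simp: prog_measurable_iff)
  then have "(\<lambda>z. indicator {a'..s} (fst z) *\<^sub>R (indicator {a..s} (fst z) *\<^sub>R \<phi> (fst z) (snd z))) \<in> borel_measurable (borel \<Otimes>\<^sub>M F s)"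
    by (rule borel_measurable_scaleR[rotated]) measurable
  also have "(\<lambda>z. indicator {a'..s} (fst z) *\<^sub>R (indicator {a..s} (fst z) *\<^sub>R \<phi> (fst z) (snd z))) = (\<lambda>z. indicator {a'..s} (fst z) *\<^sub>R \<phi> (fst z) (snd z))"
    using assms(2) by (auto simp: fun_eq_iff indicator_def)
  finally show "(\<lambda>z. indicator {a'..s} (fst z) *\<^sub>R \<phi> (fst z) (snd z)) \<in> borel_measurable (borel \<Otimes>\<^sub>M F s)" .
qed

lemma borel_F_measurable_mono: "f \<in> measurable (borel \<Otimes>\<^sub>M F s) N \<Longrightarrow> s \<le> t \<Longrightarrow> f \<in> measurable (borel \<Otimes>\<^sub>M F t) N"
proof -
  assume f: "f \<in> measurable (borel \<Otimes>\<^sub>M F s) N" and st: "s \<le> t"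
  have "(\<lambda>z. (fst z, snd z)) \<in> borel \<Otimes>\<^sub>M F t \<rightarrow>\<^sub>M borel \<Otimes>\<^sub>M F s"
    by (intro measurable_Pair measurable_fst measurable_compose[OF measurable_snd F_measurable_mono[OF measurable_ident_sets st]]) simp_all
  from measurable_compose[OF this f] show ?thesis by simp
qed

text \<open>
  The squared norm of the space of square integrable processes on \<open>[a, b]\<close>.
\<close>

definition E2 :: "real \<Rightarrow> real \<Rightarrow> (real \<Rightarrow> 'a \<Rightarrow> 'b::euclidean_space) \<Rightarrow> ennreal" where
  "E2 a b \<phi> = (\<integral>\<^sup>+\<omega>. (\<integral>\<^sup>+r\<in>{a..b}. nsq (\<phi> r \<omega>) \<partial>lborel) \<partial>M)"

lemma sets_borel_M [measurable_cong]: "sets (lborel \<Otimes>\<^sub>M M) = sets (borel \<Otimes>\<^sub>M M)"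
  by (rule sets_pair_measure_cong) auto

lemma E2_eq_pair:
  assumes "joint_meas a b \<phi>"
  shows "E2 a b \<phi> = (\<integral>\<^sup>+z. nsq (indicator {a..b} (fst z) *\<^sub>R \<phi> (fst z) (snd z)) \<partial>(lborel \<Otimes>\<^sub>M M))"
proof -
  have "(\<lambda>z. nsq (indicator {a..b} (fst z) *\<^sub>R \<phi> (fst z) (snd z))) \<in> borel_measurable (lborel \<Otimes>\<^sub>M M)"
    using assms unfolding joint_meas_def by measurable
  from LM.nn_integral_snd[OF this] show ?thesis
    unfolding E2_def by (simp add: nsq_indicator del: norm_scaleR)
qed

lemma E2_add_le:
  assumes "joint_meas a b \<phi>" "joint_meas a b \<psi>" "\<epsilon> > 0"
  shows "E2 a b \<phi> \<le> ennreal (1 + \<epsilon>) * E2 a b \<psi> + ennreal (1 + 1 / \<epsilon>) * E2 a b (\<lambda>r \<omega>. \<phi> r \<omega> - \<psi> r \<omega>)"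
  unfolding E2_eq_pair[OF assms(1)] E2_eq_pair[OF assms(2)] E2_eq_pair[OF joint_meas_diff[OF assms(1,2)]] scaleR_diff_right
  by (rule nn_integral_nsq_le) (use assms in \<open>auto simp: joint_meas_def measurable_cong_sets[OF sets_borel_M refl]\<close>)

lemma E2_triangle:
  assumes "joint_meas a b \<phi>" "joint_meas a b \<psi>" "joint_meas a b \<rho>"
  shows "E2 a b (\<lambda>r \<omega>. \<phi> r \<omega> - \<rho> r \<omega>) \<le> 2 * E2 a b (\<lambda>r \<omega>. \<phi> r \<omega> - \<psi> r \<omega>) + 2 * E2 a b (\<lambda>r \<omega>. \<psi> r \<omega> - \<rho> r \<omega>)"
  using E2_add_le[of a b "\<lambda>r \<omega>. \<phi> r \<omega> - \<rho> r \<omega>" "\<lambda>r \<omega>. \<phi> r \<omega> - \<psi> r \<omega>" 1] assms by (simp add: joint_meas_diff)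

lemma E2_minus_commute: "E2 a b (\<lambda>r \<omega>. \<phi> r \<omega> - \<psi> r \<omega>) = E2 a b (\<lambda>r \<omega>. \<psi> r \<omega> - \<phi> r \<omega>)"
  by (simp add: E2_def norm_minus_commute)

lemma E2_mono_interval: "a \<le> c \<Longrightarrow> d \<le> b \<Longrightarrow> E2 c d \<phi> \<le> E2 a b \<phi>"
  unfolding E2_def by (intro nn_integral_mono) (auto split: split_indicator)

lemma simple_process_prog_measurable:
  assumes s: "simple_integrand M F a b n \<tau> \<xi>"
  shows "prog_measurable F a b (simple_process n \<tau> \<xi>)"
  unfolding prog_measurable_iff simple_process_def scaleR_sum_right
proof (intro ballI borel_measurable_sum)
  fix t k assume t: "t \<in> {a..b}" and "k \<in> {..<n}"
  then have k: "k < n" by simp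
  note D = simple_integrandD[OF s k]
  show "(\<lambda>z. indicator {a..t} (fst z) *\<^sub>R indicator {\<tau> k<..\<tau> (Suc k)} (fst z) *\<^sub>R \<xi> k (snd z)) \<in> borel_measurable (borel \<Otimes>\<^sub>M F t)"
  proof (cases "\<tau> k \<le> t")
    case True
    then have [measurable]: "\<xi> k \<in> borel_measurable (F t)" using F_measurable_mono[OF D(4)] by simp
    show ?thesis by measurable
  next
    case False
    then have "(\<lambda>z. indicator {a..t} (fst z) *\<^sub>R indicator {\<tau> k<..\<tau> (Suc k)} (fst z) *\<^sub>R \<xi> k (snd z)) = (\<lambda>z. 0)"
      by (auto simp: fun_eq_iff indicator_def)
    then show ?thesis by simp
  qed
qed

section \<open>Density of the simple integrands\<close>

text \<open>
  For each \<open>\<omega>\<close> the delayed averages over uniform grids converge in \<open>L\<^sup>2\<close> of time; boundedness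
  carries this over to expectations by dominated convergence. Because of the delay the average
  is known at the beginning of the cell on which it is used.
\<close>

lemma bounded_integrand_approximation:
  fixes \<phi> :: "real \<Rightarrow> 'a \<Rightarrow> real ^ 'd"
  assumes "0 \<le> a" "a < b" and \<phi>: "prog_measurable F a b \<phi>" and bound: "\<And>r \<omega>. norm (\<phi> r \<omega>) \<le> C"
  shows "\<exists>\<tau> \<xi>. (\<forall>n. simple_integrand M F a b (Suc n) (\<tau> n) (\<xi> n)) \<and>
    (\<lambda>n. E2 a b (\<lambda>r \<omega>. simple_process (Suc n) (\<tau> n) (\<xi> n) r \<omega> - \<phi> r \<omega>)) \<longlonglongrightarrow> 0"
proof -
  define \<delta> where "\<delta> n = (b - a) / real (Suc n)" for n
  have \<delta>: "\<delta> n > 0" for n using assms by (simp add: \<delta>_def)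
  have \<delta>_end: "a + real (Suc n) * \<delta> n = b" for n by (simp add: \<delta>_def del: of_nat_Suc)
  define f where "f \<omega> r = indicator {a<..b} r *\<^sub>R \<phi> r \<omega>" for \<omega> r
  define \<tau> where "\<tau> n k = a + real k * \<delta> n" for n k
  define \<xi> where "\<xi> n k \<omega> = (1 / \<delta> n) *\<^sub>R (LINT s:{a + (real k - 1) * \<delta> n<..a + real k * \<delta> n}|lborel. f \<omega> s)" for n k \<omega>
  have C: "C \<ge> 0" using bound norm_ge_zero order_trans by blast
  have f_bound: "norm (f \<omega> r) \<le> C" for \<omega> r using bound C by (simp add: f_def split: split_indicator)
  have \<xi>_bound: "norm (\<xi> n k \<omega>) \<le> C" for n k \<omega>
  proof -
    have e: "a + real k * \<delta> n = a + (real k - 1) * \<delta> n + \<delta> n" by (simp add: field_simps)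
    show ?thesis unfolding \<xi>_def e by (rule norm_average_le) (use f_bound C \<delta> in auto)
  qed
  have \<tau>_mono: "\<tau> n j \<le> \<tau> n k" if "j \<le> k" for n j k
    unfolding \<tau>_def using that \<delta>[of n] by (intro add_left_mono mult_right_mono) auto
  have \<tau>_range: "\<tau> n k \<in> {a..b}" if "k \<le> Suc n" for n k
    using \<tau>_mono[of 0 k n] \<tau>_mono[OF that, of n] by (simp add: \<tau>_def \<delta>_end del: of_nat_Suc)
  have \<xi>_meas: "\<xi> n k \<in> borel_measurable (F (\<tau> n k))" if "k \<le> Suc n" for n k
  proof -
    let ?t = "\<tau> n k"
    have [measurable]: "(\<lambda>z. indicator {a..?t} (fst z) *\<^sub>R \<phi> (fst z) (snd z)) \<in> borel_measurable (borel \<Otimes>\<^sub>M F ?t)"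
      using \<phi> \<tau>_range[OF that] by (auto simp: prog_measurable_iff)
    define h where "h \<omega> s = indicator {a + (real k - 1) * \<delta> n<..?t} s *\<^sub>R indicator {a<..b} s *\<^sub>R (indicator {a..?t} s *\<^sub>R \<phi> s \<omega>)" for \<omega> s
    have "(\<lambda>z. indicator {a + (real k - 1) * \<delta> n<..?t} (fst z) *\<^sub>R indicator {a<..b} (fst z) *\<^sub>R (indicator {a..?t} (fst z) *\<^sub>R \<phi> (fst z) (snd z))) \<in> borel_measurable (borel \<Otimes>\<^sub>M F ?t)"
      by measurable
    from measurable_compose[OF measurable_pair_swap' this]
    have "case_prod h \<in> borel_measurable (F ?t \<Otimes>\<^sub>M borel)"
      by (simp add: h_def split_beta' case_prod_beta')
    then have "case_prod h \<in> borel_measurable (F ?t \<Otimes>\<^sub>M lborel)"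
      by (simp add: measurable_cong_sets[OF sets_pair_measure_cong[OF refl sets_lborel] refl])
    then have "(\<lambda>\<omega>. \<integral>s. h \<omega> s \<partial>lborel) \<in> borel_measurable (F ?t)"
      by (rule lborel.borel_measurable_lebesgue_integral)
    moreover have "\<xi> n k \<omega> = (1 / \<delta> n) *\<^sub>R (\<integral>s. h \<omega> s \<partial>lborel)" for \<omega>
    proof -
      have "h \<omega> s = indicator {a + (real k - 1) * \<delta> n<..?t} s *\<^sub>R f \<omega> s" for s
        by (auto simp: h_def f_def split: split_indicator)
      then show ?thesis by (simp add: \<xi>_def set_lebesgue_integral_def \<tau>_def)
    qed
    ultimately show ?thesis by (simp cong: measurable_cong)
  qed
  have simple: "simple_integrand M F a b (Suc n) (\<tau> n) (\<xi> n)" for n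
  proof -
    have "\<exists>C. \<forall>\<omega>\<in>space M. norm (\<xi> n k \<omega>) \<le> C" for k using \<xi>_bound by blast
    then show ?thesis unfolding simple_integrand_def using \<tau>_range \<tau>_mono \<xi>_meas by auto
  qed
  have avg: "simple_process (Suc n) (\<tau> n) (\<xi> n) r \<omega> = grid_average a b n (f \<omega>) r" for n r \<omega>
    unfolding grid_average_def delayed_average_def simple_process_def \<xi>_def \<tau>_def \<delta>_def ..
  have joint_meas: "joint_meas a b (\<lambda>r \<omega>. simple_process (Suc n) (\<tau> n) (\<xi> n) r \<omega> - \<phi> r \<omega>)" for n
    by (intro joint_meas_diff prog_measurable_joint_meas simple_process_prog_measurable simple \<phi>)
  define h where "h n \<omega> = (\<integral>\<^sup>+r\<in>{a..b}. nsq (simple_process (Suc n) (\<tau> n) (\<xi> n) r \<omega> - \<phi> r \<omega>) \<partial>lborel)" for n \<omega>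
  have h_meas: "h n \<in> borel_measurable M" for n
  proof -
    have "(\<lambda>z. nsq (indicator {a..b} (fst z) *\<^sub>R (simple_process (Suc n) (\<tau> n) (\<xi> n) (fst z) (snd z) - \<phi> (fst z) (snd z)))) \<in> borel_measurable (borel \<Otimes>\<^sub>M M)"
      using joint_meas unfolding joint_meas_def by measurable
    from measurable_compose[OF measurable_pair_swap' this]
    have "(\<lambda>(\<omega>, r). nsq (indicator {a..b} r *\<^sub>R (simple_process (Suc n) (\<tau> n) (\<xi> n) r \<omega> - \<phi> r \<omega>))) \<in> borel_measurable (M \<Otimes>\<^sub>M borel)"
      by (simp add: split_beta' case_prod_beta')
    then have "(\<lambda>(\<omega>, r). nsq (indicator {a..b} r *\<^sub>R (simple_process (Suc n) (\<tau> n) (\<xi> n) r \<omega> - \<phi> r \<omega>))) \<in> borel_measurable (M \<Otimes>\<^sub>M lborel)"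
      by (simp add: measurable_cong_sets[OF sets_pair_measure_cong[OF refl sets_lborel] refl])
    from lborel.borel_measurable_nn_integral[OF this] show ?thesis
      unfolding h_def[abs_def] nsq_indicator .
  qed
  have h_lim: "(\<lambda>n. h n \<omega>) \<longlonglongrightarrow> 0" if \<omega>: "\<omega> \<in> space M" for \<omega>
  proof -
    have "(\<lambda>r. indicator {a<..b} r *\<^sub>R indicator {a..b} r *\<^sub>R \<phi> r \<omega>) \<in> borel_measurable borel"
      using joint_meas_section[OF prog_measurable_joint_meas[OF \<phi>] \<omega>] by measurable
    also have "(\<lambda>r. indicator {a<..b} r *\<^sub>R indicator {a..b} r *\<^sub>R \<phi> r \<omega>) = f \<omega>"
      by (auto simp: f_def fun_eq_iff split: split_indicator)
    finally have "f \<omega> \<in> borel_measurable borel" .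
    then have lim: "(\<lambda>n. \<integral>\<^sup>+r. nsq (grid_average a b n (f \<omega>) r - f \<omega> r) \<partial>lborel) \<longlonglongrightarrow> 0"
      by (rule grid_average_L2_tendsto[OF assms(2) _ f_bound]) (simp add: f_def)
    have "h n \<omega> \<le> (\<integral>\<^sup>+r. nsq (grid_average a b n (f \<omega>) r - f \<omega> r) \<partial>lborel)" for n
      unfolding h_def avg
    proof (rule nn_integral_mono_AE)
      have "AE r in lborel. r \<noteq> a" by (rule AE_lborel_singleton)
      then show "AE r in lborel. nsq (grid_average a b n (f \<omega>) r - \<phi> r \<omega>) * indicator {a..b} r \<le> nsq (grid_average a b n (f \<omega>) r - f \<omega> r)"
        by eventually_elim (auto simp: f_def split: split_indicator)
    qed
    then show ?thesis by (intro tendsto_sandwich[OF _ _ tendsto_const lim]) auto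
  qed
  have "(\<lambda>n. \<integral>\<^sup>+\<omega>. h n \<omega> \<partial>M) \<longlonglongrightarrow> (\<integral>\<^sup>+(\<omega>::'a). 0 \<partial>M)"
  proof (rule nn_integral_dominated_convergence[where w="\<lambda>_. ennreal ((2 * C)\<^sup>2 * (b - a))"])
    show "AE \<omega> in M. h n \<omega> \<le> ennreal ((2 * C)\<^sup>2 * (b - a))" for n
    proof (rule AE_I2)
      fix \<omega> assume "\<omega> \<in> space M"
      have "h n \<omega> \<le> (\<integral>\<^sup>+r. ennreal ((2 * C)\<^sup>2) * indicator {a..b} r \<partial>lborel)"
        unfolding h_def
      proof (intro nn_integral_mono mult_right_mono ennreal_leI power_mono)
        fix r
        have "norm (simple_process (Suc n) (\<tau> n) (\<xi> n) r \<omega> - \<phi> r \<omega>) \<le> norm (simple_process (Suc n) (\<tau> n) (\<xi> n) r \<omega>) + norm (\<phi> r \<omega>)"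
          by (rule norm_triangle_ineq4)
        also have "\<dots> \<le> C + C"
          unfolding avg grid_average_def
          by (intro add_mono bound delayed_average_bounded f_bound) (use \<delta> in \<open>simp add: \<delta>_def\<close>)
        finally show "norm (simple_process (Suc n) (\<tau> n) (\<xi> n) r \<omega> - \<phi> r \<omega>) \<le> 2 * C" by simp
      qed auto
      also have "\<dots> = ennreal ((2 * C)\<^sup>2 * (b - a))"
        using assms(2) by (simp add: nn_integral_cmult ennreal_mult)
      finally show "h n \<omega> \<le> ennreal ((2 * C)\<^sup>2 * (b - a))" .
    qed
    show "(\<integral>\<^sup>+\<omega>. ennreal ((2 * C)\<^sup>2 * (b - a)) \<partial>M) < \<infinity>" by (simp add: emeasure_space_1)
  qed (use h_meas h_lim in auto)
  then have "(\<lambda>n. E2 a b (\<lambda>r \<omega>. simple_process (Suc n) (\<tau> n) (\<xi> n) r \<omega> - \<phi> r \<omega>)) \<longlonglongrightarrow> 0"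
    by (simp add: E2_def h_def)
  with simple show ?thesis by blast
qed

lemma L2_F_mono:
  fixes \<phi> :: "real \<Rightarrow> 'a \<Rightarrow> 'b::euclidean_space"
  assumes "\<phi> \<in> L2_F M F a b" "a \<le> a'" "b' \<le> b"
  shows "\<phi> \<in> L2_F M F a' b'"
proof -
  have "E2 a' b' \<phi> < \<infinity>"
    using E2_mono_interval[OF assms(2,3), of \<phi>] assms(1) by (auto simp: L2_F_def E2_def intro: order.strict_trans1)
  then show ?thesis using assms prog_measurable_mono[of a b \<phi> a' b'] by (auto simp: L2_F_def E2_def)
qed

text \<open>
  The integrand is truncated at a high level, by dominated convergence, and then approximated by
  averages.
\<close>

lemma simple_integrands_dense:
  fixes \<phi> :: "real \<Rightarrow> 'a \<Rightarrow> real ^ 'd"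
  assumes ab: "0 \<le> a" "a \<le> b" and \<phi>: "\<phi> \<in> L2_F M F a b" and "\<epsilon> > 0"
  shows "\<exists>n \<tau> \<xi>. simple_integrand M F a b n \<tau> \<xi> \<and> E2 a b (\<lambda>r \<omega>. simple_process n \<tau> \<xi> r \<omega> - \<phi> r \<omega>) < ennreal \<epsilon>"
proof (cases "a = b")
  case True
  have "E2 a b (\<lambda>r \<omega>. simple_process 0 (\<lambda>_. a) (\<lambda>_ _. 0) r \<omega> - \<phi> r \<omega>) = 0"
  proof -
    have "(\<integral>\<^sup>+r\<in>{a..b}. nsq (simple_process 0 (\<lambda>_. a) (\<lambda>_ _. 0) r \<omega> - \<phi> r \<omega>) \<partial>lborel) = 0" for \<omega>
    proof -
      have "(\<integral>\<^sup>+r\<in>{a..b}. nsq (simple_process 0 (\<lambda>_. a) (\<lambda>_ _. 0) r \<omega> - \<phi> r \<omega>) \<partial>lborel) = (\<integral>\<^sup>+(r::real). 0 \<partial>lborel)"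
      proof (rule nn_integral_cong_AE)
        show "AE r in lborel. nsq (simple_process 0 (\<lambda>_. a) (\<lambda>_ _. 0) r \<omega> - \<phi> r \<omega>) * indicator {a..b} r = 0"
          using AE_lborel_singleton[of a] by eventually_elim (use True in \<open>simp split: split_indicator\<close>)
      qed
      then show ?thesis by simp
    qed
    then show ?thesis by (simp add: E2_def)
  qed
  moreover have "simple_integrand M F a b 0 (\<lambda>_. a) (\<lambda>_ _. 0)" using ab by (simp add: simple_integrand_def)
  ultimately show ?thesis using assms(4) by (intro exI[of _ 0] exI[of _ "\<lambda>_. a"] exI[of _ "\<lambda>_ _. 0"]) simp
next
  case False
  have prog: "prog_measurable F a b \<phi>" and fin: "E2 a b \<phi> < \<infinity>" using \<phi> by (auto simp: L2_F_def E2_def)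
  define \<psi> where "\<psi> N r \<omega> = (if norm (\<phi> r \<omega>) \<le> real N then \<phi> r \<omega> else 0)" for N :: nat and r \<omega>
  have \<psi>_prog: "prog_measurable F a b (\<psi> N)" for N
    unfolding prog_measurable_def
  proof
    fix s assume "s \<in> {a..b}"
    then have [measurable]: "(\<lambda>(r, \<omega>). \<phi> r \<omega>) \<in> borel_measurable (restrict_space borel {a..s} \<Otimes>\<^sub>M F s)"
      using prog by (simp add: prog_measurable_def)
    have "(\<lambda>z. if norm ((\<lambda>(r, \<omega>). \<phi> r \<omega>) z) \<le> real N then (\<lambda>(r, \<omega>). \<phi> r \<omega>) z else 0) \<in> borel_measurable (restrict_space borel {a..s} \<Otimes>\<^sub>M F s)"
      by measurable
    then show "(\<lambda>(r, \<omega>). \<psi> N r \<omega>) \<in> borel_measurable (restrict_space borel {a..s} \<Otimes>\<^sub>M F s)"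
      by (simp add: \<psi>_def split_beta')
  qed
  have \<psi>_bound: "norm (\<psi> N r \<omega>) \<le> real N" for N r \<omega> by (simp add: \<psi>_def)
  have "(\<lambda>N. E2 a b (\<lambda>r \<omega>. \<psi> N r \<omega> - \<phi> r \<omega>)) \<longlonglongrightarrow> 0"
  proof -
    have joint_meas: "joint_meas a b (\<lambda>r \<omega>. \<psi> N r \<omega> - \<phi> r \<omega>)" for N by (intro joint_meas_diff prog_measurable_joint_meas \<psi>_prog prog)
    have joint_meas\<phi>: "joint_meas a b \<phi>" by (rule prog_measurable_joint_meas[OF prog])
    have "(\<lambda>N. \<integral>\<^sup>+z. nsq (indicator {a..b} (fst z) *\<^sub>R (\<psi> N (fst z) (snd z) - \<phi> (fst z) (snd z))) \<partial>(lborel \<Otimes>\<^sub>M M)) \<longlonglongrightarrow> (\<integral>\<^sup>+(z::real \<times> 'a). 0 \<partial>(lborel \<Otimes>\<^sub>M M))"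
    proof (rule nn_integral_dominated_convergence[where w="\<lambda>z. nsq (indicator {a..b} (fst z) *\<^sub>R \<phi> (fst z) (snd z))"])
      show "(\<integral>\<^sup>+z. nsq (indicator {a..b} (fst z) *\<^sub>R \<phi> (fst z) (snd z)) \<partial>(lborel \<Otimes>\<^sub>M M)) < \<infinity>"
        using fin unfolding E2_eq_pair[OF joint_meas\<phi>] .
      show "AE z in lborel \<Otimes>\<^sub>M M. nsq (indicator {a..b} (fst z) *\<^sub>R (\<psi> N (fst z) (snd z) - \<phi> (fst z) (snd z))) \<le> nsq (indicator {a..b} (fst z) *\<^sub>R \<phi> (fst z) (snd z))" for N
        by (rule AE_I2) (auto simp: \<psi>_def split: split_indicator)
      show "AE z in lborel \<Otimes>\<^sub>M M. (\<lambda>N. nsq (indicator {a..b} (fst z) *\<^sub>R (\<psi> N (fst z) (snd z) - \<phi> (fst z) (snd z)))) \<longlonglongrightarrow> 0"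
      proof (rule AE_I2)
        fix z :: "real \<times> 'a"
        obtain N0 :: nat where N0: "norm (\<phi> (fst z) (snd z)) \<le> real N0" using real_arch_simple by blast
        have "\<forall>\<^sub>F N in sequentially. nsq (indicator {a..b} (fst z) *\<^sub>R (\<psi> N (fst z) (snd z) - \<phi> (fst z) (snd z))) = 0"
          using eventually_ge_at_top[of N0] by eventually_elim (use N0 in \<open>auto simp: \<psi>_def\<close>)
        then show "(\<lambda>N. nsq (indicator {a..b} (fst z) *\<^sub>R (\<psi> N (fst z) (snd z) - \<phi> (fst z) (snd z)))) \<longlonglongrightarrow> 0"
          by (rule tendsto_eventually)
      qed
    qed (use joint_meas joint_meas\<phi> in \<open>auto simp: joint_meas_def measurable_cong_sets[OF sets_borel_M refl] simp del: norm_scaleR intro!: measurable_compose[OF _ measurable_ennreal] borel_measurable_power borel_measurable_norm\<close>)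
    then show ?thesis unfolding E2_eq_pair[OF joint_meas] by simp
  qed
  then have "\<forall>\<^sub>F N in sequentially. E2 a b (\<lambda>r \<omega>. \<psi> N r \<omega> - \<phi> r \<omega>) < ennreal (\<epsilon> / 4)"
    by (rule order_tendstoD) (use assms(4) in simp)
  then obtain N where N: "E2 a b (\<lambda>r \<omega>. \<psi> N r \<omega> - \<phi> r \<omega>) < ennreal (\<epsilon> / 4)" by (auto simp: eventually_sequentially)
  have "a < b" using ab(2) False by simp
  from bounded_integrand_approximation[OF ab(1) this \<psi>_prog[of N] \<psi>_bound[of N]]
  obtain \<tau> \<xi> where s: "\<forall>n. simple_integrand M F a b (Suc n) (\<tau> n) (\<xi> n)"
    and lim: "(\<lambda>n. E2 a b (\<lambda>r \<omega>. simple_process (Suc n) (\<tau> n) (\<xi> n) r \<omega> - \<psi> N r \<omega>)) \<longlonglongrightarrow> 0"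
    by blast
  note s = s[rule_format]
  have "\<forall>\<^sub>F n in sequentially. E2 a b (\<lambda>r \<omega>. simple_process (Suc n) (\<tau> n) (\<xi> n) r \<omega> - \<psi> N r \<omega>) < ennreal (\<epsilon> / 4)"
    by (rule order_tendstoD[OF lim]) (use assms(4) in simp)
  then obtain n where n: "E2 a b (\<lambda>r \<omega>. simple_process (Suc n) (\<tau> n) (\<xi> n) r \<omega> - \<psi> N r \<omega>) < ennreal (\<epsilon> / 4)" by (auto simp: eventually_sequentially)
  have "E2 a b (\<lambda>r \<omega>. simple_process (Suc n) (\<tau> n) (\<xi> n) r \<omega> - \<phi> r \<omega>) \<le>
      2 * E2 a b (\<lambda>r \<omega>. simple_process (Suc n) (\<tau> n) (\<xi> n) r \<omega> - \<psi> N r \<omega>) + 2 * E2 a b (\<lambda>r \<omega>. \<psi> N r \<omega> - \<phi> r \<omega>)"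
    by (intro E2_triangle prog_measurable_joint_meas simple_process_prog_measurable s \<psi>_prog prog)
  also have "\<dots> < 2 * ennreal (\<epsilon> / 4) + 2 * ennreal (\<epsilon> / 4)"
    by (intro add_strict_mono ennreal_mult_strict_left_mono n N) auto
  also have "\<dots> = ennreal \<epsilon>"
    using assms(4) by (simp add: mult_2 ennreal_plus[symmetric] del: ennreal_plus)
  finally show ?thesis using s by blast
qed

section \<open>The Ito integral\<close>

lemma ito_approximation:
  assumes "has_ito_integral M B a b \<phi> J"
  shows "\<exists>n \<tau> \<xi>. (\<forall>m. simple_integrand M F a b (n m) (\<tau> m) (\<xi> m)) \<and>
    (\<lambda>m. E2 a b (\<lambda>r \<omega>. simple_process (n m) (\<tau> m) (\<xi> m) r \<omega> - \<phi> r \<omega>)) \<longlonglongrightarrow> 0 \<and>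
    (\<forall>t\<in>{a..b}. (\<lambda>m. \<integral>\<^sup>+\<omega>. nsq (simple_ito_integral B (n m) (\<tau> m) (\<xi> m) t \<omega> - J t \<omega>) \<partial>M) \<longlonglongrightarrow> 0)"
  using assms unfolding has_ito_integral_def E2_def by auto

lemma ito_adapted: "has_ito_integral M B a b \<phi> J \<Longrightarrow> t \<in> {a..b} \<Longrightarrow> J t \<in> borel_measurable (F t)"
  by (auto simp: has_ito_integral_def)

lemma ito_continuous: "has_ito_integral M B a b \<phi> J \<Longrightarrow> \<omega> \<in> space M \<Longrightarrow> continuous_on {a..b} (\<lambda>t. J t \<omega>)"
  by (auto simp: has_ito_integral_def)

lemma ito_integrand: "has_ito_integral M B a b \<phi> J \<Longrightarrow> \<phi> \<in> L2_F M F a b"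
  by (auto simp: has_ito_integral_def)

lemma L2_F_joint_meas: "\<phi> \<in> L2_F M F a b \<Longrightarrow> joint_meas a b \<phi>"
  by (auto simp: L2_F_def intro: prog_measurable_joint_meas)

lemma ito_start:
  assumes J: "has_ito_integral M B a b \<phi> J" and ab: "a \<le> b"
  shows "AE \<omega> in M. J a \<omega> = 0"
proof -
  obtain n \<tau> \<xi> where simple: "\<forall>m. simple_integrand M F a b (n m) (\<tau> m) (\<xi> m)"
    and lim: "\<forall>t\<in>{a..b}. (\<lambda>m. \<integral>\<^sup>+\<omega>. nsq (simple_ito_integral B (n m) (\<tau> m) (\<xi> m) t \<omega> - J t \<omega>) \<partial>M) \<longlonglongrightarrow> 0"
    using ito_approximation[OF J] by blast
  have a: "a \<in> {a..b}" using ab by simp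
  have "(\<lambda>m::nat. \<integral>\<^sup>+\<omega>. nsq (J a \<omega>) \<partial>M) \<longlonglongrightarrow> 0"
    using lim[rule_format, OF a] by (simp add: simple_ito_start[OF simple[rule_format]])
  then have "(\<integral>\<^sup>+\<omega>. nsq (J a \<omega>) \<partial>M) = 0" using LIMSEQ_unique tendsto_const by blast
  moreover have "J a \<in> borel_measurable M" by (rule F_measurable_M[OF ito_adapted[OF J a]])
  ultimately have "AE \<omega> in M. nsq (J a \<omega>) = 0" by (subst (asm) nn_integral_0_iff_AE) auto
  then show ?thesis by eventually_elim simp
qed

lemma ito_sq_integrable:
  assumes "0 \<le> a" and J: "has_ito_integral M B a b \<phi> J" and t: "t \<in> {a..b}"
  shows "sq_integrable (J t)"
proof -
  obtain n \<tau> \<xi> where s: "\<forall>m. simple_integrand M F a b (n m) (\<tau> m) (\<xi> m)"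
    and limE: "(\<lambda>m. E2 a b (\<lambda>r \<omega>. simple_process (n m) (\<tau> m) (\<xi> m) r \<omega> - \<phi> r \<omega>)) \<longlonglongrightarrow> 0"
    and lim: "\<forall>t\<in>{a..b}. (\<lambda>m. \<integral>\<^sup>+\<omega>. nsq (simple_ito_integral B (n m) (\<tau> m) (\<xi> m) t \<omega> - J t \<omega>) \<partial>M) \<longlonglongrightarrow> 0"
    using ito_approximation[OF J] by blast
  note s = s[rule_format] and lim = lim[rule_format]
  have "\<forall>\<^sub>F m in sequentially. (\<integral>\<^sup>+\<omega>. nsq (simple_ito_integral B (n m) (\<tau> m) (\<xi> m) t \<omega> - J t \<omega>) \<partial>M) < 1"
    by (rule order_tendstoD[OF lim[OF t]]) simp
  then obtain m where m: "(\<integral>\<^sup>+\<omega>. nsq (simple_ito_integral B (n m) (\<tau> m) (\<xi> m) t \<omega> - J t \<omega>) \<partial>M) < 1"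
    by (auto simp: eventually_sequentially)
  have J_meas: "J t \<in> borel_measurable M" by (rule F_measurable_M[OF ito_adapted[OF J t]])
  have I: "sq_integrable (simple_ito_integral B (n m) (\<tau> m) (\<xi> m) t)" by (rule simple_ito_sq_integrable[OF assms(1) s])
  have "sq_integrable (\<lambda>\<omega>. simple_ito_integral B (n m) (\<tau> m) (\<xi> m) t \<omega> - J t \<omega>)"
    unfolding sq_integrable_iff using J_meas sq_integrable_measurable[OF I] m
    by (auto intro: order.strict_trans)
  from sq_integrable_diff[OF I this] show ?thesis by simp
qed

text \<open>
  Cauchy-Schwarz: expectation against a fixed square integrable variable is continuous in \<open>L\<^sup>2\<close>.
\<close>

lemma expectation_product_limit:
  fixes Z :: "'a \<Rightarrow> real" and W :: "nat \<Rightarrow> 'a \<Rightarrow> real"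
  assumes Z: "sq_integrable Z" and W: "\<And>m. sq_integrable (W m)"
    and lim: "(\<lambda>m. \<integral>\<^sup>+\<omega>. nsq (W m \<omega>) \<partial>M) \<longlonglongrightarrow> 0"
    and c: "\<And>m. expectation (\<lambda>\<omega>. Z \<omega> * W m \<omega>) = c"
  shows "c = 0"
proof -
  let ?A = "\<integral>\<^sup>+\<omega>. nsq (Z \<omega>) \<partial>M"
  have A: "?A < top" using Z by (auto simp: sq_integrable_iff)
  have [measurable]: "Z \<in> borel_measurable M" "W m \<in> borel_measurable M" for m
    using Z W by (auto simp: sq_integrable_def)
  have "(ennreal \<bar>c\<bar>)\<^sup>2 \<le> ?A * (\<integral>\<^sup>+\<omega>. nsq (W m \<omega>) \<partial>M)" for m
  proof -
    have int: "integrable M (\<lambda>\<omega>. Z \<omega> * W m \<omega>)"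
      by (rule sq_integrable_product[OF Z W[of m]]) (auto simp: abs_mult)
    have "ennreal \<bar>c\<bar> \<le> (\<integral>\<^sup>+\<omega>. ennreal \<bar>Z \<omega>\<bar> * ennreal \<bar>W m \<omega>\<bar> \<partial>M)"
      using integral_norm_bound_ennreal[OF int] unfolding c by (simp add: abs_mult ennreal_mult)
    then have "(ennreal \<bar>c\<bar>)\<^sup>2 \<le> (\<integral>\<^sup>+\<omega>. ennreal \<bar>Z \<omega>\<bar> * ennreal \<bar>W m \<omega>\<bar> \<partial>M)\<^sup>2"
      by (rule power_mono) simp
    also have "\<dots> \<le> (\<integral>\<^sup>+\<omega>. (ennreal \<bar>Z \<omega>\<bar>)\<^sup>2 \<partial>M) * (\<integral>\<^sup>+\<omega>. (ennreal \<bar>W m \<omega>\<bar>)\<^sup>2 \<partial>M)"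
      by (rule Cauchy_Schwarz_nn_integral) auto
    finally show ?thesis by (simp add: ennreal_power)
  qed
  moreover have "(\<lambda>m. ?A * (\<integral>\<^sup>+\<omega>. nsq (W m \<omega>) \<partial>M)) \<longlonglongrightarrow> ?A * 0"
    by (intro ennreal_tendsto_cmult lim A)
  ultimately have "(ennreal \<bar>c\<bar>)\<^sup>2 \<le> ?A * 0"
    by (intro LIMSEQ_le_const[where X="\<lambda>m. ?A * (\<integral>\<^sup>+\<omega>. nsq (W m \<omega>) \<partial>M)"]) auto
  then show ?thesis by (simp add: ennreal_power)
qed

lemma tendsto_0_twice_sum:
  fixes p q :: "nat \<Rightarrow> ennreal"
  assumes "p \<longlonglongrightarrow> 0" "q \<longlonglongrightarrow> 0"
  shows "(\<lambda>m. 2 * p m + 2 * q m) \<longlonglongrightarrow> 0"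
proof -
  have "(\<lambda>m. 2 * p m + 2 * q m) \<longlonglongrightarrow> 2 * 0 + 2 * 0"
    by (intro tendsto_add ennreal_tendsto_cmult assms) auto
  then show ?thesis by simp
qed

lemma ito_martingale:
  assumes a: "0 \<le> a" and J: "has_ito_integral M B a b \<phi> J" and st: "a \<le> s" "s \<le> t" "t \<le> b"
    and Z: "Z \<in> borel_measurable (F s)" "sq_integrable Z"
  shows "expectation (\<lambda>\<omega>. Z \<omega> * (J t \<omega> - J s \<omega>)) = 0"
proof -
  obtain n \<tau> \<xi> where simple: "\<forall>m. simple_integrand M F a b (n m) (\<tau> m) (\<xi> m)"
    and limE: "(\<lambda>m. E2 a b (\<lambda>r \<omega>. simple_process (n m) (\<tau> m) (\<xi> m) r \<omega> - \<phi> r \<omega>)) \<longlonglongrightarrow> 0"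
    and lim: "\<forall>t\<in>{a..b}. (\<lambda>m. \<integral>\<^sup>+\<omega>. nsq (simple_ito_integral B (n m) (\<tau> m) (\<xi> m) t \<omega> - J t \<omega>) \<partial>M) \<longlonglongrightarrow> 0"
    using ito_approximation[OF J] by blast
  note simple = simple[rule_format] and lim = lim[rule_format]
  define I where "I m = simple_ito_integral B (n m) (\<tau> m) (\<xi> m)" for m
  have in_ab: "s \<in> {a..b}" "t \<in> {a..b}" using st by auto
  have sqI: "sq_integrable (I m r)" for m r unfolding I_def by (rule simple_ito_sq_integrable[OF a simple])
  have sqJ: "sq_integrable (J s)" "sq_integrable (J t)" using ito_sq_integrable[OF a J] in_ab by auto
  have [measurable]: "I m r \<in> borel_measurable M" "J s \<in> borel_measurable M" "J t \<in> borel_measurable M" "Z \<in> borel_measurable M" for m r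
    using sqI sqJ Z by (auto simp: sq_integrable_def)
  define W where "W m \<omega> = (J t \<omega> - J s \<omega>) - (I m t \<omega> - I m s \<omega>)" for m \<omega>
  have sqW: "sq_integrable (W m)" for m
    unfolding W_def by (intro sq_integrable_diff sqI sqJ)
  show ?thesis
  proof (rule expectation_product_limit[OF Z(2) sqW])
    show "(\<lambda>m. \<integral>\<^sup>+\<omega>. nsq (W m \<omega>) \<partial>M) \<longlonglongrightarrow> 0"
    proof (rule tendsto_sandwich[OF _ _ tendsto_const tendsto_0_twice_sum[OF lim[OF in_ab(1)] lim[OF in_ab(2)]]])
      have "(\<integral>\<^sup>+\<omega>. nsq (W m \<omega>) \<partial>M) \<le> 2 * (\<integral>\<^sup>+\<omega>. nsq (I m s \<omega> - J s \<omega>) \<partial>M) + 2 * (\<integral>\<^sup>+\<omega>. nsq (I m t \<omega> - J t \<omega>) \<partial>M)" for m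
      proof -
        have "(\<integral>\<^sup>+\<omega>. nsq (W m \<omega>) \<partial>M) \<le> (\<integral>\<^sup>+\<omega>. 2 * nsq (I m s \<omega> - J s \<omega>) + 2 * nsq (I m t \<omega> - J t \<omega>) \<partial>M)"
        proof (rule nn_integral_mono)
          fix \<omega>
          have "W m \<omega> = (I m s \<omega> - J s \<omega>) - (I m t \<omega> - J t \<omega>)" by (simp add: W_def)
          then show "nsq (W m \<omega>) \<le> 2 * nsq (I m s \<omega> - J s \<omega>) + 2 * nsq (I m t \<omega> - J t \<omega>)"
            by (simp only: nsq_diff_le2)
        qed
        also have "\<dots> = 2 * (\<integral>\<^sup>+\<omega>. nsq (I m s \<omega> - J s \<omega>) \<partial>M) + 2 * (\<integral>\<^sup>+\<omega>. nsq (I m t \<omega> - J t \<omega>) \<partial>M)"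
          by (simp add: nn_integral_add nn_integral_cmult)
        finally show ?thesis .
      qed
      then show "\<forall>\<^sub>F m in sequentially. (\<integral>\<^sup>+\<omega>. nsq (W m \<omega>) \<partial>M) \<le>
          2 * (\<integral>\<^sup>+\<omega>. nsq (simple_ito_integral B (n m) (\<tau> m) (\<xi> m) s \<omega> - J s \<omega>) \<partial>M) +
          2 * (\<integral>\<^sup>+\<omega>. nsq (simple_ito_integral B (n m) (\<tau> m) (\<xi> m) t \<omega> - J t \<omega>) \<partial>M)"
        unfolding I_def by simp
    qed simp
    fix m
    have 1: "integrable M (\<lambda>\<omega>. Z \<omega> * (J t \<omega> - J s \<omega>))"
      by (rule sq_integrable_product[OF Z(2) sq_integrable_diff[OF sqJ(2) sqJ(1)]]) (auto simp: abs_mult)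
    have 2: "integrable M (\<lambda>\<omega>. Z \<omega> * (I m t \<omega> - I m s \<omega>))"
      by (rule sq_integrable_product[OF Z(2) sq_integrable_diff[OF sqI sqI]]) (auto simp: abs_mult)
    have "expectation (\<lambda>\<omega>. Z \<omega> * W m \<omega>) = expectation (\<lambda>\<omega>. Z \<omega> * (J t \<omega> - J s \<omega>) - Z \<omega> * (I m t \<omega> - I m s \<omega>))"
      by (simp only: W_def right_diff_distrib)
    also have "\<dots> = expectation (\<lambda>\<omega>. Z \<omega> * (J t \<omega> - J s \<omega>)) - expectation (\<lambda>\<omega>. Z \<omega> * (I m t \<omega> - I m s \<omega>))"
      by (rule Bochner_Integration.integral_diff[OF 1 2])
    also have "expectation (\<lambda>\<omega>. Z \<omega> * (I m t \<omega> - I m s \<omega>)) = 0"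
      unfolding I_def by (rule simple_ito_martingale[OF a simple st(2) Z])
    finally show "expectation (\<lambda>\<omega>. Z \<omega> * W m \<omega>) = expectation (\<lambda>\<omega>. Z \<omega> * (J t \<omega> - J s \<omega>))" by simp
  qed
qed

text \<open>
  The isometry for simple integrands passes to the limit by \<open>le_of_L2_approximation\<close>.
\<close>

lemma ito_diff_bound:
  assumes a: "0 \<le> a" and J: "has_ito_integral M B a b \<phi> J" and J': "has_ito_integral M B a b \<phi>' J'" and t: "t \<in> {a..b}"
  shows "(\<integral>\<^sup>+\<omega>. nsq (J t \<omega> - J' t \<omega>) \<partial>M) \<le> E2 a t (\<lambda>r \<omega>. \<phi> r \<omega> - \<phi>' r \<omega>)"
proof -
  obtain n \<tau> \<xi> where simple: "\<forall>m. simple_integrand M F a b (n m) (\<tau> m) (\<xi> m)"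
    and limE: "(\<lambda>m. E2 a b (\<lambda>r \<omega>. simple_process (n m) (\<tau> m) (\<xi> m) r \<omega> - \<phi> r \<omega>)) \<longlonglongrightarrow> 0"
    and lim: "\<forall>t\<in>{a..b}. (\<lambda>m. \<integral>\<^sup>+\<omega>. nsq (simple_ito_integral B (n m) (\<tau> m) (\<xi> m) t \<omega> - J t \<omega>) \<partial>M) \<longlonglongrightarrow> 0"
    using ito_approximation[OF J] by blast
  note simple = simple[rule_format] and lim = lim[rule_format]
  obtain n' \<tau>' \<xi>' where simple': "\<forall>m. simple_integrand M F a b (n' m) (\<tau>' m) (\<xi>' m)"
    and limE': "(\<lambda>m. E2 a b (\<lambda>r \<omega>. simple_process (n' m) (\<tau>' m) (\<xi>' m) r \<omega> - \<phi>' r \<omega>)) \<longlonglongrightarrow> 0"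
    and lim': "\<forall>t\<in>{a..b}. (\<lambda>m. \<integral>\<^sup>+\<omega>. nsq (simple_ito_integral B (n' m) (\<tau>' m) (\<xi>' m) t \<omega> - J' t \<omega>) \<partial>M) \<longlonglongrightarrow> 0"
    using ito_approximation[OF J'] by blast
  note simple' = simple'[rule_format] and lim' = lim'[rule_format]
  define I I' where "I m = simple_ito_integral B (n m) (\<tau> m) (\<xi> m) t" and "I' m = simple_ito_integral B (n' m) (\<tau>' m) (\<xi>' m) t" for m
  define S S' where "S m = simple_process (n m) (\<tau> m) (\<xi> m)" and "S' m = simple_process (n' m) (\<tau>' m) (\<xi>' m)" for m
  have [measurable]: "I m \<in> borel_measurable M" "I' m \<in> borel_measurable M" "J t \<in> borel_measurable M" "J' t \<in> borel_measurable M" for m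
    unfolding I_def I'_def
    using sq_integrable_measurable[OF simple_ito_sq_integrable[OF a simple]] sq_integrable_measurable[OF simple_ito_sq_integrable[OF a simple']]
      F_measurable_M[OF ito_adapted[OF J t]] F_measurable_M[OF ito_adapted[OF J' t]] by auto
  have joint_meas: "joint_meas a t (S m)" "joint_meas a t (S' m)" "joint_meas a t \<phi>" "joint_meas a t \<phi>'" for m
    unfolding S_def S'_def
    using joint_meas_mono[OF prog_measurable_joint_meas[OF simple_process_prog_measurable[OF simple]] order.refl, of t]
      joint_meas_mono[OF prog_measurable_joint_meas[OF simple_process_prog_measurable[OF simple']] order.refl, of t]
      joint_meas_mono[OF L2_F_joint_meas[OF ito_integrand[OF J]] order.refl, of t] joint_meas_mono[OF L2_F_joint_meas[OF ito_integrand[OF J']] order.refl, of t] t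
    by auto
  have regroup: "nsq (x - y - (x' - y')) \<le> 2 * nsq (x' - x) + 2 * nsq (y' - y)" for x y x' y' :: "'c::real_normed_vector"
  proof -
    have "x - y - (x' - y') = (y' - y) - (x' - x)" by simp
    then show ?thesis using nsq_diff_le2[of "y' - y" "x' - x"] by (simp only: add.commute)
  qed
  show ?thesis
  proof (rule le_of_L2_approximation[where D="\<lambda>m. \<integral>\<^sup>+\<omega>. nsq (I m \<omega> - I' m \<omega>) \<partial>M",
      OF tendsto_0_twice_sum[OF lim[OF t] lim'[OF t]] tendsto_0_twice_sum[OF limE limE']])
    fix m :: nat and \<epsilon> :: real assume \<epsilon>: "\<epsilon> > 0"
    have "(\<integral>\<^sup>+\<omega>. nsq (J t \<omega> - J' t \<omega>) \<partial>M) \<le> ennreal (1 + \<epsilon>) * (\<integral>\<^sup>+\<omega>. nsq (I m \<omega> - I' m \<omega>) \<partial>M) +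
        ennreal (1 + 1 / \<epsilon>) * (\<integral>\<^sup>+\<omega>. nsq (J t \<omega> - J' t \<omega> - (I m \<omega> - I' m \<omega>)) \<partial>M)"
      by (rule nn_integral_nsq_le) (use \<epsilon> in auto)
    also have "(\<integral>\<^sup>+\<omega>. nsq (J t \<omega> - J' t \<omega> - (I m \<omega> - I' m \<omega>)) \<partial>M) \<le> (\<integral>\<^sup>+\<omega>. 2 * nsq (I m \<omega> - J t \<omega>) + 2 * nsq (I' m \<omega> - J' t \<omega>) \<partial>M)"
      by (intro nn_integral_mono regroup)
    also have "\<dots> = 2 * (\<integral>\<^sup>+\<omega>. nsq (I m \<omega> - J t \<omega>) \<partial>M) + 2 * (\<integral>\<^sup>+\<omega>. nsq (I' m \<omega> - J' t \<omega>) \<partial>M)"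
      by (simp add: nn_integral_add nn_integral_cmult)
    finally show "(\<integral>\<^sup>+\<omega>. nsq (J t \<omega> - J' t \<omega>) \<partial>M) \<le> ennreal (1 + \<epsilon>) * (\<integral>\<^sup>+\<omega>. nsq (I m \<omega> - I' m \<omega>) \<partial>M) +
        ennreal (1 + 1 / \<epsilon>) * (2 * (\<integral>\<^sup>+\<omega>. nsq (simple_ito_integral B (n m) (\<tau> m) (\<xi> m) t \<omega> - J t \<omega>) \<partial>M) +
          2 * (\<integral>\<^sup>+\<omega>. nsq (simple_ito_integral B (n' m) (\<tau>' m) (\<xi>' m) t \<omega> - J' t \<omega>) \<partial>M))"
      by (simp add: I_def I'_def mult_left_mono add_left_mono)
    have "(\<integral>\<^sup>+\<omega>. nsq (I m \<omega> - I' m \<omega>) \<partial>M) = E2 a t (\<lambda>r \<omega>. S m r \<omega> - S' m r \<omega>)"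
      unfolding I_def I'_def S_def S'_def E2_def by (rule simple_ito_diff_isometry[OF a simple simple'])
    also have "\<dots> \<le> ennreal (1 + \<epsilon>) * E2 a t (\<lambda>r \<omega>. \<phi> r \<omega> - \<phi>' r \<omega>) + ennreal (1 + 1 / \<epsilon>) * E2 a t (\<lambda>r \<omega>. S m r \<omega> - S' m r \<omega> - (\<phi> r \<omega> - \<phi>' r \<omega>))"
      by (rule E2_add_le) (use joint_meas \<epsilon> in \<open>auto intro: joint_meas_diff\<close>)
    also have "E2 a t (\<lambda>r \<omega>. S m r \<omega> - S' m r \<omega> - (\<phi> r \<omega> - \<phi>' r \<omega>)) \<le> 2 * E2 a t (\<lambda>r \<omega>. S m r \<omega> - \<phi> r \<omega>) + 2 * E2 a t (\<lambda>r \<omega>. S' m r \<omega> - \<phi>' r \<omega>)"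
    proof -
      have "E2 a t (\<lambda>r \<omega>. S m r \<omega> - S' m r \<omega> - (\<phi> r \<omega> - \<phi>' r \<omega>)) = E2 a t (\<lambda>r \<omega>. (S m r \<omega> - \<phi> r \<omega>) - (S' m r \<omega> - \<phi>' r \<omega>))"
        by (simp add: algebra_simps)
      also have "\<dots> \<le> ennreal (1 + 1) * E2 a t (\<lambda>r \<omega>. S m r \<omega> - \<phi> r \<omega>) + ennreal (1 + 1 / 1) * E2 a t (\<lambda>r \<omega>. (S m r \<omega> - \<phi> r \<omega>) - (S' m r \<omega> - \<phi>' r \<omega>) - (S m r \<omega> - \<phi> r \<omega>))"
        by (rule E2_add_le) (intro joint_meas_diff joint_meas, intro joint_meas_diff joint_meas, simp)
      also have "E2 a t (\<lambda>r \<omega>. (S m r \<omega> - \<phi> r \<omega>) - (S' m r \<omega> - \<phi>' r \<omega>) - (S m r \<omega> - \<phi> r \<omega>)) = E2 a t (\<lambda>r \<omega>. S' m r \<omega> - \<phi>' r \<omega>)"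
        by (simp add: E2_def norm_minus_commute)
      finally show ?thesis by simp
    qed
    also have "E2 a t (\<lambda>r \<omega>. S m r \<omega> - \<phi> r \<omega>) \<le> E2 a b (\<lambda>r \<omega>. S m r \<omega> - \<phi> r \<omega>)" by (rule E2_mono_interval) (use t in auto)
    also have "E2 a t (\<lambda>r \<omega>. S' m r \<omega> - \<phi>' r \<omega>) \<le> E2 a b (\<lambda>r \<omega>. S' m r \<omega> - \<phi>' r \<omega>)" by (rule E2_mono_interval) (use t in auto)
    finally show "(\<integral>\<^sup>+\<omega>. nsq (I m \<omega> - I' m \<omega>) \<partial>M) \<le> ennreal (1 + \<epsilon>) * E2 a t (\<lambda>r \<omega>. \<phi> r \<omega> - \<phi>' r \<omega>) +
        ennreal (1 + 1 / \<epsilon>) * (2 * E2 a b (\<lambda>r \<omega>. simple_process (n m) (\<tau> m) (\<xi> m) r \<omega> - \<phi> r \<omega>) + 2 * E2 a b (\<lambda>r \<omega>. simple_process (n' m) (\<tau>' m) (\<xi>' m) r \<omega> - \<phi>' r \<omega>))"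
      by (simp add: S_def S'_def mult_left_mono add_left_mono)
  qed
qed

lemma ito_cong:
  assumes J: "has_ito_integral M B a b \<phi> J" and \<psi>: "\<psi> \<in> L2_F M F a b"
    and eq: "E2 a b (\<lambda>r \<omega>. \<phi> r \<omega> - \<psi> r \<omega>) = 0"
  shows "has_ito_integral M B a b \<psi> J"
proof -
  obtain n \<tau> \<xi> where simple: "\<forall>m. simple_integrand M F a b (n m) (\<tau> m) (\<xi> m)"
    and limE: "(\<lambda>m. E2 a b (\<lambda>r \<omega>. simple_process (n m) (\<tau> m) (\<xi> m) r \<omega> - \<phi> r \<omega>)) \<longlonglongrightarrow> 0"
    and lim: "\<forall>t\<in>{a..b}. (\<lambda>m. \<integral>\<^sup>+\<omega>. nsq (simple_ito_integral B (n m) (\<tau> m) (\<xi> m) t \<omega> - J t \<omega>) \<partial>M) \<longlonglongrightarrow> 0"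
    using ito_approximation[OF J] by blast
  note simple = simple[rule_format] and lim = lim[rule_format]
  have "(\<lambda>m. E2 a b (\<lambda>r \<omega>. simple_process (n m) (\<tau> m) (\<xi> m) r \<omega> - \<psi> r \<omega>)) \<longlonglongrightarrow> 0"
  proof (rule tendsto_sandwich[OF _ _ tendsto_const])
    show "\<forall>\<^sub>F m in sequentially. E2 a b (\<lambda>r \<omega>. simple_process (n m) (\<tau> m) (\<xi> m) r \<omega> - \<psi> r \<omega>) \<le>
       2 * E2 a b (\<lambda>r \<omega>. simple_process (n m) (\<tau> m) (\<xi> m) r \<omega> - \<phi> r \<omega>) + 2 * E2 a b (\<lambda>r \<omega>. \<phi> r \<omega> - \<psi> r \<omega>)"
      by (intro always_eventually allI E2_triangle L2_F_joint_meas[OF ito_integrand[OF J]] L2_F_joint_meas[OF \<psi>]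
            prog_measurable_joint_meas[OF simple_process_prog_measurable[OF simple]])
    show "(\<lambda>m. 2 * E2 a b (\<lambda>r \<omega>. simple_process (n m) (\<tau> m) (\<xi> m) r \<omega> - \<phi> r \<omega>) + 2 * E2 a b (\<lambda>r \<omega>. \<phi> r \<omega> - \<psi> r \<omega>)) \<longlonglongrightarrow> 0"
      by (rule tendsto_0_twice_sum[OF limE]) (simp add: eq)
  qed simp
  with J \<psi> simple lim show ?thesis
    unfolding has_ito_integral_def E2_def
    by (intro conjI exI[of _ n] exI[of _ \<tau>] exI[of _ \<xi>]) auto
qed

text \<open>
  The integral is the limit of simple integrals \<open>I m\<close> whose integrands are within squared
  distance \<open>(1 / 16) ^ m\<close> of \<open>\<phi>\<close>. By Doob's inequality the squared supremum of \<open>I m - I (Suc m)\<close>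
  has expectation at most \<open>16 * (1 / 16) ^ m\<close>. After weighting by \<open>4 ^ m\<close> these still sum up, so
  that almost surely the suprema are at most a multiple of \<open>(1 / 2) ^ m\<close> and the paths converge
  uniformly.
\<close>

lemma ito_exists:
  assumes ab: "0 \<le> a" "a \<le> b" and \<phi>: "\<phi> \<in> L2_F M F a b"
  shows "\<exists>J. has_ito_integral M B a b \<phi> J \<and> (\<forall>\<omega>. J a \<omega> = 0)"
proof -
  have "\<forall>m::nat. \<exists>n \<tau> \<xi>. simple_integrand M F a b n \<tau> \<xi> \<and> E2 a b (\<lambda>r \<omega>. simple_process n \<tau> \<xi> r \<omega> - \<phi> r \<omega>) < ennreal ((1 / 16) ^ m)"
    using simple_integrands_dense[OF ab \<phi>] by simp
  then obtain n \<tau> \<xi> where ex: "\<forall>m::nat. simple_integrand M F a b (n m) (\<tau> m) (\<xi> m) \<and> E2 a b (\<lambda>r \<omega>. simple_process (n m) (\<tau> m) (\<xi> m) r \<omega> - \<phi> r \<omega>) < ennreal ((1 / 16) ^ m)"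
    unfolding choice_iff by blast
  define S where "S m = simple_process (n m) (\<tau> m) (\<xi> m)" for m
  define I where "I m = simple_ito_integral B (n m) (\<tau> m) (\<xi> m)" for m
  have simple: "simple_integrand M F a b (n m) (\<tau> m) (\<xi> m)" for m using ex by blast
  have S_close: "E2 a b (\<lambda>r \<omega>. S m r \<omega> - \<phi> r \<omega>) \<le> ennreal ((1 / 16) ^ m)" for m
    using ex unfolding S_def by (blast intro: less_imp_le)
  have joint_meas: "joint_meas a b (S m)" "joint_meas a b \<phi>" for m
    unfolding S_def by (intro prog_measurable_joint_meas[OF simple_process_prog_measurable[OF simple]] L2_F_joint_meas \<phi>)+
  have S_diff: "E2 a b (\<lambda>r \<omega>. S m r \<omega> - S k r \<omega>) \<le> ennreal (4 * (1 / 16) ^ m)" if "m \<le> k" for m k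
  proof -
    have "E2 a b (\<lambda>r \<omega>. S m r \<omega> - S k r \<omega>) \<le> 2 * E2 a b (\<lambda>r \<omega>. S m r \<omega> - \<phi> r \<omega>) + 2 * E2 a b (\<lambda>r \<omega>. \<phi> r \<omega> - S k r \<omega>)"
      by (intro E2_triangle joint_meas)
    also have "\<dots> \<le> 2 * ennreal ((1 / 16) ^ m) + 2 * ennreal ((1 / 16) ^ k)"
      unfolding E2_minus_commute[of a b \<phi>] by (intro add_mono mult_left_mono S_close) auto
    also have "\<dots> \<le> 2 * ennreal ((1 / 16) ^ m) + 2 * ennreal ((1 / 16) ^ m)"
      using that by (intro add_mono mult_left_mono ennreal_leI power_decreasing) auto
    also have "\<dots> = (2 + 2) * ennreal ((1 / 16) ^ m)" by (simp only: distrib_right)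
    also have "\<dots> = ennreal 4 * ennreal ((1 / 16) ^ m)" by simp
    also have "\<dots> = ennreal (4 * (1 / 16) ^ m)" by (subst ennreal_mult[symmetric]) simp_all
    finally show ?thesis .
  qed
  have I_diff: "(\<integral>\<^sup>+\<omega>. nsq (I m t \<omega> - I k t \<omega>) \<partial>M) \<le> ennreal (4 * (1 / 16) ^ m)" if "m \<le> k" "t \<le> b" for m k t
  proof -
    have "(\<integral>\<^sup>+\<omega>. nsq (I m t \<omega> - I k t \<omega>) \<partial>M) = E2 a t (\<lambda>r \<omega>. S m r \<omega> - S k r \<omega>)"
      unfolding I_def S_def E2_def by (rule simple_ito_diff_isometry[OF ab(1) simple simple])
    also have "\<dots> \<le> E2 a b (\<lambda>r \<omega>. S m r \<omega> - S k r \<omega>)" by (rule E2_mono_interval) (use that in auto)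
    also have "\<dots> \<le> ennreal (4 * (1 / 16) ^ m)" by (rule S_diff[OF that(1)])
    finally show ?thesis .
  qed
  have I_F: "I m t \<in> borel_measurable (F t)" for m t
    unfolding I_def by (rule simple_ito_F_measurable[OF ab(1) simple])
  have I_sq: "sq_integrable (I m t)" for m t
    unfolding I_def by (rule simple_ito_sq_integrable[OF ab(1) simple])
  have I_M [measurable]: "I m t \<in> borel_measurable M" for m t
    by (rule sq_integrable_measurable[OF I_sq])
  have "\<exists>G. G \<in> borel_measurable M \<and> (AE \<omega> in M. \<forall>r\<in>{a..b}. nsq (I m r \<omega> - I (Suc m) r \<omega>) \<le> G \<omega>) \<and>
      (\<integral>\<^sup>+\<omega>. G \<omega> \<partial>M) \<le> ennreal (16 * (1 / 16) ^ m)" for m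
  proof -
    define N where "N t \<omega> = I m t \<omega> - I (Suc m) t \<omega>" for t \<omega>
    obtain G where G: "G \<in> borel_measurable M" "AE \<omega> in M. \<forall>r\<in>{a..b}. nsq (N r \<omega>) \<le> G \<omega>"
      "(\<integral>\<^sup>+\<omega>. G \<omega> \<partial>M) \<le> 4 * (\<integral>\<^sup>+\<omega>. nsq (N b \<omega>) \<partial>M)"
    proof (rule Doob_maximal[OF ab(2)])
      show "N t \<in> borel_measurable (F t)" for t unfolding N_def[abs_def] by (intro borel_measurable_diff I_F)
      show "sq_integrable (N t)" for t unfolding N_def[abs_def] by (intro sq_integrable_diff I_sq)
      show "AE \<omega> in M. continuous_on {a..b} (\<lambda>t. N t \<omega>)"
        using B_continuous
      proof eventually_elim
        case (elim \<omega>)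
        show ?case unfolding N_def I_def by (intro continuous_on_diff simple_ito_continuous[OF ab(1) simple elim])
      qed
      show "expectation (\<lambda>\<omega>. Z \<omega> * (N t \<omega> - N s \<omega>)) = 0"
        if st: "a \<le> s" "s \<le> t" "t \<le> b" and Z: "Z \<in> borel_measurable (F s)" "sq_integrable Z" for s t Z
      proof -
        have [measurable]: "Z \<in> borel_measurable M" by (rule sq_integrable_measurable[OF Z(2)])
        have int: "integrable M (\<lambda>\<omega>. Z \<omega> * (I j t \<omega> - I j s \<omega>))" for j
          by (rule sq_integrable_product[OF Z(2) sq_integrable_diff[OF I_sq I_sq]]) (auto simp: abs_mult)
        have zero: "expectation (\<lambda>\<omega>. Z \<omega> * (I j t \<omega> - I j s \<omega>)) = 0" for j
          unfolding I_def by (rule simple_ito_martingale[OF ab(1) simple st(2) Z])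
        have "expectation (\<lambda>\<omega>. Z \<omega> * (N t \<omega> - N s \<omega>)) =
            expectation (\<lambda>\<omega>. Z \<omega> * (I m t \<omega> - I m s \<omega>) - Z \<omega> * (I (Suc m) t \<omega> - I (Suc m) s \<omega>))"
          by (simp add: N_def algebra_simps)
        also have "\<dots> = 0" by (simp only: Bochner_Integration.integral_diff[OF int int] zero diff_self)
        finally show ?thesis .
      qed
    qed
    note G(3)
    also have "4 * (\<integral>\<^sup>+\<omega>. nsq (N b \<omega>) \<partial>M) \<le> 4 * ennreal (4 * (1 / 16) ^ m)"
      unfolding N_def by (intro mult_left_mono I_diff) auto
    also have "\<dots> = ennreal (16 * (1 / 16) ^ m)"
    proof -
      have "4 * ennreal (4 * (1 / 16) ^ m) = ennreal 4 * ennreal (4 * (1 / 16) ^ m)" by simp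
      also have "\<dots> = ennreal (16 * (1 / 16) ^ m)" by (subst ennreal_mult[symmetric]) simp_all
      finally show ?thesis .
    qed
    finally show ?thesis using G(1,2) unfolding N_def by blast
  qed
  then have "\<exists>G. \<forall>m. G m \<in> borel_measurable M \<and> (AE \<omega> in M. \<forall>r\<in>{a..b}. nsq (I m r \<omega> - I (Suc m) r \<omega>) \<le> G m \<omega>) \<and>
      (\<integral>\<^sup>+\<omega>. G m \<omega> \<partial>M) \<le> ennreal (16 * (1 / 16) ^ m)"
    by (intro choice allI)
  then obtain G where G: "G m \<in> borel_measurable M \<and> (AE \<omega> in M. \<forall>r\<in>{a..b}. nsq (I m r \<omega> - I (Suc m) r \<omega>) \<le> G m \<omega>) \<and>
      (\<integral>\<^sup>+\<omega>. G m \<omega> \<partial>M) \<le> ennreal (16 * (1 / 16) ^ m)" for m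
    by (elim exE) (rule that, erule spec)
  have [measurable]: "G m \<in> borel_measurable M" for m using G by blast
  have "(\<integral>\<^sup>+\<omega>. (\<Sum>m. ennreal (4 ^ m) * G m \<omega>) \<partial>M) = (\<Sum>m. ennreal (4 ^ m) * (\<integral>\<^sup>+\<omega>. G m \<omega> \<partial>M))"
    by (subst nn_integral_suminf) (auto simp: nn_integral_cmult)
  also have "\<dots> \<le> (\<Sum>m. ennreal (16 * (1 / 4) ^ m))"
  proof (intro suminf_le summableI)
    fix m
    have "ennreal (4 ^ m) * (\<integral>\<^sup>+\<omega>. G m \<omega> \<partial>M) \<le> ennreal (4 ^ m) * ennreal (16 * (1 / 16) ^ m)"
      using G by (intro mult_left_mono) auto
    also have "\<dots> = ennreal (16 * (1 / 4) ^ m)"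
    proof -
      have "(4::real) ^ m * (16 * (1 / 16) ^ m) = 16 * (1 / 4) ^ m"
        by (simp add: power_divide power_mult_distrib[symmetric] field_simps)
      then show ?thesis by (subst ennreal_mult[symmetric]) simp_all
    qed
    finally show "ennreal (4 ^ m) * (\<integral>\<^sup>+\<omega>. G m \<omega> \<partial>M) \<le> ennreal (16 * (1 / 4) ^ m)" .
  qed
  also have "\<dots> < top"
    by (subst less_top[symmetric], rule ennreal_suminf_neq_top) (auto intro: summable_mult summable_geometric)
  finally have e1: "AE \<omega> in M. (\<Sum>m. ennreal (4 ^ m) * G m \<omega>) \<noteq> \<infinity>"
    by (intro nn_integral_PInf_AE) auto
  have e2: "AE \<omega> in M. \<forall>m. \<forall>r\<in>{a..b}. nsq (I m r \<omega> - I (Suc m) r \<omega>) \<le> G m \<omega>"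
    using G by (simp add: AE_all_countable)
  define good where "good \<omega> \<longleftrightarrow> continuous_on {0..} (\<lambda>t. B t \<omega>) \<and> (\<exists>c. \<forall>m. \<forall>r\<in>{a..b}. \<bar>I (Suc m) r \<omega> - I m r \<omega>\<bar> \<le> c * (1 / 2) ^ m)" for \<omega>
  from e1 e2 B_continuous have AE_good: "AE \<omega> in M. good \<omega>"
  proof eventually_elim
    case (elim \<omega>)
    obtain c where c: "(\<Sum>m. ennreal (4 ^ m) * G m \<omega>) = ennreal c" "c \<ge> 0"
      using elim(1) by (cases "\<Sum>m. ennreal (4 ^ m) * G m \<omega>") auto
    have "\<bar>I (Suc m) r \<omega> - I m r \<omega>\<bar> \<le> sqrt c * (1 / 2) ^ m" if r: "r \<in> {a..b}" for m r
    proof -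
      have "ennreal (4 ^ m * (I m r \<omega> - I (Suc m) r \<omega>)\<^sup>2) = ennreal (4 ^ m) * nsq (I m r \<omega> - I (Suc m) r \<omega>)"
        by (subst ennreal_mult) auto
      also have "\<dots> \<le> ennreal (4 ^ m) * G m \<omega>" using elim(2) r by (intro mult_left_mono) auto
      also have "\<dots> \<le> (\<Sum>m. ennreal (4 ^ m) * G m \<omega>)"
        using sum_le_suminf[OF summableI, of "{m}" "\<lambda>m. ennreal (4 ^ m) * G m \<omega>"] by simp
      finally have "4 ^ m * (I m r \<omega> - I (Suc m) r \<omega>)\<^sup>2 \<le> c" using c by simp
      then have "(I (Suc m) r \<omega> - I m r \<omega>)\<^sup>2 \<le> c * (1 / 4) ^ m"
        by (simp add: power_divide field_simps power2_commute)
      then have "\<bar>I (Suc m) r \<omega> - I m r \<omega>\<bar> \<le> sqrt (c * (1 / 4) ^ m)"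
        by (metis real_sqrt_abs real_sqrt_le_iff)
      also have "sqrt (c * (1 / 4) ^ m) = sqrt c * (1 / 2) ^ m"
        by (simp add: real_sqrt_mult real_sqrt_power real_sqrt_divide)
      finally show ?thesis .
    qed
    then show ?case using elim(3) unfolding good_def by blast
  qed
  \<comment> \<open>The value 0 on the exceptional null set makes every path continuous; adaptedness is kept
     because null sets belong to the filtration.\<close>
  define J where "J t \<omega> = (if good \<omega> then lim (\<lambda>m. I m t \<omega>) else 0)" for t \<omega>
  have unif: "uniform_limit {a..b} (\<lambda>m t. I m t \<omega>) (\<lambda>t. J t \<omega>) sequentially" if good: "good \<omega>" for \<omega>
  proof -
    obtain c where c: "\<And>m r. r \<in> {a..b} \<Longrightarrow> \<bar>I (Suc m) r \<omega> - I m r \<omega>\<bar> \<le> c * (1 / 2) ^ m"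
      using good unfolding good_def by blast
    have "uniform_limit {a..b} (\<lambda>m t. \<Sum>k<m. I (Suc k) t \<omega> - I k t \<omega>) (\<lambda>t. \<Sum>k. I (Suc k) t \<omega> - I k t \<omega>) sequentially"
      by (rule Weierstrass_m_test[where M="\<lambda>m. c * (1 / 2) ^ m"]) (use c in \<open>auto intro: summable_mult summable_geometric\<close>)
    then have u0: "uniform_limit {a..b} (\<lambda>m t. I 0 t \<omega> + (\<Sum>k<m. I (Suc k) t \<omega> - I k t \<omega>)) (\<lambda>t. I 0 t \<omega> + (\<Sum>k. I (Suc k) t \<omega> - I k t \<omega>)) sequentially"
      by (intro uniform_limit_add uniform_limit_const)
    have u: "uniform_limit {a..b} (\<lambda>m t. I m t \<omega>) (\<lambda>t. I 0 t \<omega> + (\<Sum>k. I (Suc k) t \<omega> - I k t \<omega>)) sequentially"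
    proof -
      have "(\<Sum>k<m. I (Suc k) t \<omega> - I k t \<omega>) = I m t \<omega> - I 0 t \<omega>" for m t
        by (rule sum_lessThan_telescope)
      then show ?thesis using u0 by simp
    qed
    have "J t \<omega> = I 0 t \<omega> + (\<Sum>k. I (Suc k) t \<omega> - I k t \<omega>)" if "t \<in> {a..b}" for t
      using limI[OF tendsto_uniform_limitI[OF u that]] good by (simp add: J_def)
    then show ?thesis using u by (subst uniform_limit_cong') auto
  qed
  have J_lim: "AE \<omega> in M. (\<lambda>m. I m t \<omega>) \<longlonglongrightarrow> J t \<omega>" if "t \<in> {a..b}" for t
    using AE_good by eventually_elim (rule tendsto_uniform_limitI[OF unif that])
  have J_F: "J t \<in> borel_measurable (F t)" for t
  proof (rule F_measurable_AE_eq)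
    show "(\<lambda>\<omega>. lim (\<lambda>m. I m t \<omega>)) \<in> borel_measurable (F t)" by (intro borel_measurable_lim_metric I_F)
    show "AE \<omega> in M. lim (\<lambda>m. I m t \<omega>) = J t \<omega>" using AE_good by eventually_elim (simp add: J_def)
  qed simp
  have J_cont: "continuous_on {a..b} (\<lambda>t. J t \<omega>)" for \<omega>
  proof (cases "good \<omega>")
    case True
    then have cB: "continuous_on {0..} (\<lambda>t. B t \<omega>)" by (simp add: good_def)
    show ?thesis
      by (rule uniform_limit_theorem[OF _ unif[OF True]])
         (simp_all add: I_def simple_ito_continuous[OF ab(1) simple cB])
  qed (simp add: J_def)
  have J_start: "J a \<omega> = 0" for \<omega>
    unfolding J_def I_def simple_ito_start[OF simple] by simp
  have J_L2: "(\<integral>\<^sup>+\<omega>. nsq (I m t \<omega> - J t \<omega>) \<partial>M) \<le> ennreal (4 * (1 / 16) ^ m)" if t: "t \<in> {a..b}" for m t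
  proof -
    have "(\<integral>\<^sup>+\<omega>. nsq (I m t \<omega> - J t \<omega>) \<partial>M) \<le> (\<integral>\<^sup>+\<omega>. liminf (\<lambda>k. nsq (I m t \<omega> - I k t \<omega>)) \<partial>M)"
    proof (rule nn_integral_mono_AE)
      show "AE \<omega> in M. nsq (I m t \<omega> - J t \<omega>) \<le> liminf (\<lambda>k. nsq (I m t \<omega> - I k t \<omega>))"
        using J_lim[OF t]
      proof eventually_elim
        case (elim \<omega>)
        have "(\<lambda>k. nsq (I m t \<omega> - I k t \<omega>)) \<longlonglongrightarrow> nsq (I m t \<omega> - J t \<omega>)"
          using elim by (intro tendsto_intros)
        then have "nsq (I m t \<omega> - J t \<omega>) = liminf (\<lambda>k. nsq (I m t \<omega> - I k t \<omega>))"
          by (rule lim_imp_Liminf[OF sequentially_bot, symmetric])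
        then show ?case by (rule eq_refl)
      qed
    qed
    also have "\<dots> \<le> liminf (\<lambda>k. \<integral>\<^sup>+\<omega>. nsq (I m t \<omega> - I k t \<omega>) \<partial>M)"
      by (rule nn_integral_liminf) measurable
    also have "\<dots> \<le> liminf (\<lambda>k::nat. ennreal (4 * (1 / 16) ^ m))"
      using eventually_ge_at_top[of m] by (intro Liminf_mono, eventually_elim) (use t in \<open>auto intro!: I_diff[simplified]\<close>)
    also have "\<dots> = ennreal (4 * (1 / 16) ^ m)" by (simp add: Liminf_const)
    finally show ?thesis .
  qed
  have "has_ito_integral M B a b \<phi> J"
    unfolding has_ito_integral_def
  proof (intro conjI \<phi> ballI J_F J_cont exI[of _ n] exI[of _ \<tau>] exI[of _ \<xi>] allI simple)
    have p0: "(\<lambda>m. ennreal (c * (1 / 16) ^ m)) \<longlonglongrightarrow> 0" for c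
    proof -
      have "(\<lambda>m. c * (1 / 16) ^ m) \<longlonglongrightarrow> c * (0::real)" by (intro tendsto_mult tendsto_const LIMSEQ_realpow_zero) auto
      from tendsto_ennrealI[OF this] show ?thesis by simp
    qed
    show "(\<lambda>m. \<integral>\<^sup>+\<omega>. (\<integral>\<^sup>+r\<in>{a..b}. nsq (simple_process (n m) (\<tau> m) (\<xi> m) r \<omega> - \<phi> r \<omega>) \<partial>lborel) \<partial>M) \<longlonglongrightarrow> 0"
      by (rule tendsto_sandwich[OF _ _ tendsto_const p0[of 1]]) (use S_close in \<open>simp_all add: E2_def S_def\<close>)
    show "(\<lambda>m. \<integral>\<^sup>+\<omega>. ennreal ((simple_ito_integral B (n m) (\<tau> m) (\<xi> m) t \<omega> - J t \<omega>)\<^sup>2) \<partial>M) \<longlonglongrightarrow> 0" if "t \<in> {a..b}" for t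
      by (rule tendsto_sandwich[OF _ _ tendsto_const p0[of 4]]) (use J_L2[OF that] in \<open>simp_all add: I_def\<close>)
  qed
  with J_start show ?thesis by blast
qed

lemma ito_majorant:
  assumes "0 \<le> a" "a \<le> b" and J: "has_ito_integral M B a b \<phi> J"
  shows "\<exists>G. G \<in> borel_measurable M \<and> (AE \<omega> in M. \<forall>r\<in>{a..b}. nsq (J r \<omega>) \<le> G \<omega>) \<and> (\<integral>\<^sup>+\<omega>. G \<omega> \<partial>M) < \<infinity>"
proof -
  obtain G where G: "G \<in> borel_measurable M" "AE \<omega> in M. \<forall>r\<in>{a..b}. nsq (J r \<omega>) \<le> G \<omega>"
    "(\<integral>\<^sup>+\<omega>. G \<omega> \<partial>M) \<le> 4 * (\<integral>\<^sup>+\<omega>. nsq (J b \<omega>) \<partial>M)"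
    by (rule Doob_maximal[OF assms(2) ito_adapted[OF J] ito_sq_integrable[OF assms(1) J] ito_martingale[OF assms(1) J]])
       (use ito_continuous[OF J] in auto)
  have "(\<integral>\<^sup>+\<omega>. G \<omega> \<partial>M) < \<infinity>"
    using G(3) ito_sq_integrable[OF assms(1) J, of b] assms(2)
    by (auto simp: sq_integrable_iff ennreal_mult_less_top intro: order.strict_trans1)
  with G show ?thesis by blast
qed

section \<open>Conditional expectations and continuous adapted processes\<close>

text \<open>
  With \<open>g\<close> the conditional expectation of \<open>f\<close>, the mean of \<open>g\<^sup>2\<close> is that of \<open>g * f\<close>, hence at
  most half the sum of the means of \<open>g\<^sup>2\<close> and \<open>f\<^sup>2\<close>. To subtract the mean of \<open>g\<^sup>2\<close> it must be
  finite, which is why \<open>g\<close> is first truncated to \<open>min g n\<close>.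
\<close>

lemma nn_cond_exp_L2_contraction:
  assumes [measurable]: "f \<in> borel_measurable M"
  shows "(\<integral>\<^sup>+\<omega>. (nn_cond_exp M (F t) f \<omega>)\<^sup>2 \<partial>M) \<le> (\<integral>\<^sup>+\<omega>. (f \<omega>)\<^sup>2 \<partial>M)"
proof -
  interpret S: finite_measure_subalgebra M "F t"
    by unfold_locales (rule subalgebra_F)
  define g where "g = nn_cond_exp M (F t) f"
  have gF [measurable]: "g \<in> borel_measurable (F t)" unfolding g_def by simp
  have [measurable]: "g \<in> borel_measurable M" by (rule F_measurable_M[OF gF])
  define h where "h n \<omega> = min (g \<omega>) (of_nat n)" for n :: nat and \<omega>
  have hF [measurable]: "h n \<in> borel_measurable (F t)" for n unfolding h_def[abs_def] by measurable
  have [measurable]: "h n \<in> borel_measurable M" for n by (rule F_measurable_M[OF hF])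
  have bound: "(\<integral>\<^sup>+\<omega>. (h n \<omega>)\<^sup>2 \<partial>M) \<le> (\<integral>\<^sup>+\<omega>. (f \<omega>)\<^sup>2 \<partial>M)" for n
  proof -
    have "(\<integral>\<^sup>+\<omega>. (h n \<omega>)\<^sup>2 \<partial>M) \<le> (\<integral>\<^sup>+\<omega>. (of_nat n)\<^sup>2 \<partial>M)"
      by (intro nn_integral_mono power_mono) (auto simp: h_def)
    also have "\<dots> < \<infinity>" by (simp add: emeasure_space_1 ennreal_of_nat_eq_real_of_nat ennreal_power)
    finally have fin: "(\<integral>\<^sup>+\<omega>. (h n \<omega>)\<^sup>2 \<partial>M) < \<infinity>" .
    have "(\<integral>\<^sup>+\<omega>. (h n \<omega>)\<^sup>2 \<partial>M) \<le> (\<integral>\<^sup>+\<omega>. h n \<omega> * g \<omega> \<partial>M)"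
      by (intro nn_integral_mono) (auto simp: h_def power2_eq_square intro!: mult_left_mono)
    also have "\<dots> = (\<integral>\<^sup>+\<omega>. h n \<omega> * f \<omega> \<partial>M)"
      unfolding g_def by (rule S.nn_cond_exp_intg) auto
    finally have "2 * (\<integral>\<^sup>+\<omega>. (h n \<omega>)\<^sup>2 \<partial>M) \<le> 2 * (\<integral>\<^sup>+\<omega>. h n \<omega> * f \<omega> \<partial>M)"
      by (intro mult_left_mono) auto
    also have "\<dots> = (\<integral>\<^sup>+\<omega>. 2 * (h n \<omega> * f \<omega>) \<partial>M)" by (simp add: nn_integral_cmult)
    also have "\<dots> \<le> (\<integral>\<^sup>+\<omega>. (h n \<omega>)\<^sup>2 + (f \<omega>)\<^sup>2 \<partial>M)"
      using ennreal_weighted_AM_GM[of 1] by (intro nn_integral_mono) simp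
    also have "\<dots> = (\<integral>\<^sup>+\<omega>. (h n \<omega>)\<^sup>2 \<partial>M) + (\<integral>\<^sup>+\<omega>. (f \<omega>)\<^sup>2 \<partial>M)" by (simp add: nn_integral_add)
    finally show ?thesis using fin by (auto simp: mult_2 ennreal_add_left_cancel_le)
  qed
  have lim: "(\<lambda>n. (h n \<omega>)\<^sup>2) \<longlonglongrightarrow> (g \<omega>)\<^sup>2" for \<omega>
  proof (cases "g \<omega>")
    case (real x)
    obtain N :: nat where N: "x \<le> real N" using real_arch_simple by blast
    have "\<forall>\<^sub>F n in sequentially. (h n \<omega>)\<^sup>2 = (g \<omega>)\<^sup>2"
      using eventually_ge_at_top[of N]
    proof eventually_elim
      case (elim n)
      then have "g \<omega> \<le> of_nat n" using real N by (simp add: ennreal_of_nat_eq_real_of_nat)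
      then show ?case by (simp add: h_def)
    qed
    then show ?thesis by (rule tendsto_eventually)
  next
    case top
    have sm: "strict_mono (\<lambda>n::nat. n\<^sup>2)" by (intro strict_monoI power_strict_mono) auto
    have "(\<lambda>n. of_nat (n\<^sup>2) :: ennreal) \<longlonglongrightarrow> top"
      using LIMSEQ_subseq_LIMSEQ[OF of_nat_tendsto_top_ennreal sm] by (simp add: comp_def)
    then show ?thesis using top by (simp add: h_def)
  qed
  have "(\<integral>\<^sup>+\<omega>. (g \<omega>)\<^sup>2 \<partial>M) = (\<integral>\<^sup>+\<omega>. liminf (\<lambda>n. (h n \<omega>)\<^sup>2) \<partial>M)"
    using lim_imp_Liminf[OF sequentially_bot lim] by simp
  also have "\<dots> \<le> liminf (\<lambda>n. \<integral>\<^sup>+\<omega>. (h n \<omega>)\<^sup>2 \<partial>M)" by (rule nn_integral_liminf) measurable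
  also have "\<dots> \<le> liminf (\<lambda>n::nat. \<integral>\<^sup>+\<omega>. (f \<omega>)\<^sup>2 \<partial>M)" by (intro Liminf_mono always_eventually allI bound)
  also have "\<dots> = (\<integral>\<^sup>+\<omega>. (f \<omega>)\<^sup>2 \<partial>M)" by (simp add: Liminf_const)
  finally show ?thesis unfolding g_def .
qed

text \<open>
  Rounding time down to a multiple of \<open>1 / (n + 1)\<close> turns evaluation into a countable choice
  between measurable variables; continuity gives the limit. Stopping at \<open>s\<close> keeps all values
  known at \<open>s\<close>.
\<close>

lemma continuous_adapted_measurable:
  fixes V :: "real \<Rightarrow> 'a \<Rightarrow> real"
  assumes V: "\<And>r. r \<le> s \<Longrightarrow> V r \<in> borel_measurable (F s)"
    and cont: "\<And>\<omega>. \<omega> \<in> space M \<Longrightarrow> continuous_on UNIV (\<lambda>r. V r \<omega>)"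
  shows "(\<lambda>z. V (min s (fst z)) (snd z)) \<in> borel_measurable (borel \<Otimes>\<^sub>M F s)"
proof (rule borel_measurable_LIMSEQ_metric)
  fix n :: nat
  show "(\<lambda>z. V (min s (of_int \<lfloor>fst z * real (Suc n)\<rfloor> / real (Suc n))) (snd z)) \<in> borel_measurable (borel \<Otimes>\<^sub>M F s)"
  proof (rule measurable_compose_countable[where f="\<lambda>i z. V (min s (of_int i / real (Suc n))) (snd z)" and g="\<lambda>z. \<lfloor>fst z * real (Suc n)\<rfloor>"])
    show "(\<lambda>z. V (min s (of_int i / real (Suc n))) (snd z)) \<in> borel_measurable (borel \<Otimes>\<^sub>M F s)" for i
      by (rule measurable_compose[OF measurable_snd V]) simp
    show "(\<lambda>z. \<lfloor>fst z * real (Suc n)\<rfloor>) \<in> borel \<Otimes>\<^sub>M F s \<rightarrow>\<^sub>M count_space UNIV" by measurable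
  qed
next
  fix z :: "real \<times> 'a" assume "z \<in> space (borel \<Otimes>\<^sub>M F s)"
  then have z: "snd z \<in> space M" by (auto simp: space_pair_measure)
  have "(\<lambda>n. of_int \<lfloor>fst z * real (Suc n)\<rfloor> / real (Suc n)) \<longlonglongrightarrow> fst z"
  proof (rule tendsto_sandwich)
    show "\<forall>\<^sub>F n in sequentially. fst z - 1 / real (Suc n) \<le> of_int \<lfloor>fst z * real (Suc n)\<rfloor> / real (Suc n)"
    proof (intro always_eventually allI)
      fix n
      have "fst z * real (Suc n) - 1 \<le> of_int \<lfloor>fst z * real (Suc n)\<rfloor>" by linarith
      then have "(fst z * real (Suc n) - 1) / real (Suc n) \<le> of_int \<lfloor>fst z * real (Suc n)\<rfloor> / real (Suc n)" by (rule divide_right_mono) simp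
      then show "fst z - 1 / real (Suc n) \<le> of_int \<lfloor>fst z * real (Suc n)\<rfloor> / real (Suc n)" by (simp add: diff_divide_distrib del: of_nat_Suc)
    qed
    show "\<forall>\<^sub>F n in sequentially. of_int \<lfloor>fst z * real (Suc n)\<rfloor> / real (Suc n) \<le> fst z"
      by (intro always_eventually allI) (simp add: divide_le_eq del: of_nat_Suc)
    have "(\<lambda>n. fst z - 1 / real (Suc n)) \<longlonglongrightarrow> fst z - 0" by (intro tendsto_intros LIMSEQ_Suc[OF lim_1_over_n])
    then show "(\<lambda>n. fst z - 1 / real (Suc n)) \<longlonglongrightarrow> fst z" by simp
  qed simp
  then have "(\<lambda>n. min s (of_int \<lfloor>fst z * real (Suc n)\<rfloor> / real (Suc n))) \<longlonglongrightarrow> min s (fst z)"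
    by (intro tendsto_min tendsto_const)
  then show "(\<lambda>n. V (min s (of_int \<lfloor>fst z * real (Suc n)\<rfloor> / real (Suc n))) (snd z)) \<longlonglongrightarrow> V (min s (fst z)) (snd z)"
    by (rule continuous_on_tendsto_compose[OF cont[OF z]]) auto
qed

lemma nn_integral_time_measurable:
  assumes "h \<in> borel_measurable (borel \<Otimes>\<^sub>M M)"
  shows "(\<lambda>\<omega>. \<integral>\<^sup>+s. h (s, \<omega>) \<partial>lborel) \<in> borel_measurable M"
proof -
  from measurable_compose[OF measurable_pair_swap' assms]
  have "(\<lambda>(\<omega>, s). h (s, \<omega>)) \<in> borel_measurable (M \<Otimes>\<^sub>M borel)" by (simp add: case_prod_beta')
  then have "(\<lambda>(\<omega>, s). h (s, \<omega>)) \<in> borel_measurable (M \<Otimes>\<^sub>M lborel)"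
    by (simp add: measurable_cong_sets[OF sets_pair_measure_cong[OF refl sets_lborel] refl])
  from lborel.borel_measurable_nn_integral[OF this] show ?thesis .
qed

lemma nn_integral_time_swap:
  assumes "h \<in> borel_measurable (borel \<Otimes>\<^sub>M M)"
  shows "(\<integral>\<^sup>+\<omega>. \<integral>\<^sup>+s. h (s, \<omega>) \<partial>lborel \<partial>M) = (\<integral>\<^sup>+s. \<integral>\<^sup>+\<omega>. h (s, \<omega>) \<partial>M \<partial>lborel)"
  by (rule LM.Fubini) (use assms in \<open>simp add: measurable_cong_sets[OF sets_borel_M refl]\<close>)

section \<open>The weighted norm\<close>

text \<open>
  The weighted square norm in which the Picard map is a contraction.
\<close>

definition W :: "real \<Rightarrow> real \<Rightarrow> real \<Rightarrow> (real \<Rightarrow> 'a \<Rightarrow> 'b::euclidean_space) \<Rightarrow> ennreal" where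
  "W \<beta> a c \<phi> = (\<integral>\<^sup>+\<omega>. (\<integral>\<^sup>+s\<in>{a..c}. ennreal (exp (- \<beta> * s)) * nsq (\<phi> s \<omega>) \<partial>lborel) \<partial>M)"

text \<open>
  The weight is absorbed into the process: \<open>W\<close> is the plain squared \<open>L\<^sup>2\<close> norm of \<open>wt\<close> on the
  product space. With \<open>\<beta> = 0\<close> this covers \<open>E2\<close> as well.
\<close>

definition wt :: "real \<Rightarrow> real \<Rightarrow> real \<Rightarrow> (real \<Rightarrow> 'a \<Rightarrow> 'b::euclidean_space) \<Rightarrow> real \<times> 'a \<Rightarrow> 'b" where
  "wt \<beta> a c \<phi> z = exp (- \<beta> * fst z / 2) *\<^sub>R (indicator {a..c} (fst z) *\<^sub>R \<phi> (fst z) (snd z))"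

lemma wt_measurable: "joint_meas a c \<phi> \<Longrightarrow> wt \<beta> a c \<phi> \<in> borel_measurable (borel \<Otimes>\<^sub>M M)"
  unfolding joint_meas_def wt_def[abs_def] by (erule borel_measurable_scaleR[rotated]) measurable

lemma nsq_wt: "nsq (wt \<beta> a c \<phi> (s, \<omega>)) = ennreal (exp (- \<beta> * s)) * nsq (\<phi> s \<omega>) * indicator {a..c} s"
proof -
  have "(exp (- \<beta> * s / 2))\<^sup>2 = exp (- \<beta> * s)" by (simp add: power2_eq_square exp_add[symmetric])
  then show ?thesis unfolding wt_def
    by (simp add: power_mult_distrib ennreal_mult split: split_indicator)
qed

lemma wt_diff: "wt \<beta> a c (\<lambda>s \<omega>. \<phi> s \<omega> - \<psi> s \<omega>) z = wt \<beta> a c \<phi> z - wt \<beta> a c \<psi> z"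
  by (simp add: wt_def scaleR_diff_right)

lemma W_wt: "W \<beta> a c \<phi> = (\<integral>\<^sup>+\<omega>. \<integral>\<^sup>+s. nsq (wt \<beta> a c \<phi> (s, \<omega>)) \<partial>lborel \<partial>M)"
  unfolding W_def nsq_wt ..

lemma W_eq_pair:
  assumes "joint_meas a c \<phi>"
  shows "W \<beta> a c \<phi> = (\<integral>\<^sup>+z. nsq (wt \<beta> a c \<phi> z) \<partial>(lborel \<Otimes>\<^sub>M M))"
proof -
  have "(\<lambda>z. nsq (wt \<beta> a c \<phi> z)) \<in> borel_measurable (lborel \<Otimes>\<^sub>M M)"
    using wt_measurable[OF assms] by measurable
  from LM.nn_integral_snd[OF this] show ?thesis unfolding W_def nsq_wt .
qed

lemma W_swap:
  assumes "joint_meas a c \<phi>"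
  shows "W \<beta> a c \<phi> = (\<integral>\<^sup>+s\<in>{a..c}. ennreal (exp (- \<beta> * s)) * (\<integral>\<^sup>+\<omega>. nsq (\<phi> s \<omega>) \<partial>M) \<partial>lborel)"
proof -
  have "(\<lambda>z. nsq (wt \<beta> a c \<phi> z)) \<in> borel_measurable (borel \<Otimes>\<^sub>M M)"
    using wt_measurable[OF assms] by measurable
  from nn_integral_time_swap[OF this]
  have "W \<beta> a c \<phi> = (\<integral>\<^sup>+s. (\<integral>\<^sup>+\<omega>. nsq (wt \<beta> a c \<phi> (s, \<omega>)) \<partial>M) \<partial>lborel)" unfolding W_def nsq_wt .
  also have "\<dots> = (\<integral>\<^sup>+s\<in>{a..c}. ennreal (exp (- \<beta> * s)) * (\<integral>\<^sup>+\<omega>. nsq (\<phi> s \<omega>) \<partial>M) \<partial>lborel)"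
  proof (rule nn_integral_cong)
    fix s
    show "(\<integral>\<^sup>+\<omega>. nsq (wt \<beta> a c \<phi> (s, \<omega>)) \<partial>M) = ennreal (exp (- \<beta> * s)) * (\<integral>\<^sup>+\<omega>. nsq (\<phi> s \<omega>) \<partial>M) * indicator {a..c} s"
    proof (cases "s \<in> {a..c}")
      case True
      have "(\<lambda>\<omega>. indicator {a..c} s *\<^sub>R \<phi> s \<omega>) \<in> borel_measurable M"
        using measurable_compose[OF measurable_Pair1'[of s borel M] assms[unfolded joint_meas_def]] by simp
      then have [measurable]: "\<phi> s \<in> borel_measurable M" using True by simp
      show ?thesis using True unfolding nsq_wt by (simp add: nn_integral_cmult)
    qed (simp add: nsq_wt)
  qed
  finally show ?thesis .
qed

lemma W_le_E2:
  assumes "0 \<le> a" "\<beta> > 0"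
  shows "W \<beta> a c \<phi> \<le> E2 a c \<phi>"
  unfolding W_def E2_def
proof (intro nn_integral_mono)
  fix \<omega> s
  show "ennreal (exp (- \<beta> * s)) * nsq (\<phi> s \<omega>) * indicator {a..c} s \<le> nsq (\<phi> s \<omega>) * indicator {a..c} s"
  proof (cases "s \<in> {a..c}")
    case True
    then have "exp (- \<beta> * s) \<le> 1" using assms by simp
    then have "ennreal (exp (- \<beta> * s)) * nsq (\<phi> s \<omega>) \<le> 1 * nsq (\<phi> s \<omega>)"
      by (intro mult_right_mono) (auto simp: ennreal_le_1)
    then show ?thesis using True by simp
  qed simp
qed

lemma E2_le_W:
  assumes "joint_meas a c \<phi>" "\<beta> > 0"
  shows "E2 a c \<phi> \<le> ennreal (exp (\<beta> * c)) * W \<beta> a c \<phi>"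
proof -
  have m: "(\<lambda>z. nsq (wt \<beta> a c \<phi> z)) \<in> borel_measurable (borel \<Otimes>\<^sub>M M)"
    using wt_measurable[OF assms(1)] by measurable
  have m1: "(\<lambda>s. nsq (wt \<beta> a c \<phi> (s, \<omega>))) \<in> borel_measurable borel" if "\<omega> \<in> space M" for \<omega>
    using measurable_compose[OF measurable_Pair2'[OF that] m] .
  have "E2 a c \<phi> \<le> (\<integral>\<^sup>+\<omega>. (\<integral>\<^sup>+s. ennreal (exp (\<beta> * c)) * nsq (wt \<beta> a c \<phi> (s, \<omega>)) \<partial>lborel) \<partial>M)"
    unfolding E2_def
  proof (intro nn_integral_mono)
    fix \<omega> s
    show "nsq (\<phi> s \<omega>) * indicator {a..c} s \<le> ennreal (exp (\<beta> * c)) * nsq (wt \<beta> a c \<phi> (s, \<omega>))"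
    proof (cases "s \<in> {a..c}")
      case True
      then have "1 \<le> exp (\<beta> * c) * exp (- \<beta> * s)" using assms(2) by (simp add: exp_add[symmetric])
      then have "1 \<le> ennreal (exp (\<beta> * c)) * ennreal (exp (- \<beta> * s))"
        by (subst ennreal_mult[symmetric]) (auto simp: ennreal_ge_1)
      from mult_right_mono[OF this, of "nsq (\<phi> s \<omega>)"] show ?thesis
        using True unfolding nsq_wt by (simp add: mult.assoc)
    qed simp
  qed
  also have "\<dots> = (\<integral>\<^sup>+\<omega>. ennreal (exp (\<beta> * c)) * (\<integral>\<^sup>+s. nsq (wt \<beta> a c \<phi> (s, \<omega>)) \<partial>lborel) \<partial>M)"
    using m1 by (intro nn_integral_cong nn_integral_cmult) auto
  also have "\<dots> = ennreal (exp (\<beta> * c)) * W \<beta> a c \<phi>"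
    unfolding W_def nsq_wt[symmetric] by (rule nn_integral_cmult[OF nn_integral_time_measurable[OF m]])
  finally show ?thesis .
qed

lemma W_diff_le:
  assumes "joint_meas a c \<phi>" "joint_meas a c \<psi>" "joint_meas a c \<rho>" "\<epsilon> > 0"
  shows "W \<beta> a c (\<lambda>s \<omega>. \<phi> s \<omega> - \<rho> s \<omega>) \<le> ennreal (1 + \<epsilon>) * W \<beta> a c (\<lambda>s \<omega>. \<phi> s \<omega> - \<psi> s \<omega>) + ennreal (1 + 1 / \<epsilon>) * W \<beta> a c (\<lambda>s \<omega>. \<psi> s \<omega> - \<rho> s \<omega>)"
proof -
  have [measurable]: "wt \<beta> a c \<phi> \<in> borel_measurable (lborel \<Otimes>\<^sub>M M)" "wt \<beta> a c \<psi> \<in> borel_measurable (lborel \<Otimes>\<^sub>M M)" "wt \<beta> a c \<rho> \<in> borel_measurable (lborel \<Otimes>\<^sub>M M)"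
    using assms by (simp_all add: measurable_cong_sets[OF sets_borel_M refl] wt_measurable)
  have "(\<integral>\<^sup>+z. nsq (wt \<beta> a c \<phi> z - wt \<beta> a c \<rho> z) \<partial>(lborel \<Otimes>\<^sub>M M)) \<le>
      ennreal (1 + \<epsilon>) * (\<integral>\<^sup>+z. nsq (wt \<beta> a c \<phi> z - wt \<beta> a c \<psi> z) \<partial>(lborel \<Otimes>\<^sub>M M)) +
      ennreal (1 + 1 / \<epsilon>) * (\<integral>\<^sup>+z. nsq (wt \<beta> a c \<phi> z - wt \<beta> a c \<rho> z - (wt \<beta> a c \<phi> z - wt \<beta> a c \<psi> z)) \<partial>(lborel \<Otimes>\<^sub>M M))"
    by (rule nn_integral_nsq_le) (use assms in auto)
  then show ?thesis
    using assms by (simp add: W_eq_pair joint_meas_diff wt_diff)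
qed

lemma W_minus_commute: "W \<beta> a c (\<lambda>r \<omega>. \<phi> r \<omega> - \<psi> r \<omega>) = W \<beta> a c (\<lambda>r \<omega>. \<psi> r \<omega> - \<phi> r \<omega>)"
  by (simp add: W_def norm_minus_commute)

lemma L2_F_set_integrable:
  fixes \<phi> :: "real \<Rightarrow> 'a \<Rightarrow> 'b::euclidean_space"
  assumes "\<phi> \<in> L2_F M F a b"
  shows "AE \<omega> in M. set_integrable lborel {a..b} (\<lambda>s. \<phi> s \<omega>)"
proof -
  have joint_meas: "joint_meas a b \<phi>" by (rule L2_F_joint_meas[OF assms])
  have "(\<lambda>z. nsq (wt 0 a b \<phi> z)) \<in> borel_measurable (borel \<Otimes>\<^sub>M M)"
    using wt_measurable[OF joint_meas] by measurable
  from nn_integral_time_measurable[OF this]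
  have "(\<lambda>\<omega>. \<integral>\<^sup>+s\<in>{a..b}. nsq (\<phi> s \<omega>) \<partial>lborel) \<in> borel_measurable M" unfolding nsq_wt by simp
  moreover have "(\<integral>\<^sup>+\<omega>. (\<integral>\<^sup>+s\<in>{a..b}. nsq (\<phi> s \<omega>) \<partial>lborel) \<partial>M) \<noteq> \<infinity>"
    using assms by (auto simp: L2_F_def)
  ultimately have "AE \<omega> in M. (\<integral>\<^sup>+s\<in>{a..b}. nsq (\<phi> s \<omega>) \<partial>lborel) \<noteq> \<infinity>" by (rule nn_integral_PInf_AE)
  with AE_space show ?thesis
  proof eventually_elim
    case (elim \<omega>)
    have [measurable]: "(\<lambda>s. indicator {a..b} s *\<^sub>R \<phi> s \<omega>) \<in> borel_measurable borel" by (rule joint_meas_section[OF joint_meas elim(1)])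
    have "(\<integral>\<^sup>+s. norm (indicator {a..b} s *\<^sub>R \<phi> s \<omega>) \<partial>lborel) \<le> (\<integral>\<^sup>+s. indicator {a..b} s + nsq (indicator {a..b} s *\<^sub>R \<phi> s \<omega>) \<partial>lborel)"
    proof (rule nn_integral_mono)
      fix s
      have "norm x \<le> 1 + (norm x)\<^sup>2" for x :: 'b
      proof -
        have "2 * norm x \<le> (norm x)\<^sup>2 + 1" using sum_squares_bound[of "norm x" 1] by simp
        with norm_ge_zero[of x] show ?thesis by linarith
      qed
      then have "ennreal (norm (\<phi> s \<omega>)) \<le> ennreal (1 + (norm (\<phi> s \<omega>))\<^sup>2)" by (intro ennreal_leI)
      then show "ennreal (norm (indicator {a..b} s *\<^sub>R \<phi> s \<omega>)) \<le> indicator {a..b} s + nsq (indicator {a..b} s *\<^sub>R \<phi> s \<omega>)"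
        by (simp split: split_indicator)
    qed
    also have "\<dots> = emeasure lborel {a..b} + (\<integral>\<^sup>+s\<in>{a..b}. nsq (\<phi> s \<omega>) \<partial>lborel)"
    proof -
      have "(\<integral>\<^sup>+s. indicator {a..b} s + nsq (indicator {a..b} s *\<^sub>R \<phi> s \<omega>) \<partial>lborel) =
          (\<integral>\<^sup>+s. indicator {a..b} s \<partial>lborel) + (\<integral>\<^sup>+s. nsq (indicator {a..b} s *\<^sub>R \<phi> s \<omega>) \<partial>lborel)"
        by (rule nn_integral_add) measurable
      then show ?thesis unfolding nsq_indicator by simp
    qed
    also have "\<dots> < \<infinity>" using elim(2) by (simp add: less_top emeasure_lborel_Icc_eq)
    finally show ?case unfolding set_integrable_def by (simp add: integrable_iff_bounded)
  qed
qed

lemma W_zero_imp_E2_zero: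
  assumes "joint_meas a c \<phi>" "\<beta> > 0" "W \<beta> a c \<phi> = 0"
  shows "E2 a c \<phi> = 0"
  using E2_le_W[OF assms(1,2)] assms(3) by simp

lemma W_zero_AE:
  assumes joint_meas: "joint_meas a c \<phi>" and W0: "W \<beta> a c \<phi> = 0"
  shows "AE \<omega> in M. AE s in lborel. s \<in> {a..c} \<longrightarrow> \<phi> s \<omega> = 0"
proof -
  have m: "(\<lambda>z. nsq (wt \<beta> a c \<phi> z)) \<in> borel_measurable (borel \<Otimes>\<^sub>M M)"
    using wt_measurable[OF joint_meas] by measurable
  have "AE \<omega> in M. (\<integral>\<^sup>+s. nsq (wt \<beta> a c \<phi> (s, \<omega>)) \<partial>lborel) = 0"
    using W0 unfolding W_wt by (subst (asm) nn_integral_0_iff_AE[OF nn_integral_time_measurable[OF m]])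
  with AE_space show ?thesis
  proof eventually_elim
    case (elim \<omega>)
    have ms: "(\<lambda>s. nsq (wt \<beta> a c \<phi> (s, \<omega>))) \<in> borel_measurable lborel"
      using measurable_compose[OF measurable_Pair2'[OF elim(1)] m] by simp
    have "AE s in lborel. nsq (wt \<beta> a c \<phi> (s, \<omega>)) = 0"
      using elim(2) by (subst (asm) nn_integral_0_iff_AE[OF ms])
    then show ?case by eventually_elim (auto simp: wt_def)
  qed
qed

lemma E2_split: "E2 a c \<phi> \<le> E2 a m \<phi> + E2 m c \<phi>" if "joint_meas a m \<phi>" "joint_meas m c \<phi>" for \<phi> :: "real \<Rightarrow> 'a \<Rightarrow> 'b::euclidean_space"
proof -
  have m1: "(\<lambda>z. nsq (wt 0 a m \<phi> z)) \<in> borel_measurable (borel \<Otimes>\<^sub>M M)" and m2: "(\<lambda>z. nsq (wt 0 m c \<phi> z)) \<in> borel_measurable (borel \<Otimes>\<^sub>M M)"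
    using wt_measurable[OF that(1)] wt_measurable[OF that(2)] by measurable
  have E: "nsq (\<phi> s \<omega>) * indicator {p..q} s = nsq (wt 0 p q \<phi> (s, \<omega>))" for p q s \<omega>
    unfolding nsq_wt by simp
  have "E2 a c \<phi> \<le> (\<integral>\<^sup>+\<omega>. (\<integral>\<^sup>+s. nsq (wt 0 a m \<phi> (s, \<omega>)) + nsq (wt 0 m c \<phi> (s, \<omega>)) \<partial>lborel) \<partial>M)"
    unfolding E2_def E[symmetric] by (intro nn_integral_mono) (auto split: split_indicator)
  also have "\<dots> = (\<integral>\<^sup>+\<omega>. (\<integral>\<^sup>+s. nsq (wt 0 a m \<phi> (s, \<omega>)) \<partial>lborel) + (\<integral>\<^sup>+s. nsq (wt 0 m c \<phi> (s, \<omega>)) \<partial>lborel) \<partial>M)"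
    using measurable_compose[OF measurable_Pair2' m1] measurable_compose[OF measurable_Pair2' m2]
    by (intro nn_integral_cong nn_integral_add) auto
  also have "\<dots> = E2 a m \<phi> + E2 m c \<phi>"
    unfolding E2_def E by (intro nn_integral_add nn_integral_time_measurable[OF m1] nn_integral_time_measurable[OF m2])
  finally show ?thesis .
qed

section \<open>Integral processes in the weighted norm\<close>

text \<open>
  The drift is bounded path by path by the integral of the modulus, the stochastic integral in
  mean square by \<open>ito_diff_bound\<close>. Cutting the integrands off at \<open>T\<close> instead of the integrals
  treats the times after \<open>T\<close>, where the processes are constant, in the same way as the others.
\<close>

lemma picard_difference_at:
  fixes X Y b1 b2 :: "real \<Rightarrow> 'a \<Rightarrow> real" and \<sigma>1 \<sigma>2 :: "real \<Rightarrow> 'a \<Rightarrow> real ^ 'd"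
  assumes a: "0 \<le> a" "a \<le> T" and b: "b1 \<in> L2_F M F a T" "b2 \<in> L2_F M F a T"
    and J: "has_ito_integral M B a T \<sigma>1 J1" "has_ito_integral M B a T \<sigma>2 J2" and t: "a \<le> t"
    and eq: "AE \<omega> in M. X t \<omega> - Y t \<omega> =
       (LINT s:{a..min t T}|lborel. b1 s \<omega>) - (LINT s:{a..min t T}|lborel. b2 s \<omega>) + (J1 (min t T) \<omega> - J2 (min t T) \<omega>)"
    and \<epsilon>: "\<epsilon> > 0"
  shows "(\<integral>\<^sup>+\<omega>. nsq (X t \<omega> - Y t \<omega>) \<partial>M) \<le>
     ennreal (1 + \<epsilon>) * (\<integral>\<^sup>+\<omega>. (\<integral>\<^sup>+s\<in>{a..t}. ennreal \<bar>indicator {a..T} s *\<^sub>R (b1 s \<omega> - b2 s \<omega>)\<bar> \<partial>lborel)\<^sup>2 \<partial>M) +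
     ennreal (1 + 1 / \<epsilon>) * (\<integral>\<^sup>+\<omega>. (\<integral>\<^sup>+s\<in>{a..t}. nsq (indicator {a..T} s *\<^sub>R (\<sigma>1 s \<omega> - \<sigma>2 s \<omega>)) \<partial>lborel) \<partial>M)"
proof -
  define m where "m = min t T"
  have m: "m \<in> {a..T}" using a t by (auto simp: m_def)
  have jmb: "joint_meas a T (\<lambda>s \<omega>. b1 s \<omega> - b2 s \<omega>)" using b by (intro joint_meas_diff L2_F_joint_meas)
  define D where "D \<omega> = (\<integral>\<^sup>+s\<in>{a..t}. ennreal \<bar>indicator {a..T} s *\<^sub>R (b1 s \<omega> - b2 s \<omega>)\<bar> \<partial>lborel)" for \<omega>
  have D_meas [measurable]: "D \<in> borel_measurable M"
  proof -
    have "(\<lambda>z. ennreal \<bar>indicator {a..T} (fst z) *\<^sub>R (b1 (fst z) (snd z) - b2 (fst z) (snd z))\<bar> * indicator {a..t} (fst z)) \<in> borel_measurable (borel \<Otimes>\<^sub>M M)"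
      using jmb unfolding joint_meas_def by measurable
    from nn_integral_time_measurable[OF this] show ?thesis unfolding D_def[abs_def] by simp
  qed
  have [measurable]: "J1 m \<in> borel_measurable M" "J2 m \<in> borel_measurable M"
    using F_measurable_M[OF ito_adapted[OF J(1) m]] F_measurable_M[OF ito_adapted[OF J(2) m]] by auto
  have "AE \<omega> in M. nsq (X t \<omega> - Y t \<omega>) \<le> ennreal (1 + \<epsilon>) * (D \<omega>)\<^sup>2 + ennreal (1 + 1 / \<epsilon>) * nsq (J1 m \<omega> - J2 m \<omega>)"
    using eq L2_F_set_integrable[OF b(1)] L2_F_set_integrable[OF b(2)] AE_space
  proof eventually_elim
    case (elim \<omega>)
    have int: "set_integrable lborel {a..m} (\<lambda>s. b1 s \<omega>)" "set_integrable lborel {a..m} (\<lambda>s. b2 s \<omega>)"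
      using elim(2,3) m by (auto intro: set_integrable_subset)
    have int_d: "set_integrable lborel {a..m} (\<lambda>s. b1 s \<omega> - b2 s \<omega>)" by (intro set_integral_diff int)
    let ?A = "LINT s:{a..m}|lborel. b1 s \<omega> - b2 s \<omega>"
    have XY: "X t \<omega> - Y t \<omega> = ?A + (J1 m \<omega> - J2 m \<omega>)"
      using elim(1) set_integral_diff(2)[OF int] by (simp add: m_def)
    have "ennreal (norm ?A) \<le> (\<integral>\<^sup>+s. norm (indicator {a..m} s *\<^sub>R (b1 s \<omega> - b2 s \<omega>)) \<partial>lborel)"
      unfolding set_lebesgue_integral_def using int_d by (intro integral_norm_bound_ennreal) (simp add: set_integrable_def)
    also have "\<dots> = D \<omega>"
      unfolding D_def by (intro nn_integral_cong) (auto simp: m_def split: split_indicator)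
    finally have "(ennreal (norm ?A))\<^sup>2 \<le> (D \<omega>)\<^sup>2" by (rule power_mono) simp
    then have "nsq ?A \<le> (D \<omega>)\<^sup>2" by (simp add: ennreal_power)
    moreover have "nsq (X t \<omega> - Y t \<omega>) \<le> ennreal (1 + \<epsilon>) * nsq ?A + ennreal (1 + 1 / \<epsilon>) * nsq (J1 m \<omega> - J2 m \<omega>)"
      unfolding XY by (rule nsq_add_le[OF \<epsilon>])
    ultimately show ?case by (meson add_right_mono mult_left_mono order_trans zero_le)
  qed
  then have "(\<integral>\<^sup>+\<omega>. nsq (X t \<omega> - Y t \<omega>) \<partial>M) \<le> (\<integral>\<^sup>+\<omega>. ennreal (1 + \<epsilon>) * (D \<omega>)\<^sup>2 + ennreal (1 + 1 / \<epsilon>) * nsq (J1 m \<omega> - J2 m \<omega>) \<partial>M)"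
    by (rule nn_integral_mono_AE)
  also have "\<dots> = ennreal (1 + \<epsilon>) * (\<integral>\<^sup>+\<omega>. (D \<omega>)\<^sup>2 \<partial>M) + ennreal (1 + 1 / \<epsilon>) * (\<integral>\<^sup>+\<omega>. nsq (J1 m \<omega> - J2 m \<omega>) \<partial>M)"
    by (simp add: nn_integral_add nn_integral_cmult)
  also have "(\<integral>\<^sup>+\<omega>. nsq (J1 m \<omega> - J2 m \<omega>) \<partial>M) \<le> E2 a m (\<lambda>s \<omega>. \<sigma>1 s \<omega> - \<sigma>2 s \<omega>)"
    by (rule ito_diff_bound[OF a(1) J m])
  also have "E2 a m (\<lambda>s \<omega>. \<sigma>1 s \<omega> - \<sigma>2 s \<omega>) = (\<integral>\<^sup>+\<omega>. (\<integral>\<^sup>+s\<in>{a..t}. nsq (indicator {a..T} s *\<^sub>R (\<sigma>1 s \<omega> - \<sigma>2 s \<omega>)) \<partial>lborel) \<partial>M)"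
    unfolding E2_def by (intro nn_integral_cong) (auto simp: m_def split: split_indicator)
  finally show ?thesis unfolding D_def by (simp add: add_left_mono mult_left_mono)
qed

lemma running_integral_measurable:
  fixes h :: "real \<times> 'a \<Rightarrow> ennreal"
  assumes [measurable]: "h \<in> borel_measurable (borel \<Otimes>\<^sub>M M)"
  shows "(\<lambda>z. \<integral>\<^sup>+r\<in>{a..fst z}. h (r, snd z) \<partial>lborel) \<in> borel_measurable (borel \<Otimes>\<^sub>M M)"
proof -
  have [measurable]: "(\<lambda>p. (snd p, snd (fst p))) \<in> (borel \<Otimes>\<^sub>M M) \<Otimes>\<^sub>M lborel \<rightarrow>\<^sub>M borel \<Otimes>\<^sub>M M" by measurable
  have "(\<lambda>p. h (snd p, snd (fst p)) * (if a \<le> snd p \<and> snd p \<le> fst (fst p) then 1 else 0)) \<in> borel_measurable ((borel \<Otimes>\<^sub>M M) \<Otimes>\<^sub>M lborel)"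
    by measurable
  then have "(\<lambda>z. \<integral>\<^sup>+r. h (r, snd z) * (if a \<le> r \<and> r \<le> fst z then 1 else 0) \<partial>lborel) \<in> borel_measurable (borel \<Otimes>\<^sub>M M)"
    by (intro lborel.borel_measurable_nn_integral) (simp add: split_beta')
  moreover have "(\<lambda>z. \<integral>\<^sup>+r. h (r, snd z) * (if a \<le> r \<and> r \<le> fst z then 1 else 0) \<partial>lborel) = (\<lambda>z. \<integral>\<^sup>+r\<in>{a..fst z}. h (r, snd z) \<partial>lborel)"
    by (intro ext nn_integral_cong) (simp add: indicator_def)
  ultimately show ?thesis by simp
qed

text \<open>
  The estimate \<open>picard_difference_at\<close> is integrated against the weight. By \<open>Hardy_exp_weight\<close>
  the drift contributes the constant \<open>4 / \<beta>\<^sup>2\<close> and by \<open>nn_integral_exp_weight\<close> the stochastic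
  integral contributes \<open>1 / \<beta>\<close>.
\<close>

lemma picard_difference:
  fixes X Y b1 b2 :: "real \<Rightarrow> 'a \<Rightarrow> real" and \<sigma>1 \<sigma>2 :: "real \<Rightarrow> 'a \<Rightarrow> real ^ 'd"
  assumes a: "0 \<le> a" "a \<le> T" and b: "b1 \<in> L2_F M F a T" "b2 \<in> L2_F M F a T"
    and J: "has_ito_integral M B a T \<sigma>1 J1" "has_ito_integral M B a T \<sigma>2 J2"
    and XY: "joint_meas a c (\<lambda>s \<omega>. X s \<omega> - Y s \<omega>)"
    and eq: "\<And>t. a < t \<Longrightarrow> t \<le> c \<Longrightarrow> AE \<omega> in M. X t \<omega> - Y t \<omega> =
       (LINT s:{a..min t T}|lborel. b1 s \<omega>) - (LINT s:{a..min t T}|lborel. b2 s \<omega>) + (J1 (min t T) \<omega> - J2 (min t T) \<omega>)"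
    and \<beta>: "\<beta> > 0"
  shows "W \<beta> a c (\<lambda>s \<omega>. X s \<omega> - Y s \<omega>) \<le> ennreal (4 / \<beta>\<^sup>2 + 1 / \<beta>) *
    (W \<beta> a T (\<lambda>s \<omega>. b1 s \<omega> - b2 s \<omega>) + W \<beta> a T (\<lambda>s \<omega>. \<sigma>1 s \<omega> - \<sigma>2 s \<omega>))"
proof -
  \<comment> \<open>With this choice \<open>(1 + \<epsilon>) * (4 / \<beta>\<^sup>2)\<close> and \<open>(1 + 1 / \<epsilon>) / \<beta>\<close> coincide.\<close>
  define \<epsilon> where "\<epsilon> = \<beta> / 4"
  have \<epsilon>: "\<epsilon> > 0" using \<beta> by (simp add: \<epsilon>_def)
  have jmb: "joint_meas a T (\<lambda>s \<omega>. b1 s \<omega> - b2 s \<omega>)" using b by (intro joint_meas_diff L2_F_joint_meas)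
  have jms: "joint_meas a T (\<lambda>s \<omega>. \<sigma>1 s \<omega> - \<sigma>2 s \<omega>)" using ito_integrand[OF J(1)] ito_integrand[OF J(2)] by (intro joint_meas_diff L2_F_joint_meas)
  define g where "g z = ennreal \<bar>indicator {a..T} (fst z) *\<^sub>R (b1 (fst z) (snd z) - b2 (fst z) (snd z))\<bar>" for z :: "real \<times> 'a"
  define k where "k z = nsq (indicator {a..T} (fst z) *\<^sub>R (\<sigma>1 (fst z) (snd z) - \<sigma>2 (fst z) (snd z)))" for z :: "real \<times> 'a"
  have g_meas [measurable]: "g \<in> borel_measurable (borel \<Otimes>\<^sub>M M)" unfolding g_def[abs_def] using jmb unfolding joint_meas_def by measurable
  have k_meas [measurable]: "k \<in> borel_measurable (borel \<Otimes>\<^sub>M M)" unfolding k_def[abs_def] using jms unfolding joint_meas_def by measurable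
  define D where "D z = (\<integral>\<^sup>+r\<in>{a..fst z}. g (r, snd z) \<partial>lborel)" for z
  define K where "K z = (\<integral>\<^sup>+r\<in>{a..fst z}. k (r, snd z) \<partial>lborel)" for z
  have [measurable]: "D \<in> borel_measurable (borel \<Otimes>\<^sub>M M)" "K \<in> borel_measurable (borel \<Otimes>\<^sub>M M)"
    unfolding D_def[abs_def] K_def[abs_def] by (rule running_integral_measurable g_meas k_meas)+
  have step: "(\<integral>\<^sup>+\<omega>. nsq (X t \<omega> - Y t \<omega>) \<partial>M) \<le> ennreal (1 + \<epsilon>) * (\<integral>\<^sup>+\<omega>. (D (t, \<omega>))\<^sup>2 \<partial>M) + ennreal (1 + 1 / \<epsilon>) * (\<integral>\<^sup>+\<omega>. K (t, \<omega>) \<partial>M)"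
    if "a < t" "t \<le> c" for t
    using picard_difference_at[where X=X and Y=Y, OF a b J less_imp_le[OF that(1)] eq[OF that] \<epsilon>] by (simp add: D_def K_def g_def k_def)
  have "W \<beta> a c (\<lambda>s \<omega>. X s \<omega> - Y s \<omega>) \<le> (\<integral>\<^sup>+t. ennreal (exp (- \<beta> * t)) *
     (ennreal (1 + \<epsilon>) * (\<integral>\<^sup>+\<omega>. (D (t, \<omega>))\<^sup>2 \<partial>M) + ennreal (1 + 1 / \<epsilon>) * (\<integral>\<^sup>+\<omega>. K (t, \<omega>) \<partial>M)) \<partial>lborel)"
    unfolding W_swap[OF XY]
  proof (rule nn_integral_mono_AE)
    have "AE t in lborel. t \<noteq> a" by (rule AE_lborel_singleton)
    then show "AE t in lborel. ennreal (exp (- \<beta> * t)) * (\<integral>\<^sup>+\<omega>. nsq (X t \<omega> - Y t \<omega>) \<partial>M) * indicator {a..c} t \<le> ennreal (exp (- \<beta> * t)) *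
      (ennreal (1 + \<epsilon>) * (\<integral>\<^sup>+\<omega>. (D (t, \<omega>))\<^sup>2 \<partial>M) + ennreal (1 + 1 / \<epsilon>) * (\<integral>\<^sup>+\<omega>. K (t, \<omega>) \<partial>M))"
    proof eventually_elim
      case (elim t)
      show ?case
      proof (cases "t \<in> {a..c}")
        case True
        then have "a < t" "t \<le> c" using elim by auto
        from mult_left_mono[OF step[OF this], of "ennreal (exp (- \<beta> * t))"] True show ?thesis by simp
      qed simp
    qed
  qed
  also have "\<dots> = (\<integral>\<^sup>+t. ennreal (1 + \<epsilon>) * (\<integral>\<^sup>+\<omega>. ennreal (exp (- \<beta> * t)) * (D (t, \<omega>))\<^sup>2 \<partial>M) + ennreal (1 + 1 / \<epsilon>) * (\<integral>\<^sup>+\<omega>. ennreal (exp (- \<beta> * t)) * K (t, \<omega>) \<partial>M) \<partial>lborel)"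
    by (intro nn_integral_cong) (simp add: nn_integral_cmult distrib_left mult.left_commute)
  also have "\<dots> = ennreal (1 + \<epsilon>) * (\<integral>\<^sup>+t. \<integral>\<^sup>+\<omega>. ennreal (exp (- \<beta> * t)) * (D (t, \<omega>))\<^sup>2 \<partial>M \<partial>lborel) + ennreal (1 + 1 / \<epsilon>) * (\<integral>\<^sup>+t. \<integral>\<^sup>+\<omega>. ennreal (exp (- \<beta> * t)) * K (t, \<omega>) \<partial>M \<partial>lborel)"
    by (simp add: nn_integral_add nn_integral_cmult)
  also have "(\<integral>\<^sup>+t. \<integral>\<^sup>+\<omega>. ennreal (exp (- \<beta> * t)) * (D (t, \<omega>))\<^sup>2 \<partial>M \<partial>lborel) = (\<integral>\<^sup>+\<omega>. \<integral>\<^sup>+t. ennreal (exp (- \<beta> * t)) * (D (t, \<omega>))\<^sup>2 \<partial>lborel \<partial>M)"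
    using nn_integral_time_swap[of "\<lambda>z. ennreal (exp (- \<beta> * fst z)) * (D z)\<^sup>2"] by simp
  also have "(\<integral>\<^sup>+t. \<integral>\<^sup>+\<omega>. ennreal (exp (- \<beta> * t)) * K (t, \<omega>) \<partial>M \<partial>lborel) = (\<integral>\<^sup>+\<omega>. \<integral>\<^sup>+t. ennreal (exp (- \<beta> * t)) * K (t, \<omega>) \<partial>lborel \<partial>M)"
    using nn_integral_time_swap[of "\<lambda>z. ennreal (exp (- \<beta> * fst z)) * K z"] by simp
  also have "(\<integral>\<^sup>+\<omega>. \<integral>\<^sup>+t. ennreal (exp (- \<beta> * t)) * (D (t, \<omega>))\<^sup>2 \<partial>lborel \<partial>M) \<le> ennreal (4 / \<beta>\<^sup>2) * W \<beta> a T (\<lambda>s \<omega>. b1 s \<omega> - b2 s \<omega>)"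
  proof -
    have "(\<integral>\<^sup>+\<omega>. \<integral>\<^sup>+t. ennreal (exp (- \<beta> * t)) * (D (t, \<omega>))\<^sup>2 \<partial>lborel \<partial>M) \<le>
        (\<integral>\<^sup>+\<omega>. ennreal (4 / \<beta>\<^sup>2) * (\<integral>\<^sup>+s. nsq (wt \<beta> a T (\<lambda>s \<omega>. b1 s \<omega> - b2 s \<omega>) (s, \<omega>)) \<partial>lborel) \<partial>M)"
    proof (rule nn_integral_mono)
      fix \<omega> assume \<omega>: "\<omega> \<in> space M"
      have "(\<integral>\<^sup>+t. ennreal (exp (- \<beta> * t)) * (D (t, \<omega>))\<^sup>2 \<partial>lborel) \<le> ennreal (4 / \<beta>\<^sup>2) * (\<integral>\<^sup>+s\<in>{a..}. ennreal (exp (- \<beta> * s)) * (g (s, \<omega>))\<^sup>2 \<partial>lborel)"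
        unfolding D_def fst_conv snd_conv
        by (rule Hardy_exp_weight[OF \<beta> measurable_compose[OF measurable_Pair2'[OF \<omega>] g_meas]])
      also have "(\<integral>\<^sup>+s\<in>{a..}. ennreal (exp (- \<beta> * s)) * (g (s, \<omega>))\<^sup>2 \<partial>lborel) = (\<integral>\<^sup>+s. nsq (wt \<beta> a T (\<lambda>s \<omega>. b1 s \<omega> - b2 s \<omega>) (s, \<omega>)) \<partial>lborel)"
        unfolding nsq_wt by (intro nn_integral_cong) (auto simp: g_def ennreal_power split: split_indicator)
      finally show "(\<integral>\<^sup>+t. ennreal (exp (- \<beta> * t)) * (D (t, \<omega>))\<^sup>2 \<partial>lborel) \<le> ennreal (4 / \<beta>\<^sup>2) * (\<integral>\<^sup>+s. nsq (wt \<beta> a T (\<lambda>s \<omega>. b1 s \<omega> - b2 s \<omega>) (s, \<omega>)) \<partial>lborel)" .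
    qed
    also have "\<dots> = ennreal (4 / \<beta>\<^sup>2) * W \<beta> a T (\<lambda>s \<omega>. b1 s \<omega> - b2 s \<omega>)"
    proof -
      have "(\<lambda>z. nsq (wt \<beta> a T (\<lambda>s \<omega>. b1 s \<omega> - b2 s \<omega>) z)) \<in> borel_measurable (borel \<Otimes>\<^sub>M M)"
        using wt_measurable[OF jmb] by measurable
      from nn_integral_cmult[OF nn_integral_time_measurable[OF this]] show ?thesis
        unfolding W_wt .
    qed
    finally show ?thesis .
  qed
  also have "(\<integral>\<^sup>+\<omega>. \<integral>\<^sup>+t. ennreal (exp (- \<beta> * t)) * K (t, \<omega>) \<partial>lborel \<partial>M) = ennreal (1 / \<beta>) * W \<beta> a T (\<lambda>s \<omega>. \<sigma>1 s \<omega> - \<sigma>2 s \<omega>)"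
  proof -
    have "(\<integral>\<^sup>+\<omega>. \<integral>\<^sup>+t. ennreal (exp (- \<beta> * t)) * K (t, \<omega>) \<partial>lborel \<partial>M) =
        (\<integral>\<^sup>+\<omega>. ennreal (1 / \<beta>) * (\<integral>\<^sup>+s. nsq (wt \<beta> a T (\<lambda>s \<omega>. \<sigma>1 s \<omega> - \<sigma>2 s \<omega>) (s, \<omega>)) \<partial>lborel) \<partial>M)"
    proof (rule nn_integral_cong)
      fix \<omega> assume \<omega>: "\<omega> \<in> space M"
      have "(\<integral>\<^sup>+t. ennreal (exp (- \<beta> * t)) * K (t, \<omega>) \<partial>lborel) = ennreal (1 / \<beta>) * (\<integral>\<^sup>+s\<in>{a..}. ennreal (exp (- \<beta> * s)) * k (s, \<omega>) \<partial>lborel)"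
        unfolding K_def fst_conv snd_conv
        by (rule nn_integral_exp_weight[OF \<beta> measurable_compose[OF measurable_Pair2'[OF \<omega>] k_meas]])
      also have "(\<integral>\<^sup>+s\<in>{a..}. ennreal (exp (- \<beta> * s)) * k (s, \<omega>) \<partial>lborel) = (\<integral>\<^sup>+s. nsq (wt \<beta> a T (\<lambda>s \<omega>. \<sigma>1 s \<omega> - \<sigma>2 s \<omega>) (s, \<omega>)) \<partial>lborel)"
        unfolding nsq_wt by (intro nn_integral_cong) (auto simp: k_def split: split_indicator)
      finally show "(\<integral>\<^sup>+t. ennreal (exp (- \<beta> * t)) * K (t, \<omega>) \<partial>lborel) = ennreal (1 / \<beta>) * (\<integral>\<^sup>+s. nsq (wt \<beta> a T (\<lambda>s \<omega>. \<sigma>1 s \<omega> - \<sigma>2 s \<omega>) (s, \<omega>)) \<partial>lborel)" .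
    qed
    also have "\<dots> = ennreal (1 / \<beta>) * W \<beta> a T (\<lambda>s \<omega>. \<sigma>1 s \<omega> - \<sigma>2 s \<omega>)"
    proof -
      have "(\<lambda>z. nsq (wt \<beta> a T (\<lambda>s \<omega>. \<sigma>1 s \<omega> - \<sigma>2 s \<omega>) z)) \<in> borel_measurable (borel \<Otimes>\<^sub>M M)"
        using wt_measurable[OF jms] by measurable
      from nn_integral_cmult[OF nn_integral_time_measurable[OF this]] show ?thesis
        unfolding W_wt .
    qed
    finally show ?thesis .
  qed
  finally have "W \<beta> a c (\<lambda>s \<omega>. X s \<omega> - Y s \<omega>) \<le>
     ennreal (1 + \<epsilon>) * (ennreal (4 / \<beta>\<^sup>2) * W \<beta> a T (\<lambda>s \<omega>. b1 s \<omega> - b2 s \<omega>)) + ennreal (1 + 1 / \<epsilon>) * (ennreal (1 / \<beta>) * W \<beta> a T (\<lambda>s \<omega>. \<sigma>1 s \<omega> - \<sigma>2 s \<omega>))"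
    by (simp add: add_mono mult_left_mono)
  moreover have "ennreal (1 + \<epsilon>) * ennreal (4 / \<beta>\<^sup>2) = ennreal (4 / \<beta>\<^sup>2 + 1 / \<beta>)"
  proof -
    have "(1 + \<epsilon>) * (4 / \<beta>\<^sup>2) = 4 / \<beta>\<^sup>2 + 1 / \<beta>" using \<beta> by (simp add: \<epsilon>_def field_simps power2_eq_square)
    then show ?thesis using \<epsilon> by (subst ennreal_mult[symmetric]) auto
  qed
  moreover have "ennreal (1 + 1 / \<epsilon>) * ennreal (1 / \<beta>) = ennreal (4 / \<beta>\<^sup>2 + 1 / \<beta>)"
  proof -
    have "(1 + 1 / \<epsilon>) * (1 / \<beta>) = 4 / \<beta>\<^sup>2 + 1 / \<beta>" using \<beta> by (simp add: \<epsilon>_def field_simps power2_eq_square)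
    then show ?thesis using \<epsilon> \<beta> by (subst ennreal_mult[symmetric]) auto
  qed
  ultimately show ?thesis by (simp only: mult.assoc[symmetric] distrib_left)
qed

end

section \<open>The Picard map\<close>

locale delay_sde = brownian_space M B
  for M :: "'a measure" and B :: "real \<Rightarrow> 'a \<Rightarrow> real ^ 'd::finite" +
  fixes T l u t0 :: real and \<theta> :: "real \<Rightarrow> 'a \<Rightarrow> real"
    and b :: "'a \<Rightarrow> real \<Rightarrow> (real \<Rightarrow> 'a \<Rightarrow> real) \<Rightarrow> real"
    and \<sigma> :: "'a \<Rightarrow> real \<Rightarrow> (real \<Rightarrow> 'a \<Rightarrow> real) \<Rightarrow> real ^ 'd"
  assumes T: "T > 0" and l: "l \<ge> 0" and u: "u \<ge> 0" and t0: "t0 \<in> {0..T}"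
    and \<theta>: "\<theta> \<in> L2bar_F M F (t0 - l) t0" and \<theta>_t0: "\<theta> t0 \<in> L2_rv M (F t0)"
    and b_L2: "\<And>x. x \<in> L2bar_F M F (t0 - l) (T + u) \<Longrightarrow> (\<lambda>t \<omega>. b \<omega> t x) \<in> L2_F M F 0 T"
    and \<sigma>_L2: "\<And>x. x \<in> L2bar_F M F (t0 - l) (T + u) \<Longrightarrow> (\<lambda>t \<omega>. \<sigma> \<omega> t x) \<in> L2_F M F 0 T"
begin

abbreviation Lbar :: "(real \<Rightarrow> 'a \<Rightarrow> real) set" where "Lbar \<equiv> L2bar_F M F (t0 - l) (T + u)"

text \<open>
  Up to time \<open>0\<close> the extended processes are deterministic; from \<open>start\<close> on they are
  progressively measurable.
\<close>

abbreviation start :: real where "start \<equiv> max (t0 - l) 0"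

lemma times: "0 \<le> t0" "t0 \<le> T" "start \<le> t0" "0 \<le> start" "T \<le> T + u" "t0 \<le> T + u" "start \<le> T + u"
  using t0 l u by auto

lemma b_L2': "x \<in> Lbar \<Longrightarrow> (\<lambda>t \<omega>. b \<omega> t x) \<in> L2_F M F t0 T"
  using L2_F_mono[OF b_L2] times by auto

lemma \<sigma>_L2': "x \<in> Lbar \<Longrightarrow> (\<lambda>t \<omega>. \<sigma> \<omega> t x) \<in> L2_F M F t0 T"
  using L2_F_mono[OF \<sigma>_L2] times by auto

lemma Lbar_joint_meas: "x \<in> Lbar \<Longrightarrow> joint_meas start (T + u) x"
  by (rule L2_F_joint_meas) (simp add: L2bar_F_def)

lemma Lbar_joint_meas': "x \<in> Lbar \<Longrightarrow> joint_meas t0 (T + u) x"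
  using joint_meas_mono[OF Lbar_joint_meas, of x t0 "T + u"] times by simp

lemma Lbar_diff_joint_meas: "x \<in> Lbar \<Longrightarrow> y \<in> Lbar \<Longrightarrow> joint_meas t0 (T + u) (\<lambda>s \<omega>. x s \<omega> - y s \<omega>)"
  by (intro joint_meas_diff Lbar_joint_meas')

lemma Lbar_E2: "x \<in> Lbar \<Longrightarrow> E2 start (T + u) x < \<infinity>"
  by (simp add: L2bar_F_def L2_F_def E2_def)

definition extension :: "(real \<Rightarrow> 'a \<Rightarrow> real) \<Rightarrow> real \<Rightarrow> 'a \<Rightarrow> real" where
  "extension Z r \<omega> = (if r \<le> t0 then \<theta> r \<omega> else Z (min r T) \<omega>)"

lemma deterministic_past:
  "t0 - l < 0 \<Longrightarrow> \<exists>f. f \<in> borel_measurable (lebesgue_on {t0 - l..0}) \<and>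
     (\<integral>\<^sup>+r\<in>{t0 - l..0}. ennreal ((norm (f r))\<^sup>2) \<partial>lebesgue) < \<infinity> \<and>
     (\<forall>r\<in>{t0 - l..0}. \<forall>\<omega>\<in>space M. \<theta> r \<omega> = f r)"
  using \<theta> by (auto simp: L2bar_F_def)

lemma \<theta>_prog: "prog_measurable F start t0 \<theta>" and \<theta>_E2: "E2 start t0 \<theta> < \<infinity>"
  using \<theta> by (auto simp: L2bar_F_def L2_F_def E2_def)

text \<open>
  Progressive measurability joins that of \<open>\<theta>\<close> up to \<open>t0\<close> to that of a continuous adapted process
  afterwards. The majorant \<open>H\<close> provides square integrability, and the deterministic part is that
  of \<open>\<theta>\<close>.
\<close>

lemma extension_in_Lbar:
  assumes adapted: "\<And>r. r \<in> {t0..T} \<Longrightarrow> Z r \<in> borel_measurable (F r)"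
    and cont: "\<And>\<omega>. \<omega> \<in> space M \<Longrightarrow> continuous_on {t0..T} (\<lambda>r. Z r \<omega>)"
    and init: "\<And>\<omega>. \<omega> \<in> space M \<Longrightarrow> Z t0 \<omega> = \<theta> t0 \<omega>"
    and H: "H \<in> borel_measurable M" "(\<integral>\<^sup>+\<omega>. H \<omega> \<partial>M) < \<infinity>" "AE \<omega> in M. \<forall>r\<in>{t0..T}. nsq (Z r \<omega>) \<le> H \<omega>"
  shows "extension Z \<in> Lbar" "extension Z \<in> S2_F M F t0 T"
proof -
  define V where "V r = Z (max t0 (min r T))" for r
  have V_cont: "continuous_on UNIV (\<lambda>r. V r \<omega>)" if "\<omega> \<in> space M" for \<omega>
    unfolding V_def
    by (rule continuous_on_compose2[OF cont[OF that]]) (use times in \<open>auto intro!: continuous_intros\<close>)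
  have prog: "prog_measurable F start (T + u) (extension Z)"
    unfolding prog_measurable_iff
  proof
    fix s assume s: "s \<in> {start..T + u}"
    define s' where "s' = min s t0"
    have s': "s' \<in> {start..t0}" "s' \<le> s" using s times by (auto simp: s'_def)
    have 1: "(\<lambda>z. indicator {start..s'} (fst z) *\<^sub>R \<theta> (fst z) (snd z)) \<in> borel_measurable (borel \<Otimes>\<^sub>M F s)"
      using \<theta>_prog s' by (intro borel_F_measurable_mono[OF _ s'(2)]) (auto simp: prog_measurable_iff)
    have 2: "(\<lambda>z. indicator {t0<..s} (fst z) *\<^sub>R V (min s (fst z)) (snd z)) \<in> borel_measurable (borel \<Otimes>\<^sub>M F s)"
    proof (cases "t0 < s")
      case True
      have "V r \<in> borel_measurable (F s)" if "r \<le> s" for r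
      proof -
        have "max t0 (min r T) \<in> {t0..T}" using times by auto
        from F_measurable_mono[OF adapted[OF this], of s] show ?thesis using that True times unfolding V_def by auto
      qed
      from continuous_adapted_measurable[OF this V_cont] show ?thesis
        by (rule borel_measurable_scaleR[rotated]) measurable
    qed simp
    have "(\<lambda>z. indicator {start..s'} (fst z) *\<^sub>R \<theta> (fst z) (snd z) + indicator {t0<..s} (fst z) *\<^sub>R V (min s (fst z)) (snd z)) =
      (\<lambda>z. indicator {start..s} (fst z) *\<^sub>R extension Z (fst z) (snd z))"
      using times by (auto simp: fun_eq_iff s'_def extension_def V_def max_absorb2 split: split_indicator)
    with borel_measurable_add[OF 1 2]
    show "(\<lambda>z. indicator {start..s} (fst z) *\<^sub>R extension Z (fst z) (snd z)) \<in> borel_measurable (borel \<Otimes>\<^sub>M F s)" by simp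
  qed
  have joint_meas: "joint_meas start t0 (extension Z)" "joint_meas t0 (T + u) (extension Z)"
    using prog_measurable_joint_meas[OF prog] times by (auto intro: joint_meas_mono)
  have E_future: "E2 t0 (T + u) (extension Z) < \<infinity>"
  proof -
    have "E2 t0 (T + u) (extension Z) \<le> (\<integral>\<^sup>+\<omega>. H \<omega> * emeasure lborel {t0..T + u} \<partial>M)"
      unfolding E2_def
    proof (rule nn_integral_mono_AE)
      show "AE \<omega> in M. (\<integral>\<^sup>+r\<in>{t0..T + u}. nsq (extension Z r \<omega>) \<partial>lborel) \<le> H \<omega> * emeasure lborel {t0..T + u}"
        using H(3) AE_space
      proof eventually_elim
        case (elim \<omega>)
        have "nsq (extension Z r \<omega>) \<le> H \<omega>" if "r \<in> {t0..T + u}" for r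
          using elim(1) init[OF elim(2)] that times by (cases "r = t0") (force simp: extension_def)+
        then have "(\<integral>\<^sup>+r\<in>{t0..T + u}. nsq (extension Z r \<omega>) \<partial>lborel) \<le> (\<integral>\<^sup>+r. H \<omega> * indicator {t0..T + u} r \<partial>lborel)"
          by (intro nn_integral_mono) (auto split: split_indicator)
        then show ?case by (simp add: nn_integral_cmult_indicator)
      qed
    qed
    also have "\<dots> = (\<integral>\<^sup>+\<omega>. H \<omega> \<partial>M) * emeasure lborel {t0..T + u}" using H(1) by (simp add: nn_integral_multc)
    also have "\<dots> < \<infinity>" using H(2) by (simp add: ennreal_mult_less_top emeasure_lborel_Icc_eq)
    finally show ?thesis .
  qed
  have E_past: "E2 start t0 (extension Z) = E2 start t0 \<theta>"
    unfolding E2_def by (intro nn_integral_cong) (auto simp: extension_def split: split_indicator)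
  have "E2 start (T + u) (extension Z) < \<infinity>"
    using E2_split[OF joint_meas] E_past E_future \<theta>_E2 by (auto intro: order.strict_trans1)
  then have L2: "extension Z \<in> L2_F M F start (T + u)" using prog by (simp add: L2_F_def E2_def)
  have past: "extension Z r \<omega> = \<theta> r \<omega>" if "r \<in> {t0 - l..0}" for r \<omega>
    using that times by (auto simp: extension_def)
  show "extension Z \<in> Lbar"
    unfolding L2bar_F_def using L2 deterministic_past past by simp
  have eqZ: "extension Z r \<omega> = Z r \<omega>" if "r \<in> {t0..T}" "\<omega> \<in> space M" for r \<omega>
    using that init[OF that(2)] by (cases "r = t0") (auto simp: extension_def min_absorb1)
  have "extension Z \<in> L2_F M F t0 T" by (rule L2_F_mono[OF L2]) (use times in auto)
  moreover have "continuous_on {t0..T} (\<lambda>r. extension Z r \<omega>)" if "\<omega> \<in> space M" for \<omega>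
    using cont[OF that] by (rule continuous_on_eq) (use eqZ that in auto)
  moreover have "(\<integral>\<^sup>+\<omega>. (SUP r\<in>{t0..T}. nsq (extension Z r \<omega>)) \<partial>M) < \<infinity>"
  proof -
    have "(\<integral>\<^sup>+\<omega>. (SUP r\<in>{t0..T}. nsq (extension Z r \<omega>)) \<partial>M) \<le> (\<integral>\<^sup>+\<omega>. H \<omega> \<partial>M)"
    proof (rule nn_integral_mono_AE)
      show "AE \<omega> in M. (SUP r\<in>{t0..T}. nsq (extension Z r \<omega>)) \<le> H \<omega>"
        using H(3) AE_space by eventually_elim (auto intro!: SUP_least simp: eqZ)
    qed
    then show ?thesis using H(2) by (rule order.strict_trans1)
  qed
  ultimately show "extension Z \<in> S2_F M F t0 T" by (simp add: S2_F_def)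
qed

text \<open>
  A relation instead of a map, because the Ito integral \<open>J\<close> is determined only up to
  indistinguishability.
\<close>

definition picard_image :: "(real \<Rightarrow> 'a \<Rightarrow> real) \<Rightarrow> (real \<Rightarrow> 'a \<Rightarrow> real) \<Rightarrow> (real \<Rightarrow> 'a \<Rightarrow> real) \<Rightarrow> bool" where
  "picard_image x Y J \<longleftrightarrow> Y \<in> Lbar \<and> Y \<in> S2_F M F t0 T \<and> has_ito_integral M B t0 T (\<lambda>s \<omega>. \<sigma> \<omega> s x) J \<and>
     (\<forall>\<omega>\<in>space M. \<forall>t\<in>{t0 - l..t0}. Y t \<omega> = \<theta> t \<omega>) \<and>
     (\<forall>\<omega>\<in>space M. \<forall>t\<in>{T<..T + u}. Y t \<omega> = Y T \<omega>) \<and>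
     (AE \<omega> in M. \<forall>t\<in>{t0<..T}. Y t \<omega> = \<theta> t0 \<omega> + (LINT s:{t0..t}|lborel. b \<omega> s x) + J t \<omega>)"

lemma picard_image_exists:
  assumes x: "x \<in> Lbar"
  shows "\<exists>Y J. picard_image x Y J"
proof -
  obtain J where J: "has_ito_integral M B t0 T (\<lambda>s \<omega>. \<sigma> \<omega> s x) J" and J0: "\<forall>\<omega>. J t0 \<omega> = 0"
    using ito_exists[OF times(1,2) \<sigma>_L2'[OF x]] by blast
  obtain G where G: "G \<in> borel_measurable M" "AE \<omega> in M. \<forall>r\<in>{t0..T}. nsq (J r \<omega>) \<le> G \<omega>" "(\<integral>\<^sup>+\<omega>. G \<omega> \<partial>M) < \<infinity>"
    using ito_majorant[OF times(1,2) J] by blast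
  have bL2: "(\<lambda>s \<omega>. b \<omega> s x) \<in> L2_F M F t0 T" by (rule b_L2'[OF x])
  have jmb: "joint_meas t0 T (\<lambda>s \<omega>. b \<omega> s x)" by (rule L2_F_joint_meas[OF bL2])
  define good where "good \<omega> \<longleftrightarrow> set_integrable lborel {t0..T} (\<lambda>s. b \<omega> s x)" for \<omega>
  have AE_good: "AE \<omega> in M. good \<omega>" unfolding good_def by (rule L2_F_set_integrable[OF bL2])
  \<comment> \<open>The drift integral is set to 0 where the drift is not integrable in time, so that every
     path is continuous.\<close>
  define A where "A t \<omega> = (if good \<omega> then LINT s:{t0..t}|lborel. b \<omega> s x else 0)" for t \<omega>
  have A_meas: "A t \<in> borel_measurable (F t)" if t: "t \<in> {t0..T}" for t
  proof (rule F_measurable_AE_eq)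
    have "(\<lambda>z. indicator {t0..t} (fst z) *\<^sub>R b (snd z) (fst z) x) \<in> borel_measurable (borel \<Otimes>\<^sub>M F t)"
      using bL2 t by (auto simp: L2_F_def prog_measurable_iff)
    from measurable_compose[OF measurable_pair_swap' this]
    have "(\<lambda>(\<omega>, s). indicator {t0..t} s *\<^sub>R b \<omega> s x) \<in> borel_measurable (F t \<Otimes>\<^sub>M borel)"
      by (simp add: case_prod_beta')
    then have "(\<lambda>(\<omega>, s). indicator {t0..t} s *\<^sub>R b \<omega> s x) \<in> borel_measurable (F t \<Otimes>\<^sub>M lborel)"
      by (simp add: measurable_cong_sets[OF sets_pair_measure_cong[OF refl sets_lborel] refl])
    from lborel.borel_measurable_lebesgue_integral[OF this]
    show "(\<lambda>\<omega>. LINT s:{t0..t}|lborel. b \<omega> s x) \<in> borel_measurable (F t)" unfolding set_lebesgue_integral_def .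
    show "AE \<omega> in M. (LINT s:{t0..t}|lborel. b \<omega> s x) = A t \<omega>"
      using AE_good by eventually_elim (simp add: A_def)
  qed simp
  have A_cont: "continuous_on {t0..T} (\<lambda>t. A t \<omega>)" for \<omega>
  proof (cases "good \<omega>")
    case True
    then have int: "set_integrable lborel {t0..T} (\<lambda>s. b \<omega> s x)" by (simp add: good_def)
    have "A t \<omega> = integral {t0..t} (\<lambda>s. b \<omega> s x)" if "t \<in> {t0..T}" for t
    proof -
      have "set_integrable lborel {t0..t} (\<lambda>s. b \<omega> s x)" by (rule set_integrable_subset[OF int]) (use that in auto)
      from set_borel_integral_eq_integral(2)[OF this] show ?thesis using True by (simp add: A_def)
    qed
    moreover have "continuous_on {t0..T} (\<lambda>t. integral {t0..t} (\<lambda>s. b \<omega> s x))"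
      by (rule indefinite_integral_continuous_1[OF set_borel_integral_eq_integral(1)[OF int]])
    ultimately show ?thesis by (metis (no_types, lifting) continuous_on_cong)
  qed (simp add: A_def)
  have A0: "A t0 \<omega> = 0" for \<omega>
  proof -
    have "(LINT s:{t0..t0}|lborel. b \<omega> s x) = 0"
      unfolding set_lebesgue_integral_def
    proof (rule integral_eq_zero_AE)
      show "AE s in lborel. indicator {t0..t0} s *\<^sub>R b \<omega> s x = 0"
        using AE_lborel_singleton[of t0] by eventually_elim (auto split: split_indicator)
    qed
    then show ?thesis by (simp add: A_def)
  qed
  define Z where "Z t \<omega> = \<theta> t0 \<omega> + A t \<omega> + J t \<omega>" for t \<omega>
  have \<theta>F: "\<theta> t0 \<in> borel_measurable (F t0)" and \<theta>2: "(\<integral>\<^sup>+\<omega>. nsq (\<theta> t0 \<omega>) \<partial>M) < \<infinity>" using \<theta>_t0 by (auto simp: L2_rv_def)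
  have [measurable]: "\<theta> t0 \<in> borel_measurable M" by (rule F_measurable_M[OF \<theta>F])
  define D where "D \<omega> = (\<integral>\<^sup>+s\<in>{t0..T}. nsq (b \<omega> s x) \<partial>lborel)" for \<omega>
  have D_meas [measurable]: "D \<in> borel_measurable M"
  proof -
    have "(\<lambda>z. nsq (wt 0 t0 T (\<lambda>s \<omega>. b \<omega> s x) z)) \<in> borel_measurable (borel \<Otimes>\<^sub>M M)"
      using wt_measurable[OF jmb] by measurable
    from nn_integral_time_measurable[OF this] show ?thesis unfolding nsq_wt D_def[abs_def] by simp
  qed
  have D_int: "(\<integral>\<^sup>+\<omega>. D \<omega> \<partial>M) < \<infinity>" using bL2 by (simp add: D_def L2_F_def)
  \<comment> \<open>The three parts of \<open>Z\<close> are dominated separately, the drift by Cauchy-Schwarz in time and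
     the stochastic integral by Doob's inequality.\<close>
  define H where "H \<omega> = 2 * nsq (\<theta> t0 \<omega>) + 2 * (2 * (ennreal (T - t0) * D \<omega>) + 2 * G \<omega>)" for \<omega>
  have [measurable]: "G \<in> borel_measurable M" by fact
  have H_meas: "H \<in> borel_measurable M" unfolding H_def[abs_def] by measurable
  have H_int: "(\<integral>\<^sup>+\<omega>. H \<omega> \<partial>M) < \<infinity>"
    unfolding H_def using \<theta>2 D_int G(3) by (simp add: nn_integral_add nn_integral_cmult ennreal_mult_less_top)
  have H_bound: "AE \<omega> in M. \<forall>r\<in>{t0..T}. nsq (Z r \<omega>) \<le> H \<omega>"
    using G(2) AE_good AE_space
  proof eventually_elim
    case (elim \<omega>)
    show ?case
    proof
      fix r assume r: "r \<in> {t0..T}"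
      have sec: "(\<lambda>s. indicator {t0..T} s *\<^sub>R b \<omega> s x) \<in> borel_measurable borel" by (rule joint_meas_section[OF jmb elim(3)])
      have int: "set_integrable lborel {t0..r} (\<lambda>s. b \<omega> s x)"
        using elim(2) unfolding good_def by (rule set_integrable_subset) (use r in auto)
      have "ennreal \<bar>A r \<omega>\<bar> \<le> (\<integral>\<^sup>+s. norm (indicator {t0..r} s *\<^sub>R b \<omega> s x) \<partial>lborel)"
        using elim(2) int unfolding A_def set_lebesgue_integral_def set_integrable_def
        by (auto intro: order.trans[OF integral_norm_bound_ennreal] simp flip: real_norm_def)
      also have "\<dots> \<le> (\<integral>\<^sup>+s. indicator {t0..T} s * ennreal \<bar>indicator {t0..T} s *\<^sub>R b \<omega> s x\<bar> \<partial>lborel)"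
        using r by (intro nn_integral_mono) (auto split: split_indicator)
      finally have "(ennreal \<bar>A r \<omega>\<bar>)\<^sup>2 \<le> (\<integral>\<^sup>+s. indicator {t0..T} s * ennreal \<bar>indicator {t0..T} s *\<^sub>R b \<omega> s x\<bar> \<partial>lborel)\<^sup>2"
        by (rule power_mono) simp
      also have "\<dots> \<le> (\<integral>\<^sup>+s. (indicator {t0..T} s)\<^sup>2 \<partial>lborel) * (\<integral>\<^sup>+s. (ennreal \<bar>indicator {t0..T} s *\<^sub>R b \<omega> s x\<bar>)\<^sup>2 \<partial>lborel)"
        by (rule Cauchy_Schwarz_nn_integral) (use sec in measurable)
      also have "(\<integral>\<^sup>+s. (indicator {t0..T} s)\<^sup>2 \<partial>lborel) = (\<integral>\<^sup>+s. indicator {t0..T} s \<partial>lborel)"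
        by (intro nn_integral_cong) (auto split: split_indicator)
      also have "\<dots> = ennreal (T - t0)" using times by simp
      also have "(\<integral>\<^sup>+s. (ennreal \<bar>indicator {t0..T} s *\<^sub>R b \<omega> s x\<bar>)\<^sup>2 \<partial>lborel) = D \<omega>"
        unfolding D_def by (intro nn_integral_cong) (auto simp: ennreal_power split: split_indicator)
      finally have A_le: "nsq (A r \<omega>) \<le> ennreal (T - t0) * D \<omega>" by (simp add: ennreal_power)
      have "nsq (Z r \<omega>) \<le> 2 * nsq (\<theta> t0 \<omega>) + 2 * nsq (A r \<omega> + J r \<omega>)"
        unfolding Z_def using nsq_add_le2[of "\<theta> t0 \<omega>" "A r \<omega> + J r \<omega>"] by (simp add: add.assoc)
      also have "nsq (A r \<omega> + J r \<omega>) \<le> 2 * nsq (A r \<omega>) + 2 * nsq (J r \<omega>)" by (rule nsq_add_le2)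
      also have "nsq (A r \<omega>) \<le> ennreal (T - t0) * D \<omega>" by (rule A_le)
      also have "nsq (J r \<omega>) \<le> G \<omega>" using elim(1) r by auto
      finally show "nsq (Z r \<omega>) \<le> H \<omega>" unfolding H_def by (simp add: add_left_mono mult_left_mono)
    qed
  qed
  have Z_adapted: "Z r \<in> borel_measurable (F r)" if "r \<in> {t0..T}" for r
    unfolding Z_def[abs_def]
    using F_measurable_mono[OF \<theta>F, of r] A_meas[OF that] ito_adapted[OF J that] that by (intro borel_measurable_add) auto
  have Z_cont: "continuous_on {t0..T} (\<lambda>r. Z r \<omega>)" if "\<omega> \<in> space M" for \<omega>
    unfolding Z_def by (intro continuous_intros A_cont ito_continuous[OF J that])
  have Z0: "Z t0 \<omega> = \<theta> t0 \<omega>" for \<omega> by (simp add: Z_def A0 J0)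
  have "picard_image x (extension Z) J"
    unfolding picard_image_def
  proof (intro conjI J ballI)
    show "extension Z \<in> Lbar" "extension Z \<in> S2_F M F t0 T"
      using extension_in_Lbar[of Z H] Z_adapted Z_cont Z0 H_meas H_int H_bound by auto
    show "extension Z t \<omega> = \<theta> t \<omega>" if "t \<in> {t0 - l..t0}" for t \<omega>
      using that by (simp add: extension_def)
    show "extension Z t \<omega> = extension Z T \<omega>" if "t \<in> {T<..T + u}" for t \<omega>
      using that times Z0 by (auto simp: extension_def)
    show "AE \<omega> in M. \<forall>t\<in>{t0<..T}. extension Z t \<omega> = \<theta> t0 \<omega> + (LINT s:{t0..t}|lborel. b \<omega> s x) + J t \<omega>"
      using AE_good by eventually_elim (auto simp: extension_def Z_def A_def min_absorb1)
  qed
  then show ?thesis by blast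
qed

section \<open>Contraction and uniqueness\<close>

text \<open>
  What Picard images and solutions have in common, as one formula for all times after \<open>t0\<close>. A
  solution \<open>X\<close> is driven by itself, so that one contraction estimate serves both existence and
  uniqueness.
\<close>

definition driven :: "(real \<Rightarrow> 'a \<Rightarrow> real) \<Rightarrow> (real \<Rightarrow> 'a \<Rightarrow> real) \<Rightarrow> (real \<Rightarrow> 'a \<Rightarrow> real) \<Rightarrow> bool" where
  "driven x Y J \<longleftrightarrow> x \<in> Lbar \<and> Y \<in> Lbar \<and> has_ito_integral M B t0 T (\<lambda>s \<omega>. \<sigma> \<omega> s x) J \<and>
     (AE \<omega> in M. \<forall>t\<in>{t0<..T + u}. Y t \<omega> = \<theta> t0 \<omega> + (LINT s:{t0..min t T}|lborel. b \<omega> s x) + J (min t T) \<omega>)"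

text \<open>
  If \<open>t0 = T\<close> the equation concerns no time in \<open>(t0, T]\<close>; the value at \<open>T\<close> then comes from the
  initial condition and from the stochastic integral starting at 0.
\<close>

lemma drivenI:
  assumes "x \<in> Lbar" "Y \<in> Lbar" and J: "has_ito_integral M B t0 T (\<lambda>s \<omega>. \<sigma> \<omega> s x) J"
    and eq: "AE \<omega> in M. \<forall>t\<in>{t0<..T}. Y t \<omega> = \<theta> t0 \<omega> + (LINT s:{t0..t}|lborel. b \<omega> s x) + J t \<omega>"
    and init: "AE \<omega> in M. Y t0 \<omega> = \<theta> t0 \<omega>"
    and fin: "AE \<omega> in M. \<forall>t\<in>{T<..T + u}. Y t \<omega> = Y T \<omega>"
  shows "driven x Y J"
proof -
  have "AE \<omega> in M. \<forall>t\<in>{t0<..T + u}. Y t \<omega> = \<theta> t0 \<omega> + (LINT s:{t0..min t T}|lborel. b \<omega> s x) + J (min t T) \<omega>"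
    using eq init fin ito_start[OF J times(2)]
  proof eventually_elim
    case (elim \<omega>)
    have null: "(LINT s:{t0..t0}|lborel. b \<omega> s x) = 0"
      unfolding set_lebesgue_integral_def
    proof (rule integral_eq_zero_AE)
      show "AE s in lborel. indicator {t0..t0} s *\<^sub>R b \<omega> s x = 0"
        using AE_lborel_singleton[of t0] by eventually_elim (auto split: split_indicator)
    qed
    show ?case
    proof
      fix t assume t: "t \<in> {t0<..T + u}"
      have at_T: "Y T \<omega> = \<theta> t0 \<omega> + (LINT s:{t0..T}|lborel. b \<omega> s x) + J T \<omega>"
      proof (cases "t0 = T")
        case True
        then show ?thesis using elim(2,4) null by simp
      next
        case False
        then show ?thesis using elim(1) times by auto
      qed
      show "Y t \<omega> = \<theta> t0 \<omega> + (LINT s:{t0..min t T}|lborel. b \<omega> s x) + J (min t T) \<omega>"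
      proof (cases "t \<le> T")
        case True
        then show ?thesis using elim(1) t by (simp add: min_absorb1)
      next
        case False
        then show ?thesis using elim(3) at_T t by (simp add: min_absorb2)
      qed
    qed
  qed
  with assms show ?thesis by (simp add: driven_def)
qed

lemma picard_image_driven:
  assumes "x \<in> Lbar" "picard_image x Y J"
  shows "driven x Y J"
proof (rule drivenI)
  have "t0 \<in> {t0 - l..t0}" using l by simp
  with assms show "AE \<omega> in M. Y t0 \<omega> = \<theta> t0 \<omega>" unfolding picard_image_def by (intro AE_I2) blast
  show "AE \<omega> in M. \<forall>t\<in>{T<..T + u}. Y t \<omega> = Y T \<omega>" using assms unfolding picard_image_def by (intro AE_I2) blast
qed (use assms in \<open>auto simp: picard_image_def\<close>)

lemma sde_solution_driven:
  assumes "sde_solution M B T l u t0 b \<sigma> \<theta> X"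
  shows "\<exists>J. driven X X J"
proof -
  have X: "X \<in> Lbar" and init: "AE \<omega> in M. \<forall>t\<in>{t0 - l..t0}. X t \<omega> = \<theta> t \<omega>"
    and fin: "AE \<omega> in M. \<forall>t\<in>{T<..T + u}. X t \<omega> = X T \<omega>" using assms by (auto simp: sde_solution_def)
  obtain J where J: "has_ito_integral M B t0 T (\<lambda>s \<omega>. \<sigma> \<omega> s X) J"
    and eq: "AE \<omega> in M. \<forall>t\<in>{t0<..T}. X t \<omega> = X t0 \<omega> + (LINT s:{t0..t}|lborel. b \<omega> s X) + J t \<omega>"
    using assms unfolding sde_solution_def by blast
  have init0: "AE \<omega> in M. X t0 \<omega> = \<theta> t0 \<omega>" using init by eventually_elim (use l in auto)
  have "AE \<omega> in M. \<forall>t\<in>{t0<..T}. X t \<omega> = \<theta> t0 \<omega> + (LINT s:{t0..t}|lborel. b \<omega> s X) + J t \<omega>"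
    using eq init0 by eventually_elim simp
  from drivenI[OF X X J this init0 fin] show ?thesis by blast
qed

text \<open>
  The common form of the two Lipschitz conditions. Only processes with the same past are
  compared, so that no time before \<open>t0\<close> enters the right-hand side.
\<close>

definition lipschitz_weighted :: "real \<Rightarrow> real \<Rightarrow> bool" where
  "lipschitz_weighted \<beta> L \<longleftrightarrow> (\<forall>x\<in>Lbar. \<forall>y\<in>Lbar. (AE \<omega> in M. \<forall>t\<in>{t0 - l..t0}. x t \<omega> = y t \<omega>) \<longrightarrow>
     W \<beta> t0 T (\<lambda>s \<omega>. b \<omega> s x - b \<omega> s y) + W \<beta> t0 T (\<lambda>s \<omega>. \<sigma> \<omega> s x - \<sigma> \<omega> s y) \<le>
     ennreal L * W \<beta> t0 (T + u) (\<lambda>s \<omega>. x s \<omega> - y s \<omega>))"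

lemma picard_contraction:
  assumes \<beta>: "\<beta> > 0" and L: "L \<ge> 0" "lipschitz_weighted \<beta> L"
    and Y: "driven x Y J" and Y': "driven x' Y' J'"
    and init: "AE \<omega> in M. \<forall>t\<in>{t0 - l..t0}. x t \<omega> = x' t \<omega>"
  shows "W \<beta> t0 (T + u) (\<lambda>s \<omega>. Y s \<omega> - Y' s \<omega>) \<le> ennreal ((4 / \<beta>\<^sup>2 + 1 / \<beta>) * L) * W \<beta> t0 (T + u) (\<lambda>s \<omega>. x s \<omega> - x' s \<omega>)"
proof -
  have Lbar: "x \<in> Lbar" "x' \<in> Lbar" "Y \<in> Lbar" "Y' \<in> Lbar" using Y Y' by (auto simp: driven_def)
  have J: "has_ito_integral M B t0 T (\<lambda>s \<omega>. \<sigma> \<omega> s x) J" "has_ito_integral M B t0 T (\<lambda>s \<omega>. \<sigma> \<omega> s x') J'"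
    using Y Y' by (auto simp: driven_def)
  have "W \<beta> t0 (T + u) (\<lambda>s \<omega>. Y s \<omega> - Y' s \<omega>) \<le> ennreal (4 / \<beta>\<^sup>2 + 1 / \<beta>) *
      (W \<beta> t0 T (\<lambda>s \<omega>. b \<omega> s x - b \<omega> s x') + W \<beta> t0 T (\<lambda>s \<omega>. \<sigma> \<omega> s x - \<sigma> \<omega> s x'))"
  proof (rule picard_difference[where X = Y and Y = Y' and c = "T + u", OF times(1,2) b_L2'[OF Lbar(1)] b_L2'[OF Lbar(2)] J _ _ \<beta>])
    show "joint_meas t0 (T + u) (\<lambda>s \<omega>. Y s \<omega> - Y' s \<omega>)" by (intro joint_meas_diff Lbar_joint_meas' Lbar)
    fix t assume t: "t0 < t" "t \<le> T + u"
    have "AE \<omega> in M. \<forall>t\<in>{t0<..T + u}. Y t \<omega> = \<theta> t0 \<omega> + (LINT s:{t0..min t T}|lborel. b \<omega> s x) + J (min t T) \<omega>"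
      and "AE \<omega> in M. \<forall>t\<in>{t0<..T + u}. Y' t \<omega> = \<theta> t0 \<omega> + (LINT s:{t0..min t T}|lborel. b \<omega> s x') + J' (min t T) \<omega>"
      using Y Y' by (auto simp: driven_def)
    then show "AE \<omega> in M. Y t \<omega> - Y' t \<omega> = (LINT s:{t0..min t T}|lborel. b \<omega> s x) - (LINT s:{t0..min t T}|lborel. b \<omega> s x') + (J (min t T) \<omega> - J' (min t T) \<omega>)"
      by eventually_elim (use t in simp)
  qed
  also have "\<dots> \<le> ennreal (4 / \<beta>\<^sup>2 + 1 / \<beta>) * (ennreal L * W \<beta> t0 (T + u) (\<lambda>s \<omega>. x s \<omega> - x' s \<omega>))"
    using L(2) Lbar init unfolding lipschitz_weighted_def by (intro mult_left_mono) auto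
  also have "\<dots> = ennreal ((4 / \<beta>\<^sup>2 + 1 / \<beta>) * L) * W \<beta> t0 (T + u) (\<lambda>s \<omega>. x s \<omega> - x' s \<omega>)"
    using \<beta> L(1) by (subst ennreal_mult) (auto simp: mult.assoc)
  finally show ?thesis .
qed

lemma W_finite:
  assumes "x \<in> Lbar" "y \<in> Lbar" "\<beta> > 0"
  shows "W \<beta> t0 (T + u) (\<lambda>s \<omega>. x s \<omega> - y s \<omega>) < \<infinity>"
proof -
  have "joint_meas t0 (T + u) (\<lambda>s \<omega>. 0::real)" by (simp add: joint_meas_def)
  from E2_triangle[OF Lbar_joint_meas'[OF assms(1)] this Lbar_joint_meas'[OF assms(2)]]
  have "E2 t0 (T + u) (\<lambda>s \<omega>. x s \<omega> - y s \<omega>) \<le> 2 * E2 t0 (T + u) x + 2 * E2 t0 (T + u) y"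
    by (simp add: E2_def)
  also have "\<dots> \<le> 2 * E2 start (T + u) x + 2 * E2 start (T + u) y"
    by (intro add_mono mult_left_mono E2_mono_interval) (use times in auto)
  also have "\<dots> < \<infinity>" using Lbar_E2[OF assms(1)] Lbar_E2[OF assms(2)] by (simp add: ennreal_mult_less_top)
  finally show ?thesis using W_le_E2[OF times(1) assms(3)] by (rule order.strict_trans1[rotated])
qed

text \<open>
  Both solutions are driven by themselves, so that their distance is at most a factor below 1
  times itself; being finite, it is 0. Continuity turns equality at almost all times into
  equality at all times.
\<close>

lemma sde_uniqueness:
  assumes \<beta>: "\<beta> > 0" and L: "L \<ge> 0" "lipschitz_weighted \<beta> L" and c: "(4 / \<beta>\<^sup>2 + 1 / \<beta>) * L < 1"
    and X: "sde_solution M B T l u t0 b \<sigma> \<theta> X" and Y: "sde_solution M B T l u t0 b \<sigma> \<theta> Y"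
  shows "AE \<omega> in M. \<forall>t\<in>{t0 - l..T + u}. X t \<omega> = Y t \<omega>"
proof -
  obtain J J' where d: "driven X X J" "driven Y Y J'" using sde_solution_driven X Y by blast
  have Lbar: "X \<in> Lbar" "Y \<in> Lbar" using d by (auto simp: driven_def)
  have iX: "AE \<omega> in M. \<forall>t\<in>{t0 - l..t0}. X t \<omega> = \<theta> t \<omega>" and iY: "AE \<omega> in M. \<forall>t\<in>{t0 - l..t0}. Y t \<omega> = \<theta> t \<omega>"
    and fX: "AE \<omega> in M. \<forall>t\<in>{T<..T + u}. X t \<omega> = X T \<omega>" and fY: "AE \<omega> in M. \<forall>t\<in>{T<..T + u}. Y t \<omega> = Y T \<omega>"
    and cX: "\<And>\<omega>. \<omega> \<in> space M \<Longrightarrow> continuous_on {t0..T} (\<lambda>r. X r \<omega>)" and cY: "\<And>\<omega>. \<omega> \<in> space M \<Longrightarrow> continuous_on {t0..T} (\<lambda>r. Y r \<omega>)"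
    using X Y by (auto simp: sde_solution_def S2_F_def)
  have init: "AE \<omega> in M. \<forall>t\<in>{t0 - l..t0}. X t \<omega> = Y t \<omega>" using iX iY by eventually_elim simp
  let ?w = "W \<beta> t0 (T + u) (\<lambda>s \<omega>. X s \<omega> - Y s \<omega>)" and ?c = "(4 / \<beta>\<^sup>2 + 1 / \<beta>) * L"
  have "?w \<le> ennreal ?c * ?w" by (rule picard_contraction[OF \<beta> L d init])
  moreover obtain w where w: "?w = ennreal w" "w \<ge> 0" using W_finite[OF Lbar \<beta>] by (cases ?w) auto
  moreover have c0: "0 \<le> ?c" using \<beta> L by (intro mult_nonneg_nonneg add_nonneg_nonneg) auto
  ultimately have "w \<le> ?c * w" by (simp add: ennreal_mult[symmetric])
  then have "(1 - ?c) * w \<le> 0" by (simp add: algebra_simps)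
  then have "w \<le> 0" using c by (simp add: mult_le_0_iff)
  then have "?w = 0" using w by simp
  from W_zero_AE[OF joint_meas_diff[OF Lbar_joint_meas'[OF Lbar(1)] Lbar_joint_meas'[OF Lbar(2)]] this]
  show ?thesis using init fX fY AE_space
  proof eventually_elim
    case (elim \<omega>)
    have mid: "X t \<omega> = Y t \<omega>" if t: "t \<in> {t0..T}" for t
    proof (cases "t0 = T")
      case True
      then show ?thesis using elim(2) t l by auto
    next
      case False
      then have "t0 < T" using times by simp
      moreover have "continuous_on {t0..T} (\<lambda>t. X t \<omega> - Y t \<omega>)" by (intro continuous_intros cX cY elim(5))
      moreover have "AE s in lborel. s \<in> {t0..T} \<longrightarrow> X s \<omega> - Y s \<omega> = 0"
        using elim(1) by eventually_elim (use times in auto)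
      ultimately have "X t \<omega> - Y t \<omega> = 0" using t by (rule continuous_AE_zero)
      then show ?thesis by simp
    qed
    show ?case
    proof
      fix t assume t: "t \<in> {t0 - l..T + u}"
      consider "t \<in> {t0 - l..t0}" | "t \<in> {t0..T}" | "t \<in> {T<..T + u}" using t by fastforce
      then show "X t \<omega> = Y t \<omega>"
        by cases (use elim(2-4) mid mid[of T] times in auto)
    qed
  qed
qed

section \<open>Existence\<close>

definition agrees_past :: "(real \<Rightarrow> 'a \<Rightarrow> real) \<Rightarrow> bool" where
  "agrees_past x \<longleftrightarrow> (\<forall>\<omega>\<in>space M. \<forall>t\<in>{t0 - l..t0}. x t \<omega> = \<theta> t \<omega>)"

lemma agrees_past_AE: "agrees_past x \<Longrightarrow> agrees_past y \<Longrightarrow> AE \<omega> in M. \<forall>t\<in>{t0 - l..t0}. x t \<omega> = y t \<omega>"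
  unfolding agrees_past_def by (intro AE_I2) simp

lemma initial_guess: "extension (\<lambda>_. \<theta> t0) \<in> Lbar" "agrees_past (extension (\<lambda>_. \<theta> t0))"
proof -
  have \<theta>F: "\<theta> t0 \<in> borel_measurable (F t0)" and \<theta>2: "(\<integral>\<^sup>+\<omega>. nsq (\<theta> t0 \<omega>) \<partial>M) < \<infinity>" using \<theta>_t0 by (auto simp: L2_rv_def)
  have [measurable]: "\<theta> t0 \<in> borel_measurable M" by (rule F_measurable_M[OF \<theta>F])
  show "extension (\<lambda>_. \<theta> t0) \<in> Lbar"
    by (rule extension_in_Lbar(1)[where H="\<lambda>\<omega>. nsq (\<theta> t0 \<omega>)"])
       (use \<theta>2 F_measurable_mono[OF \<theta>F] in auto)
  show "agrees_past (extension (\<lambda>_. \<theta> t0))" by (simp add: agrees_past_def extension_def)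
qed

text \<open>
  The everywhere defined pointwise limit is used, in place of a limit in \<open>L\<^sup>2\<close>: \<open>lim\<close> preserves
  progressive measurability whether or not the sequence converges, and reproduces the common
  past exactly.
\<close>

lemma pointwise_limit_in_Lbar:
  assumes X: "\<And>n. X n \<in> Lbar" and past: "\<And>n. agrees_past (X n)"
    and lim: "Y = (\<lambda>r \<omega>. lim (\<lambda>n. X n r \<omega>))" and fin: "W \<beta> t0 (T + u) (\<lambda>s \<omega>. Y s \<omega> - X 0 s \<omega>) < \<infinity>" and \<beta>: "\<beta> > 0"
  shows "Y \<in> Lbar" "agrees_past Y"
proof -
  show past_Y: "agrees_past Y"
    using past unfolding agrees_past_def lim by simp
  have prog: "prog_measurable F start (T + u) Y"
    unfolding prog_measurable_iff
  proof
    fix s assume s: "s \<in> {start..T + u}"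
    have "(\<lambda>z. indicator {start..s} (fst z) *\<^sub>R X n (fst z) (snd z)) \<in> borel_measurable (borel \<Otimes>\<^sub>M F s)" for n
      using X[of n] s by (auto simp: L2bar_F_def L2_F_def prog_measurable_iff)
    then have "(\<lambda>z. lim (\<lambda>n. indicator {start..s} (fst z) *\<^sub>R X n (fst z) (snd z))) \<in> borel_measurable (borel \<Otimes>\<^sub>M F s)"
      by (rule borel_measurable_lim_metric)
    moreover have "(\<lambda>z. lim (\<lambda>n. indicator {start..s} (fst z) *\<^sub>R X n (fst z) (snd z))) = (\<lambda>z. indicator {start..s} (fst z) *\<^sub>R Y (fst z) (snd z))"
      by (rule ext) (simp add: lim split: split_indicator)
    ultimately show "(\<lambda>z. indicator {start..s} (fst z) *\<^sub>R Y (fst z) (snd z)) \<in> borel_measurable (borel \<Otimes>\<^sub>M F s)" by simp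
  qed
  have joint_meas: "joint_meas start t0 Y" "joint_meas t0 (T + u) Y"
    using prog_measurable_joint_meas[OF prog] times by (auto intro: joint_meas_mono)
  have jm0: "joint_meas t0 (T + u) (\<lambda>s \<omega>. 0::real)" by (simp add: joint_meas_def)
  have "W \<beta> t0 (T + u) (\<lambda>s \<omega>. Y s \<omega> - 0) \<le> ennreal (1 + 1) * W \<beta> t0 (T + u) (\<lambda>s \<omega>. Y s \<omega> - X 0 s \<omega>) + ennreal (1 + 1 / 1) * W \<beta> t0 (T + u) (\<lambda>s \<omega>. X 0 s \<omega> - 0)"
    by (rule W_diff_le[OF joint_meas(2) Lbar_joint_meas'[OF X] jm0]) simp
  also have "W \<beta> t0 (T + u) (\<lambda>s \<omega>. X 0 s \<omega> - 0) \<le> E2 start (T + u) (X 0)"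
    using W_le_E2[OF times(1) \<beta>, of "T + u" "X 0"] E2_mono_interval[of start t0 "T + u" "T + u" "X 0"] times by simp
  finally have "W \<beta> t0 (T + u) Y \<le> ennreal (1 + 1) * W \<beta> t0 (T + u) (\<lambda>s \<omega>. Y s \<omega> - X 0 s \<omega>) + ennreal (1 + 1 / 1) * E2 start (T + u) (X 0)"
    by (simp add: add_left_mono mult_left_mono)
  also have "\<dots> < \<infinity>" using fin Lbar_E2[OF X] by (simp add: ennreal_mult_less_top)
  finally have "E2 t0 (T + u) Y < \<infinity>"
    using E2_le_W[OF joint_meas(2) \<beta>] by (auto intro: order.strict_trans1 simp: ennreal_mult_less_top)
  moreover have "E2 start t0 Y = E2 start t0 \<theta>"
    using past_Y unfolding E2_def agrees_past_def by (intro nn_integral_cong) (auto split: split_indicator)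
  ultimately have "E2 start (T + u) Y < \<infinity>"
    using E2_split[OF joint_meas] \<theta>_E2 by (auto intro: order.strict_trans1)
  then have L2: "Y \<in> L2_F M F start (T + u)" using prog by (simp add: L2_F_def E2_def)
  have "Y r \<omega> = \<theta> r \<omega>" if "r \<in> {t0 - l..0}" "\<omega> \<in> space M" for r \<omega>
    using past_Y that times by (auto simp: agrees_past_def)
  then show "Y \<in> Lbar"
    unfolding L2bar_F_def using L2 deterministic_past by simp
qed

text \<open>
  Fatou's lemma in the second index.
\<close>

lemma W_limit_le:
  assumes X: "\<And>n. X n \<in> Lbar" and Y: "joint_meas t0 (T + u) Y"
    and conv: "AE z in lborel \<Otimes>\<^sub>M M. (\<lambda>n. wt \<beta> t0 (T + u) (X n) z) \<longlonglongrightarrow> wt \<beta> t0 (T + u) Y z"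
    and bound: "\<And>k. k \<ge> n \<Longrightarrow> W \<beta> t0 (T + u) (\<lambda>s \<omega>. X n s \<omega> - X k s \<omega>) \<le> C"
  shows "W \<beta> t0 (T + u) (\<lambda>s \<omega>. X n s \<omega> - Y s \<omega>) \<le> C"
proof -
  let ?w = "wt \<beta> t0 (T + u)"
  have [measurable]: "?w (X k) \<in> borel_measurable (lborel \<Otimes>\<^sub>M M)" for k
    using wt_measurable[OF Lbar_joint_meas'[OF X]] by (simp add: measurable_cong_sets[OF sets_borel_M refl])
  have "W \<beta> t0 (T + u) (\<lambda>s \<omega>. X n s \<omega> - Y s \<omega>) = (\<integral>\<^sup>+z. nsq (?w (X n) z - ?w Y z) \<partial>(lborel \<Otimes>\<^sub>M M))"
    by (simp add: W_eq_pair[OF joint_meas_diff[OF Lbar_joint_meas'[OF X] Y]] wt_diff)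
  also have "\<dots> \<le> (\<integral>\<^sup>+z. liminf (\<lambda>k. nsq (?w (X n) z - ?w (X k) z)) \<partial>(lborel \<Otimes>\<^sub>M M))"
  proof (rule nn_integral_mono_AE)
    show "AE z in lborel \<Otimes>\<^sub>M M. nsq (?w (X n) z - ?w Y z) \<le> liminf (\<lambda>k. nsq (?w (X n) z - ?w (X k) z))"
      using conv
    proof eventually_elim
      case (elim z)
      have "(\<lambda>k. nsq (?w (X n) z - ?w (X k) z)) \<longlonglongrightarrow> nsq (?w (X n) z - ?w Y z)"
        using elim by (intro tendsto_intros)
      then have "nsq (?w (X n) z - ?w Y z) = liminf (\<lambda>k. nsq (?w (X n) z - ?w (X k) z))"
        by (rule lim_imp_Liminf[OF sequentially_bot, symmetric])
      then show ?case by (rule eq_refl)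
    qed
  qed
  also have "\<dots> \<le> liminf (\<lambda>k. \<integral>\<^sup>+z. nsq (?w (X n) z - ?w (X k) z) \<partial>(lborel \<Otimes>\<^sub>M M))"
    by (rule nn_integral_liminf) measurable
  also have "\<dots> = liminf (\<lambda>k. W \<beta> t0 (T + u) (\<lambda>s \<omega>. X n s \<omega> - X k s \<omega>))"
    by (simp add: W_eq_pair[OF Lbar_diff_joint_meas[OF X X]] wt_diff)
  also have "\<dots> \<le> liminf (\<lambda>k::nat. C)"
    using eventually_ge_at_top[of n] by (intro Liminf_mono, eventually_elim) (rule bound)
  also have "\<dots> = C" by (simp add: Liminf_const)
  finally show ?thesis .
qed

text \<open>
  The Picard iterates \<open>X n\<close> form a geometric Cauchy sequence for \<open>W\<close> and converge almost
  everywhere to some \<open>Y\<close>. The Picard image \<open>Z\<close> of \<open>Y\<close> is at distance 0 from \<open>Y\<close>. It is \<open>Z\<close>, not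
  \<open>Y\<close>, that solves the equation: its paths are continuous, and by the Lipschitz condition the
  coefficients along \<open>Y\<close> and \<open>Z\<close> agree at almost all times, so that both integrals may be
  written along \<open>Z\<close>.
\<close>

lemma sde_existence:
  assumes \<beta>: "\<beta> > 0" and L: "L \<ge> 0" "lipschitz_weighted \<beta> L" and c: "(4 / \<beta>\<^sup>2 + 1 / \<beta>) * L < 1"
  shows "\<exists>X. sde_solution M B T l u t0 b \<sigma> \<theta> X"
proof -
  let ?W = "\<lambda>x y. W \<beta> t0 (T + u) (\<lambda>s \<omega>. x s \<omega> - y s \<omega>)"
  \<comment> \<open>The lower bound keeps the ratio positive when \<open>L = 0\<close>.\<close>
  define \<rho> where "\<rho> = max ((4 / \<beta>\<^sup>2 + 1 / \<beta>) * L) (1 / 2)"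
  have \<rho>: "0 < \<rho>" "\<rho> < 1" "(4 / \<beta>\<^sup>2 + 1 / \<beta>) * L \<le> \<rho>" using c by (auto simp: \<rho>_def)
  have contract: "?W Y Y' \<le> ennreal \<rho> * ?W x x'"
    if "driven x Y J" "driven x' Y' J'" "agrees_past x" "agrees_past x'" for x x' Y Y' J J'
    using picard_contraction[OF \<beta> L that(1,2) agrees_past_AE[OF that(3,4)]] mult_right_mono[OF ennreal_leI[OF \<rho>(3)], of "?W x x'"]
    by (meson order_trans zero_le)
  define \<Phi> where "\<Phi> x = (SOME Y. \<exists>J. picard_image x Y J)" for x
  have \<Phi>: "\<exists>J. picard_image x (\<Phi> x) J" if "x \<in> Lbar" for x
    unfolding \<Phi>_def using picard_image_exists[OF that] by (rule someI_ex)
  define X where "X n = (\<Phi> ^^ n) (extension (\<lambda>_. \<theta> t0))" for n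
  have X_Suc: "X (Suc n) = \<Phi> (X n)" for n by (simp add: X_def)
  have X: "X n \<in> Lbar \<and> agrees_past (X n)" for n
  proof (induction n)
    case 0
    show ?case using initial_guess by (simp add: X_def)
  next
    case (Suc n)
    then obtain J where "picard_image (X n) (X (Suc n)) J" using \<Phi> X_Suc by auto
    then show ?case by (auto simp: picard_image_def agrees_past_def)
  qed
  then have X_XX: "X n \<in> Lbar" and X_past: "agrees_past (X n)" for n by auto
  have X_driven: "\<exists>J. driven (X n) (X (Suc n)) J" for n
    using \<Phi>[OF X_XX] picard_image_driven[OF X_XX] X_Suc by metis
  obtain d where d: "?W (X 0) (X 1) = ennreal d" "d \<ge> 0"
    using W_finite[OF X_XX X_XX \<beta>, of 0 1] by (cases "?W (X 0) (X 1)") auto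
  have step: "?W (X n) (X (Suc n)) \<le> ennreal (d * \<rho> ^ n)" for n
  proof (induction n)
    case 0
    show ?case using d by simp
  next
    case (Suc n)
    obtain J J' where "driven (X n) (X (Suc n)) J" "driven (X (Suc n)) (X (Suc (Suc n))) J'" using X_driven by blast
    then have "?W (X (Suc n)) (X (Suc (Suc n))) \<le> ennreal \<rho> * ?W (X n) (X (Suc n))"
      by (rule contract) (use X_past in auto)
    also have "\<dots> \<le> ennreal \<rho> * ennreal (d * \<rho> ^ n)" by (intro mult_left_mono Suc) simp
    also have "\<dots> = ennreal (d * \<rho> ^ Suc n)" using \<rho> d by (subst ennreal_mult[symmetric]) (auto simp: ac_simps)
    finally show ?case .
  qed
  \<comment> \<open>As \<open>W\<close> is a squared norm, the telescoping sum of steps of size \<open>d * \<rho> ^ n\<close> is bounded by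
     the square of a geometric series with ratio \<open>sqrt \<rho>\<close>.\<close>
  define q where "q = sqrt \<rho>"
  have q: "0 < q" "q < 1" "\<rho> = q * q" using \<rho> by (auto simp: q_def)
  define C where "C = d / (1 - q)\<^sup>2"
  have C: "C \<ge> 0" using d by (simp add: C_def)
  have cauchy: "?W (X n) (X (n + k)) \<le> ennreal (C * \<rho> ^ n)" for n k
  proof (induction k arbitrary: n)
    case 0
    show ?case by (simp add: W_def)
  next
    case (Suc k)
    \<comment> \<open>Then \<open>(1 + \<epsilon>) * d = C * (1 - q)\<close> and \<open>(1 + 1 / \<epsilon>) * \<rho> = q\<close>, which makes the induction
       close.\<close>
    define \<epsilon> where "\<epsilon> = q / (1 - q)"
    have \<epsilon>: "\<epsilon> > 0" "1 + \<epsilon> = 1 / (1 - q)" "1 + 1 / \<epsilon> = 1 / q" using q by (auto simp: \<epsilon>_def field_simps)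
    have "?W (X n) (X (n + Suc k)) \<le> ennreal (1 + \<epsilon>) * ?W (X n) (X (Suc n)) + ennreal (1 + 1 / \<epsilon>) * ?W (X (Suc n)) (X (Suc n + k))"
      using W_diff_le[OF Lbar_joint_meas'[OF X_XX[of n]] Lbar_joint_meas'[OF X_XX[of "Suc n"]] Lbar_joint_meas'[OF X_XX[of "n + Suc k"]] \<epsilon>(1)] by simp
    also have "\<dots> \<le> ennreal (1 / (1 - q)) * ennreal (d * \<rho> ^ n) + ennreal (1 / q) * ennreal (C * \<rho> ^ Suc n)"
      unfolding \<epsilon>(2,3) by (intro add_mono mult_left_mono step Suc) auto
    also have "\<dots> = ennreal (1 / (1 - q) * (d * \<rho> ^ n) + 1 / q * (C * \<rho> ^ Suc n))"
      using q d C by (subst (1 2) ennreal_mult[symmetric]) (auto simp: ennreal_plus[symmetric] simp del: ennreal_plus)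
    also have "1 / (1 - q) * (d * \<rho> ^ n) + 1 / q * (C * \<rho> ^ Suc n) = C * \<rho> ^ n"
    proof -
      have "d = C * (1 - q)\<^sup>2" using q by (simp add: C_def)
      then have "1 / (1 - q) * d = C * (1 - q)" using q by (simp add: power2_eq_square)
      moreover have "1 / q * (C * \<rho> ^ Suc n) = C * q * \<rho> ^ n" using q by (simp add: field_simps)
      ultimately have "1 / (1 - q) * (d * \<rho> ^ n) + 1 / q * (C * \<rho> ^ Suc n) = C * (1 - q) * \<rho> ^ n + C * q * \<rho> ^ n"
        by (simp only: mult.assoc[symmetric])
      then show ?thesis by (simp add: algebra_simps)
    qed
    finally show ?case .
  qed
  define Y where "Y = (\<lambda>r \<omega>. lim (\<lambda>n. X n r \<omega>))"
  let ?w = "wt \<beta> t0 (T + u)"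
  have "AE z in lborel \<Otimes>\<^sub>M M. convergent (\<lambda>n. ?w (X n) z)"
  proof (rule L2_geometric_AE_convergent[OF _ \<rho>(1,2) d(2)])
    show "?w (X n) \<in> borel_measurable (lborel \<Otimes>\<^sub>M M)" for n
      using wt_measurable[OF Lbar_joint_meas'[OF X_XX]] by (simp add: measurable_cong_sets[OF sets_borel_M refl])
    show "(\<integral>\<^sup>+z. nsq (?w (X n) z - ?w (X (Suc n)) z) \<partial>(lborel \<Otimes>\<^sub>M M)) \<le> ennreal (d * \<rho> ^ n)" for n
      using step[of n] by (simp add: W_eq_pair[OF Lbar_diff_joint_meas[OF X_XX X_XX]] wt_diff)
  qed
  then have conv: "AE z in lborel \<Otimes>\<^sub>M M. (\<lambda>n. ?w (X n) z) \<longlonglongrightarrow> ?w Y z"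
  proof eventually_elim
    case (elim z)
    show ?case
    proof (cases "fst z \<in> {t0..T + u}")
      case True
      have "convergent (\<lambda>n. exp (\<beta> * fst z / 2) *\<^sub>R ?w (X n) z)"
      proof -
        obtain y where "(\<lambda>n. ?w (X n) z) \<longlonglongrightarrow> y" using elim by (auto simp: convergent_def)
        from tendsto_scaleR[OF tendsto_const this] show ?thesis unfolding convergent_def by blast
      qed
      moreover have "exp (\<beta> * fst z / 2) *\<^sub>R ?w (X n) z = X n (fst z) (snd z)" for n
        using True by (simp add: wt_def mult.assoc[symmetric] exp_add[symmetric])
      ultimately have "(\<lambda>n. X n (fst z) (snd z)) \<longlonglongrightarrow> Y (fst z) (snd z)"
        by (simp add: Y_def convergent_LIMSEQ_iff)
      then show ?thesis unfolding wt_def by (intro tendsto_intros)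
    qed (simp add: wt_def)
  qed
  have jmY: "joint_meas t0 (T + u) Y"
  proof -
    have "(\<lambda>z. lim (\<lambda>n. indicator {t0..T + u} (fst z) *\<^sub>R X n (fst z) (snd z))) \<in> borel_measurable (borel \<Otimes>\<^sub>M M)"
      using Lbar_joint_meas'[OF X_XX] unfolding joint_meas_def by (rule borel_measurable_lim_metric)
    moreover have "(\<lambda>z. lim (\<lambda>n. indicator {t0..T + u} (fst z) *\<^sub>R X n (fst z) (snd z))) = (\<lambda>z. indicator {t0..T + u} (fst z) *\<^sub>R Y (fst z) (snd z))"
      by (rule ext) (simp add: Y_def split: split_indicator)
    ultimately show ?thesis unfolding joint_meas_def by simp
  qed
  have close: "?W (X n) Y \<le> ennreal (C * \<rho> ^ n)" for n
  proof (rule W_limit_le[OF X_XX jmY conv])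
    fix k assume "k \<ge> n"
    then obtain j where "k = n + j" using le_Suc_ex by blast
    then show "?W (X n) (X k) \<le> ennreal (C * \<rho> ^ n)" using cauchy by simp
  qed
  have "?W Y (X 0) < \<infinity>"
    using close[of 0] unfolding W_minus_commute[of _ _ _ Y] by (auto intro: order.strict_trans1)
  from pointwise_limit_in_Lbar[OF X_XX X_past Y_def this \<beta>]
  have Y: "Y \<in> Lbar" "agrees_past Y" .
  obtain Z J where Z: "picard_image Y Z J" using picard_image_exists[OF Y(1)] by blast
  have Z_XX: "Z \<in> Lbar" and Z_past: "agrees_past Z" using Z by (auto simp: picard_image_def agrees_past_def)
  have dZ: "driven Y Z J" by (rule picard_image_driven[OF Y(1) Z])
  have YZ: "?W Y Z = 0"
  proof -
    have *: "?W Y Z \<le> ennreal (4 * C * \<rho> ^ n)" for n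
    proof -
      have "?W Y Z \<le> ennreal (1 + 1) * ?W Y (X (Suc n)) + ennreal (1 + 1 / 1) * ?W (X (Suc n)) Z"
        by (rule W_diff_le[OF Lbar_joint_meas'[OF Y(1)] Lbar_joint_meas'[OF X_XX] Lbar_joint_meas'[OF Z_XX]]) simp
      also have "?W Y (X (Suc n)) \<le> ennreal (C * \<rho> ^ Suc n)" using close[of "Suc n"] by (simp only: W_minus_commute[of _ _ _ Y])
      also have "\<dots> \<le> ennreal (C * \<rho> ^ n)" using C \<rho> by (intro ennreal_leI mult_left_mono) (auto simp: mult_left_le_one_le)
      also have "?W (X (Suc n)) Z \<le> ennreal (C * \<rho> ^ n)"
      proof -
        obtain J' where "driven (X n) (X (Suc n)) J'" using X_driven by blast
        from contract[OF this dZ X_past Y(2)] have "?W (X (Suc n)) Z \<le> ennreal \<rho> * ?W (X n) Y" .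
        also have "\<dots> \<le> 1 * ?W (X n) Y" using \<rho> by (intro mult_right_mono) (auto simp: ennreal_le_1)
        also have "\<dots> \<le> ennreal (C * \<rho> ^ n)" using close by simp
        finally show ?thesis .
      qed
      finally have "?W Y Z \<le> ennreal 2 * ennreal (C * \<rho> ^ n) + ennreal 2 * ennreal (C * \<rho> ^ n)"
        by (simp add: add_mono mult_left_mono)
      also have "\<dots> = ennreal (2 * (C * \<rho> ^ n)) + ennreal (2 * (C * \<rho> ^ n))"
        using C \<rho> by (subst (1 2) ennreal_mult[symmetric]) auto
      also have "\<dots> = ennreal (4 * C * \<rho> ^ n)" using C \<rho> by (subst ennreal_plus[symmetric]) auto
      finally show ?thesis .
    qed
    have "(\<lambda>n. 4 * C * \<rho> ^ n) \<longlonglongrightarrow> 4 * C * 0" using \<rho> by (intro tendsto_mult tendsto_const LIMSEQ_realpow_zero) auto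
    from tendsto_ennrealI[OF this] have "(\<lambda>n. ennreal (4 * C * \<rho> ^ n)) \<longlonglongrightarrow> 0" by simp
    then have "?W Y Z \<le> 0" by (rule LIMSEQ_le_const) (use * in auto)
    then show ?thesis by simp
  qed
  have "W \<beta> t0 T (\<lambda>s \<omega>. b \<omega> s Y - b \<omega> s Z) + W \<beta> t0 T (\<lambda>s \<omega>. \<sigma> \<omega> s Y - \<sigma> \<omega> s Z) \<le> ennreal L * ?W Y Z"
    using L(2) Y(1) Z_XX agrees_past_AE[OF Y(2) Z_past] unfolding lipschitz_weighted_def by blast
  then have Wb: "W \<beta> t0 T (\<lambda>s \<omega>. b \<omega> s Y - b \<omega> s Z) = 0" and W\<sigma>: "W \<beta> t0 T (\<lambda>s \<omega>. \<sigma> \<omega> s Y - \<sigma> \<omega> s Z) = 0"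
    unfolding YZ by auto
  have jmb: "joint_meas t0 T (\<lambda>s \<omega>. b \<omega> s Y)" "joint_meas t0 T (\<lambda>s \<omega>. b \<omega> s Z)" using b_L2'[OF Y(1)] b_L2'[OF Z_XX] by (auto intro: L2_F_joint_meas)
  have joint_meas\<sigma>: "joint_meas t0 T (\<lambda>s \<omega>. \<sigma> \<omega> s Y)" "joint_meas t0 T (\<lambda>s \<omega>. \<sigma> \<omega> s Z)" using \<sigma>_L2'[OF Y(1)] \<sigma>_L2'[OF Z_XX] by (auto intro: L2_F_joint_meas)
  have J: "has_ito_integral M B t0 T (\<lambda>s \<omega>. \<sigma> \<omega> s Z) J"
  proof (rule ito_cong[OF _ \<sigma>_L2'[OF Z_XX]])
    show "has_ito_integral M B t0 T (\<lambda>s \<omega>. \<sigma> \<omega> s Y) J" using Z by (simp add: picard_image_def)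
    show "E2 t0 T (\<lambda>r \<omega>. \<sigma> \<omega> r Y - \<sigma> \<omega> r Z) = 0" by (rule W_zero_imp_E2_zero[OF joint_meas_diff[OF joint_meas\<sigma>] \<beta> W\<sigma>])
  qed
  have drift: "AE \<omega> in M. \<forall>t\<in>{t0<..T}. (LINT s:{t0..t}|lborel. b \<omega> s Y) = (LINT s:{t0..t}|lborel. b \<omega> s Z)"
    using W_zero_AE[OF joint_meas_diff[OF jmb] Wb] AE_space
  proof eventually_elim
    case (elim \<omega>)
    show ?case
    proof
      fix t assume t: "t \<in> {t0<..T}"
      show "(LINT s:{t0..t}|lborel. b \<omega> s Y) = (LINT s:{t0..t}|lborel. b \<omega> s Z)"
        unfolding set_lebesgue_integral_def
      proof (rule integral_cong_AE)
        show "(\<lambda>s. indicator {t0..t} s *\<^sub>R b \<omega> s Y) \<in> borel_measurable lborel" "(\<lambda>s. indicator {t0..t} s *\<^sub>R b \<omega> s Z) \<in> borel_measurable lborel"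
          using joint_meas_section[OF joint_meas_mono[OF jmb(1), of t0 t] elim(2)] joint_meas_section[OF joint_meas_mono[OF jmb(2), of t0 t] elim(2)] t by auto
        show "AE s in lborel. indicator {t0..t} s *\<^sub>R b \<omega> s Y = indicator {t0..t} s *\<^sub>R b \<omega> s Z"
          using elim(1) by eventually_elim (use t in \<open>auto split: split_indicator\<close>)
      qed
    qed
  qed
  have t0_past: "t0 \<in> {t0 - l..t0}" using l by simp
  have "AE \<omega> in M. \<forall>t\<in>{t0<..T}. Z t \<omega> = \<theta> t0 \<omega> + (LINT s:{t0..t}|lborel. b \<omega> s Y) + J t \<omega>"
    using Z by (simp add: picard_image_def)
  then have eq: "AE \<omega> in M. \<forall>t\<in>{t0<..T}. Z t \<omega> = Z t0 \<omega> + (LINT s:{t0..t}|lborel. b \<omega> s Z) + J t \<omega>"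
    using drift AE_space
  proof eventually_elim
    case (elim \<omega>)
    have "Z t0 \<omega> = \<theta> t0 \<omega>" using Z_past elim(3) t0_past by (auto simp: agrees_past_def)
    then show ?case using elim(1,2) by simp
  qed
  have "AE \<omega> in M. \<forall>t\<in>{t0 - l..t0}. Z t \<omega> = \<theta> t \<omega>" using Z_past by (auto simp: agrees_past_def intro: AE_I2)
  moreover have "AE \<omega> in M. \<forall>t\<in>{T<..T + u}. Z t \<omega> = Z T \<omega>" using Z by (auto simp: picard_image_def intro: AE_I2)
  moreover have "Z \<in> S2_F M F t0 T" using Z by (simp add: picard_image_def)
  ultimately have "sde_solution M B T l u t0 b \<sigma> \<theta> Z"
    unfolding sde_solution_def using Z_XX J eq by blast
  then show ?thesis by blast
qed

theorem sde_well_posed: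
  assumes "\<beta> > 0" "L \<ge> 0" "lipschitz_weighted \<beta> L" "(4 / \<beta>\<^sup>2 + 1 / \<beta>) * L < 1"
  shows "sde_unique_solution M B T l u t0 b \<sigma> \<theta>"
  unfolding sde_unique_solution_def using sde_existence[OF assms] sde_uniqueness[OF assms] by blast

section \<open>The two Lipschitz conditions\<close>

text \<open>
  The weight is at most \<open>exp (- \<beta> * t0)\<close> on \<open>[t0, T]\<close> and at least \<open>exp (- \<beta> * (T + u))\<close> on
  \<open>[t0, T + u]\<close>, and the processes agree before \<open>t0\<close>.
\<close>

lemma lipschitz_integrated_imp_weighted:
  assumes \<beta>: "\<beta> > 0" and K: "K \<ge> 0" and lip: "lipschitz_integrated M B T l u t0 b \<sigma> K"
  shows "lipschitz_weighted \<beta> (K * exp (\<beta> * (T + u - t0)))"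
  unfolding lipschitz_weighted_def
proof (intro ballI impI)
  fix x y assume x: "x \<in> Lbar" and y: "y \<in> Lbar" and init: "AE \<omega> in M. \<forall>t\<in>{t0 - l..t0}. x t \<omega> = y t \<omega>"
  define \<delta> where "\<delta> s \<omega> = x s \<omega> - y s \<omega>" for s \<omega>
  define bd where "bd s \<omega> = b \<omega> s x - b \<omega> s y" for s \<omega>
  define \<sigma>d where "\<sigma>d s \<omega> = \<sigma> \<omega> s x - \<sigma> \<omega> s y" for s \<omega>
  have jmb: "joint_meas t0 T bd" unfolding bd_def[abs_def] by (intro joint_meas_diff L2_F_joint_meas b_L2' x y)
  have jms: "joint_meas t0 T \<sigma>d" unfolding \<sigma>d_def[abs_def] by (intro joint_meas_diff L2_F_joint_meas \<sigma>_L2' x y)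
  have jmd: "joint_meas t0 (T + u) \<delta>" unfolding \<delta>_def[abs_def] by (rule Lbar_diff_joint_meas[OF x y])
  have W_const: "W \<beta> t0 T \<phi> \<le> ennreal (exp (- \<beta> * t0)) * E2 t0 T \<phi>" if joint_meas: "joint_meas t0 T \<phi>" for \<phi> :: "real \<Rightarrow> 'a \<Rightarrow> 'c::euclidean_space"
  proof -
    have m: "(\<lambda>z. nsq (wt 0 t0 T \<phi> z)) \<in> borel_measurable (borel \<Otimes>\<^sub>M M)"
      using wt_measurable[OF joint_meas] by measurable
    have E: "E2 t0 T \<phi> = (\<integral>\<^sup>+\<omega>. \<integral>\<^sup>+s. nsq (wt 0 t0 T \<phi> (s, \<omega>)) \<partial>lborel \<partial>M)" unfolding E2_def nsq_wt by simp
    have "W \<beta> t0 T \<phi> \<le> (\<integral>\<^sup>+\<omega>. \<integral>\<^sup>+s. ennreal (exp (- \<beta> * t0)) * nsq (wt 0 t0 T \<phi> (s, \<omega>)) \<partial>lborel \<partial>M)"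
      unfolding W_wt nsq_wt
      by (intro nn_integral_mono) (use \<beta> in \<open>auto intro!: mult_right_mono ennreal_leI split: split_indicator\<close>)
    also have "\<dots> = (\<integral>\<^sup>+\<omega>. ennreal (exp (- \<beta> * t0)) * (\<integral>\<^sup>+s. nsq (wt 0 t0 T \<phi> (s, \<omega>)) \<partial>lborel) \<partial>M)"
      using measurable_compose[OF measurable_Pair2' m] by (intro nn_integral_cong nn_integral_cmult) auto
    also have "\<dots> = ennreal (exp (- \<beta> * t0)) * E2 t0 T \<phi>"
      unfolding E by (rule nn_integral_cmult[OF nn_integral_time_measurable[OF m]])
    finally show ?thesis .
  qed
  have sum_E2: "E2 t0 T bd + E2 t0 T \<sigma>d = (\<integral>\<^sup>+\<omega>. (\<integral>\<^sup>+t\<in>{t0..T}. ennreal (\<bar>b \<omega> t x - b \<omega> t y\<bar>\<^sup>2 + (norm (\<sigma> \<omega> t x - \<sigma> \<omega> t y))\<^sup>2) \<partial>lborel) \<partial>M)"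
  proof -
    have m1: "(\<lambda>z. nsq (wt 0 t0 T bd z)) \<in> borel_measurable (borel \<Otimes>\<^sub>M M)" and m2: "(\<lambda>z. nsq (wt 0 t0 T \<sigma>d z)) \<in> borel_measurable (borel \<Otimes>\<^sub>M M)"
      using wt_measurable[OF jmb] wt_measurable[OF jms] by measurable
    have E: "E2 t0 T \<phi> = (\<integral>\<^sup>+\<omega>. \<integral>\<^sup>+s. nsq (wt 0 t0 T \<phi> (s, \<omega>)) \<partial>lborel \<partial>M)" for \<phi> :: "real \<Rightarrow> 'a \<Rightarrow> 'c::euclidean_space"
      unfolding E2_def nsq_wt by simp
    have "E2 t0 T bd + E2 t0 T \<sigma>d = (\<integral>\<^sup>+\<omega>. (\<integral>\<^sup>+s. nsq (wt 0 t0 T bd (s, \<omega>)) \<partial>lborel) + (\<integral>\<^sup>+s. nsq (wt 0 t0 T \<sigma>d (s, \<omega>)) \<partial>lborel) \<partial>M)"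
      unfolding E by (rule nn_integral_add[symmetric]) (intro nn_integral_time_measurable m1 m2)+
    also have "\<dots> = (\<integral>\<^sup>+\<omega>. (\<integral>\<^sup>+s. nsq (wt 0 t0 T bd (s, \<omega>)) + nsq (wt 0 t0 T \<sigma>d (s, \<omega>)) \<partial>lborel) \<partial>M)"
      using measurable_compose[OF measurable_Pair2' m1] measurable_compose[OF measurable_Pair2' m2]
      by (intro nn_integral_cong nn_integral_add[symmetric]) auto
    also have "\<dots> = (\<integral>\<^sup>+\<omega>. (\<integral>\<^sup>+t\<in>{t0..T}. ennreal (\<bar>b \<omega> t x - b \<omega> t y\<bar>\<^sup>2 + (norm (\<sigma> \<omega> t x - \<sigma> \<omega> t y))\<^sup>2) \<partial>lborel) \<partial>M)"
      unfolding nsq_wt by (intro nn_integral_cong) (auto simp: bd_def \<sigma>d_def split: split_indicator)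
    finally show ?thesis .
  qed
  have past: "(\<integral>\<^sup>+\<omega>. (\<integral>\<^sup>+t\<in>{t0 - l..T + u}. ennreal (\<bar>x t \<omega> - y t \<omega>\<bar>\<^sup>2) \<partial>lebesgue) \<partial>M) = E2 t0 (T + u) \<delta>"
    unfolding E2_def
  proof (rule nn_integral_cong_AE)
    show "AE \<omega> in M. (\<integral>\<^sup>+t\<in>{t0 - l..T + u}. ennreal (\<bar>x t \<omega> - y t \<omega>\<bar>\<^sup>2) \<partial>lebesgue) = (\<integral>\<^sup>+t\<in>{t0..T + u}. nsq (\<delta> t \<omega>) \<partial>lborel)"
      using init
    proof eventually_elim
      case (elim \<omega>)
      show ?case unfolding nn_integral_completion
        by (intro nn_integral_cong) (use elim l in \<open>auto simp: \<delta>_def not_le split: split_indicator\<close>)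
    qed
  qed
  have "W \<beta> t0 T bd + W \<beta> t0 T \<sigma>d \<le> ennreal (exp (- \<beta> * t0)) * (E2 t0 T bd + E2 t0 T \<sigma>d)"
    unfolding distrib_left by (intro add_mono W_const jmb jms)
  also have "\<dots> \<le> ennreal (exp (- \<beta> * t0)) * (ennreal K * E2 t0 (T + u) \<delta>)"
    unfolding sum_E2 past[symmetric] using lip x y unfolding lipschitz_integrated_def by (intro mult_left_mono) auto
  also have "\<dots> \<le> ennreal (exp (- \<beta> * t0)) * (ennreal K * (ennreal (exp (\<beta> * (T + u))) * W \<beta> t0 (T + u) \<delta>))"
    by (intro mult_left_mono E2_le_W jmd \<beta>) auto
  also have "\<dots> = ennreal (K * exp (\<beta> * (T + u - t0))) * W \<beta> t0 (T + u) \<delta>"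
  proof -
    have "exp (- \<beta> * t0) * (K * exp (\<beta> * (T + u))) = K * exp (\<beta> * (T + u - t0))"
      by (simp add: exp_add[symmetric] exp_diff exp_minus field_simps right_diff_distrib distrib_left)
    then have "ennreal (exp (- \<beta> * t0)) * (ennreal K * ennreal (exp (\<beta> * (T + u)))) = ennreal (K * exp (\<beta> * (T + u - t0)))"
      using K by (simp flip: ennreal_mult)
    then show ?thesis by (simp only: mult.assoc[symmetric])
  qed
  finally show "W \<beta> t0 T (\<lambda>s \<omega>. b \<omega> s x - b \<omega> s y) + W \<beta> t0 T (\<lambda>s \<omega>. \<sigma> \<omega> s x - \<sigma> \<omega> s y)
     \<le> ennreal (K * exp (\<beta> * (T + u - t0))) * W \<beta> t0 (T + u) (\<lambda>s \<omega>. x s \<omega> - y s \<omega>)"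
    unfolding \<delta>_def[abs_def] bd_def[abs_def] \<sigma>d_def[abs_def] .
qed

text \<open>
  Before \<open>start\<close> both processes are deterministic, so that almost sure agreement is agreement
  for every \<open>\<omega>\<close>. Individual times matter here because \<open>\<mu>\<close> may have atoms.
\<close>

lemma difference_in_past:
  assumes x: "x \<in> Lbar" and y: "y \<in> Lbar" and init: "AE \<omega> in M. \<forall>t\<in>{t0 - l..t0}. x t \<omega> = y t \<omega>"
    and r: "r \<in> {t0 - l..T + u}" and \<omega>: "\<omega> \<in> space M"
  shows "x r \<omega> - y r \<omega> = indicator {start..T + u} r *\<^sub>R (x r \<omega> - y r \<omega>)"
proof (cases "r \<in> {start..T + u}")
  case False
  then have neg: "t0 - l < 0" "r < 0" "r \<in> {t0 - l..0}" "r \<in> {t0 - l..t0}" using r times by auto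
  obtain f where f: "\<forall>r\<in>{t0 - l..0}. \<forall>\<omega>\<in>space M. x r \<omega> = f r" using x neg by (auto simp: L2bar_F_def)
  obtain g where g: "\<forall>r\<in>{t0 - l..0}. \<forall>\<omega>\<in>space M. y r \<omega> = g r" using y neg by (auto simp: L2bar_F_def)
  have "AE \<omega> in M. f r = g r"
    using init AE_space
  proof eventually_elim
    case (elim \<omega>)
    then show ?case using f g neg by metis
  qed
  then have "f r = g r" by simp
  then show ?thesis using f g neg \<omega> by simp
qed simp

text \<open>
  At each time the condition is squared; the conditional expectation contracts mean squares, and
  Cauchy-Schwarz for the probability measure \<open>\<mu>\<close> moves the square inside. Integrating against
  \<open>exp (- \<beta> * t)\<close> and substituting \<open>s = t + r\<close> costs the factor \<open>exp (\<beta> * r) \<le> exp (\<beta> * u)\<close>.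
\<close>

lemma lipschitz_cond_exp_imp_weighted:
  assumes \<beta>: "\<beta> > 0" and K: "K \<ge> 0" and \<mu>: "prob_space \<mu>" "sets \<mu> = sets (restrict_space borel {-l..u})"
    and lip: "lipschitz_cond_exp M B T l u t0 b \<sigma> K \<mu>"
  shows "lipschitz_weighted \<beta> (K\<^sup>2 * exp (\<beta> * u))"
  unfolding lipschitz_weighted_def
proof (intro ballI impI)
  fix x y assume x: "x \<in> Lbar" and y: "y \<in> Lbar" and init: "AE \<omega> in M. \<forall>t\<in>{t0 - l..t0}. x t \<omega> = y t \<omega>"
  interpret \<mu>: prob_space \<mu> by fact
  interpret \<mu>M: pair_prob_space M \<mu> ..
  interpret LP: pair_sigma_finite lborel "M \<Otimes>\<^sub>M \<mu>" ..
  have space_\<mu>: "space \<mu> = {-l..u}" using sets_eq_imp_space_eq[OF \<mu>(2)] by (simp add: space_restrict_space)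
  have id_\<mu>: "(\<lambda>r. r) \<in> \<mu> \<rightarrow>\<^sub>M borel"
    using measurable_restrict_space1[OF measurable_ident, of borel "{-l..u}"] by (simp add: id_def measurable_cong_sets[OF \<mu>(2) refl])
  note [measurable] = id_\<mu>
  \<comment> \<open>The cut-off at \<open>start\<close> yields a jointly measurable process; it does not change the
     difference, which vanishes before.\<close>
  define \<delta> where "\<delta> z = indicator {start..T + u} (fst z) *\<^sub>R (x (fst z) (snd z) - y (fst z) (snd z))" for z :: "real \<times> 'a"
  have \<delta>_meas [measurable]: "\<delta> \<in> borel_measurable (borel \<Otimes>\<^sub>M M)"
    using joint_meas_diff[OF Lbar_joint_meas[OF x] Lbar_joint_meas[OF y]] unfolding joint_meas_def \<delta>_def .
  have \<delta>_eq: "x (t + r) \<omega> - y (t + r) \<omega> = \<delta> (t + r, \<omega>)" if "t \<in> {t0..T}" "r \<in> space \<mu>" "\<omega> \<in> space M" for t r \<omega>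
    unfolding \<delta>_def fst_conv snd_conv
    by (rule difference_in_past[OF x y init _ that(3)]) (use that space_\<mu> in auto)
  define bd where "bd s \<omega> = b \<omega> s x - b \<omega> s y" for s \<omega>
  define \<sigma>d where "\<sigma>d s \<omega> = \<sigma> \<omega> s x - \<sigma> \<omega> s y" for s \<omega>
  have jmb: "joint_meas t0 T bd" unfolding bd_def[abs_def] by (intro joint_meas_diff L2_F_joint_meas b_L2' x y)
  have jms: "joint_meas t0 T \<sigma>d" unfolding \<sigma>d_def[abs_def] by (intro joint_meas_diff L2_F_joint_meas \<sigma>_L2' x y)
  have at_time: "(\<integral>\<^sup>+\<omega>. nsq (bd t \<omega>) \<partial>M) + (\<integral>\<^sup>+\<omega>. nsq (\<sigma>d t \<omega>) \<partial>M) \<le> ennreal (K\<^sup>2) * (\<integral>\<^sup>+\<omega>. \<integral>\<^sup>+r. nsq (\<delta> (t + r, \<omega>)) \<partial>\<mu> \<partial>M)"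
    if t: "t \<in> {t0..T}" for t
  proof -
    have [measurable]: "bd t \<in> borel_measurable M" "\<sigma>d t \<in> borel_measurable M"
      using measurable_compose[OF measurable_Pair1'[of t borel M] jmb[unfolded joint_meas_def]] measurable_compose[OF measurable_Pair1'[of t borel M] jms[unfolded joint_meas_def]] t
      by simp_all
    define f where "f \<omega> = (\<integral>\<^sup>+r. ennreal \<bar>x (t + r) \<omega> - y (t + r) \<omega>\<bar> \<partial>\<mu>)" for \<omega>
    have f_eq: "f \<omega> = (\<integral>\<^sup>+r. ennreal \<bar>\<delta> (t + r, \<omega>)\<bar> \<partial>\<mu>)" if "\<omega> \<in> space M" for \<omega>
      unfolding f_def by (intro nn_integral_cong) (use \<delta>_eq[OF t _ that] in simp)
    have "(\<lambda>\<omega>. \<integral>\<^sup>+r. ennreal \<bar>\<delta> (t + r, \<omega>)\<bar> \<partial>\<mu>) \<in> borel_measurable M" by measurable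
    then have f_meas [measurable]: "f \<in> borel_measurable M"
      by (rule measurable_cong[THEN iffD2, rotated]) (rule f_eq)
    have "\<forall>\<omega>\<in>space M. (\<lambda>r. x (t + r) \<omega> - y (t + r) \<omega>) \<in> borel_measurable \<mu>"
    proof
      fix \<omega> assume \<omega>: "\<omega> \<in> space M"
      have "(\<lambda>r. \<delta> (r, \<omega>)) \<in> borel_measurable borel" by (rule measurable_compose[OF measurable_Pair2'[OF \<omega>] \<delta>_meas])
      then have "(\<lambda>r. \<delta> (t + r, \<omega>)) \<in> borel_measurable \<mu>"
        by (rule measurable_compose[rotated]) measurable
      then show "(\<lambda>r. x (t + r) \<omega> - y (t + r) \<omega>) \<in> borel_measurable \<mu>"
        by (rule measurable_cong[THEN iffD2, rotated]) (rule \<delta>_eq[OF t _ \<omega>])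
    qed
    then have "AE \<omega> in M. ennreal (\<bar>bd t \<omega>\<bar> + norm (\<sigma>d t \<omega>)) \<le> ennreal K * nn_cond_exp M (F t) f \<omega>"
      using lip x y t unfolding lipschitz_cond_exp_def bd_def \<sigma>d_def f_def by blast
    then have "AE \<omega> in M. nsq (bd t \<omega>) + nsq (\<sigma>d t \<omega>) \<le> ennreal (K\<^sup>2) * (nn_cond_exp M (F t) f \<omega>)\<^sup>2"
    proof eventually_elim
      case (elim \<omega>)
      have "nsq (bd t \<omega>) + nsq (\<sigma>d t \<omega>) = ennreal ((bd t \<omega>)\<^sup>2 + (norm (\<sigma>d t \<omega>))\<^sup>2)" by simp
      also have "\<dots> \<le> ennreal ((\<bar>bd t \<omega>\<bar> + norm (\<sigma>d t \<omega>))\<^sup>2)" by (intro ennreal_leI) (simp add: power2_sum)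
      also have "\<dots> = (ennreal (\<bar>bd t \<omega>\<bar> + norm (\<sigma>d t \<omega>)))\<^sup>2" by (simp only: ennreal_power add_nonneg_nonneg abs_ge_zero norm_ge_zero)
      also have "\<dots> \<le> (ennreal K * nn_cond_exp M (F t) f \<omega>)\<^sup>2" by (intro power_mono elim) simp
      also have "\<dots> = ennreal (K\<^sup>2) * (nn_cond_exp M (F t) f \<omega>)\<^sup>2" using K by (simp add: power_mult_distrib ennreal_power)
      finally show ?case .
    qed
    then have "(\<integral>\<^sup>+\<omega>. nsq (bd t \<omega>) + nsq (\<sigma>d t \<omega>) \<partial>M) \<le> (\<integral>\<^sup>+\<omega>. ennreal (K\<^sup>2) * (nn_cond_exp M (F t) f \<omega>)\<^sup>2 \<partial>M)"
      by (rule nn_integral_mono_AE)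
    also have "\<dots> = ennreal (K\<^sup>2) * (\<integral>\<^sup>+\<omega>. (nn_cond_exp M (F t) f \<omega>)\<^sup>2 \<partial>M)"
      by (rule nn_integral_cmult) (simp add: F_measurable_M[OF borel_measurable_nn_cond_exp])
    also have "(\<integral>\<^sup>+\<omega>. (nn_cond_exp M (F t) f \<omega>)\<^sup>2 \<partial>M) \<le> (\<integral>\<^sup>+\<omega>. (f \<omega>)\<^sup>2 \<partial>M)" by (rule nn_cond_exp_L2_contraction[OF f_meas])
    also have "\<dots> \<le> (\<integral>\<^sup>+\<omega>. \<integral>\<^sup>+r. nsq (\<delta> (t + r, \<omega>)) \<partial>\<mu> \<partial>M)"
    proof (rule nn_integral_mono)
      fix \<omega> assume \<omega>: "\<omega> \<in> space M"
      have [measurable]: "(\<lambda>r. \<delta> (r, \<omega>)) \<in> borel_measurable borel" by (rule measurable_compose[OF measurable_Pair2'[OF \<omega>] \<delta>_meas])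
      have "(\<lambda>r. \<delta> (t + r, \<omega>)) \<in> borel_measurable \<mu>"
        by (rule measurable_compose[of "\<lambda>r. t + r" \<mu> borel "\<lambda>r. \<delta> (r, \<omega>)" borel]) measurable
      then have "(\<integral>\<^sup>+r. ennreal \<bar>\<delta> (t + r, \<omega>)\<bar> * 1 \<partial>\<mu>)\<^sup>2 \<le> (\<integral>\<^sup>+r. (ennreal \<bar>\<delta> (t + r, \<omega>)\<bar>)\<^sup>2 \<partial>\<mu>) * (\<integral>\<^sup>+r. 1\<^sup>2 \<partial>\<mu>)"
        by (intro Cauchy_Schwarz_nn_integral) measurable
      then show "(f \<omega>)\<^sup>2 \<le> (\<integral>\<^sup>+r. nsq (\<delta> (t + r, \<omega>)) \<partial>\<mu>)"
        unfolding f_eq[OF \<omega>] by (simp add: \<mu>.emeasure_space_1 ennreal_power)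
    qed
    finally have "(\<integral>\<^sup>+\<omega>. nsq (bd t \<omega>) + nsq (\<sigma>d t \<omega>) \<partial>M) \<le> ennreal (K\<^sup>2) * (\<integral>\<^sup>+\<omega>. \<integral>\<^sup>+r. nsq (\<delta> (t + r, \<omega>)) \<partial>\<mu> \<partial>M)"
      by (simp add: mult_left_mono)
    then show ?thesis by (subst (asm) nn_integral_add) auto
  qed
  define G where "G \<omega> = (\<integral>\<^sup>+s. ennreal (exp (- \<beta> * s)) * nsq (\<delta> (s, \<omega>)) \<partial>lborel)" for \<omega>
  have G_meas [measurable]: "G \<in> borel_measurable M"
    using nn_integral_time_measurable[of "\<lambda>z. ennreal (exp (- \<beta> * fst z)) * nsq (\<delta> z)"] by (simp add: G_def[abs_def])
  have shift: "(\<integral>\<^sup>+t\<in>{t0..T}. ennreal (exp (- \<beta> * t)) * nsq (\<delta> (t + r, \<omega>)) \<partial>lborel) \<le> ennreal (exp (\<beta> * u)) * G \<omega>"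
    if r: "r \<in> space \<mu>" and \<omega>: "\<omega> \<in> space M" for r \<omega>
  proof -
    have [measurable]: "(\<lambda>r. \<delta> (r, \<omega>)) \<in> borel_measurable borel" by (rule measurable_compose[OF measurable_Pair2'[OF \<omega>] \<delta>_meas])
    have m [measurable]: "(\<lambda>s. ennreal (exp (- \<beta> * s)) * nsq (\<delta> (s, \<omega>))) \<in> borel_measurable borel" by measurable
    have "(\<integral>\<^sup>+t\<in>{t0..T}. ennreal (exp (- \<beta> * t)) * nsq (\<delta> (t + r, \<omega>)) \<partial>lborel) \<le>
        (\<integral>\<^sup>+t. ennreal (exp (\<beta> * u)) * (ennreal (exp (- \<beta> * (r + 1 * t))) * nsq (\<delta> (r + 1 * t, \<omega>))) \<partial>lborel)"
    proof (rule nn_integral_mono)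
      fix t
      have "- \<beta> * t \<le> \<beta> * u + - \<beta> * (r + t)" using r space_\<mu> \<beta> by (simp add: algebra_simps)
      then have "ennreal (exp (- \<beta> * t)) \<le> ennreal (exp (\<beta> * u)) * ennreal (exp (- \<beta> * (r + t)))"
        by (subst ennreal_mult[symmetric]) (auto simp: exp_add[symmetric] intro!: ennreal_leI)
      then have "ennreal (exp (- \<beta> * t)) * nsq (\<delta> (t + r, \<omega>)) \<le> ennreal (exp (\<beta> * u)) * ennreal (exp (- \<beta> * (r + t))) * nsq (\<delta> (t + r, \<omega>))"
        by (rule mult_right_mono) simp
      then show "ennreal (exp (- \<beta> * t)) * nsq (\<delta> (t + r, \<omega>)) * indicator {t0..T} t \<le> ennreal (exp (\<beta> * u)) * (ennreal (exp (- \<beta> * (r + 1 * t))) * nsq (\<delta> (r + 1 * t, \<omega>)))"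
        by (auto simp: mult.assoc add.commute split: split_indicator)
    qed
    also have "\<dots> = ennreal (exp (\<beta> * u)) * (\<integral>\<^sup>+t. ennreal (exp (- \<beta> * (r + 1 * t))) * nsq (\<delta> (r + 1 * t, \<omega>)) \<partial>lborel)"
    proof (rule nn_integral_cmult)
      show "(\<lambda>t. ennreal (exp (- \<beta> * (r + 1 * t))) * nsq (\<delta> (r + 1 * t, \<omega>))) \<in> borel_measurable lborel"
        using measurable_compose[of "\<lambda>t. r + 1 * t" lborel borel, OF _ m] by simp
    qed
    also have "(\<integral>\<^sup>+t. ennreal (exp (- \<beta> * (r + 1 * t))) * nsq (\<delta> (r + 1 * t, \<omega>)) \<partial>lborel) = G \<omega>"
      using nn_integral_real_affine[OF m, of 1 r] by (simp add: G_def)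
    finally show ?thesis .
  qed
  have "W \<beta> t0 T bd + W \<beta> t0 T \<sigma>d = (\<integral>\<^sup>+t. ennreal (exp (- \<beta> * t)) * ((\<integral>\<^sup>+\<omega>. nsq (bd t \<omega>) \<partial>M) + (\<integral>\<^sup>+\<omega>. nsq (\<sigma>d t \<omega>) \<partial>M)) * indicator {t0..T} t \<partial>lborel)"
  proof -
    have m: "(\<lambda>t. ennreal (exp (- \<beta> * t)) * (\<integral>\<^sup>+\<omega>. nsq (\<phi> t \<omega>) \<partial>M) * indicator {t0..T} t) \<in> borel_measurable lborel"
      if "joint_meas t0 T \<phi>" for \<phi> :: "real \<Rightarrow> 'a \<Rightarrow> 'c::euclidean_space"
    proof -
      have [measurable]: "(\<lambda>z. indicator {t0..T} (fst z) *\<^sub>R \<phi> (fst z) (snd z)) \<in> borel_measurable (borel \<Otimes>\<^sub>M M)" using that by (simp add: joint_meas_def)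
      have "(\<lambda>t. ennreal (exp (- \<beta> * t)) * (\<integral>\<^sup>+\<omega>. nsq (indicator {t0..T} (fst (t, \<omega>)) *\<^sub>R \<phi> (fst (t, \<omega>)) (snd (t, \<omega>))) \<partial>M)) \<in> borel_measurable borel"
        by (intro borel_measurable_times_ennreal borel_measurable_nn_integral_fst[where f="\<lambda>z. nsq (indicator {t0..T} (fst z) *\<^sub>R \<phi> (fst z) (snd z))"]) measurable
      also have "(\<lambda>t. ennreal (exp (- \<beta> * t)) * (\<integral>\<^sup>+\<omega>. nsq (indicator {t0..T} (fst (t, \<omega>)) *\<^sub>R \<phi> (fst (t, \<omega>)) (snd (t, \<omega>))) \<partial>M)) =
         (\<lambda>t. ennreal (exp (- \<beta> * t)) * (\<integral>\<^sup>+\<omega>. nsq (\<phi> t \<omega>) \<partial>M) * indicator {t0..T} t)"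
        by (rule ext) (simp split: split_indicator)
      finally show ?thesis by simp
    qed
    show ?thesis
      unfolding W_swap[OF jmb] W_swap[OF jms]
      by (subst nn_integral_add[symmetric, OF m[OF jmb] m[OF jms]]) (simp add: distrib_left distrib_right)
  qed
  also have "\<dots> \<le> (\<integral>\<^sup>+t. ennreal (K\<^sup>2) * (\<integral>\<^sup>+p. indicator {t0..T} t * (ennreal (exp (- \<beta> * t)) * nsq (\<delta> (t + snd p, fst p))) \<partial>(M \<Otimes>\<^sub>M \<mu>)) \<partial>lborel)"
  proof (rule nn_integral_mono)
    fix t
    show "ennreal (exp (- \<beta> * t)) * ((\<integral>\<^sup>+\<omega>. nsq (bd t \<omega>) \<partial>M) + (\<integral>\<^sup>+\<omega>. nsq (\<sigma>d t \<omega>) \<partial>M)) * indicator {t0..T} t \<le>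
      ennreal (K\<^sup>2) * (\<integral>\<^sup>+p. indicator {t0..T} t * (ennreal (exp (- \<beta> * t)) * nsq (\<delta> (t + snd p, fst p))) \<partial>(M \<Otimes>\<^sub>M \<mu>))"
    proof (cases "t \<in> {t0..T}")
      case True
      have m: "(\<lambda>p. nsq (\<delta> (t + snd p, fst p))) \<in> borel_measurable (M \<Otimes>\<^sub>M \<mu>)" by measurable
      have "(\<integral>\<^sup>+p. indicator {t0..T} t * (ennreal (exp (- \<beta> * t)) * nsq (\<delta> (t + snd p, fst p))) \<partial>(M \<Otimes>\<^sub>M \<mu>)) =
          ennreal (exp (- \<beta> * t)) * (\<integral>\<^sup>+p. nsq (\<delta> (t + snd p, fst p)) \<partial>(M \<Otimes>\<^sub>M \<mu>))"
        using True m by (simp add: nn_integral_cmult)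
      also have "(\<integral>\<^sup>+p. nsq (\<delta> (t + snd p, fst p)) \<partial>(M \<Otimes>\<^sub>M \<mu>)) = (\<integral>\<^sup>+\<omega>. \<integral>\<^sup>+r. nsq (\<delta> (t + r, \<omega>)) \<partial>\<mu> \<partial>M)"
        using \<mu>.nn_integral_fst[OF m] by simp
      finally have e: "(\<integral>\<^sup>+p. indicator {t0..T} t * (ennreal (exp (- \<beta> * t)) * nsq (\<delta> (t + snd p, fst p))) \<partial>(M \<Otimes>\<^sub>M \<mu>)) =
          ennreal (exp (- \<beta> * t)) * (\<integral>\<^sup>+\<omega>. \<integral>\<^sup>+r. nsq (\<delta> (t + r, \<omega>)) \<partial>\<mu> \<partial>M)" .
      from mult_left_mono[OF at_time[OF True], of "ennreal (exp (- \<beta> * t))"] show ?thesis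
        unfolding e using True by (simp add: mult.left_commute)
    qed simp
  qed
  also have "\<dots> = ennreal (K\<^sup>2) * (\<integral>\<^sup>+t. \<integral>\<^sup>+p. indicator {t0..T} t * (ennreal (exp (- \<beta> * t)) * nsq (\<delta> (t + snd p, fst p))) \<partial>(M \<Otimes>\<^sub>M \<mu>) \<partial>lborel)"
    by (rule nn_integral_cmult) measurable
  also have "(\<integral>\<^sup>+t. \<integral>\<^sup>+p. indicator {t0..T} t * (ennreal (exp (- \<beta> * t)) * nsq (\<delta> (t + snd p, fst p))) \<partial>(M \<Otimes>\<^sub>M \<mu>) \<partial>lborel) =
      (\<integral>\<^sup>+p. \<integral>\<^sup>+t. indicator {t0..T} t * (ennreal (exp (- \<beta> * t)) * nsq (\<delta> (t + snd p, fst p))) \<partial>lborel \<partial>(M \<Otimes>\<^sub>M \<mu>))"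
    by (rule LP.Fubini'[symmetric]) measurable
  also have "\<dots> \<le> (\<integral>\<^sup>+p. ennreal (exp (\<beta> * u)) * G (fst p) \<partial>(M \<Otimes>\<^sub>M \<mu>))"
  proof (rule nn_integral_mono)
    fix p assume "p \<in> space (M \<Otimes>\<^sub>M \<mu>)"
    then have "snd p \<in> space \<mu>" "fst p \<in> space M" by (auto simp: space_pair_measure)
    from shift[OF this] show "(\<integral>\<^sup>+t. indicator {t0..T} t * (ennreal (exp (- \<beta> * t)) * nsq (\<delta> (t + snd p, fst p))) \<partial>lborel) \<le> ennreal (exp (\<beta> * u)) * G (fst p)"
      by (simp add: mult.commute mult.left_commute)
  qed
  also have "\<dots> = ennreal (exp (\<beta> * u)) * (\<integral>\<^sup>+\<omega>. G \<omega> \<partial>M)"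
  proof -
    have "(\<lambda>p. ennreal (exp (\<beta> * u)) * G (fst p)) \<in> borel_measurable (M \<Otimes>\<^sub>M \<mu>)" by measurable
    from \<mu>.nn_integral_fst[OF this] show ?thesis by (simp add: \<mu>.emeasure_space_1 nn_integral_cmult)
  qed
  also have "(\<integral>\<^sup>+\<omega>. G \<omega> \<partial>M) = W \<beta> t0 (T + u) (\<lambda>s \<omega>. x s \<omega> - y s \<omega>)"
    unfolding W_def
  proof (rule nn_integral_cong_AE)
    show "AE \<omega> in M. G \<omega> = (\<integral>\<^sup>+s\<in>{t0..T + u}. ennreal (exp (- \<beta> * s)) * nsq (x s \<omega> - y s \<omega>) \<partial>lborel)"
      using init
    proof eventually_elim
      case (elim \<omega>)
      show ?case unfolding G_def
        by (intro nn_integral_cong) (use elim times in \<open>auto simp: \<delta>_def not_le split: split_indicator\<close>)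
    qed
  qed
  finally have "W \<beta> t0 T bd + W \<beta> t0 T \<sigma>d \<le> ennreal (K\<^sup>2) * (ennreal (exp (\<beta> * u)) * W \<beta> t0 (T + u) (\<lambda>s \<omega>. x s \<omega> - y s \<omega>))"
    by (simp add: mult_left_mono)
  also have "\<dots> = ennreal (K\<^sup>2 * exp (\<beta> * u)) * W \<beta> t0 (T + u) (\<lambda>s \<omega>. x s \<omega> - y s \<omega>)"
    by (subst ennreal_mult) (auto simp: mult.assoc)
  finally show "W \<beta> t0 T (\<lambda>s \<omega>. b \<omega> s x - b \<omega> s y) + W \<beta> t0 T (\<lambda>s \<omega>. \<sigma> \<omega> s x - \<sigma> \<omega> s y)
     \<le> ennreal (K\<^sup>2 * exp (\<beta> * u)) * W \<beta> t0 (T + u) (\<lambda>s \<omega>. x s \<omega> - y s \<omega>)"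
    unfolding bd_def[abs_def] \<sigma>d_def[abs_def] .
qed

end

section \<open>Well-posedness under either condition\<close>

theorem theorem3p2:
  fixes M :: "'a measure"
    and B :: "real \<Rightarrow> 'a \<Rightarrow> real ^ 'd::finite"
    and T l u t0 :: real
    and \<theta> :: "real \<Rightarrow> 'a \<Rightarrow> real"
    and b :: "'a \<Rightarrow> real \<Rightarrow> (real \<Rightarrow> 'a \<Rightarrow> real) \<Rightarrow> real"
    and \<sigma> :: "'a \<Rightarrow> real \<Rightarrow> (real \<Rightarrow> 'a \<Rightarrow> real) \<Rightarrow> real ^ 'd"
  assumes "prob_space M" and "complete_measure M"
    and "std_brownian_motion M B"
    and "T > 0" and "l \<ge> 0" and "u \<ge> 0" and "t0 \<in> {0..T}"
    and "\<theta> \<in> L2bar_F M (brownian_filtration M B) (t0 - l) t0"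
    and "\<theta> t0 \<in> L2_rv M (brownian_filtration M B t0)"
    and "\<And>x. x \<in> L2bar_F M (brownian_filtration M B) (t0 - l) (T + u) \<Longrightarrow>
           (\<lambda>t \<omega>. b \<omega> t x) \<in> L2_F M (brownian_filtration M B) 0 T"
    and "\<And>x. x \<in> L2bar_F M (brownian_filtration M B) (t0 - l) (T + u) \<Longrightarrow>
           (\<lambda>t \<omega>. \<sigma> \<omega> t x) \<in> L2_F M (brownian_filtration M B) 0 T"
  shows "(\<forall>K2 \<mu>. K2 > 0 \<and>
            prob_space \<mu> \<and> sets \<mu> = sets (restrict_space borel {-l..u}) \<and>
            lipschitz_cond_exp M B T l u t0 b \<sigma> K2 \<mu> \<and>
            (\<exists>\<beta>>0. 4 * K2\<^sup>2 * exp (\<beta> * u) / \<beta> * (1 + 2 / \<beta>) < 1)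
          \<longrightarrow> sde_unique_solution M B T l u t0 b \<sigma> \<theta>) \<and>
         (\<forall>K3. K3 > 0 \<and>
            lipschitz_integrated M B T l u t0 b \<sigma> K3 \<and>
            (\<exists>\<beta>>0. 2 * K3 * exp (\<beta> * (T + u - t0)) / \<beta> * (1 + 2 / \<beta>) < 1)
          \<longrightarrow> sde_unique_solution M B T l u t0 b \<sigma> \<theta>)"
proof -
  have "delay_sde M B T l u t0 \<theta> b \<sigma>"
    using assms by (intro delay_sde.intro brownian_space.intro brownian_space_axioms.intro delay_sde_axioms.intro)
  then interpret delay_sde M B T l u t0 \<theta> b \<sigma> .
  have const: "(4 / \<beta>\<^sup>2 + 1 / \<beta>) * L < 1" if "0 < \<beta>" "0 \<le> L" "2 * L / \<beta> * (1 + 2 / \<beta>) < 1" for \<beta> L :: real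
  proof -
    have "(4 / \<beta>\<^sup>2 + 1 / \<beta>) * L \<le> 2 * L / \<beta> * (1 + 2 / \<beta>)"
      using that(1,2) by (simp add: field_simps power2_eq_square)
    with that(3) show ?thesis by simp
  qed
  show ?thesis
  proof (intro conjI allI impI)
    fix K2 \<mu> assume *: "K2 > 0 \<and> prob_space \<mu> \<and> sets \<mu> = sets (restrict_space borel {-l..u}) \<and>
            lipschitz_cond_exp M B T l u t0 b \<sigma> K2 \<mu> \<and> (\<exists>\<beta>>0. 4 * K2\<^sup>2 * exp (\<beta> * u) / \<beta> * (1 + 2 / \<beta>) < 1)"
    then obtain \<beta> where \<beta>: "\<beta> > 0" "4 * K2\<^sup>2 * exp (\<beta> * u) / \<beta> * (1 + 2 / \<beta>) < 1" by blast
    let ?L = "K2\<^sup>2 * exp (\<beta> * u)"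
    have "2 * ?L / \<beta> * (1 + 2 / \<beta>) \<le> 4 * K2\<^sup>2 * exp (\<beta> * u) / \<beta> * (1 + 2 / \<beta>)"
      using \<beta>(1) by (intro mult_right_mono divide_right_mono) auto
    with \<beta>(2) have "2 * ?L / \<beta> * (1 + 2 / \<beta>) < 1" by linarith
    from const[OF \<beta>(1) _ this] have c: "(4 / \<beta>\<^sup>2 + 1 / \<beta>) * ?L < 1" by simp
    have "lipschitz_weighted \<beta> ?L"
      using * by (intro lipschitz_cond_exp_imp_weighted[OF \<beta>(1), where \<mu>=\<mu>]) auto
    from sde_well_posed[OF \<beta>(1) _ this c] show "sde_unique_solution M B T l u t0 b \<sigma> \<theta>" by simp
  next
    fix K3 assume *: "K3 > 0 \<and> lipschitz_integrated M B T l u t0 b \<sigma> K3 \<and> (\<exists>\<beta>>0. 2 * K3 * exp (\<beta> * (T + u - t0)) / \<beta> * (1 + 2 / \<beta>) < 1)"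
    then obtain \<beta> where \<beta>: "\<beta> > 0" "2 * K3 * exp (\<beta> * (T + u - t0)) / \<beta> * (1 + 2 / \<beta>) < 1" by blast
    let ?L = "K3 * exp (\<beta> * (T + u - t0))"
    have L0: "0 \<le> ?L" using * by simp
    have c: "(4 / \<beta>\<^sup>2 + 1 / \<beta>) * ?L < 1" using const[OF \<beta>(1) L0] \<beta>(2) by (simp add: mult.assoc)
    have "lipschitz_weighted \<beta> ?L"
      by (rule lipschitz_integrated_imp_weighted[OF \<beta>(1)]) (use * in auto)
    from sde_well_posed[OF \<beta>(1) L0 this c] show "sde_unique_solution M B T l u t0 b \<sigma> \<theta>" .
  qed
qed

end
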